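(* Let $k$ be an infinite field, $S=k[[x,y]]$, $\mathfrak m=(x,y)$, and let $f=f_1\cdots f_n$ with irreducible formal power series $f_i\in\mathfrak m$ ($1\le i\le n$) such that $R=S/(f)$ is reduced (equivalently $(f_i)\ne(f_j)$ for $i\ne j$). Put $S_i=S/(f_1\cdots f_i)$ for $1\le i\le n$. (a) $\bigoplus_{i=1}^n S_i$ is a rigid object in $\mathrm{CM}(R)$. (b) If $f_i\notin\mathfrak m^2$ for every $1\le i\le n$, then $\bigoplus_{i=1}^n S_i$ is a cluster tilting object in $\mathrm{CM}(R)$.
   Context: $\mathrm{CM}(R)$ is the category of (finitely generated) maximal Cohen-Macaulay $R$-modules. $M\in\mathrm{CM}(R)$ is rigid if $\mathrm{Ext}^1_R(M,M)=0$, and cluster tilting if $\mathrm{add}\,M=\{X\in\mathrm{CM}(R)\mid \mathrm{Ext}^1_R(M,X)=0\}=\{X\in\mathrm{CM}(R)\mid \mathrm{Ext}^1_R(X,M)=0\}$, where $\mathrm{add}\,M$ is the class of direct summands of finite direct sums of copies of $M$. *)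

theory Defs
  imports
    "HOL-Library.Extended_Nat"
    "HOL-Computational_Algebra.Formal_Power_Series"
    "HOL-Algebra.Ideal_Product"
    "HOL-Algebra.Elementary_Groups"
    "HOL-Algebra.Algebraic_Closure_Type"
begin

section \<open>Commutative rings\<close>

definition reduced_ring :: "('r, 'c) ring_scheme \<Rightarrow> bool" where
  "reduced_ring R \<longleftrightarrow>
     (\<forall>a\<in>carrier R. \<forall>n::nat. a [^]\<^bsub>R\<^esub> n = \<zero>\<^bsub>R\<^esub> \<longrightarrow> a = \<zero>\<^bsub>R\<^esub>)"

definition krull_dim :: "('r, 'c) ring_scheme \<Rightarrow> enat" where
  "krull_dim R =
     (SUP n \<in> {n. \<exists>P. (\<forall>i\<le>n. primeideal (P i) R) \<and> (\<forall>i<n. P i \<subset> P (Suc i))}. enat n)"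


section \<open>Modules\<close>

text \<open>Modules are the carrier-based ones of \<^theory>\<open>HOL-Algebra.Module\<close>.  The record type
  inherits the multiplicative fields of rings, which have no meaning for a module; they are left
  \<^const>\<open>undefined\<close> where no natural choice exists.  Homomorphisms are extensional functions, so that
  equality of homomorphisms is equality in HOL.\<close>

definition mod_hom ::
  "('r, 'c) ring_scheme \<Rightarrow> ('r, 'm, 'd) module_scheme \<Rightarrow> ('r, 'n, 'e) module_scheme \<Rightarrow> ('m \<Rightarrow> 'n) set"
  where
  "mod_hom R M N =
     {h \<in> carrier M \<rightarrow>\<^sub>E carrier N.
        (\<forall>x\<in>carrier M. \<forall>y\<in>carrier M. h (x \<oplus>\<^bsub>M\<^esub> y) = h x \<oplus>\<^bsub>N\<^esub> h y) \<and>
        (\<forall>a\<in>carrier R. \<forall>x\<in>carrier M. h (a \<odot>\<^bsub>M\<^esub> x) = a \<odot>\<^bsub>N\<^esub> h x)}"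

definition mod_isomorphic ::
  "('r, 'c) ring_scheme \<Rightarrow> ('r, 'm, 'd) module_scheme \<Rightarrow> ('r, 'n, 'e) module_scheme \<Rightarrow> bool"
  where
  "mod_isomorphic R M N \<longleftrightarrow> (\<exists>h\<in>mod_hom R M N. bij_betw h (carrier M) (carrier N))"

definition fin_gen_module ::
  "('r, 'c) ring_scheme \<Rightarrow> ('r, 'm, 'd) module_scheme \<Rightarrow> bool" where
  "fin_gen_module R M \<longleftrightarrow> Module.module R M \<and>
     (\<exists>A. finite A \<and> A \<subseteq> carrier M \<and>
        (\<forall>x\<in>carrier M. \<exists>c\<in>A \<rightarrow> carrier R. x = (\<Oplus>\<^bsub>M\<^esub>a\<in>A. c a \<odot>\<^bsub>M\<^esub> a)))"

definition direct_sum :: "'i set \<Rightarrow> ('i \<Rightarrow> ('r, 'm, 'd) module_scheme) \<Rightarrow> ('r, 'i \<Rightarrow> 'm) module" where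
  "direct_sum I M =
     \<lparr> carrier = {v \<in> (\<Pi>\<^sub>E i\<in>I. carrier (M i)). finite {i\<in>I. v i \<noteq> \<zero>\<^bsub>M i\<^esub>}},
       monoid.mult = undefined,
       one = undefined,
       zero = (\<lambda>i\<in>I. \<zero>\<^bsub>M i\<^esub>),
       add = (\<lambda>v w. \<lambda>i\<in>I. v i \<oplus>\<^bsub>M i\<^esub> w i),
       module.smult = (\<lambda>a v. \<lambda>i\<in>I. a \<odot>\<^bsub>M i\<^esub> v i) \<rparr>"

definition regular_module :: "('r, 'c) ring_scheme \<Rightarrow> ('r, 'r) module" where
  "regular_module R =
     \<lparr> carrier = carrier R, monoid.mult = monoid.mult R, one = monoid.one R,
       zero = ring.zero R, add = ring.add R, module.smult = monoid.mult R \<rparr>"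

definition free_module :: "('r, 'c) ring_scheme \<Rightarrow> 'b set \<Rightarrow> ('r, 'b \<Rightarrow> 'r) module" where
  "free_module R B = direct_sum B (\<lambda>_. regular_module R)"

definition direct_summand ::
  "('r, 'c) ring_scheme \<Rightarrow> ('r, 'm, 'd) module_scheme \<Rightarrow> 'm set \<Rightarrow> bool" where
  "direct_summand R P A \<longleftrightarrow> submodule A R P \<and>
     (\<exists>B. submodule B R P \<and> A \<inter> B = {\<zero>\<^bsub>P\<^esub>} \<and> A <+>\<^bsub>P\<^esub> B = carrier P)"

text \<open>\<open>is_add R M Y\<close>: the module \<open>Y\<close> belongs to \<open>add M\<close>, that is, \<open>Y\<close> is isomorphic to a direct
  summand of a finite direct sum of copies of \<open>M\<close>.\<close>

definition is_add ::
  "('r, 'c) ring_scheme \<Rightarrow> ('r, 'm, 'd) module_scheme \<Rightarrow> ('r, 'n, 'e) module_scheme \<Rightarrow> bool" where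
  "is_add R M Y \<longleftrightarrow> Module.module R Y \<and>
     (\<exists>(m::nat) A. direct_summand R (direct_sum {..<m} (\<lambda>_. M)) A \<and>
        mod_isomorphic R Y ((direct_sum {..<m} (\<lambda>_. M))\<lparr>carrier := A\<rparr>))"


section \<open>The first extension group\<close>

definition hom_group ::
  "('r, 'c) ring_scheme \<Rightarrow> ('r, 'm, 'd) module_scheme \<Rightarrow> ('r, 'n, 'e) module_scheme \<Rightarrow> ('m \<Rightarrow> 'n) monoid"
  where
  "hom_group R M N =
     \<lparr> carrier = mod_hom R M N,
       monoid.mult = (\<lambda>g h. \<lambda>x\<in>carrier M. g x \<oplus>\<^bsub>N\<^esub> h x),
       one = (\<lambda>x\<in>carrier M. \<zero>\<^bsub>N\<^esub>) \<rparr>"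

text \<open>The homomorphism from the free module on a subset \<open>B\<close> of \<open>M\<close> to \<open>M\<close> that sends each basis
  vector to the corresponding element of \<open>B\<close>.\<close>

definition eval_free ::
  "('r, 'c) ring_scheme \<Rightarrow> ('r, 'm, 'd) module_scheme \<Rightarrow> 'm set \<Rightarrow> ('m \<Rightarrow> 'r) \<Rightarrow> 'm" where
  "eval_free R M B \<phi> = (\<Oplus>\<^bsub>M\<^esub>b\<in>{b\<in>B. \<phi> b \<noteq> \<zero>\<^bsub>R\<^esub>}. \<phi> b \<odot>\<^bsub>M\<^esub> b)"

text \<open>\<open>Ext\<^sup>1(M, N)\<close> is the first cohomology group of \<open>Hom(F\<^sub>\<bullet>, N)\<close>, where
  \<open>F\<^sub>2 \<rightarrow> F\<^sub>1 \<rightarrow> F\<^sub>0 \<rightarrow> M \<rightarrow> 0\<close> is the start of the standard free resolution of \<open>M\<close>:  \<open>F\<^sub>0\<close> is free on the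
  underlying set of \<open>M\<close>, and each further term is free on the underlying set of the kernel of the
  preceding map.\<close>

definition Ext1 ::
  "('r, 'c) ring_scheme \<Rightarrow> ('r, 'm, 'd) module_scheme \<Rightarrow> ('r, 'n, 'e) module_scheme \<Rightarrow>
     ((('m \<Rightarrow> 'r) \<Rightarrow> 'r) \<Rightarrow> 'n) set monoid" where
  "Ext1 R M N =
     (let F0 = free_module R (carrier M);
          K0 = {\<phi>\<in>carrier F0. eval_free R M (carrier M) \<phi> = \<zero>\<^bsub>M\<^esub>};
          F1 = free_module R K0;
          d1 = eval_free R F0 K0;
          K1 = {\<psi>\<in>carrier F1. d1 \<psi> = \<zero>\<^bsub>F0\<^esub>};
          F2 = free_module R K1;
          d2 = eval_free R F1 K1;
          Z = kernel (hom_group R F1 N) (hom_group R F2 N) (\<lambda>h. compose (carrier F2) h d2);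
          B = (\<lambda>g. compose (carrier F1) g d1) ` carrier (hom_group R F0 N)
      in (hom_group R F1 N)\<lparr>carrier := Z\<rparr> Mod B)"


section \<open>Maximal Cohen--Macaulay modules over a local ring\<close>

text \<open>The submodule \<open>x\<^sub>0 M + \<dots> + x\<^sub>k\<^sub>-\<^sub>1 M\<close> of \<open>M\<close>.\<close>

definition seq_span ::
  "('r, 'm, 'd) module_scheme \<Rightarrow> 'r list \<Rightarrow> nat \<Rightarrow> 'm set" where
  "seq_span M xs k = {\<Oplus>\<^bsub>M\<^esub>j\<in>{..<k}. (xs ! j) \<odot>\<^bsub>M\<^esub> v j | v. v \<in> {..<k} \<rightarrow> carrier M}"

text \<open>\<open>xs ! i\<close> is a nonzerodivisor on \<open>M / (x\<^sub>0, \<dots>, x\<^sub>i\<^sub>-\<^sub>1) M\<close> for every \<open>i\<close>, and \<open>M \<noteq> (xs) M\<close>.\<close>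

definition regular_sequence ::
  "('r, 'm, 'd) module_scheme \<Rightarrow> 'r list \<Rightarrow> bool" where
  "regular_sequence M xs \<longleftrightarrow>
     (\<forall>i<length xs. \<forall>m\<in>carrier M.
        (xs ! i) \<odot>\<^bsub>M\<^esub> m \<in> seq_span M xs i \<longrightarrow> m \<in> seq_span M xs i) \<and>
     seq_span M xs (length xs) \<noteq> carrier M"

text \<open>In a local ring the maximal ideal is the set of nonunits.\<close>

definition depth ::
  "('r, 'c) ring_scheme \<Rightarrow> ('r, 'm, 'd) module_scheme \<Rightarrow> enat" where
  "depth R M =
     (SUP xs \<in> {xs. set xs \<subseteq> carrier R - Units R \<and> regular_sequence M xs}. enat (length xs))"

text \<open>\<open>R\<close> is meant to be a Noetherian local ring.  The zero module counts as maximal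
  Cohen--Macaulay; it needs a separate clause because it has no regular sequence.\<close>

definition max_CM ::
  "('r, 'c) ring_scheme \<Rightarrow> ('r, 'm, 'd) module_scheme \<Rightarrow> bool" where
  "max_CM R M \<longleftrightarrow> fin_gen_module R M \<and>
     (carrier M = {\<zero>\<^bsub>M\<^esub>} \<or> depth R M = krull_dim R)"


section \<open>Rigid and cluster tilting objects\<close>

definition rigid_CM ::
  "('r, 'c) ring_scheme \<Rightarrow> ('r, 'm, 'd) module_scheme \<Rightarrow> bool" where
  "rigid_CM R M \<longleftrightarrow> max_CM R M \<and> trivial_group (Ext1 R M M)"

text \<open>\<open>M \<in> CM(R)\<close> and
  \<open>add M = {Y \<in> CM(R). Ext\<^sup>1(M, Y) = 0} = {Y \<in> CM(R). Ext\<^sup>1(Y, M) = 0}\<close>.  The type argument is the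
  type of the elements of the test modules \<open>Y\<close>.  A theorem in which it is a type variable asserts
  the property for test modules of every type.\<close>

definition cluster_tilting_CM ::
  "'x itself \<Rightarrow> ('r, 'c) ring_scheme \<Rightarrow> ('r, 'm, 'd) module_scheme \<Rightarrow> bool" where
  "cluster_tilting_CM (_ :: 'x itself) R M \<longleftrightarrow> max_CM R M \<and>
     {Y :: ('r, 'x) module. is_add R M Y} = {Y. max_CM R Y \<and> trivial_group (Ext1 R M Y)} \<and>
     {Y :: ('r, 'x) module. is_add R M Y} = {Y. max_CM R Y \<and> trivial_group (Ext1 R Y M)}"


section \<open>Power series in two variables\<close>

text \<open>\<open>k[[x,y]]\<close> is \<open>k[[x]][[y]]\<close>, so that \<open>x\<close> is the constant series \<open>fps_const fps_X\<close> and \<open>y\<close> is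
  \<open>fps_X\<close>.\<close>

abbreviation kxy :: "'k::field fps fps ring" where
  "kxy \<equiv> ring_of_type_algebra"

definition kxy_max :: "'k::field fps fps set" where
  "kxy_max = genideal kxy {fps_const fps_X, fps_X}"

text \<open>\<open>S/(h)\<close> as a ring, and \<open>S/(g)\<close> as a module over \<open>S/(h)\<close> where \<open>g\<close> divides \<open>h\<close>.  For a coset
  \<open>a + (h)\<close> and a coset \<open>b + (g)\<close>, the product of cosets modulo \<open>(g)\<close> is \<open>ab + (g)\<close>; hence the scalar
  multiplication does not mention \<open>h\<close>.\<close>

definition kxy_quot :: "'k::field fps fps \<Rightarrow> 'k fps fps set ring" where
  "kxy_quot h = kxy Quot (PIdl\<^bsub>kxy\<^esub> h)"

definition kxy_quot_module :: "'k::field fps fps \<Rightarrow> ('k fps fps set, 'k fps fps set) module" where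
  "kxy_quot_module g =
     \<lparr> carrier = carrier (kxy_quot g), monoid.mult = monoid.mult (kxy_quot g),
       one = monoid.one (kxy_quot g), zero = ring.zero (kxy_quot g), add = ring.add (kxy_quot g),
       module.smult = rcoset_mult kxy (PIdl\<^bsub>kxy\<^esub> g) \<rparr>"

end

theory Submission
  imports Defs
begin

text \<open>Write \<open>S = k[[x, y]]\<close>, \<open>g\<^sub>i = f\<^sub>1 \<dots> f\<^sub>i\<close> and \<open>h\<^sub>i = f\<^sub>i\<^sub>+\<^sub>1 \<dots> f\<^sub>n\<close>, so that \<open>F = g\<^sub>n = g\<^sub>i h\<^sub>i\<close> and \<open>S\<^sub>i = S / (g\<^sub>i)\<close>;
  let \<open>M\<close> be the sum of the \<open>S\<^sub>i\<close>.  Over \<open>R = S / (F)\<close> the module \<open>S\<^sub>i\<close> has a periodic free resolution in which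
  multiplications by \<open>g\<^sub>i\<close> and \<open>h\<^sub>i\<close> alternate.  Therefore \<open>Ext\<^sup>1(S\<^sub>i, X)\<close> is the kernel of \<open>h\<^sub>i\<close> on \<open>X\<close> modulo \<open>g\<^sub>i X\<close>.

  For \<open>X = S\<^sub>j\<close> this quotient is zero because \<open>g\<^sub>i\<close> and \<open>h\<^sub>i\<close> are coprime
  (\<open>chain_sum_kernel_condition\<close>); together with the fact that \<open>M\<close> is maximal Cohen--Macaulay this is
  part (a).  A finitely generated \<open>R\<close>-module is maximal Cohen--Macaulay if and only if some nonunit of
  \<open>S\<close> is regular on it (\<open>max_CM_iff\<close>); this rests on \<open>R\<close> having dimension one.

  For part (b), the hypothesis on \<open>f\<^sub>i\<close> makes each \<open>S / (f\<^sub>i)\<close> a discrete valuation ring with \<open>x\<close> or \<open>y\<close> as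
  uniformizer (\<open>residue_uniformizer_exists\<close>), so that finitely generated torsion-free modules over it
  are free.  Modules in add \<open>M\<close> are retracts of powers of \<open>M\<close> and inherit its properties; the issue is
  the converse.  It must be shown that a maximal Cohen--Macaulay module \<open>X\<close> with \<open>Ext\<^sup>1(M, X) = 0\<close>, or with
  \<open>Ext\<^sup>1(X, M) = 0\<close>, is a direct sum of modules \<open>S\<^sub>i\<close>.  Both arguments are inductions on \<open>n\<close>.

  If \<open>Ext\<^sup>1(M, X) = 0\<close>, the kernel of \<open>h\<^sub>i\<close> on \<open>X\<close> is \<open>g\<^sub>i X\<close> for all \<open>i\<close>.  This property passes to \<open>f\<^sub>n X\<close>, which is
  a module over \<open>S / (g\<^sub>n\<^sub>-\<^sub>1)\<close> and so a sum of modules \<open>S\<^sub>i\<close> with \<open>i < n\<close>.  The kernel of \<open>f\<^sub>n\<close> is \<open>g\<^sub>n\<^sub>-\<^sub>1 X\<close>, a free module over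
  \<open>S / (f\<^sub>n)\<close>, and a basis of it among the multiples of lifted generators tells which summands \<open>S\<^sub>n\<^sub>-\<^sub>1\<close> of \<open>f\<^sub>n X\<close> come from
  summands \<open>S\<^sub>n\<close> of \<open>X\<close> (\<open>kernel_condition_imp_standard_basis\<close>).

  If \<open>Ext\<^sup>1(X, M) = 0\<close>, every linear map from \<open>X\<close> to \<open>S / (h\<^sub>i)\<close> lifts to \<open>R\<close>.  This property passes to the kernel \<open>K\<close> of
  \<open>g\<^sub>n\<^sub>-\<^sub>1\<close> on \<open>X\<close>, which is therefore a sum of modules \<open>S\<^sub>i\<close> with \<open>i < n\<close>.  The quotient of \<open>X\<close> by \<open>K\<close> is free over
  \<open>S / (f\<^sub>n)\<close>.  Lifting its coordinate functions produces linear forms on \<open>K\<close> by which the elements \<open>f\<^sub>n x\<close>, for \<open>x\<close>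
  in a basis of that quotient, can be exchanged into a basis of \<open>K\<close>; replacing \<open>f\<^sub>n x\<close> by \<open>x\<close> turns this into
  a basis of \<open>X\<close> (\<open>lifting_condition_imp_standard_basis\<close>).

  Ext is translated into these conditions by the criterion that \<open>Ext\<^sup>1(X, Y)\<close> vanishes if and only if every map
  from the first syzygy of \<open>X\<close> to \<open>Y\<close> extends to the free module (\<open>trivial_Ext1_iff\<close>).  The facts on \<open>S\<close> needed
  here come from division by a series, one power of \<open>y\<close> at a time (\<open>fps_division_limit\<close>); throughout, \<open>y\<close> is
  \<open>fps_X\<close> and \<open>x\<close> is \<open>fps_const fps_X\<close>.\<close>

section \<open>Power series in two variables\<close>

lemma mult_unit_dvd_iff_ring:
  fixes w :: "'a::comm_ring_1"
  assumes "w dvd 1"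
  shows "p * w dvd a \<longleftrightarrow> p dvd a"
proof -
  obtain v where v: "1 = w * v" using assms by (auto simp: dvd_def)
  have "p * w dvd a" if pa: "p dvd a"
  proof -
    obtain c where "a = p * c" using pa by (auto simp: dvd_def)
    then have "a = p * w * (v * c)" using v by (metis mult.assoc mult.right_neutral)
    then show ?thesis by (rule dvdI)
  qed
  then show ?thesis using dvd_mult_left by blast
qed

lemma dvd_unit_mult_iff_ring:
  fixes w :: "'a::comm_ring_1"
  assumes "w dvd 1"
  shows "p dvd w * a \<longleftrightarrow> p dvd a"
proof -
  obtain v where v: "1 = w * v" using assms by (auto simp: dvd_def)
  have "p dvd a" if "p dvd w * a"
  proof -
    have "p dvd v * (w * a)" using that by (rule dvd_mult)
    then show ?thesis using v by (metis mult.assoc mult.commute mult_1)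
  qed
  then show ?thesis by auto
qed

lemma fps_fps_unit_iff: "(u :: 'k::field fps fps) dvd 1 \<longleftrightarrow> u $ 0 $ 0 \<noteq> 0"
proof
  assume "u dvd 1"
  then obtain v where "1 = u * v" by (auto simp: dvd_def)
  then have "1 = u $ 0 $ 0 * v $ 0 $ 0" by (metis fps_mult_nth_0 fps_one_nth)
  then show "u $ 0 $ 0 \<noteq> 0" by auto
next
  assume "u $ 0 $ 0 \<noteq> 0"
  then have "u $ 0 * inverse (u $ 0) = 1" by (simp add: inverse_mult_eq_1')
  then have "u * fps_right_inverse u (inverse (u $ 0)) = 1" by (rule fps_right_inverse)
  then show "u dvd 1" by (metis dvdI)
qed

lemma fps_eq_mult_X: "(a :: 'a::comm_ring_1 fps) $ 0 = 0 \<Longrightarrow> a = fps_X * fps_shift 1 a"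
  by (simp add: fps_eq_iff fps_X_mult_nth) 

lemma fps_X_dvd_iff: "fps_X dvd (a :: 'a::comm_ring_1 fps) \<longleftrightarrow> a $ 0 = 0"
  by (metis dvd_def fps_eq_mult_X fps_mult_nth_0 fps_X_nth mult_zero_left zero_neq_one)

text \<open>A remainder that can be divided again and again, each time gaining a factor \<open>y\<close>, is zero in the
  limit; the successive quotients are the coefficients of the total quotient.\<close>

lemma fps_division_limit:
  fixes q :: "'a::comm_ring_1 fps" and a :: "nat \<Rightarrow> 'a fps"
  assumes "\<And>k. a k = fps_const (r k) * q + fps_X * a (Suc k)"
  shows "a 0 = q * Abs_fps r"
proof -
  have "a k $ n = (\<Sum>i=0..n. r (k + i) * q $ (n - i))" for k n
  proof (induction n arbitrary: k)
    case 0
    show ?case by (subst assms) simp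
  next
    case (Suc n)
    have "a k $ Suc n = r k * q $ Suc n + a (Suc k) $ n"
      by (subst assms) simp
    also have "\<dots> = r k * q $ Suc n + (\<Sum>i=0..n. r (k + Suc i) * q $ (n - i))"
      by (subst Suc.IH) simp
    also have "\<dots> = (\<Sum>i=0..Suc n. r (k + i) * q $ (Suc n - i))"
      by (subst sum.atLeast0_atMost_Suc_shift) simp
    finally show ?case .
  qed
  then have "a 0 $ n = (Abs_fps r * q) $ n" for n
    by (simp add: fps_mult_nth)
  then show ?thesis by (simp add: fps_eq_iff mult.commute)
qed

text \<open>If \<open>J\<close> contains \<open>a\<close> whenever it contains \<open>y * a\<close>, then \<open>J\<close> is determined by the ideal of its
  constant terms in \<open>k[[x]]\<close>, a principal ideal.  A lift \<open>q\<close> of a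
  generator divides every element of \<open>J\<close>, because the division can be carried on one power of
  \<open>y\<close> at a time.  This replaces unique factorisation in \<open>k[[x, y]]\<close>.\<close>

lemma saturated_ideal_principal:
  fixes J :: "'k::field fps fps set"
  assumes zero: "0 \<in> J" and add: "\<And>a b. a \<in> J \<Longrightarrow> b \<in> J \<Longrightarrow> a + b \<in> J"
    and mult: "\<And>s a. a \<in> J \<Longrightarrow> s * a \<in> J"
    and sat: "\<And>a. fps_X * a \<in> J \<Longrightarrow> a \<in> J"
  shows "\<exists>q\<in>J. \<forall>a\<in>J. q dvd a"
proof -
  \<comment> \<open>A constant term of least order divides all the others.\<close>
  have "\<exists>q\<in>J. \<forall>a\<in>J. q $ 0 dvd a $ 0"
  proof (cases "\<exists>a\<in>J. a $ 0 \<noteq> 0")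
    case True
    define d where "d = (LEAST d. \<exists>a\<in>J. a $ 0 \<noteq> 0 \<and> subdegree (a $ 0) = d)"
    have "\<exists>a\<in>J. a $ 0 \<noteq> 0 \<and> subdegree (a $ 0) = d"
      unfolding d_def by (rule LeastI_ex) (use True in blast)
    then obtain q where q: "q \<in> J" "q $ 0 \<noteq> 0" "subdegree (q $ 0) = d" by blast
    have "q $ 0 dvd a $ 0" if "a \<in> J" for a
    proof (cases "a $ 0 = 0")
      case False
      then have "d \<le> subdegree (a $ 0)" unfolding d_def by (intro Least_le) (use that in blast)
      then show ?thesis using q False by (simp add: fps_dvd_iff)
    qed simp
    then show ?thesis using q by blast
  next
    case False
    then show ?thesis using zero by (intro bexI[of _ 0]) auto
  qed
  then obtain q where q: "q \<in> J" "\<And>a. a \<in> J \<Longrightarrow> q $ 0 dvd a $ 0" by blast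
  have "\<exists>r b. a = fps_const r * q + fps_X * b \<and> b \<in> J" if aJ: "a \<in> J" for a
  proof -
    obtain r where r: "a $ 0 = q $ 0 * r" using q(2)[OF aJ] by (auto simp: dvd_def)
    have "(a - fps_const r * q) $ 0 = 0" using r by simp
    then obtain b where b: "a - fps_const r * q = fps_X * b" using fps_eq_mult_X by blast
    have "a - fps_const r * q = a + fps_const (- r) * q" by (simp flip: fps_const_neg)
    then have "fps_X * b \<in> J" using b add mult aJ q(1) by metis
    then show ?thesis using b sat by (intro exI[of _ r] exI[of _ b]) (auto simp: algebra_simps)
  qed
  then obtain r b where rb: "\<And>a. a \<in> J \<Longrightarrow> a = fps_const (r a) * q + fps_X * b a"
    "\<And>a. a \<in> J \<Longrightarrow> b a \<in> J" by metis
  have "q dvd a" if "a \<in> J" for a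
  proof -
    have inJ: "(b ^^ k) a \<in> J" for k using that rb(2) by (induction k) auto
    have "(b ^^ 0) a = q * Abs_fps (\<lambda>k. r ((b ^^ k) a))"
      by (rule fps_division_limit) (use rb(1) inJ in simp)
    then show ?thesis by (metis dvdI funpow_0)
  qed
  then show ?thesis using q(1) by blast
qed

lemma fps_X_prime: "prime_elem (fps_X :: 'k::idom fps)"
  by (auto simp: prime_elem_def fps_X_dvd_iff)

text \<open>For an irreducible \<open>p\<close> that is not associated to \<open>y\<close>, the ideal quotient \<open>(p) : a\<close> is saturated
  with respect to \<open>y\<close>, hence principal; its generator divides \<open>p\<close>, so it is a unit or associated
  to \<open>p\<close>, and these cases mean \<open>p dvd a\<close> and \<open>a\<close> being regular modulo \<open>p\<close>.\<close>

lemma irreducible_fps_fps_imp_prime_elem: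
  fixes p :: "'k::field fps fps"
  assumes "Factorial_Ring.irreducible p"
  shows "prime_elem p"
proof -
  have p: "p \<noteq> 0" "\<not> p dvd 1" using assms by (auto simp: Factorial_Ring.irreducible_def)
  show ?thesis
  proof (cases "fps_X dvd p")
    case True
    then obtain w where w: "p = fps_X * w" by (auto simp: dvd_def)
    have "\<not> (fps_X :: 'k fps fps) dvd 1" by (simp add: fps_X_dvd_iff)
    then have "w dvd 1" using w assms by (auto simp: Factorial_Ring.irreducible_def)
    then have "p dvd a \<longleftrightarrow> fps_X dvd a" for a unfolding w by (rule mult_unit_dvd_iff_ring)
    then show ?thesis using fps_X_prime p(1) by (auto simp: prime_elem_def)
  next
    case False
    then have p0: "p $ 0 \<noteq> 0" by (simp add: fps_X_dvd_iff)
    have "p dvd a \<or> p dvd b" if ab: "p dvd a * b" for a b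
    proof -
      define J where "J = {s. p dvd s * a}"
      have "a' \<in> J" if a': "fps_X * a' \<in> J" for a'
      proof -
        obtain w where w: "fps_X * a' * a = p * w" using a' by (auto simp: J_def dvd_def)
        have "(fps_X * a' * a) $ 0 = 0" by (simp add: mult.assoc)
        then have "w $ 0 = 0" using w p0 by simp
        then obtain w' where "w = fps_X * w'" using fps_eq_mult_X by blast
        then have "fps_X * (a' * a) = fps_X * (p * w')" using w by (simp add: algebra_simps)
        then show ?thesis by (simp add: J_def)
      qed
      then obtain q where q: "q \<in> J" "\<And>s. s \<in> J \<Longrightarrow> q dvd s"
        using saturated_ideal_principal[of J] by (auto simp: J_def algebra_simps)
      have "p \<in> J" by (simp add: J_def)
      then obtain c where c: "p = q * c" using q(2) by (auto simp: dvd_def)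
      then have "q dvd 1 \<or> c dvd 1" using assms by (simp add: Factorial_Ring.irreducible_def)
      then consider "q dvd 1" | "c dvd 1" by blast
      then show ?thesis
      proof cases
        case 1
        then show ?thesis using q(1) by (simp add: J_def dvd_unit_mult_iff_ring)
      next
        case 2
        have "b \<in> J" using ab by (simp add: J_def mult.commute)
        then show ?thesis using q(2)[of b] c 2 by (simp add: mult_unit_dvd_iff_ring)
      qed
    qed
    then show ?thesis using p by (auto simp: prime_elem_def)
  qed
qed

text \<open>Modulo an irreducible \<open>p\<close> every nonmultiple \<open>a\<close> of \<open>p\<close> generates an ideal that contains a power
  of the maximal ideal: this is where it enters that \<open>k[[x, y]] / (p)\<close> has dimension one.  The
  saturation of \<open>(p, a)\<close> with respect to \<open>y\<close> is principal, and its generator is a common divisor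
  of \<open>p\<close> and \<open>a\<close>, so it is a unit; thus \<open>(p, a)\<close> contains a power of \<open>y\<close>.  It also contains an
  element with nonzero constant term in \<open>k[[x]]\<close>, and together they catch a power of every
  nonunit \<open>b\<close>.\<close>

lemma power_mem_ideal_of_nonmultiple:
  fixes p a b :: "'k::field fps fps"
  assumes irr: "Factorial_Ring.irreducible p" and pa: "\<not> p dvd a" and b: "\<not> b dvd 1"
  shows "\<exists>N s t. b ^ N = p * s + a * t"
proof -
  define I where "I = {p * s + a * t | s t. True}"
  have Iadd: "u + v \<in> I" if uv: "u \<in> I" "v \<in> I" for u v
  proof -
    obtain s t s' t' where "u = p * s + a * t" "v = p * s' + a * t'" using uv by (auto simp: I_def)
    then have "u + v = p * (s + s') + a * (t + t')" by (simp add: algebra_simps)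
    then show ?thesis unfolding I_def by blast
  qed
  have Imult: "r * u \<in> I" if u: "u \<in> I" for u r
  proof -
    obtain s t where "u = p * s + a * t" using u by (auto simp: I_def)
    then have "r * u = p * (r * s) + a * (r * t)" by (simp add: algebra_simps)
    then show ?thesis unfolding I_def by blast
  qed
  have pI: "p \<in> I" unfolding I_def by (intro CollectI exI[of _ 1] exI[of _ 0]) simp
  have aI: "a \<in> I" unfolding I_def by (intro CollectI exI[of _ 0] exI[of _ 1]) simp
  define J where "J = {s. \<exists>k. fps_X ^ k * s \<in> I}"
  have J: "I \<subseteq> J" unfolding J_def by (auto intro: exI[of _ 0])
  have "\<exists>q\<in>J. \<forall>a\<in>J. q dvd a"
  proof (rule saturated_ideal_principal)
    show "0 \<in> J" using J pI Imult[of p 0] by auto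
    fix u v assume "u \<in> J" "v \<in> J"
    then obtain k l where "fps_X ^ k * u \<in> I" "fps_X ^ l * v \<in> I" by (auto simp: J_def)
    then have "fps_X ^ l * (fps_X ^ k * u) + fps_X ^ k * (fps_X ^ l * v) \<in> I"
      by (intro Iadd) (rule Imult, assumption)+
    then have "fps_X ^ (k + l) * (u + v) \<in> I" by (simp add: algebra_simps power_add)
    then show "u + v \<in> J" unfolding J_def by blast
  next
    fix u s assume "u \<in> J"
    then obtain k where "fps_X ^ k * u \<in> I" by (auto simp: J_def)
    then have "fps_X ^ k * (s * u) \<in> I" using Imult[of _ s] by (metis mult.left_commute)
    then show "s * u \<in> J" unfolding J_def by blast
  next
    fix u assume "fps_X * u \<in> J"
    then obtain k where "fps_X ^ k * (fps_X * u) \<in> I" by (auto simp: J_def)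
    then have "fps_X ^ Suc k * u \<in> I" by (simp add: algebra_simps)
    then show "u \<in> J" unfolding J_def by blast
  qed
  then obtain q where q: "q \<in> J" "\<And>s. s \<in> J \<Longrightarrow> q dvd s" by blast
  obtain c where c: "p = q * c" using q(2) pI J by (auto simp: dvd_def)
  have "q dvd 1"
  proof (rule ccontr)
    assume "\<not> q dvd 1"
    then have "c dvd 1" using c irr by (auto simp: Factorial_Ring.irreducible_def)
    then have "p dvd a" using q(2)[of a] aI J c by (simp add: mult_unit_dvd_iff_ring subset_iff)
    then show False using pa by simp
  qed
  then obtain q' where "1 = q * q'" by (auto simp: dvd_def)
  moreover obtain k where "fps_X ^ k * q \<in> I" using q(1) by (auto simp: J_def)
  ultimately have k: "fps_X ^ k \<in> I" using Imult[of "fps_X ^ k * q" q']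
    by (metis mult.assoc mult.commute mult.right_neutral)
  \<comment> \<open>Otherwise \<open>y\<close> would divide \<open>p\<close> and \<open>a\<close>, and \<open>p\<close> would be associated to \<open>y\<close>.\<close>
  have "\<exists>c\<in>I. c $ 0 \<noteq> 0"
  proof (rule ccontr)
    assume "\<not> ?thesis"
    then have d: "fps_X dvd p" "fps_X dvd a" using pI aI by (auto simp: fps_X_dvd_iff)
    then obtain w where w: "p = fps_X * w" by (auto simp: dvd_def)
    have "\<not> (fps_X :: 'k fps fps) dvd 1" by (simp add: fps_X_dvd_iff)
    then have "w dvd 1" using w irr by (auto simp: Factorial_Ring.irreducible_def)
    then have "p dvd a" using d w by (simp add: mult_unit_dvd_iff_ring)
    then show False using pa by simp
  qed
  then obtain c where c: "c \<in> I" "c $ 0 \<noteq> 0" by blast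
  have b0: "b $ 0 $ 0 = 0" using b by (simp add: fps_fps_unit_iff)
  define d where "d = subdegree (c $ 0)"
  \<comment> \<open>In \<open>k[[x]]\<close> divisibility is comparison of orders, and the constant term of \<open>b ^ d\<close> is zero or of order at least \<open>d\<close>.\<close>
  have "c $ 0 dvd (b ^ d) $ 0"
  proof -
    have "subdegree ((b $ 0) ^ d) \<ge> d" if "(b $ 0) ^ d \<noteq> 0"
    proof (cases "d = 0")
      case False
      then have "b $ 0 \<noteq> 0" using that by (auto simp: power_0_left)
      then have "subdegree (b $ 0) \<ge> 1" using b0
        by (metis One_nat_def Suc_leI gr0I nth_subdegree_nonzero)
      then show ?thesis by (simp add: subdegree_power)
    qed simp
    then have "(b $ 0) ^ d = 0 \<or> c $ 0 dvd (b $ 0) ^ d"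
      using fps_dvd_iff[of "c $ 0" "(b $ 0) ^ d"] c(2) unfolding d_def by blast
    then show ?thesis unfolding fps_power_zeroth by (metis dvd_0_right)
  qed
  then obtain r where r: "(b ^ d) $ 0 = c $ 0 * r" by (auto simp: dvd_def)
  then have "(b ^ d - fps_const r * c) $ 0 = 0" by simp
  then obtain v where "b ^ d - fps_const r * c = fps_X * v" using fps_eq_mult_X by blast
  then have bd: "b ^ d = fps_const r * c + fps_X * v" by (simp add: algebra_simps)
  have "\<exists>w. (fps_const r * c + fps_X * v) ^ j = w * c + (fps_X * v) ^ j" for j
  proof (induction j)
    case (Suc j)
    then obtain w where "(fps_const r * c + fps_X * v) ^ j = w * c + (fps_X * v) ^ j" by blast
    then have "(fps_const r * c + fps_X * v) ^ Suc j
        = (fps_const r * (w * c + (fps_X * v) ^ j) + fps_X * v * w) * c + (fps_X * v) ^ Suc j"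
      by (simp add: algebra_simps)
    then show ?case by blast
  qed (auto intro: exI[of _ 0])
  then obtain w where "b ^ (d * k) = w * c + (fps_X * v) ^ k" using bd by (metis power_mult)
  then have "b ^ (d * k) = w * c + v ^ k * fps_X ^ k" by (simp add: power_mult_distrib mult.commute)
  then have "b ^ (d * k) \<in> I" using Iadd Imult c(1) k by auto
  then show ?thesis unfolding I_def by blast
qed

text \<open>For a prime \<open>p\<close> this says that the residue class ring modulo \<open>p\<close> is a discrete valuation ring
  (or a field) with uniformizer \<open>\<pi>\<close>.\<close>

definition residue_uniformizer :: "'a::comm_ring_1 \<Rightarrow> 'a \<Rightarrow> bool" where
  "residue_uniformizer p \<pi> \<longleftrightarrow>
     (\<forall>a. p dvd a \<or> (\<exists>e u. u dvd 1 \<and> p dvd a - u * \<pi> ^ e))"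

text \<open>If \<open>p\<close> has a nonzero linear coefficient at \<open>x\<close>, then \<open>x\<close> can be eliminated modulo \<open>p\<close>, and every
  series is congruent to one in \<open>y\<close> alone: write \<open>a = r * p + y * b + c\<close> with a constant \<open>c\<close> and
  iterate on \<open>b\<close> until the first nonzero constant occurs.\<close>

lemma residue_uniformizer_y:
  fixes p :: "'k::field fps fps"
  assumes p0: "p $ 0 $ 0 = 0" and p1: "p $ 0 $ 1 \<noteq> 0"
  shows "residue_uniformizer p fps_X"
proof -
  define v where "v = fps_shift 1 (p $ 0)"
  have v: "p $ 0 = fps_X * v" using p0 unfolding v_def by (rule fps_eq_mult_X)
  have v0: "v $ 0 \<noteq> 0" using p1 by (simp add: v_def)
  have "\<exists>r c b. a = fps_const r * p + fps_X * b + fps_const (fps_const c)" for a :: "'k fps fps"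
  proof -
    define c where "c = a $ 0 $ 0"
    have "(a $ 0 - fps_const c) $ 0 = 0" by (simp add: c_def)
    then obtain w where w: "a $ 0 - fps_const c = fps_X * w" using fps_eq_mult_X by blast
    define r where "r = inverse v * w"
    have "v * inverse v = 1" using v0 by (simp add: inverse_mult_eq_1')
    then have "r * (p $ 0) = fps_X * w" unfolding r_def v
      by (metis (no_types, opaque_lifting) mult.assoc mult.commute mult_1)
    then have "(a - fps_const (fps_const c) - fps_const r * p) $ 0 = 0" using w by simp
    then obtain b where "a - fps_const (fps_const c) - fps_const r * p = fps_X * b"
      using fps_eq_mult_X by blast
    then have "a = fps_const r * p + fps_X * b + fps_const (fps_const c)"
      by (simp add: algebra_simps)
    then show ?thesis by blast
  qed
  then obtain r c b where rcb:
    "\<And>a :: 'k fps fps. a = fps_const (r a) * p + fps_X * b a + fps_const (fps_const (c a))"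
    by metis
  show ?thesis unfolding residue_uniformizer_def
  proof
    fix a
    show "p dvd a \<or> (\<exists>e u. u dvd 1 \<and> p dvd a - u * fps_X ^ e)"
    proof (cases "\<forall>k. c ((b ^^ k) a) = 0")
      case True
      have "(b ^^ 0) a = p * Abs_fps (\<lambda>k. r ((b ^^ k) a))"
      proof (rule fps_division_limit)
        fix k
        show "(b ^^ k) a = fps_const (r ((b ^^ k) a)) * p + fps_X * (b ^^ Suc k) a"
          using rcb[of "(b ^^ k) a"] True by simp
      qed
      then show ?thesis by (metis dvdI funpow_0)
    next
      case False
      define k where "k = (LEAST k. c ((b ^^ k) a) \<noteq> 0)"
      have k: "c ((b ^^ k) a) \<noteq> 0" unfolding k_def by (rule LeastI_ex) (use False in blast)
      have small: "c ((b ^^ j) a) = 0" if "j < k" for j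
        using not_less_Least[of j "\<lambda>k. c ((b ^^ k) a) \<noteq> 0"] that by (auto simp: k_def)
      have "p dvd a - (b ^^ j) a * fps_X ^ j" if "j \<le> k" for j
        using that
      proof (induction j)
        case (Suc j)
        have "(b ^^ j) a = fps_const (r ((b ^^ j) a)) * p + fps_X * (b ^^ Suc j) a"
          using rcb[of "(b ^^ j) a"] small[of j] Suc.prems by simp
        moreover have "x = s * p + fps_X * y \<Longrightarrow>
          z - y * fps_X ^ Suc j = (z - x * fps_X ^ j) + p * (s * fps_X ^ j)" for x y z s :: "'k fps fps"
          by (simp add: algebra_simps)
        ultimately have "a - (b ^^ Suc j) a * fps_X ^ Suc j
            = (a - (b ^^ j) a * fps_X ^ j) + p * (fps_const (r ((b ^^ j) a)) * fps_X ^ j)"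
          by blast
        moreover have "p dvd a - (b ^^ j) a * fps_X ^ j" using Suc by simp
        ultimately show ?case by (metis dvd_add dvd_triv_left)
      qed simp
      then have 1: "p dvd a - (b ^^ k) a * fps_X ^ k" by simp
      define u where "u = fps_X * (b ^^ Suc k) a + fps_const (fps_const (c ((b ^^ k) a)))"
      have u: "u dvd 1" using k by (simp add: u_def fps_fps_unit_iff)
      have "(b ^^ k) a = u + p * fps_const (r ((b ^^ k) a))"
        by (subst rcb[of "(b ^^ k) a"]) (simp add: u_def algebra_simps)
      moreover have "x = u + p * s \<Longrightarrow>
        z - u * fps_X ^ k = (z - x * fps_X ^ k) + p * (s * fps_X ^ k)" for x z s :: "'k fps fps"
        by (simp add: algebra_simps)
      ultimately have "a - u * fps_X ^ k
          = (a - (b ^^ k) a * fps_X ^ k) + p * (fps_const (r ((b ^^ k) a)) * fps_X ^ k)"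
        by blast
      then have "p dvd a - u * fps_X ^ k" using 1 by (metis dvd_add dvd_triv_left)
      then show ?thesis using u by blast
    qed
  qed
qed

text \<open>Exchanging \<open>x\<close> and \<open>y\<close> reduces the case of a nonzero linear coefficient at \<open>y\<close> to
  the preceding lemma.\<close>

definition swap_vars :: "'a::comm_ring_1 fps fps \<Rightarrow> 'a fps fps" where
  "swap_vars f = Abs_fps (\<lambda>i. Abs_fps (\<lambda>j. f $ j $ i))"

lemma swap_vars_nth [simp]: "swap_vars f $ i $ j = f $ j $ i"
  by (simp add: swap_vars_def)

lemma swap_vars_swap_vars [simp]: "swap_vars (swap_vars f) = f"
  by (simp add: fps_eq_iff)

lemma swap_vars_mult: "swap_vars (f * g) = swap_vars f * swap_vars g"
proof -
  have *: "(f * g) $ i $ j = (\<Sum>a=0..i. \<Sum>b=0..j. f $ a $ b * g $ (i - a) $ (j - b))"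
    for f g :: "'a fps fps" and i j
    by (simp add: fps_mult_nth fps_sum_nth)
  have "(f * g) $ j $ i = (swap_vars f * swap_vars g) $ i $ j" for i j
    unfolding * by (subst sum.swap) simp
  then show ?thesis by (simp add: fps_eq_iff)
qed

lemma swap_vars_one [simp]: "swap_vars 1 = 1"
  by (auto simp: fps_eq_iff)

lemma swap_vars_diff: "swap_vars (f - g) = swap_vars f - swap_vars g"
  by (simp add: fps_eq_iff)

lemma swap_vars_power: "swap_vars (f ^ n) = swap_vars f ^ n"
  by (induction n) (simp_all add: swap_vars_mult)

lemma swap_vars_dvd_imp: "f dvd g \<Longrightarrow> swap_vars f dvd swap_vars g"
  by (auto simp: dvd_def swap_vars_mult)

lemma residue_uniformizer_swap_vars:
  assumes "residue_uniformizer p \<pi>"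
  shows "residue_uniformizer (swap_vars p) (swap_vars \<pi>)"
  unfolding residue_uniformizer_def
proof (intro allI)
  fix a
  have "p dvd swap_vars a \<or> (\<exists>e u. u dvd 1 \<and> p dvd swap_vars a - u * \<pi> ^ e)"
    using assms unfolding residue_uniformizer_def by (rule spec)
  then show "swap_vars p dvd a \<or> (\<exists>e u. u dvd 1 \<and> swap_vars p dvd a - u * swap_vars \<pi> ^ e)"
  proof (elim disjE exE conjE)
    assume "p dvd swap_vars a"
    from swap_vars_dvd_imp[OF this] have "swap_vars p dvd a" by simp
    then show ?thesis by (rule disjI1)
  next
    fix e u assume u: "u dvd 1" "p dvd swap_vars a - u * \<pi> ^ e"
    have "swap_vars p dvd swap_vars (swap_vars a - u * \<pi> ^ e)" using u(2) by (rule swap_vars_dvd_imp)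
    then have "swap_vars p dvd a - swap_vars u * swap_vars \<pi> ^ e"
      by (simp only: swap_vars_diff swap_vars_mult swap_vars_power swap_vars_swap_vars)
    moreover have "swap_vars u dvd 1" using swap_vars_dvd_imp[OF u(1)] by simp
    ultimately show ?thesis by (intro disjI2 exI conjI)
  qed
qed

lemma residue_uniformizer_exists:
  fixes p :: "'k::field fps fps"
  assumes "p $ 0 $ 0 = 0" and "p $ 0 $ 1 \<noteq> 0 \<or> p $ 1 $ 0 \<noteq> 0"
  shows "\<exists>\<pi>. residue_uniformizer p \<pi>"
proof (cases "p $ 0 $ 1 = 0")
  case True
  then have "residue_uniformizer (swap_vars p) fps_X"
    using assms by (intro residue_uniformizer_y) simp_all
  then have "residue_uniformizer (swap_vars (swap_vars p)) (swap_vars fps_X)"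
    by (rule residue_uniformizer_swap_vars)
  then show ?thesis by (simp only: swap_vars_swap_vars) (rule exI)
next
  case False
  from residue_uniformizer_y[OF assms(1) this] show ?thesis by (rule exI)
qed

text \<open>Among the series \<open>y + x ^ j\<close> with \<open>j \<ge> 1\<close>, an irreducible one divides at most one: it would
  otherwise divide a power of \<open>x\<close>, hence both \<open>x\<close> and \<open>y\<close>, which have no common factor.  So finitely many irreducibles leave
  one of them over.\<close>

lemma exists_common_nonmultiple:
  fixes f :: "'i \<Rightarrow> 'k::field fps fps"
  assumes "finite I" and "\<And>i. i \<in> I \<Longrightarrow> Factorial_Ring.irreducible (f i)"
  shows "\<exists>t. \<not> t dvd 1 \<and> (\<forall>i\<in>I. \<not> f i dvd t)"
proof -
  let ?x = "fps_const fps_X :: 'k fps fps"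
  define T where "T j = fps_X + ?x ^ j" for j
  have xpow: "?x ^ j = fps_const (fps_X ^ j)" for j by (simp add: fps_const_power)
  have one: "j = l" if i: "i \<in> I" and d: "f i dvd T j" "f i dvd T l" and le: "1 \<le> j" "j \<le> l" for i j l
  proof (rule ccontr)
    assume "j \<noteq> l"
    then have l: "l = j + (l - j)" "l - j > 0" using le by auto
    have irr: "Factorial_Ring.irreducible (f i)" using assms i by simp
    then have prime: "prime_elem (f i)" by (rule irreducible_fps_fps_imp_prime_elem)
    have nu: "\<not> f i dvd 1" using irr by (simp add: Factorial_Ring.irreducible_def)
    have "?x ^ l = ?x ^ j * ?x ^ (l - j)" using l by (metis power_add)
    then have "T j - T l = (1 - ?x ^ (l - j)) * ?x ^ j"
      unfolding T_def by (simp add: algebra_simps)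
    then have "f i dvd (1 - ?x ^ (l - j)) * ?x ^ j" using dvd_diff[OF d] by simp
    moreover have "(1 - ?x ^ (l - j)) dvd 1" using l(2) by (simp add: fps_fps_unit_iff xpow)
    ultimately have fxj: "f i dvd ?x ^ j" by (simp add: dvd_unit_mult_iff_ring)
    then have fx: "f i dvd ?x" using prime by (rule prime_elem_dvd_power[rotated])
    have "f i dvd T j - ?x ^ j" using d(1) fxj by (rule dvd_diff)
    then have "f i dvd fps_X" by (simp add: T_def)
    then obtain v where v: "fps_X = f i * v" by (auto simp: dvd_def)
    obtain w where w: "?x = f i * w" using fx by (auto simp: dvd_def)
    have "(f i * v) $ 0 = 0" "(f i * w) $ 0 \<noteq> 0" by (simp_all flip: v w)
    then have "f i $ 0 \<noteq> 0" "v $ 0 = 0" by auto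
    then obtain v' where "v = fps_X * v'" using fps_eq_mult_X by blast
    then have "fps_X * 1 = fps_X * (f i * v')" using v by (simp add: algebra_simps)
    then show False using nu by (simp add: dvd_def)
  qed
  have "finite {j. 1 \<le> j \<and> f i dvd T j}" if "i \<in> I" for i
  proof (cases "\<exists>j. 1 \<le> j \<and> f i dvd T j")
    case True
    then obtain j where "1 \<le> j" "f i dvd T j" by blast
    then have "l = j" if "1 \<le> l" "f i dvd T l" for l
      using one[OF \<open>i \<in> I\<close>, of l j] one[OF \<open>i \<in> I\<close>, of j l] that by (cases "l \<le> j") auto
    then have "{j. 1 \<le> j \<and> f i dvd T j} \<subseteq> {j}" by blast
    then show ?thesis by (rule finite_subset) simp
  next
    case False
    then have "{j. 1 \<le> j \<and> f i dvd T j} = {}" by blast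
    then show ?thesis by (simp only: finite.emptyI)
  qed
  then have "finite (\<Union>i\<in>I. {j. 1 \<le> j \<and> f i dvd T j})" using assms(1) by blast
  then have "\<not> {1..} \<subseteq> (\<Union>i\<in>I. {j. 1 \<le> j \<and> f i dvd T j})"
    using finite_subset infinite_Ici by blast
  then obtain j where "1 \<le> j" "j \<notin> (\<Union>i\<in>I. {j. 1 \<le> j \<and> f i dvd T j})" by auto
  moreover from this have "\<not> T j dvd 1" by (simp add: T_def fps_fps_unit_iff xpow)
  ultimately show ?thesis by blast
qed

section \<open>Modules over a domain\<close>

text \<open>Modules over \<open>k[[x, y]] / (F)\<close> are treated as modules over \<open>k[[x, y]]\<close>, so that all divisibility
  arguments take place in a domain.  The scalars form a type, the module is a carrier.\<close>

locale smodule = abelian_group V for V :: "('x, 'z) ring_scheme" (structure) +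
  fixes act :: "'a::idom \<Rightarrow> 'x \<Rightarrow> 'x" (infixr \<open>\<star>\<close> 75)
  assumes act_closed [simp, intro]: "v \<in> carrier V \<Longrightarrow> s \<star> v \<in> carrier V"
    and act_add_left: "v \<in> carrier V \<Longrightarrow> (s + t) \<star> v = s \<star> v \<oplus> t \<star> v"
    and act_add_right: "v \<in> carrier V \<Longrightarrow> w \<in> carrier V \<Longrightarrow> s \<star> (v \<oplus> w) = s \<star> v \<oplus> s \<star> w"
    and act_act: "v \<in> carrier V \<Longrightarrow> s \<star> t \<star> v = (s * t) \<star> v"
    and act_one [simp]: "v \<in> carrier V \<Longrightarrow> 1 \<star> v = v"
begin

lemma act_zero_left [simp]: "v \<in> carrier V \<Longrightarrow> 0 \<star> v = \<zero>"
  using act_add_left[of v 0 0] by (simp add: local.add.r_cancel_one)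

lemma act_zero_right [simp]: "s \<star> \<zero> = \<zero>"
  using act_act[of \<zero> s 0] by simp

lemma act_minus_left: "v \<in> carrier V \<Longrightarrow> (- s) \<star> v = \<ominus> (s \<star> v)"
  by (rule minus_equality[symmetric]) (auto simp flip: act_add_left)

lemma act_minus_right: "v \<in> carrier V \<Longrightarrow> s \<star> (\<ominus> v) = \<ominus> (s \<star> v)"
  by (rule minus_equality[symmetric]) (auto simp flip: act_add_right simp: l_neg)

lemma act_minus_one: "v \<in> carrier V \<Longrightarrow> \<ominus> v = (- 1) \<star> v"
  by (simp add: act_minus_left)

lemma act_diff_right:
  "v \<in> carrier V \<Longrightarrow> w \<in> carrier V \<Longrightarrow> s \<star> (v \<ominus> w) = s \<star> v \<ominus> s \<star> w"
  by (simp add: minus_eq act_add_right act_minus_right)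

lemma act_commute: "v \<in> carrier V \<Longrightarrow> s \<star> t \<star> v = t \<star> s \<star> v"
  by (simp add: act_act mult.commute)

lemma act_dvd_zero:
  assumes "a dvd b" "v \<in> carrier V" "a \<star> v = \<zero>" shows "b \<star> v = \<zero>"
proof -
  obtain c where "b = c * a" using assms(1) by (auto simp: dvd_def mult.commute)
  then have "b \<star> v = c \<star> a \<star> v" using assms(2) by (simp add: act_act)
  then show ?thesis using assms(3) by simp
qed

subsection \<open>Linear combinations and submodules\<close>

definition lc :: "'i set \<Rightarrow> ('i \<Rightarrow> 'a) \<Rightarrow> ('i \<Rightarrow> 'x) \<Rightarrow> 'x" where
  "lc I c e = (\<Oplus>i\<in>I. c i \<star> e i)"

lemma lc_cong:
  assumes "\<And>i. i \<in> I \<Longrightarrow> c i \<star> e i = c' i \<star> e' i" "\<And>i. i \<in> I \<Longrightarrow> e' i \<in> carrier V"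
  shows "lc I c e = lc I c' e'"
  unfolding lc_def using assms by (intro finsum_cong') (auto simp: Pi_def)

lemma lc_closed [simp, intro]: "e \<in> I \<rightarrow> carrier V \<Longrightarrow> lc I c e \<in> carrier V"
  unfolding lc_def by (intro finsum_closed) (auto simp: Pi_def)

lemma lc_empty [simp]: "lc {} c e = \<zero>"
  by (simp add: lc_def)

lemma lc_insert:
  "finite I \<Longrightarrow> i \<notin> I \<Longrightarrow> e \<in> insert i I \<rightarrow> carrier V \<Longrightarrow> lc (insert i I) c e = c i \<star> e i \<oplus> lc I c e"
  unfolding lc_def by (subst finsum_insert) (auto simp: Pi_def)

lemma lc_remove:
  "finite I \<Longrightarrow> i \<in> I \<Longrightarrow> e \<in> I \<rightarrow> carrier V \<Longrightarrow> lc I c e = c i \<star> e i \<oplus> lc (I - {i}) c e"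
  by (subst lc_insert[symmetric]) (auto simp: insert_absorb)

lemma lc_split:
  "finite I \<Longrightarrow> J \<subseteq> I \<Longrightarrow> e \<in> I \<rightarrow> carrier V \<Longrightarrow> lc I c e = lc J c e \<oplus> lc (I - J) c e"
  unfolding lc_def
  by (subst finsum_Un_disjoint[symmetric]) (auto simp: Pi_def Un_absorb1 intro: finite_subset)

lemma lc_add:
  "finite I \<Longrightarrow> e \<in> I \<rightarrow> carrier V \<Longrightarrow> lc I (\<lambda>i. c i + d i) e = lc I c e \<oplus> lc I d e"
proof -
  assume e: "e \<in> I \<rightarrow> carrier V"
  then have "lc I (\<lambda>i. c i + d i) e = (\<Oplus>i\<in>I. c i \<star> e i \<oplus> d i \<star> e i)"
    unfolding lc_def by (intro finsum_cong') (auto simp: Pi_def act_add_left)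
  also have "\<dots> = lc I c e \<oplus> lc I d e"
    unfolding lc_def using e by (intro finsum_addf) (auto simp: Pi_def)
  finally show ?thesis .
qed

lemma lc_add_right:
  "finite I \<Longrightarrow> e \<in> I \<rightarrow> carrier V \<Longrightarrow> e' \<in> I \<rightarrow> carrier V \<Longrightarrow>
    lc I c (\<lambda>i. e i \<oplus> e' i) = lc I c e \<oplus> lc I c e'"
proof -
  assume e: "e \<in> I \<rightarrow> carrier V" "e' \<in> I \<rightarrow> carrier V"
  then have "lc I c (\<lambda>i. e i \<oplus> e' i) = (\<Oplus>i\<in>I. c i \<star> e i \<oplus> c i \<star> e' i)"
    unfolding lc_def by (intro finsum_cong') (auto simp: Pi_def act_add_right)
  also have "\<dots> = lc I c e \<oplus> lc I c e'"
    unfolding lc_def using e by (intro finsum_addf) (auto simp: Pi_def)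
  finally show ?thesis .
qed

lemma lc_zero: "(\<And>i. i \<in> I \<Longrightarrow> c i \<star> e i = \<zero>) \<Longrightarrow> lc I c e = \<zero>"
  unfolding lc_def by (subst finsum_cong'[where g = "\<lambda>_. \<zero>" and B = I]) (auto simp: finsum_zero)

lemma act_lc:
  "finite I \<Longrightarrow> e \<in> I \<rightarrow> carrier V \<Longrightarrow> s \<star> lc I c e = lc I (\<lambda>i. s * c i) e"
proof (induction I rule: finite_induct)
  case (insert i I)
  then have "e \<in> I \<rightarrow> carrier V" "e i \<in> carrier V" by auto
  then show ?case using insert by (simp add: lc_insert act_add_right act_act)
qed simp

lemma act_lc_right:
  "finite I \<Longrightarrow> e \<in> I \<rightarrow> carrier V \<Longrightarrow> s \<star> lc I c e = lc I c (\<lambda>i. s \<star> e i)"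
  by (subst act_lc) (auto simp: act_act mult.commute Pi_def intro!: lc_cong)

lemma lc_single:
  assumes "finite I" "i \<in> I" "e \<in> I \<rightarrow> carrier V"
  shows "lc I (\<lambda>j. if j = i then s else 0) e = s \<star> e i"
proof -
  have "e i \<in> carrier V" using assms by auto
  moreover have "lc (I - {i}) (\<lambda>j. if j = i then s else 0) e = \<zero>"
    using assms by (intro lc_zero) (auto simp: Pi_def)
  ultimately show ?thesis using assms by (subst lc_remove[of I i]) auto
qed

lemma lc_minus:
  assumes "finite I" "e \<in> I \<rightarrow> carrier V"
  shows "lc I (\<lambda>i. - c i) e = \<ominus> lc I c e"
  using act_lc[OF assms, of "- 1" c] assms by (simp add: act_minus_left)

lemma lc_diff:
  assumes "finite I" "e \<in> I \<rightarrow> carrier V"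
  shows "lc I (\<lambda>i. c i - d i) e = lc I c e \<ominus> lc I d e"
  using lc_add[OF assms, of c "\<lambda>i. - d i"] lc_minus[OF assms] by (simp add: minus_eq)

text \<open>Submodules are subsets of one fixed module, so that inductions can pass to them without a change of types.\<close>

definition sub :: "'x set \<Rightarrow> bool" where
  "sub A \<longleftrightarrow> A \<subseteq> carrier V \<and> \<zero> \<in> A \<and> (\<forall>u\<in>A. \<forall>v\<in>A. u \<oplus> v \<in> A) \<and> (\<forall>s. \<forall>v\<in>A. s \<star> v \<in> A)"

lemma subD:
  assumes "sub A"
  shows "\<And>v. v \<in> A \<Longrightarrow> v \<in> carrier V" "\<zero> \<in> A" "\<And>u v. u \<in> A \<Longrightarrow> v \<in> A \<Longrightarrow> u \<oplus> v \<in> A"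
    "\<And>s v. v \<in> A \<Longrightarrow> s \<star> v \<in> A" "\<And>v. v \<in> A \<Longrightarrow> \<ominus> v \<in> A"
    "\<And>u v. u \<in> A \<Longrightarrow> v \<in> A \<Longrightarrow> u \<ominus> v \<in> A"
proof -
  show c: "\<And>v. v \<in> A \<Longrightarrow> v \<in> carrier V" and "\<zero> \<in> A"
    and add: "\<And>u v. u \<in> A \<Longrightarrow> v \<in> A \<Longrightarrow> u \<oplus> v \<in> A"
    and act: "\<And>s v. v \<in> A \<Longrightarrow> s \<star> v \<in> A"
    using assms by (auto simp: sub_def)
  show m: "\<And>v. v \<in> A \<Longrightarrow> \<ominus> v \<in> A" using act_minus_one c act by metis
  show "\<And>u v. u \<in> A \<Longrightarrow> v \<in> A \<Longrightarrow> u \<ominus> v \<in> A" unfolding minus_eq using add m by blast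
qed

lemma sub_carrier: "sub (carrier V)"
  by (auto simp: sub_def)

lemma lc_in_sub: "sub A \<Longrightarrow> finite I \<Longrightarrow> (\<And>i. i \<in> I \<Longrightarrow> e i \<in> A) \<Longrightarrow> lc I c e \<in> A"
proof (induction I rule: infinite_finite_induct)
  case (insert i I)
  have "e \<in> insert i I \<rightarrow> carrier V" using insert.prems subD(1) by blast
  then show ?case using insert by (simp add: lc_insert subD)
qed (auto simp: subD)

definition span :: "'i set \<Rightarrow> ('i \<Rightarrow> 'x) \<Rightarrow> 'x set" where
  "span I e = {lc I c e | c. True}"

lemma lc_in_span [intro]: "lc I c e \<in> span I e"
  by (auto simp: span_def)

lemma sub_span:
  assumes "finite I" "e \<in> I \<rightarrow> carrier V" shows "sub (span I e)"
  unfolding sub_def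
proof (intro conjI ballI allI)
  show "span I e \<subseteq> carrier V" using assms by (auto simp: span_def)
  have "lc I (\<lambda>_. 0) e = \<zero>" using assms by (intro lc_zero) (auto simp: Pi_def)
  then show "\<zero> \<in> span I e" using lc_in_span by metis
  fix u v assume "u \<in> span I e" "v \<in> span I e"
  then obtain c d where "u = lc I c e" "v = lc I d e" by (auto simp: span_def)
  then have "u \<oplus> v = lc I (\<lambda>i. c i + d i) e" using assms by (simp add: lc_add)
  then show "u \<oplus> v \<in> span I e" by auto
next
  fix s v assume "v \<in> span I e"
  then obtain c where "v = lc I c e" by (auto simp: span_def)
  then show "s \<star> v \<in> span I e" using assms by (auto simp: act_lc)
qed

lemma span_base:
  assumes "finite I" "e \<in> I \<rightarrow> carrier V" "i \<in> I" shows "e i \<in> span I e"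
proof -
  have "e i \<in> carrier V" using assms by auto
  then have "e i = lc I (\<lambda>j. if j = i then 1 else 0) e" using assms by (simp add: lc_single)
  then show ?thesis using lc_in_span by metis
qed

lemma span_least: "sub A \<Longrightarrow> finite I \<Longrightarrow> (\<And>i. i \<in> I \<Longrightarrow> e i \<in> A) \<Longrightarrow> span I e \<subseteq> A"
  by (auto simp: span_def lc_in_sub)

text \<open>Submodules are generated by subsets of themselves, so that the notion makes sense without
  leaving the ambient module.\<close>

definition fg :: "'x set \<Rightarrow> bool" where
  "fg A \<longleftrightarrow> (\<exists>B. finite B \<and> B \<subseteq> A \<and> A \<subseteq> span B (\<lambda>b. b))"

lemma sub_scaled: "sub A \<Longrightarrow> sub {s \<star> v | v. v \<in> A}"
  unfolding sub_def[of "{s \<star> v | v. v \<in> A}"]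
proof (intro conjI ballI allI)
  assume A: "sub A"
  show "{s \<star> v |v. v \<in> A} \<subseteq> carrier V" using subD[OF A] by auto
  show "\<zero> \<in> {s \<star> v |v. v \<in> A}" using subD(2)[OF A] by (auto intro!: exI[of _ \<zero>])
  fix u v assume "u \<in> {s \<star> v |v. v \<in> A}" "v \<in> {s \<star> v |v. v \<in> A}"
  then obtain u' v' where "u = s \<star> u'" "v = s \<star> v'" "u' \<in> A" "v' \<in> A" by blast
  then have "u \<oplus> v = s \<star> (u' \<oplus> v')" "u' \<oplus> v' \<in> A" using subD[OF A] by (auto simp: act_add_right)
  then show "u \<oplus> v \<in> {s \<star> v |v. v \<in> A}" by blast
next
  fix t v assume A: "sub A" and "v \<in> {s \<star> v |v. v \<in> A}"
  then obtain v' where "v = s \<star> v'" "v' \<in> A" by blast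
  then have "t \<star> v = s \<star> (t \<star> v')" "t \<star> v' \<in> A"
    using subD[OF A] by (auto simp: act_act mult.commute)
  then show "t \<star> v \<in> {s \<star> v |v. v \<in> A}" by blast
qed

lemma sub_kernel: "sub A \<Longrightarrow> sub {v \<in> A. s \<star> v = \<zero>}"
  unfolding sub_def[of "{v \<in> A. s \<star> v = \<zero>}"]
proof (intro conjI ballI allI)
  assume A: "sub A"
  show "{v \<in> A. s \<star> v = \<zero>} \<subseteq> carrier V" "\<zero> \<in> {v \<in> A. s \<star> v = \<zero>}" using subD[OF A] by auto
  fix u v assume "u \<in> {v \<in> A. s \<star> v = \<zero>}" "v \<in> {v \<in> A. s \<star> v = \<zero>}"
  then show "u \<oplus> v \<in> {v \<in> A. s \<star> v = \<zero>}" using subD[OF A] by (auto simp: act_add_right)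
next
  fix t v assume A: "sub A" and v: "v \<in> {v \<in> A. s \<star> v = \<zero>}"
  then have "s \<star> t \<star> v = t \<star> s \<star> v" using subD(1)[OF A] act_commute by blast
  then have "s \<star> t \<star> v = \<zero>" using v by simp
  then show "t \<star> v \<in> {v \<in> A. s \<star> v = \<zero>}" using v subD(4)[OF A] by blast
qed

lemma fg_scaled:
  assumes A: "sub A" and "fg A" shows "fg {s \<star> v | v. v \<in> A}"
proof -
  obtain B where B: "finite B" "B \<subseteq> A" "A \<subseteq> span B (\<lambda>b. b)" using assms by (auto simp: fg_def)
  have BX: "B \<subseteq> carrier V" using B(2) subD(1)[OF A] by blast
  have sp: "sub (span ((\<star>) s ` B) (\<lambda>b. b))" using B BX by (intro sub_span) auto
  have "s \<star> v \<in> span ((\<star>) s ` B) (\<lambda>b. b)" if v: "v \<in> A" for v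
  proof -
    obtain c where "v = lc B c (\<lambda>b. b)" using v B by (auto simp: span_def)
    then have "s \<star> v = lc B c (\<lambda>b. s \<star> b)" using B BX by (simp add: act_lc_right Pi_def subset_iff)
    also have "\<dots> \<in> span ((\<star>) s ` B) (\<lambda>b. b)"
      using B(1) BX by (intro lc_in_sub[OF sp]) (auto intro!: span_base[where e = "\<lambda>b. b"])
    finally show ?thesis .
  qed
  then show ?thesis unfolding fg_def using B by (intro exI[of _ "(\<star>) s ` B"]) auto
qed

end

context smodule begin
text \<open>Nakayama's lemma, for the ideal generated by one element \<open>\<mu>\<close> of the Jacobson radical.  The
  generators of \<open>L\<close> modulo \<open>N\<close> are removed one at a time, solving the equation for a generator \<open>b\<close>
  in which the coefficient \<open>1 - \<mu> * c b\<close> is a unit.\<close>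

lemma nakayama:
  assumes N: "sub N" and L: "sub L" "fg L"
    and rad: "\<And>c. (1 - \<mu> * c) dvd 1"
    and ex: "\<And>v. v \<in> L \<Longrightarrow> \<exists>u\<in>N. \<exists>w\<in>L. v = u \<oplus> \<mu> \<star> w"
  shows "L \<subseteq> N"
proof -
  note ND = subD[OF N] and LD = subD[OF L(1)]
  have step: "L \<subseteq> N" if "finite B" "B \<subseteq> L" "\<And>v. v \<in> L \<Longrightarrow> \<exists>u\<in>N. \<exists>c. v = u \<oplus> lc B c (\<lambda>b. b)" for B
    using that
  proof (induction B rule: finite_induct)
    case empty
    show ?case
    proof
      fix v assume "v \<in> L"
      then obtain u c where "u \<in> N" "v = u \<oplus> lc {} c (\<lambda>b. b)" using empty.prems(2) by blast
      then show "v \<in> N" using ND(1) by simp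
    qed
  next
    case (insert b B)
    have b: "b \<in> L" "b \<in> carrier V" and BX: "B \<subseteq> carrier V" using insert LD by auto
    have lcB [simp]: "lc B c (\<lambda>b. b) \<in> carrier V" for c using BX by auto
    have lc_ins: "lc (insert b B) c (\<lambda>b. b) = c b \<star> b \<oplus> lc B c (\<lambda>b. b)" for c
      using insert.hyps BX b(2) by (intro lc_insert) auto
    obtain u w where u: "u \<in> N" "w \<in> L" "b = u \<oplus> \<mu> \<star> w" using ex b by blast
    obtain u' c where u': "u' \<in> N" "w = u' \<oplus> lc (insert b B) c (\<lambda>b. b)" using insert.prems(2) u by blast
    have w: "w = u' \<oplus> (c b \<star> b \<oplus> lc B c (\<lambda>b. b))"
      unfolding u'(2) using lc_ins by simp
    have uX: "u \<in> carrier V" "u' \<in> carrier V" using ND(1)[OF u(1)] ND(1)[OF u'(1)] by simp_all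
    obtain t where t: "1 = (1 - \<mu> * c b) * t" using rad[of "c b"] by (auto simp: dvd_def)
    define n where "n = u \<oplus> \<mu> \<star> u'"
    have n: "n \<in> N" "n \<in> carrier V" using ND(3)[OF u(1) ND(4)[OF u'(1)]] ND(1) by (auto simp: n_def)
    have "u \<oplus> \<mu> \<star> (u' \<oplus> (c b \<star> b \<oplus> lc B c (\<lambda>b. b)))
        = n \<oplus> ((\<mu> * c b) \<star> b \<oplus> lc B (\<lambda>b. \<mu> * c b) (\<lambda>b. b))"
      unfolding n_def using uX b BX insert.hyps(1)
      by (simp add: act_add_right act_act a_assoc act_lc Pi_def subset_iff)
    then have "b = n \<oplus> ((\<mu> * c b) \<star> b \<oplus> lc B (\<lambda>b. \<mu> * c b) (\<lambda>b. b))"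
      using u(3) w by metis
    then have "b \<oplus> (- (\<mu> * c b)) \<star> b = n \<oplus> lc B (\<lambda>b. \<mu> * c b) (\<lambda>b. b)"
    proof -
      assume eq: "b = n \<oplus> ((\<mu> * c b) \<star> b \<oplus> lc B (\<lambda>b. \<mu> * c b) (\<lambda>b. b))"
      have "n \<oplus> (x \<oplus> l) \<oplus> \<ominus> x = n \<oplus> l" if "x \<in> carrier V" "l \<in> carrier V" for x l
      proof -
        have "n \<oplus> (x \<oplus> l) \<oplus> \<ominus> x = n \<oplus> (l \<oplus> (x \<oplus> \<ominus> x))"
          using that n(2) a_comm[of x l] by (simp only: a_assoc a_closed a_inv_closed)
        then show ?thesis using that n(2) by (simp add: r_neg)
      qed
      from this[of "(\<mu> * c b) \<star> b" "lc B (\<lambda>b. \<mu> * c b) (\<lambda>b. b)"] show ?thesis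
        using b by (simp add: act_minus_left flip: eq)
    qed
    then have "(1 - \<mu> * c b) \<star> b = n \<oplus> lc B (\<lambda>b. \<mu> * c b) (\<lambda>b. b)"
      using b act_add_left[of b 1 "- (\<mu> * c b)"] by simp
    then have "t \<star> (1 - \<mu> * c b) \<star> b = t \<star> n \<oplus> t \<star> lc B (\<lambda>b. \<mu> * c b) (\<lambda>b. b)"
      using n by (simp add: act_add_right)
    moreover have "t * (1 - \<mu> * c b) = 1" using t by (metis mult.commute)
    ultimately have eb: "b = t \<star> n \<oplus> lc B (\<lambda>b. t * (\<mu> * c b)) (\<lambda>b. b)"
      using b(2) BX insert.hyps(1) by (simp add: act_act act_lc Pi_def subset_iff)
    show ?case
    proof (rule insert.IH)
      show "B \<subseteq> L" using insert by auto
      fix v assume "v \<in> L"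
      then obtain u'' c' where v: "u'' \<in> N" "v = u'' \<oplus> lc (insert b B) c' (\<lambda>b. b)" using insert.prems(2) by blast
      then have "v = u'' \<oplus> (c' b \<star> b \<oplus> lc B c' (\<lambda>b. b))"
        using lc_ins by simp
      also have "c' b \<star> b = c' b \<star> t \<star> n \<oplus> lc B (\<lambda>b'. c' b * (t * (\<mu> * c b'))) (\<lambda>b. b)"
        by (subst eb) (use n BX insert.hyps(1) in \<open>simp add: act_add_right act_lc Pi_def subset_iff\<close>)
      also have "u'' \<oplus> (\<dots> \<oplus> lc B c' (\<lambda>b. b))
          = (u'' \<oplus> c' b \<star> t \<star> n) \<oplus> lc B (\<lambda>b'. c' b * (t * (\<mu> * c b')) + c' b') (\<lambda>b. b)"
        using v ND(1) n BX insert.hyps(1) by (subst lc_add) (auto simp: a_assoc Pi_def subset_iff)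
      moreover have "u'' \<oplus> c' b \<star> t \<star> n \<in> N" using v(1) n(1) ND(3,4) by simp
      ultimately show "\<exists>u\<in>N. \<exists>c. v = u \<oplus> lc B c (\<lambda>b. b)" by (metis (no_types))
    qed
  qed
  obtain B where B: "finite B" "B \<subseteq> L" "L \<subseteq> span B (\<lambda>b. b)" using L by (auto simp: fg_def)
  show ?thesis
  proof (rule step[OF B(1,2)])
    fix v assume v: "v \<in> L"
    then obtain c where "v = lc B c (\<lambda>b. b)" using B by (auto simp: span_def)
    then have "v = \<zero> \<oplus> lc B c (\<lambda>b. b)" using LD(1)[OF v] by simp
    then show "\<exists>u\<in>N. \<exists>c. v = u \<oplus> lc B c (\<lambda>b. b)" using ND(2) by blast
  qed
qed

subsection \<open>Cyclic bases\<close>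

text \<open>The elements \<open>e i\<close> split \<open>A\<close> into the direct sum of the cyclic modules generated by them, and
  the annihilator of \<open>e i\<close> is the ideal generated by \<open>d i\<close>.\<close>

definition cyclic_basis :: "'x set \<Rightarrow> 'i set \<Rightarrow> ('i \<Rightarrow> 'x) \<Rightarrow> ('i \<Rightarrow> 'a) \<Rightarrow> bool" where
  "cyclic_basis A I e d \<longleftrightarrow> finite I \<and> e \<in> I \<rightarrow> A \<and> A \<subseteq> span I e \<and>
     (\<forall>i\<in>I. d i \<star> e i = \<zero>) \<and> (\<forall>c. lc I c e = \<zero> \<longrightarrow> (\<forall>i\<in>I. d i dvd c i))"

text \<open>A torsion-free finitely generated module over a discrete valuation ring is free, and a
  generating family of least size is a basis: in a nontrivial relation the common power of the
  uniformizer cancels, and then some coefficient is a unit.\<close>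

lemma torsion_free_imp_free_over_residue_ring:
  assumes \<pi>: "residue_uniformizer p \<pi>"
    and L: "sub L" and J: "finite J" "d \<in> J \<rightarrow> L" "L \<subseteq> span J d"
    and p: "\<And>v. v \<in> L \<Longrightarrow> p \<star> v = \<zero>"
    and tf: "\<And>v. v \<in> L \<Longrightarrow> \<pi> \<star> v = \<zero> \<Longrightarrow> v = \<zero>"
  shows "\<exists>J0\<subseteq>J. cyclic_basis L J0 d (\<lambda>_. p)"
proof -
  note LD = subD[OF L]
  define P where "P m \<longleftrightarrow> (\<exists>J0\<subseteq>J. card J0 = m \<and> L \<subseteq> span J0 d)" for m
  have "P (card J)" using J unfolding P_def by blast
  then have "P (LEAST m. P m)" by (rule LeastI)
  then obtain J0 where J0: "J0 \<subseteq> J" "card J0 = (LEAST m. P m)" "L \<subseteq> span J0 d"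
    unfolding P_def by blast
  have min: "\<not> L \<subseteq> span (J0 - {i}) d" if "i \<in> J0" for i
  proof
    assume "L \<subseteq> span (J0 - {i}) d"
    then have "P (card (J0 - {i}))" unfolding P_def using J0 by blast
    then have "card J0 \<le> card (J0 - {i})" unfolding J0(2) by (rule Least_le)
    moreover have "finite J0" using J0 J finite_subset by blast
    ultimately show False using that by (metis card_Diff1_less not_le)
  qed
  have fin: "finite J0" using J0 J finite_subset by blast
  have dX: "d \<in> J0 \<rightarrow> carrier V" using J0 J LD(1) by blast
  have dL: "d i \<in> L" if "i \<in> J0" for i using that J0 J by auto
  have tfk: "v = \<zero>" if "v \<in> L" "\<pi> ^ k \<star> v = \<zero>" for k v
    using that
  proof (induction k)
    case 0
    then show ?case using LD by simp
  next
    case (Suc k)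
    have "\<pi> \<star> \<pi> ^ k \<star> v = \<zero>" using Suc.prems LD by (simp add: act_act)
    then show ?case using Suc tf LD by blast
  qed
  have "p dvd c i" if c: "lc J0 c d = \<zero>" and i: "i \<in> J0" for c i
  proof (rule ccontr)
    assume ni: "\<not> p dvd c i"
    define T where "T = {i \<in> J0. \<not> p dvd c i}"
    have "\<forall>i\<in>T. \<exists>e u. u dvd 1 \<and> p dvd c i - u * \<pi> ^ e"
      using \<pi> unfolding T_def residue_uniformizer_def by blast
    then obtain e u where eu: "\<And>i. i \<in> T \<Longrightarrow> u i dvd 1" "\<And>i. i \<in> T \<Longrightarrow> p dvd c i - u i * \<pi> ^ e i"
      by metis
    have "finite T" "T \<noteq> {}" using fin ni i by (auto simp: T_def)
    \<comment> \<open>The index at which the coefficient has the least valuation.\<close>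
    then obtain k where k: "k \<in> T" "\<And>i. i \<in> T \<Longrightarrow> e k \<le> e i"
    proof -
      have "Min (e ` T) \<in> e ` T" using \<open>finite T\<close> \<open>T \<noteq> {}\<close> by (intro Min_in) auto
      then obtain k where "k \<in> T" "e k = Min (e ` T)" by auto
      then show ?thesis using that[of k] \<open>finite T\<close> by simp
    qed
    define c' where "c' i = (if i \<in> T then u i * \<pi> ^ (e i - e k) else 0)" for i
    have "lc J0 c' d \<in> L" using fin dL by (intro lc_in_sub[OF L]) auto
    moreover have "\<pi> ^ e k \<star> lc J0 c' d = \<zero>"
    proof -
      have "c i \<star> d i = (\<pi> ^ e k * c' i) \<star> d i" if i: "i \<in> J0" for i
      proof -
        have "p dvd c i - \<pi> ^ e k * c' i"
        proof (cases "i \<in> T")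
          case True
          then have "\<pi> ^ e k * c' i = u i * \<pi> ^ e i"
            using k(2) by (simp add: c'_def flip: power_add)
          then show ?thesis using eu(2)[OF True] by simp
        next
          case False
          then show ?thesis using i by (auto simp: c'_def T_def)
        qed
        then have "(c i - \<pi> ^ e k * c' i) \<star> d i = \<zero>"
          using p[OF dL[OF i]] LD(1)[OF dL[OF i]] act_dvd_zero by blast
        then show ?thesis
          using act_add_left[OF LD(1)[OF dL[OF i]], of "c i - \<pi> ^ e k * c' i" "\<pi> ^ e k * c' i"]
            LD(1)[OF dL[OF i]] by simp
      qed
      then have "lc J0 c d = lc J0 (\<lambda>i. \<pi> ^ e k * c' i) d" using dX by (intro lc_cong) auto
      then show ?thesis using c fin dX by (simp add: act_lc)
    qed
    ultimately have z: "lc J0 c' d = \<zero>" using tfk by blast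
    have kJ: "k \<in> J0" using k by (auto simp: T_def)
    have dk: "d k \<in> carrier V" using dX kJ by auto
    obtain r where r: "1 = u k * r" using eu(1)[OF k(1)] by (auto simp: dvd_def)
    let ?K = "J0 - {k}"
    have dK: "d \<in> ?K \<rightarrow> carrier V" using dX by auto
    have sK: "sub (span ?K d)" using fin dK by (intro sub_span) auto
    have "u k \<star> d k \<oplus> lc ?K c' d = \<zero>" using z fin kJ dX k(1) by (subst (asm) lc_remove) (auto simp: c'_def)
    then have "u k \<star> d k = \<ominus> lc ?K c' d" using dk dK by (intro minus_equality[symmetric]) auto
    moreover have "lc ?K c' d \<in> span ?K d" by (rule lc_in_span)
    ultimately have "r \<star> u k \<star> d k \<in> span ?K d" using subD(4,5)[OF sK] by simp
    moreover have "r \<star> u k \<star> d k = d k" using r dk by (simp add: act_act mult.commute)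
    ultimately have dks: "d k \<in> span ?K d" by simp
    have "span J0 d \<subseteq> span ?K d"
    proof (rule span_least[OF sK fin])
      fix j assume "j \<in> J0"
      then show "d j \<in> span ?K d" using dks span_base[of ?K d j] fin dK by (cases "j = k") auto
    qed
    then show False using min[OF kJ] J0(3) by blast
  qed
  then have "cyclic_basis L J0 d (\<lambda>_. p)"
    unfolding cyclic_basis_def using fin dL p J0 by auto
  then show ?thesis using J0 by blast
qed

text \<open>A basis element may be replaced by an element of \<open>K\<close> in which it occurs with unit coefficient,
  provided that the annihilator does not shrink.\<close>

lemma cyclic_basis_exchange:
  assumes K: "sub K" and b: "cyclic_basis K I e d" and i: "i \<in> I" and \<kappa>: "\<kappa> = lc I a e"
    and u: "a i dvd 1" and ann: "d i \<star> \<kappa> = \<zero>"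
  shows "cyclic_basis K I (e(i := \<kappa>)) d"
proof -
  have fin: "finite I" and eK: "\<And>i. i \<in> I \<Longrightarrow> e i \<in> K" and sp: "K \<subseteq> span I e"
    and kill: "\<And>i. i \<in> I \<Longrightarrow> d i \<star> e i = \<zero>" and ind: "\<And>c i. lc I c e = \<zero> \<Longrightarrow> i \<in> I \<Longrightarrow> d i dvd c i"
    using b by (auto simp: cyclic_basis_def)
  have eX: "e \<in> I \<rightarrow> carrier V" using eK subD(1)[OF K] by auto
  have \<kappa>K: "\<kappa> \<in> K" unfolding \<kappa> using fin eK by (intro lc_in_sub[OF K])
  have \<kappa>V: "\<kappa> \<in> carrier V" using \<kappa>K subD(1)[OF K] by auto
  let ?e = "e(i := \<kappa>)"
  have e'V: "?e \<in> I \<rightarrow> carrier V" using eX \<kappa>V by auto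
  have s: "sub (span I ?e)" using fin e'V by (rule sub_span)
  have base: "?e j \<in> span I ?e" if "j \<in> I" for j using span_base[OF fin e'V that] .
  have ei: "e i \<in> carrier V" using eX i by auto
  have rest: "lc (I - {i}) c ?e = lc (I - {i}) c e" for c using eX by (intro lc_cong) auto
  have "e i \<in> span I ?e"
  proof -
    have "\<kappa> = a i \<star> e i \<oplus> lc (I - {i}) a e" unfolding \<kappa> using fin i eX by (rule lc_remove)
    then have "a i \<star> e i = \<kappa> \<ominus> lc (I - {i}) a ?e"
      unfolding rest using ei eX lc_closed[of e "I - {i}" a] by (simp add: a_minus_def a_assoc r_neg Pi_def)
    moreover have "lc (I - {i}) a ?e \<in> span I ?e" using lc_in_sub[OF s, of "I - {i}" ?e a] fin base by blast
    moreover have "\<kappa> \<in> span I ?e" using base[OF i] by simp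
    ultimately have "a i \<star> e i \<in> span I ?e" using subD(6)[OF s] by simp
    moreover obtain r where "1 = a i * r" using u by (auto simp: dvd_def)
    then have "e i = r \<star> a i \<star> e i" using ei by (simp add: act_act mult.commute)
    ultimately show ?thesis using subD(4)[OF s] by metis
  qed
  then have "e j \<in> span I ?e" if "j \<in> I" for j using base[OF that] by (cases "j = i") auto
  then have "span I e \<subseteq> span I ?e" using fin by (intro span_least[OF s]) 
  moreover have "d j dvd c j" if c: "lc I c ?e = \<zero>" and j: "j \<in> I" for c j
  proof -
    define c0 where "c0 j = (if j = i then 0 else c j)" for j
    have c0: "lc I c0 e = lc (I - {i}) c e"
    proof -
      have "lc (I - {i}) c0 e = lc (I - {i}) c e" using eX by (intro lc_cong) (auto simp: c0_def)
      then show ?thesis using lc_remove[OF fin i eX, of c0] ei eX by (simp add: c0_def Pi_def)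
    qed
    have 1: "c i \<star> \<kappa> \<oplus> lc (I - {i}) c e = \<zero>"
      using c fin i e'V rest[of c] by (subst (asm) lc_remove[of I i]) auto
    then have "lc I (\<lambda>j. c i * a j + c0 j) e = \<zero>"
      unfolding \<kappa> using fin eX c0 by (simp add: lc_add act_lc)
    from ind[OF this i] have "d i dvd c i * a i" by (simp add: c0_def)
    moreover obtain r where "1 = a i * r" using u by (auto simp: dvd_def)
    then have "c i = (c i * a i) * r" by (metis mult.assoc mult.right_neutral)
    ultimately have di: "d i dvd c i" by (metis dvd_mult2)
    then have "c i \<star> \<kappa> = \<zero>" using act_dvd_zero ann \<kappa>V by blast
    moreover have "lc (I - {i}) c e \<in> carrier V" using eX by (intro lc_closed) auto
    ultimately have "lc I c0 e = \<zero>" using 1 c0 by simp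
    from ind[OF this j] show ?thesis using di by (auto simp: c0_def split: if_splits)
  qed
  ultimately show ?thesis
    unfolding cyclic_basis_def using fin eK \<kappa>K sp kill ann by (auto simp: Pi_def)
qed

end

section \<open>Two criteria for splitting into cyclic modules\<close>

text \<open>\<open>seg f i m\<close> is the product of the factors with indices in \<open>i < j \<le> m\<close>; thus \<open>seg f 0 i\<close> defines the
  \<open>i\<close>-th quotient in the chain and \<open>seg f 0 i * seg f i n\<close> is the equation of the whole curve.\<close>

definition seg :: "(nat \<Rightarrow> 'a::comm_monoid_mult) \<Rightarrow> nat \<Rightarrow> nat \<Rightarrow> 'a" where
  "seg f i m = (\<Prod>j=Suc i..m. f j)"

lemma dvd_diffD: "m dvd x - y \<Longrightarrow> m dvd x \<Longrightarrow> m dvd (y :: 'a::comm_ring_1)"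
  using dvd_diff[of m x "x - y"] by simp

lemma seg_refl [simp]: "seg f i i = 1"
  by (simp add: seg_def)

lemma seg_mult: "i \<le> j \<Longrightarrow> j \<le> m \<Longrightarrow> seg f i j * seg f j m = seg f i m"
  unfolding seg_def by (subst prod.union_disjoint[symmetric]) (auto intro!: prod.cong)

lemma seg_Suc: "i \<le> m \<Longrightarrow> seg f i (Suc m) = seg f i m * f (Suc m)"
  by (simp add: seg_def)

lemma seg_dvd: "i < j \<Longrightarrow> j \<le> m \<Longrightarrow> (f j :: 'a::comm_ring_1) dvd seg f i m"
  by (auto simp: seg_def intro!: dvd_prodI)

text \<open>Every branch of the curve is regular.\<close>

definition chain_factors :: "(nat \<Rightarrow> 'a::comm_ring_1) \<Rightarrow> nat \<Rightarrow> bool" where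
  "chain_factors f n \<longleftrightarrow>
     (\<forall>j\<in>{1..n}. f j \<noteq> 0 \<and> \<not> f j dvd 1 \<and> (\<exists>\<pi>. residue_uniformizer (f j) \<pi>))"

context smodule
begin

text \<open>Over \<open>S / (g * h)\<close> the module \<open>S / (g)\<close> has the periodic free resolution in which multiplications
  by \<open>g\<close> and \<open>h\<close> alternate.  Hence \<open>Ext\<^sup>1(S/(g), A)\<close> is the kernel of \<open>h\<close> on \<open>A\<close> modulo \<open>g A\<close>, and
  the condition says that it vanishes for all quotients \<open>S / (seg f 0 i)\<close>.\<close>

definition kernel_condition :: "(nat \<Rightarrow> 'a) \<Rightarrow> nat \<Rightarrow> 'x set \<Rightarrow> bool" where
  "kernel_condition f n A \<longleftrightarrow>
     (\<forall>i\<in>{1..n}. \<forall>v\<in>A. seg f i n \<star> v = \<zero> \<longrightarrow> (\<exists>w\<in>A. v = seg f 0 i \<star> w))"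

text \<open>Isomorphism to a finite direct sum of modules \<open>S / (seg f 0 l)\<close> with \<open>1 \<le> l \<le> n\<close>.  The index set is
  taken in the type of the module: a definition cannot quantify over types, and a minimal
  generating set can index itself.\<close>

definition has_standard_basis :: "(nat \<Rightarrow> 'a) \<Rightarrow> nat \<Rightarrow> 'x set \<Rightarrow> bool" where
  "has_standard_basis f n A \<longleftrightarrow>
     (\<exists>(I :: 'x set) e l. l \<in> I \<rightarrow> {1..n} \<and> cyclic_basis A I e (\<lambda>i. seg f 0 (l i)))"

text \<open>Linear maps from \<open>A\<close> to the residue class ring modulo \<open>m\<close>, given by representatives; two such
  functions describe the same map if they agree modulo \<open>m\<close>.\<close>

definition lin :: "'a \<Rightarrow> 'x set \<Rightarrow> ('x \<Rightarrow> 'a) \<Rightarrow> bool" where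
  "lin m A \<phi> \<longleftrightarrow> (\<forall>u\<in>A. \<forall>v\<in>A. m dvd \<phi> (u \<oplus> v) - (\<phi> u + \<phi> v)) \<and>
     (\<forall>s. \<forall>v\<in>A. m dvd \<phi> (s \<star> v) - s * \<phi> v)"

text \<open>Applying \<open>Hom(A, -)\<close> to the exact sequence \<open>0 \<rightarrow> S/(g) \<rightarrow> S/(g * h) \<rightarrow> S/(h) \<rightarrow> 0\<close> shows that
  the vanishing of \<open>Ext\<^sup>1(A, S/(g))\<close> makes every linear map to \<open>S / (h)\<close> lift to \<open>S / (g * h)\<close>.\<close>

definition lifting_condition :: "(nat \<Rightarrow> 'a) \<Rightarrow> nat \<Rightarrow> 'x set \<Rightarrow> bool" where
  "lifting_condition f n A \<longleftrightarrow>
     (\<forall>i\<in>{1..n}. \<forall>\<phi>. lin (seg f i n) A \<phi> \<longrightarrow>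
        (\<exists>\<psi>. lin (seg f 0 n) A \<psi> \<and> (\<forall>v\<in>A. seg f i n dvd \<phi> v - \<psi> v)))"

end

text \<open>The existence of a nonzerodivisor \<open>t\<close> in the maximal ideal is the form in which the
  Cohen--Macaulay property is used.\<close>

locale local_smodule = smodule V act
  for V :: "('x, 'z) ring_scheme" (structure) and act :: "'a::idom \<Rightarrow> 'x \<Rightarrow> 'x" (infixr \<open>\<star>\<close> 75) +
  fixes t :: 'a
  assumes local: "\<And>a b :: 'a. \<not> a dvd 1 \<Longrightarrow> \<not> b dvd 1 \<Longrightarrow> \<not> (a + b) dvd 1"
    and t_nonunit: "\<not> t dvd 1" and t_regular: "\<And>v. v \<in> carrier V \<Longrightarrow> t \<star> v = \<zero> \<Longrightarrow> v = \<zero>"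
begin

lemma add_diff_cancel_left':
  assumes "x \<in> carrier V" "y \<in> carrier V" shows "(x \<oplus> y) \<ominus> x = y"
proof -
  have "(x \<oplus> y) \<ominus> x = y \<oplus> (x \<oplus> \<ominus> x)"
    using assms by (simp only: a_minus_def a_comm[of x y] a_assoc a_inv_closed)
  then show ?thesis using assms by (simp add: r_neg)
qed

lemma radical: "\<not> \<mu> dvd 1 \<Longrightarrow> (1 - \<mu> * c) dvd (1::'a)"
proof (rule ccontr)
  assume "\<not> \<mu> dvd 1" "\<not> (1 - \<mu> * c) dvd 1"
  moreover from this have "\<not> \<mu> * c dvd 1" using dvd_mult_left by blast
  ultimately have "\<not> ((1 - \<mu> * c) + \<mu> * c) dvd 1" using local by blast
  then show False by simp
qed

text \<open>Modulo \<open>p\<close> the nonzerodivisor \<open>t\<close> is zero or a unit times a positive power of \<open>\<pi>\<close>.  So it kills what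
  is killed by \<open>p\<close> and \<open>\<pi>\<close>.\<close>

lemma residue_torsion_free:
  assumes \<pi>: "residue_uniformizer p \<pi>" and p: "\<not> p dvd 1"
    and v: "v \<in> carrier V" "p \<star> v = \<zero>" "\<pi> \<star> v = \<zero>"
  shows "v = \<zero>"
proof -
  have "p dvd t \<or> (\<exists>e u. u dvd 1 \<and> p dvd t - u * \<pi> ^ e)"
    using \<pi> unfolding residue_uniformizer_def by (rule spec)
  then consider "p dvd t" | e u where "u dvd 1" "p dvd t - u * \<pi> ^ e" by (elim disjE exE conjE)
  then have "t \<star> v = \<zero>"
  proof cases
    case 1
    then show ?thesis using act_dvd_zero v by blast
  next
    case 2
    have "e \<noteq> 0"
    proof
      assume "e = 0"
      then have "\<not> (t - u) dvd 1" using 2(2) p by (auto intro: dvd_trans)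
      moreover have "\<not> (u - t) dvd 1"
      proof
        assume "(u - t) dvd 1"
        then have "(- (t - u)) dvd 1" by simp
        then show False using calculation by (simp only: minus_dvd_iff)
      qed
      ultimately have "\<not> (t + (u - t)) dvd 1" using local[OF t_nonunit] by blast
      then show False using 2(1) by simp
    qed
    then have "(u * \<pi> ^ e) \<star> v = \<zero>" using act_dvd_zero[of \<pi> "u * \<pi> ^ e" v] v by (simp add: dvd_power)
    moreover have "(t - u * \<pi> ^ e) \<star> v = \<zero>" using act_dvd_zero[OF 2(2)] v by blast
    ultimately show ?thesis using act_add_left[OF v(1), of "t - u * \<pi> ^ e" "u * \<pi> ^ e"] v(1) by simp
  qed
  then show ?thesis using t_regular v by blast
qed

lemma residue_basis_exists:
  assumes "chain_factors f n" "j \<in> {1..n}" "sub L" "finite J" "d \<in> J \<rightarrow> L" "L \<subseteq> span J d"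
    and p: "\<And>v. v \<in> L \<Longrightarrow> f j \<star> v = \<zero>"
  shows "\<exists>J0\<subseteq>J. cyclic_basis L J0 d (\<lambda>_. f j)"
proof -
  have nu: "\<not> f j dvd 1" and "\<exists>\<pi>. residue_uniformizer (f j) \<pi>"
    using assms(1,2) by (simp_all add: chain_factors_def)
  then obtain \<pi> where \<pi>: "residue_uniformizer (f j) \<pi>" by (elim exE)
  show ?thesis
  proof (rule torsion_free_imp_free_over_residue_ring[OF \<pi> assms(3-6) p])
    show "v = \<zero>" if "v \<in> L" "\<pi> \<star> v = \<zero>" for v
      using residue_torsion_free[OF \<pi> nu subD(1)[OF assms(3)] p] that by blast
  qed
qed

lemma has_standard_basis_one:
  assumes "chain_factors f 1" "sub A" "fg A" and kill: "\<And>v. v \<in> A \<Longrightarrow> seg f 0 1 \<star> v = \<zero>"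
  shows "has_standard_basis f 1 A"
proof -
  obtain B where B: "finite B" "B \<subseteq> A" "A \<subseteq> span B (\<lambda>b. b)" using assms by (auto simp: fg_def)
  have f1: "seg f 0 1 = f 1" by (simp add: seg_def)
  obtain J0 where "J0 \<subseteq> B" "cyclic_basis A J0 (\<lambda>b. b) (\<lambda>_. f 1)"
    using residue_basis_exists[OF assms(1) _ assms(2), of 1 B "\<lambda>b. b"] B kill f1 by auto
  then show ?thesis unfolding has_standard_basis_def
    by (intro exI[of _ J0] exI[of _ "\<lambda>b. b"] exI[of _ "\<lambda>_. 1"]) (simp only: f1, simp)
qed

text \<open>Let \<open>p\<close> be the last factor and \<open>g n\<close> the product of the others.  A basis \<open>e\<close> of \<open>p A\<close> is lifted to
  elements \<open>E\<close> with \<open>e i = p \<star> E i\<close>.  The kernel \<open>L\<close> of \<open>p\<close> equals \<open>g n A\<close> by the kernel condition, it is free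
  over the discrete valuation ring \<open>S / (p)\<close>, and by Nakayama it is generated by the elements
  \<open>d i = g (l i) \<star> E i\<close> of top label \<open>l i = n\<close>.  The lifts of those that form a basis of \<open>L\<close> get
  the label \<open>Suc n\<close>; every other lift is corrected by a combination of these so that \<open>g (l i)\<close>
  kills it.\<close>

lemma standard_basis_lift:
  assumes n: "1 \<le> n" and f: "chain_factors f (Suc n)" and A: "sub A" "fg A"
    and kill: "\<And>v. v \<in> A \<Longrightarrow> seg f 0 (Suc n) \<star> v = \<zero>"
    and kc: "kernel_condition f (Suc n) A"
    and quot: "has_standard_basis f n {f (Suc n) \<star> v | v. v \<in> A}"
  shows "has_standard_basis f (Suc n) A"
proof -
  note AD = subD[OF A(1)]
  define p where "p = f (Suc n)"
  define g where "g = seg f 0"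
  define L where "L = {v \<in> A. p \<star> v = \<zero>}"
  have gS: "g (Suc n) = g n * p" by (simp add: g_def p_def seg_Suc)
  have L: "sub L" unfolding L_def using A(1) by (rule sub_kernel)
  note LD = subD[OF L]
  have LA: "v \<in> A" "p \<star> v = \<zero>" if "v \<in> L" for v using that by (auto simp: L_def)
  obtain I :: "'x set" and e l where l: "l \<in> I \<rightarrow> {1..n}"
    and b: "cyclic_basis {p \<star> v | v. v \<in> A} I e (\<lambda>i. g (l i))"
    using quot unfolding has_standard_basis_def p_def g_def by blast
  have fin: "finite I" and spA: "{p \<star> v | v. v \<in> A} \<subseteq> span I e"
    and ge: "\<And>i. i \<in> I \<Longrightarrow> g (l i) \<star> e i = \<zero>"
    and ind: "\<And>c i. lc I c e = \<zero> \<Longrightarrow> i \<in> I \<Longrightarrow> g (l i) dvd c i"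
    using b by (auto simp: cyclic_basis_def)
  have "\<forall>i\<in>I. \<exists>w\<in>A. e i = p \<star> w" using b by (auto simp: cyclic_basis_def Pi_def)
  then obtain E where E: "\<And>i. i \<in> I \<Longrightarrow> E i \<in> A" "\<And>i. i \<in> I \<Longrightarrow> e i = p \<star> E i" by metis
  have EX: "\<And>i. i \<in> I \<Longrightarrow> E i \<in> carrier V" using E AD by blast
  have EXs: "E \<in> J \<rightarrow> carrier V" if "J \<subseteq> I" for J using EX that by auto
  have pE: "p \<star> lc I c E = lc I c e" for c
    using fin EX E(2) by (subst act_lc_right) (auto intro!: lc_cong)
  define d where "d i = g (l i) \<star> E i" for i
  have dL: "d i \<in> L" if i: "i \<in> I" for i
  proof -
    have "p \<star> d i = g (l i) \<star> e i" unfolding d_def E(2)[OF i] using EX[OF i] by (rule act_commute)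
    then show ?thesis using ge[OF i] E(1)[OF i] AD(4) by (auto simp: L_def d_def)
  qed
  have dX: "\<And>i. i \<in> I \<Longrightarrow> d i \<in> carrier V" using dL LD by blast
  have Lg: "\<exists>w\<in>A. v = g n \<star> w" if v: "v \<in> L" for v
  proof -
    have "seg f n (Suc n) = p" by (simp add: seg_def p_def)
    then show ?thesis using kc n v unfolding kernel_condition_def g_def L_def by auto
  qed
  have gL: "g n \<star> w \<in> L" if w: "w \<in> A" for w
  proof -
    have "p \<star> g n \<star> w = g (Suc n) \<star> w" using AD(1)[OF w] by (simp add: act_act gS mult.commute)
    then show ?thesis using kill[OF w] AD(4)[OF w] by (simp add: L_def g_def)
  qed
  \<comment> \<open>The kernel condition for the index \<open>n\<close>.\<close>
  have "L = {g n \<star> w | w. w \<in> A}" using Lg gL by blast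
  then have fgL: "fg L" using fg_scaled[OF A] by simp
  have lift: "\<exists>b. \<exists>w\<in>L. v = lc I b E \<oplus> w" if v: "v \<in> A" for v
  proof -
    obtain b where b: "p \<star> v = lc I b e" using spA v by (auto simp: span_def)
    have lA: "lc I b E \<in> A" using E(1) fin by (intro lc_in_sub[OF A(1)])
    define w where "w = v \<ominus> lc I b E"
    have "w \<in> A" unfolding w_def using v lA AD(6) by blast
    moreover have "p \<star> w = \<zero>"
    proof -
      have "p \<star> w = p \<star> v \<ominus> p \<star> lc I b E"
        unfolding w_def using AD(1)[OF v] AD(1)[OF lA] by (rule act_diff_right)
      also have "\<dots> = p \<star> v \<ominus> p \<star> v" using pE[of b] b by simp
      finally show ?thesis using AD(1)[OF v] by (simp add: a_minus_def r_neg)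
    qed
    moreover have "v = lc I b E \<oplus> w"
      unfolding w_def using AD(1)[OF v] AD(1)[OF lA] by (simp add: a_minus_def a_lcomm r_neg)
    ultimately show ?thesis unfolding L_def by blast
  qed
  define J where "J = {i \<in> I. l i = n}"
  have J: "finite J" "J \<subseteq> I" using fin by (auto simp: J_def)
  \<comment> \<open>For a label below \<open>n\<close> the element \<open>g n \<star> E i\<close> is a multiple of \<open>f n\<close>, which lies in the radical.\<close>
  have "L \<subseteq> span J d"
  proof (rule nakayama)
    show "sub (span J d)" using J dX by (intro sub_span) auto
    show "sub L" "fg L" by fact+
    have "\<not> f n dvd 1" using f n by (simp add: chain_factors_def)
    then show "(1 - f n * c) dvd 1" for c by (rule radical)
    fix v assume "v \<in> L"
    then obtain w0 where w0: "w0 \<in> A" "v = g n \<star> w0" using Lg by blast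
    then obtain b w where w: "w \<in> L" "w0 = lc I b E \<oplus> w" using lift by blast
    have wX: "w \<in> carrier V" using w LD by blast
    define y where "y = lc (I - J) b (\<lambda>i. seg f (l i) (n - 1) \<star> d i)"
    have yL: "y \<in> L" unfolding y_def using fin dL LD(4) by (intro lc_in_sub[OF L]) auto
    have yX: "y \<in> carrier V" using yL LD by blast
    have gn: "g n = f n * g (n - 1)" using n seg_Suc[of 0 "n - 1" f] by (simp add: g_def mult.commute)
    have "v = lc I b (\<lambda>i. g n \<star> E i) \<oplus> g n \<star> w"
      unfolding w0(2) w(2) using fin EX wX by (simp add: act_add_right act_lc_right Pi_def)
    also have "lc I b (\<lambda>i. g n \<star> E i) = lc J b (\<lambda>i. g n \<star> E i) \<oplus> lc (I - J) b (\<lambda>i. g n \<star> E i)"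
      using fin J EX by (intro lc_split) auto
    also have "lc J b (\<lambda>i. g n \<star> E i) = lc J b d"
      using dX J by (intro lc_cong) (auto simp: d_def J_def)
    also have "lc (I - J) b (\<lambda>i. g n \<star> E i) = f n \<star> y"
    proof -
      have "g n \<star> E i = f n \<star> seg f (l i) (n - 1) \<star> d i" if i: "i \<in> I - J" for i
      proof -
        have "l i \<le> n - 1" 
        proof -
          have "l i \<in> {1..n}" "l i \<noteq> n" using i l by (auto simp: J_def)
          then show ?thesis by auto
        qed
        then have "g (l i) * seg f (l i) (n - 1) = g (n - 1)" unfolding g_def by (intro seg_mult) auto
        then have "f n * (seg f (l i) (n - 1) * g (l i)) = g n" by (simp add: gn mult.commute)
        then show ?thesis using i EX by (simp add: d_def act_act mult.assoc)
      qed
      then show ?thesis unfolding y_def using fin dX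
        by (subst act_lc_right) (auto intro!: lc_cong)
    qed
    also have "g n \<star> w = f n \<star> g (n - 1) \<star> w" using wX by (simp add: act_act gn)
    finally have "v = lc J b d \<oplus> f n \<star> (y \<oplus> g (n - 1) \<star> w)"
      using yX wX J dX lc_closed[of d J b] by (simp add: act_add_right a_assoc Pi_def subset_iff)
    moreover have "y \<oplus> g (n - 1) \<star> w \<in> L" using yL w(1) LD by blast
    ultimately show "\<exists>u\<in>span J d. \<exists>w\<in>L. v = u \<oplus> f n \<star> w" by blast
  qed
  then obtain J0 where J0: "J0 \<subseteq> J" and bL: "cyclic_basis L J0 d (\<lambda>_. p)"
    using residue_basis_exists[OF f _ L J(1), of "Suc n" d] dL J LA unfolding p_def by auto
  have finJ0: "finite J0" and J0I: "J0 \<subseteq> I" and lJ0: "\<And>i. i \<in> J0 \<Longrightarrow> l i = n"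
    using J0 J finite_subset unfolding J_def by auto
  have spL: "L \<subseteq> span J0 d" and indL: "\<And>c i. lc J0 c d = \<zero> \<Longrightarrow> i \<in> J0 \<Longrightarrow> p dvd c i"
    using bL by (auto simp: cyclic_basis_def)
  have "\<forall>i\<in>I. \<exists>c. d i = lc J0 c d" using dL spL by (auto simp: span_def)
  then obtain c where c: "\<And>i. i \<in> I \<Longrightarrow> d i = lc J0 (c i) d" by metis
  \<comment> \<open>Multiplication by \<open>g (l i)\<close> turns \<open>W i\<close> into the expansion of \<open>d i\<close> in the basis of \<open>L\<close>.\<close>
  define W where "W i = lc J0 (\<lambda>j. c i j * seg f (l i) n) E" for i
  have WX: "W i \<in> carrier V" for i unfolding W_def using EXs[OF J0I] by blast
  have WA: "W i \<in> A" for i unfolding W_def using E(1) J0I finJ0 by (intro lc_in_sub[OF A(1)]) auto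
  have gW: "g (l i) \<star> W i = d i" if i: "i \<in> I" for i
  proof -
    have li: "g (l i) * seg f (l i) n = g n" unfolding g_def using i l by (intro seg_mult) auto
    have "g (l i) \<star> W i = lc J0 (\<lambda>j. g (l i) * (c i j * seg f (l i) n)) E"
      unfolding W_def using finJ0 EXs[OF J0I] by (rule act_lc)
    also have "\<dots> = lc J0 (c i) d"
    proof (rule lc_cong)
      fix j assume j: "j \<in> J0"
      have eq: "g (l i) * (c i j * seg f (l i) n) = c i j * g n" using li by (metis mult.left_commute)
      have "E j \<in> carrier V" using EX J0I j by blast
      then show "(g (l i) * (c i j * seg f (l i) n)) \<star> E j = c i j \<star> d j"
        unfolding eq d_def lJ0[OF j] by (simp add: act_act)
    qed (use dX J0I in auto)
    finally show ?thesis using c[OF i] by simp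
  qed
  define E' where "E' i = (if i \<in> J0 then E i else E i \<ominus> W i)" for i
  define l' where "l' i = (if i \<in> J0 then Suc n else l i)" for i
  have E'A: "E' i \<in> A" if "i \<in> I" for i unfolding E'_def using that E(1) WA AD(6) by auto
  have E'X: "E' \<in> I \<rightarrow> carrier V" using E'A AD(1) by auto
  have EE': "E i = E' i \<oplus> W i" if "i \<in> I - J0" for i
    unfolding E'_def using that EX WX by (simp add: a_minus_def a_assoc l_neg)
  have killE': "g (l' i) \<star> E' i = \<zero>" if i: "i \<in> I" for i
  proof (cases "i \<in> J0")
    case True
    then show ?thesis using kill[OF E(1)[OF i]] by (simp add: l'_def E'_def g_def)
  next
    case False
    then show ?thesis
    proof -
      have "g (l i) \<star> (E i \<ominus> W i) = d i \<ominus> d i"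
        using act_diff_right[OF EX[OF i] WX, of "g (l i)"] gW[OF i] by (simp only: d_def)
      then show ?thesis using False dX[OF i] by (simp add: l'_def E'_def a_minus_def r_neg)
    qed
  qed
  have sS: "sub (span I E')" using fin E'X by (rule sub_span)
  have E'S: "E' i \<in> span I E'" if "i \<in> I" for i using fin E'X that by (rule span_base)
  have ES0: "E i \<in> span I E'" if "i \<in> J0" for i
    using E'S[of i] that J0I by (auto simp: E'_def)
  have WS: "W i \<in> span I E'" for i unfolding W_def using ES0 finJ0 by (intro lc_in_sub[OF sS])
  have ES: "E i \<in> span I E'" if "i \<in> I" for i
    using EE'[of i] ES0 E'S[OF that] WS subD(3)[OF sS] that by (cases "i \<in> J0") auto
  have "A \<subseteq> span I E'"
  proof
    fix v assume "v \<in> A"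
    then obtain b w where w: "w \<in> L" "v = lc I b E \<oplus> w" using lift by blast
    have "lc I b E \<in> span I E'" using ES fin by (intro lc_in_sub[OF sS])
    moreover have "d i \<in> span I E'" if "i \<in> J0" for i
      unfolding d_def using ES0[OF that] subD(4)[OF sS] by blast
    then have "span J0 d \<subseteq> span I E'" using finJ0 by (intro span_least[OF sS])
    ultimately show "v \<in> span I E'" using w spL subD(3)[OF sS] by blast
  qed
  moreover have "g (l' i) dvd a i" if a: "lc I a E' = \<zero>" and i: "i \<in> I" for a i
  proof -
    have E'0: "lc J0 a E' = lc J0 a E" using EXs[OF J0I] by (intro lc_cong) (auto simp: E'_def)
    have EI: "E \<in> I - J0 \<rightarrow> carrier V" "E' \<in> I - J0 \<rightarrow> carrier V" "E \<in> J0 \<rightarrow> carrier V"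
      using EX E'X J0I by auto
    have EW: "lc (I - J0) a E = lc (I - J0) a E' \<oplus> lc (I - J0) a W"
    proof -
      have "lc (I - J0) a E = lc (I - J0) a (\<lambda>i. E' i \<oplus> W i)"
        using EE' EI WX by (intro lc_cong) auto
      then show ?thesis using fin EI WX by (subst (asm) lc_add_right) auto
    qed
    have "sub (span J0 E)" using finJ0 EI(3) by (rule sub_span)
    then have "lc (I - J0) a W \<in> span J0 E"
      using fin by (intro lc_in_sub) (auto simp: W_def)
    then obtain q where q: "lc (I - J0) a W = lc J0 q E" by (auto simp: span_def)
    have sp: "lc J0 a E \<oplus> lc (I - J0) a E' = \<zero>"
      using a lc_split[OF fin J0I E'X, of a] E'0 by simp
    \<comment> \<open>The coefficients of the same relation with respect to \<open>E\<close> instead of \<open>E'\<close>.\<close>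
    define a' where "a' i = (if i \<in> J0 then a i - q i else a i)" for i
    have lcs: "lc J0 a E \<in> carrier V" "lc J0 q E \<in> carrier V" "lc (I - J0) a E' \<in> carrier V"
      using EI by auto
    have "lc I a' E = lc J0 a' E \<oplus> lc (I - J0) a' E" using fin J0I EXs by (intro lc_split) auto
    also have "lc J0 a' E = lc J0 (\<lambda>i. a i - q i) E"
      using EI(3) by (intro lc_cong) (auto simp: a'_def)
    also have "\<dots> = lc J0 a E \<ominus> lc J0 q E" using finJ0 EI(3) by (rule lc_diff)
    also have "lc (I - J0) a' E = lc (I - J0) a E"
      using EI by (intro lc_cong) (auto simp: a'_def)
    also have "\<dots> = lc (I - J0) a E' \<oplus> lc J0 q E" using EW q by simp
    also have "lc J0 a E \<ominus> lc J0 q E \<oplus> (lc (I - J0) a E' \<oplus> lc J0 q E)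
        = lc J0 a E \<oplus> lc (I - J0) a E' \<oplus> (lc J0 q E \<oplus> \<ominus> lc J0 q E)"
      using lcs by (simp only: a_minus_def a_ac a_closed a_inv_closed)
    finally have "lc I a' E = \<zero>" using sp lcs by (simp add: r_neg)
    then have "lc I a' e = \<zero>" using pE[of a'] by simp
    note inda' = ind[OF this]
    have "a i \<star> E' i = \<zero>" if i: "i \<in> I - J0" for i
    proof -
      have "g (l i) dvd a i" "g (l i) \<star> E' i = \<zero>"
        using inda'[of i] killE'[of i] i by (auto simp: a'_def l'_def)
      then show ?thesis using act_dvd_zero E'X i by blast
    qed
    \<comment> \<open>Only the elements of label \<open>Suc n\<close> remain in the relation.  Multiplied by \<open>p\<close> it says that \<open>g n\<close>
      divides the coefficients; then it becomes a relation in \<open>L\<close>, which gives the factor \<open>p\<close>.\<close>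
    then have E'z: "lc (I - J0) a E' = \<zero>" by (rule lc_zero)
    then have Ez: "lc J0 a E = \<zero>" using sp lcs by simp
    have "lc I (\<lambda>i. if i \<in> J0 then a i else 0) E = lc J0 a E"
    proof -
      have "lc (I - J0) (\<lambda>i. if i \<in> J0 then a i else 0) E = \<zero>" using EX by (intro lc_zero) auto
      moreover have "lc J0 (\<lambda>i. if i \<in> J0 then a i else 0) E = lc J0 a E"
        using EI by (intro lc_cong) auto
      ultimately show ?thesis using lc_split[OF fin J0I EXs[OF subset_refl]] lcs by simp
    qed
    then have "lc I (\<lambda>i. if i \<in> J0 then a i else 0) e = \<zero>" using Ez pE by (metis act_zero_right)
    from ind[OF this] have "\<forall>i\<in>J0. \<exists>b. a i = g n * b" using J0I lJ0 by (fastforce simp: dvd_def)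
    then obtain b where b: "\<And>i. i \<in> J0 \<Longrightarrow> a i = g n * b i" by metis
    have "lc J0 b d = lc J0 a E"
      using EI(3) b lJ0 by (intro lc_cong) (auto simp: d_def act_act mult.commute Pi_def)
    then have "p dvd b i" if "i \<in> J0" for i using indL Ez that by simp
    then have J0c: "g (Suc n) dvd a i" if "i \<in> J0" for i
      using b[OF that] that by (simp add: gS)
    show ?thesis
    proof (cases "i \<in> J0")
      case True
      then show ?thesis using J0c by (simp add: l'_def)
    next
      case False
      then show ?thesis using inda'[OF i] by (simp add: l'_def a'_def)
    qed
  qed
  ultimately have "cyclic_basis A I E' (\<lambda>i. g (l' i))"
    unfolding cyclic_basis_def using fin E'A killE' by auto
  moreover have "l' \<in> I \<rightarrow> {1..Suc n}" using l by (fastforce simp: l'_def)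
  ultimately show ?thesis unfolding has_standard_basis_def g_def by blast
qed

text \<open>Induction on the number of factors: the kernel condition passes from \<open>A\<close> to \<open>f (Suc n) A\<close>, on which
  one factor less acts as zero.\<close>

theorem kernel_condition_imp_standard_basis:
  assumes "1 \<le> n" "chain_factors f n" "sub A" "fg A"
    and "\<And>v. v \<in> A \<Longrightarrow> seg f 0 n \<star> v = \<zero>" and "kernel_condition f n A"
  shows "has_standard_basis f n A"
  using assms
proof (induction n arbitrary: A rule: nat_induct_at_least)
  case base
  then show ?case using has_standard_basis_one by blast
next
  case (Suc n)
  let ?p = "f (Suc n)"
  let ?A' = "{?p \<star> v | v. v \<in> A}"
  have AX: "v \<in> carrier V" if "v \<in> A" for v using subD(1)[OF Suc.prems(2) that] .
  have "has_standard_basis f n ?A'"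
  proof (rule Suc.IH)
    show "chain_factors f n" using Suc.prems(1) by (auto simp: chain_factors_def)
    show "sub ?A'" using Suc.prems(2) by (rule sub_scaled)
    show "fg ?A'" using Suc.prems(2,3) by (rule fg_scaled)
    show "seg f 0 n \<star> v = \<zero>" if "v \<in> ?A'" for v
      using that Suc.prems(4) AX by (auto simp: act_act seg_Suc)
    show "kernel_condition f n ?A'"
      unfolding kernel_condition_def
    proof (intro ballI impI)
      fix i v assume i: "i \<in> {1..n}" and v: "v \<in> ?A'" "seg f i n \<star> v = \<zero>"
      obtain w where w: "w \<in> A" "v = ?p \<star> w" using v(1) by blast
      have "seg f i (Suc n) \<star> w = \<zero>" using v(2) w i AX by (simp add: act_act seg_Suc)
      then obtain u where u: "u \<in> A" "w = seg f 0 i \<star> u"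
        using Suc.prems(5) i w(1) unfolding kernel_condition_def by force
      have "v = seg f 0 i \<star> ?p \<star> u" unfolding w(2) u(2) using AX[OF u(1)] by (rule act_commute)
      then show "\<exists>w\<in>?A'. v = seg f 0 i \<star> w" using u(1) by blast
    qed
  qed
  then show ?case using Suc.hyps Suc.prems by (intro standard_basis_lift)
qed

subsection \<open>The lifting condition\<close>

lemma linD:
  assumes "lin m A \<phi>"
  shows "u \<in> A \<Longrightarrow> v \<in> A \<Longrightarrow> m dvd \<phi> (u \<oplus> v) - (\<phi> u + \<phi> v)"
    and "v \<in> A \<Longrightarrow> m dvd \<phi> (s \<star> v) - s * \<phi> v"
  using assms unfolding lin_def by blast+

lemma lin_zero: "lin m A \<phi> \<Longrightarrow> sub A \<Longrightarrow> m dvd \<phi> \<zero>"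
  unfolding lin_def using subD(2) act_zero_right[of 0] by (metis diff_zero mult_zero_left)

lemma lin_lc:
  assumes "lin m A \<phi>" "sub A" "finite I" "\<And>i. i \<in> I \<Longrightarrow> e i \<in> A"
  shows "m dvd \<phi> (lc I c e) - (\<Sum>i\<in>I. c i * \<phi> (e i))"
  using assms(3,4)
proof (induction I rule: finite_induct)
  case empty
  then show ?case using lin_zero[OF assms(1,2)] by simp
next
  case (insert i I)
  have e: "e \<in> insert i I \<rightarrow> carrier V" "e i \<in> A" using insert.prems subD(1)[OF assms(2)] by auto
  have 1: "lc I c e \<in> A" "c i \<star> e i \<in> A"
    using insert.prems insert.hyps subD(4)[OF assms(2)] by (auto intro: lc_in_sub[OF assms(2)])
  have "m dvd \<phi> (c i \<star> e i \<oplus> lc I c e) - (\<phi> (c i \<star> e i) + \<phi> (lc I c e))"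
    "m dvd \<phi> (c i \<star> e i) - c i * \<phi> (e i)" "m dvd \<phi> (lc I c e) - (\<Sum>i\<in>I. c i * \<phi> (e i))"
    using assms(1) 1 e(2) insert.IH insert.prems unfolding lin_def by auto
  then have "m dvd (\<phi> (c i \<star> e i \<oplus> lc I c e) - (\<phi> (c i \<star> e i) + \<phi> (lc I c e)))
      + (\<phi> (c i \<star> e i) - c i * \<phi> (e i)) + (\<phi> (lc I c e) - (\<Sum>i\<in>I. c i * \<phi> (e i)))"
    by (intro dvd_add)
  then show ?case using insert.hyps e(1) by (simp add: lc_insert algebra_simps)
qed

text \<open>Steinitz exchange, controlled by linear forms \<open>\<psi> j\<close> that are dual to the elements \<open>\<kappa> j\<close> up to
  nonunits.  A form can take a unit value only on a basis element of top label \<open>n\<close>, because on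
  an element that is killed by a proper divisor \<open>seg f 0 l\<close> its values are multiples of \<open>f n\<close>; and it takes no unit value on the
  elements that have been exchanged before.\<close>

lemma cyclic_basis_exchange_family:
  assumes K: "sub K" and f: "chain_factors f n" and l: "l \<in> I \<rightarrow> {1..n}" and n: "1 \<le> n"
    and b: "cyclic_basis K I e (\<lambda>i. seg f 0 (l i))"
    and kill: "\<And>v. v \<in> K \<Longrightarrow> seg f 0 n \<star> v = \<zero>"
    and J: "finite J" "\<And>j. j \<in> J \<Longrightarrow> \<kappa> j \<in> K"
    and \<psi>: "\<And>j. j \<in> J \<Longrightarrow> lin (seg f 0 n) K (\<psi> j)"
    and diag: "\<And>j. j \<in> J \<Longrightarrow> \<psi> j (\<kappa> j) dvd 1"
    and off: "\<And>j k. j \<in> J \<Longrightarrow> k \<in> J \<Longrightarrow> j \<noteq> k \<Longrightarrow> \<not> \<psi> j (\<kappa> k) dvd 1"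
  shows "\<exists>e' s. cyclic_basis K I e' (\<lambda>i. seg f 0 (l i)) \<and> inj_on s J \<and> s ` J \<subseteq> I \<and>
    (\<forall>j\<in>J. e' (s j) = \<kappa> j \<and> l (s j) = n)"
  using J diag off \<psi>
proof (induction J rule: finite_induct)
  case empty
  then show ?case using b by auto
next
  case (insert j J)
  have "\<exists>e' s. cyclic_basis K I e' (\<lambda>i. seg f 0 (l i)) \<and> inj_on s J \<and> s ` J \<subseteq> I \<and>
    (\<forall>j\<in>J. e' (s j) = \<kappa> j \<and> l (s j) = n)"
    by (rule insert.IH) (simp_all add: insert.prems)
  then obtain e' s where b': "cyclic_basis K I e' (\<lambda>i. seg f 0 (l i))" and s: "inj_on s J" "s ` J \<subseteq> I"
    and es: "\<And>j. j \<in> J \<Longrightarrow> e' (s j) = \<kappa> j" "\<And>j. j \<in> J \<Longrightarrow> l (s j) = n" by blast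
  have fin: "finite I" and e'K: "\<And>i. i \<in> I \<Longrightarrow> e' i \<in> K" and sp: "K \<subseteq> span I e'"
    and kille: "\<And>i. i \<in> I \<Longrightarrow> seg f 0 (l i) \<star> e' i = \<zero>"
    using b' by (auto simp: cyclic_basis_def)
  have \<kappa>K: "\<kappa> j \<in> K" using insert.prems by simp
  then obtain a where a: "\<kappa> j = lc I a e'" using sp by (auto simp: span_def)
  have lin: "lin (seg f 0 n) K (\<psi> j)" and u: "\<psi> j (\<kappa> j) dvd 1" using insert.prems by auto
  have fn: "f n dvd seg f 0 n" and fnu: "\<not> f n dvd 1"
    using n f by (auto intro: seg_dvd simp: chain_factors_def)
  have fnu': "\<not> x dvd 1" if "f n dvd x" for x using that fnu dvd_trans by blast
  have lind: "f n dvd \<psi> j (lc I a e') - (\<Sum>i\<in>I. a i * \<psi> j (e' i))"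
    using lin_lc[where c = a and e = e', OF lin K fin e'K] fn dvd_trans by blast
  \<comment> \<open>In a local ring a sum of nonunits is a nonunit.\<close>
  have "\<exists>i\<in>I. (a i * \<psi> j (e' i)) dvd 1"
  proof (rule ccontr)
    assume none: "\<not> ?thesis"
    have *: "\<not> (\<Sum>i\<in>I'. a i * \<psi> j (e' i)) dvd 1" if "finite I'" "I' \<subseteq> I" for I'
      using that
    proof (induction I' rule: finite_induct)
      case (insert k I')
      then have "\<not> (a k * \<psi> j (e' k)) dvd 1" "\<not> (\<Sum>i\<in>I'. a i * \<psi> j (e' i)) dvd 1"
        using none by auto
      then show ?case using local insert.hyps by (simp only: sum.insert not_False_eq_True)
    qed simp
    have "\<not> (\<psi> j (lc I a e') - (\<Sum>i\<in>I. a i * \<psi> j (e' i)) + (\<Sum>i\<in>I. a i * \<psi> j (e' i))) dvd 1"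
      by (rule local[OF fnu'[OF lind] *[OF fin subset_refl]])
    then show False using u a by simp
  qed
  then obtain i where i: "i \<in> I" "a i dvd 1" "\<psi> j (e' i) dvd 1"
    using dvd_mult_left dvd_mult_right by blast
  have inew: "i \<notin> s ` J"
  proof
    assume "i \<in> s ` J"
    then obtain k where k: "k \<in> J" "i = s k" by blast
    then have "e' i = \<kappa> k" "j \<noteq> k" using es insert.hyps by auto
    then show False using insert.prems(3)[of j k] k i(3) by simp
  qed
  have li: "l i = n"
  proof (rule ccontr)
    assume "l i \<noteq> n"
    moreover have "l i \<in> {1..n}" using l i(1) by blast
    ultimately have lt: "l i < n" "l i \<in> {1..n}" by auto
    have g: "seg f 0 (l i) * seg f (l i) n = seg f 0 n" using lt by (intro seg_mult) auto
    have "seg f 0 n dvd \<psi> j (seg f 0 (l i) \<star> e' i) - seg f 0 (l i) * \<psi> j (e' i)"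
      using lin e'K[OF i(1)] by (rule linD(2))
    moreover have "seg f 0 n dvd \<psi> j (seg f 0 (l i) \<star> e' i)"
      using kille[OF i(1)] lin_zero[OF lin K] by simp
    ultimately have "seg f 0 (l i) * seg f (l i) n dvd seg f 0 (l i) * \<psi> j (e' i)"
      unfolding g by (rule dvd_diffD)
    moreover have "seg f 0 (l i) \<noteq> 0" using lt f by (auto simp: seg_def chain_factors_def)
    ultimately have "seg f (l i) n dvd \<psi> j (e' i)" by simp
    then have "f n dvd \<psi> j (e' i)" using seg_dvd[of "l i" n n f] lt dvd_trans by blast
    then show False using fnu' i(3) by blast
  qed
  let ?e = "e'(i := \<kappa> j)"
  have "cyclic_basis K I ?e (\<lambda>i. seg f 0 (l i))"
    by (rule cyclic_basis_exchange[OF K b' i(1) a i(2)]) (simp add: li kill \<kappa>K)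
  moreover have "inj_on (s(j := i)) (insert j J)"
    using s(1) inew insert.hyps by (auto simp: inj_on_def)
  moreover have "(s(j := i)) ` insert j J \<subseteq> I" using s i by auto
  moreover have "\<forall>k\<in>insert j J. ?e ((s(j := i)) k) = \<kappa> k \<and> l ((s(j := i)) k) = n"
    using es inew li insert.hyps by auto
  ultimately show ?case by blast
qed

text \<open>Let \<open>p\<close> be the last factor and \<open>g n\<close> the product of the others.  The kernel \<open>K\<close> of \<open>g n\<close> satisfies the
  lifting condition for one factor less, so it has a standard basis.  The quotient of \<open>A\<close> by \<open>K\<close>
  is isomorphic to \<open>g n A\<close>, which is free over the discrete valuation ring \<open>S / (p)\<close>; let \<open>J\<close> be a set
  of preimages of a basis.  The coordinate functions on it lift to linear forms on \<open>A\<close> and, divided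
  by \<open>p\<close>, give forms on \<open>K\<close> that are dual to the elements \<open>\<kappa> x = p \<star> x\<close> with \<open>x \<in> J\<close>.  By exchange these become
  members of label \<open>n\<close> of a standard basis of \<open>K\<close>.  Replacing each \<open>\<kappa> x\<close> by \<open>x\<close> then yields
  a standard basis of \<open>A\<close>, where \<open>x\<close> has the label \<open>Suc n\<close>.\<close>

lemma standard_basis_extend:
  assumes n: "1 \<le> n" and f: "chain_factors f (Suc n)" and A: "sub A" "fg A"
    and kill: "\<And>v. v \<in> A \<Longrightarrow> seg f 0 (Suc n) \<star> v = \<zero>"
    and lc: "lifting_condition f (Suc n) A"
    and IH: "\<And>K. sub K \<Longrightarrow> fg K \<Longrightarrow> (\<And>v. v \<in> K \<Longrightarrow> seg f 0 n \<star> v = \<zero>) \<Longrightarrow>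
      lifting_condition f n K \<Longrightarrow> has_standard_basis f n K"
  shows "has_standard_basis f (Suc n) A"
proof -
  note AD = subD[OF A(1)]
  define p where "p = f (Suc n)"
  define g where "g = seg f 0"
  define K where "K = {v \<in> A. g n \<star> v = \<zero>}"
  define G where "G = {g n \<star> v | v. v \<in> A}"
  have gS: "g (Suc n) = g n * p" by (simp add: g_def p_def seg_Suc)
  have gn0: "g n \<noteq> 0" and p0: "p \<noteq> 0" and pnu: "\<not> p dvd 1"
    using f by (auto simp: g_def p_def seg_def chain_factors_def)
  have K: "sub K" unfolding K_def using A(1) by (rule sub_kernel)
  note KD = subD[OF K]
  have KA: "v \<in> A" "g n \<star> v = \<zero>" if "v \<in> K" for v using that by (auto simp: K_def)
  have pK: "p \<star> v \<in> K" if v: "v \<in> A" for v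
  proof -
    have "g n \<star> p \<star> v = g (Suc n) \<star> v" using AD(1)[OF v] by (simp add: act_act gS)
    then show ?thesis using kill[OF v] AD(4)[OF v] by (simp add: K_def g_def)
  qed
  obtain B where B: "finite B" "B \<subseteq> A" "A \<subseteq> span B (\<lambda>b. b)" using A(2) by (auto simp: fg_def)
  define d where "d x = g n \<star> x" for x
  have "\<exists>J\<subseteq>B. cyclic_basis G J d (\<lambda>_. f (Suc n))"
  proof (rule residue_basis_exists[OF f])
    show "sub G" unfolding G_def using A(1) by (rule sub_scaled)
    show "finite B" by fact
    show "d \<in> B \<rightarrow> G" using B(2) by (auto simp: G_def d_def)
    show "G \<subseteq> span B d"
    proof
      fix v assume "v \<in> G"
      then obtain w c where "v = g n \<star> w" "w = lc B c (\<lambda>b. b)" using B(3) by (auto simp: G_def span_def)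
      then have "v = lc B c d" unfolding d_def using B AD(1) by (simp add: act_lc_right Pi_def subset_iff)
      then show "v \<in> span B d" by blast
    qed
    show "f (Suc n) \<star> v = \<zero>" if "v \<in> G" for v
      using that pK KA(2) act_commute AD(1) by (force simp: G_def p_def)
  qed simp
  then obtain J where J: "J \<subseteq> B" and bG: "cyclic_basis G J d (\<lambda>_. p)" unfolding p_def by blast
  have finJ: "finite J" and spG: "G \<subseteq> span J d" and indG: "\<And>c j. lc J c d = \<zero> \<Longrightarrow> j \<in> J \<Longrightarrow> p dvd c j"
    using bG by (auto simp: cyclic_basis_def)
  have JA: "x \<in> A" if "x \<in> J" for x using that J B(2) by blast
  have JX: "(\<lambda>x. x) \<in> J \<rightarrow> carrier V" using JA AD(1) by blast
  have gJ: "g n \<star> lc J c (\<lambda>x. x) = lc J c d" for c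
    unfolding d_def using finJ JX by (rule act_lc_right)
  have lJA: "lc J c (\<lambda>x. x) \<in> A" for c using finJ JA by (intro lc_in_sub[OF A(1)])
  define \<kappa> where "\<kappa> x = p \<star> x" for x
  have \<kappa>K: "\<kappa> x \<in> K" if "x \<in> J" for x using pK JA that by (simp add: \<kappa>_def)
  have \<kappa>X: "\<kappa> \<in> J \<rightarrow> carrier V" using \<kappa>K KD(1) by blast
  have ind: "p dvd c j" if "lc J c (\<lambda>x. x) \<in> K" "j \<in> J" for c j
    using indG[of c j] gJ[of c] KA(2)[OF that(1)] that(2) by simp
  have "\<forall>v\<in>A. \<exists>c. v \<ominus> lc J c (\<lambda>x. x) \<in> K"
  proof
    fix v assume v: "v \<in> A"
    then have "g n \<star> v \<in> span J d" using spG by (auto simp: G_def)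
    then obtain c where c: "g n \<star> v = lc J c d" by (auto simp: span_def)
    have "g n \<star> (v \<ominus> lc J c (\<lambda>x. x)) = g n \<star> v \<ominus> g n \<star> lc J c (\<lambda>x. x)"
      using AD(1)[OF v] AD(1)[OF lJA] by (rule act_diff_right)
    also have "\<dots> = g n \<star> v \<ominus> g n \<star> v" using c gJ by simp
    also have "\<dots> = \<zero>" using AD(1)[OF v] by (simp add: a_minus_def r_neg)
    finally show "\<exists>c. v \<ominus> lc J c (\<lambda>x. x) \<in> K" using AD(6)[OF v lJA] unfolding K_def by blast
  qed
  then obtain coef where coef: "\<And>v. v \<in> A \<Longrightarrow> v \<ominus> lc J (coef v) (\<lambda>x. x) \<in> K" by metis
  \<comment> \<open>Every element splits as a part in \<open>K\<close> plus a combination of \<open>J\<close>; neither part depends linearly on it.\<close>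
  define \<rho> where "\<rho> v = v \<ominus> lc J (coef v) (\<lambda>x. x)" for v
  have \<rho>K: "\<rho> v \<in> K" if "v \<in> A" for v using coef that by (simp add: \<rho>_def)
  have \<rho>: "v = \<rho> v \<oplus> lc J (coef v) (\<lambda>x. x)" if "v \<in> A" for v
    unfolding \<rho>_def using AD(1)[OF that] AD(1)[OF lJA] by (simp add: a_minus_def a_assoc l_neg)
  \<comment> \<open>Two decompositions of the same element differ by a combination of the \<open>\<kappa> x\<close>.\<close>
  have uniq: "\<exists>b. (\<forall>j\<in>J. coef v j - a j = p * b j) \<and> k = \<rho> v \<oplus> lc J b \<kappa>"
    if v: "v \<in> A" and k: "k \<in> K" "v = k \<oplus> lc J a (\<lambda>x. x)" for v k a
  proof -
    have X: "k \<in> carrier V" "\<rho> v \<in> carrier V" "lc J c (\<lambda>x. x) \<in> carrier V" for c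
      using KD(1)[OF k(1)] KD(1)[OF \<rho>K[OF v]] AD(1)[OF lJA] by auto
    have eq: "\<rho> v \<oplus> lc J (coef v) (\<lambda>x. x) = k \<oplus> lc J a (\<lambda>x. x)" using \<rho>[OF v] k(2) by simp
    have "lc J (\<lambda>j. coef v j - a j) (\<lambda>x. x) = lc J (coef v) (\<lambda>x. x) \<ominus> lc J a (\<lambda>x. x)"
      using finJ JX by (rule lc_diff)
    also have "\<dots> = (\<ominus> \<rho> v \<oplus> (\<rho> v \<oplus> lc J (coef v) (\<lambda>x. x))) \<ominus> lc J a (\<lambda>x. x)"
      using X by (simp add: r_neg1)
    also have "\<dots> = \<ominus> \<rho> v \<oplus> k \<oplus> (lc J a (\<lambda>x. x) \<ominus> lc J a (\<lambda>x. x))"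
      unfolding eq using X by (simp add: a_minus_def a_assoc)
    also have "\<dots> = k \<ominus> \<rho> v" using X by (simp add: a_minus_def r_neg a_comm)
    finally have diff: "lc J (\<lambda>j. coef v j - a j) (\<lambda>x. x) = k \<ominus> \<rho> v" .
    have "lc J (\<lambda>j. coef v j - a j) (\<lambda>x. x) \<in> K" unfolding diff using k(1) \<rho>K[OF v] by (rule KD(6))
    then have "\<forall>j\<in>J. p dvd coef v j - a j" using ind by blast
    then obtain b where b: "\<And>j. j \<in> J \<Longrightarrow> coef v j - a j = p * b j" unfolding dvd_def by metis
    have "lc J (\<lambda>j. coef v j - a j) (\<lambda>x. x) = lc J b \<kappa>"
      using JX \<kappa>X by (intro lc_cong) (auto simp: \<kappa>_def b act_act mult.commute Pi_def)
    then have "k \<ominus> \<rho> v = lc J b \<kappa>" using diff by simp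
    then have "k = \<rho> v \<oplus> lc J b \<kappa>" using X
      by (metis a_minus_def a_comm a_inv_closed a_assoc l_neg r_zero a_closed)
    then show ?thesis using b by blast
  qed
  have "fg K"
  proof -
    let ?B = "\<rho> ` B \<union> \<kappa> ` J"
    have BK: "?B \<subseteq> K" using \<rho>K \<kappa>K B(2) by blast
    have s: "sub (span ?B (\<lambda>b. b))" using B finJ BK KD(1) by (intro sub_span) blast+
    have base: "b \<in> span ?B (\<lambda>b. b)" if "b \<in> ?B" for b
      using span_base[of ?B "\<lambda>b. b" b] B(1) finJ BK KD(1) that by blast
    have "K \<subseteq> span ?B (\<lambda>b. b)"
    proof
      fix v assume v: "v \<in> K"
      then obtain c where c: "v = lc B c (\<lambda>b. b)" using B(3) KA(1) by (auto simp: span_def)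
      have BX: "\<rho> \<in> B \<rightarrow> carrier V" "(\<lambda>b. lc J (coef b) (\<lambda>x. x)) \<in> B \<rightarrow> carrier V"
        using \<rho>K KD(1) B(2) AD(1)[OF lJA] by blast+
      have "v = lc B c (\<lambda>b. \<rho> b \<oplus> lc J (coef b) (\<lambda>x. x))"
        unfolding c using \<rho> B(2) BX by (intro lc_cong) auto
      also have "\<dots> = lc B c \<rho> \<oplus> lc B c (\<lambda>b. lc J (coef b) (\<lambda>x. x))"
        using B(1) BX by (rule lc_add_right)
      finally have v1: "v = lc B c \<rho> \<oplus> lc B c (\<lambda>b. lc J (coef b) (\<lambda>x. x))" .
      have "lc B c (\<lambda>b. lc J (coef b) (\<lambda>x. x)) \<in> span J (\<lambda>x. x)"
        by (rule lc_in_sub[OF sub_span[OF finJ JX] B(1) lc_in_span])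
      then obtain a where a: "lc B c (\<lambda>b. lc J (coef b) (\<lambda>x. x)) = lc J a (\<lambda>x. x)" by (auto simp: span_def)
      have \<rho>B: "lc B c \<rho> \<in> K" using B \<rho>K by (intro lc_in_sub[OF K]) auto
      have "lc J a (\<lambda>x. x) = v \<ominus> lc B c \<rho>"
        unfolding v1 a using KD(1)[OF \<rho>B] AD(1)[OF lJA] by (simp add: add_diff_cancel_left')
      then have "lc J a (\<lambda>x. x) \<in> K" using KD(6)[OF v \<rho>B] by simp
      then have "\<forall>j\<in>J. \<exists>b. a j = p * b" using ind by (auto simp: dvd_def)
      then obtain b where b: "\<And>j. j \<in> J \<Longrightarrow> a j = p * b j" by metis
      have "lc J a (\<lambda>x. x) = lc J b \<kappa>"
        using JX \<kappa>X by (intro lc_cong) (auto simp: \<kappa>_def b act_act mult.commute Pi_def)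
      moreover have "lc J b \<kappa> \<in> span ?B (\<lambda>b. b)" using finJ base by (intro lc_in_sub[OF s]) auto
      moreover have "lc B c \<rho> \<in> span ?B (\<lambda>b. b)" using B(1) base by (intro lc_in_sub[OF s]) auto
      ultimately show "v \<in> span ?B (\<lambda>b. b)" using v1 a subD(3)[OF s] by simp
    qed
    moreover have "finite ?B" using B(1) finJ by simp
    ultimately show ?thesis unfolding fg_def using BK by (intro exI[of _ ?B] conjI)
  qed
  \<comment> \<open>A linear form on \<open>A\<close> with values modulo \<open>g (Suc n)\<close> is divisible by \<open>p\<close> on \<open>K\<close>.\<close>
  have divide: "\<exists>\<psi>'. lin (g n) K \<psi>' \<and> (\<forall>v\<in>K. \<psi> v = p * \<psi>' v)" if \<psi>: "lin (g (Suc n)) A \<psi>" for \<psi>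
  proof -
    have "p dvd \<psi> v" if v: "v \<in> K" for v
    proof -
      have "g (Suc n) dvd \<psi> (g n \<star> v) - g n * \<psi> v" using \<psi> KA(1)[OF v] by (rule linD(2))
      moreover have "g (Suc n) dvd \<psi> (g n \<star> v)" using lin_zero[OF \<psi> A(1)] KA(2)[OF v] by simp
      ultimately have "g n * p dvd g n * \<psi> v" unfolding gS by (rule dvd_diffD)
      then show ?thesis using gn0 by simp
    qed
    then have "\<forall>v\<in>K. \<exists>y. \<psi> v = p * y" unfolding dvd_def by (intro ballI)
    from bchoice[OF this] obtain \<psi>' where \<psi>': "\<And>v. v \<in> K \<Longrightarrow> \<psi> v = p * \<psi>' v" by blast
    have "lin (g n) K \<psi>'"
      unfolding lin_def
    proof (intro conjI ballI allI)
      fix u v assume uv: "u \<in> K" "v \<in> K"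
      have "p * g n dvd p * (\<psi>' (u \<oplus> v) - (\<psi>' u + \<psi>' v))"
        using linD(1)[OF \<psi> KA(1)[OF uv(1)] KA(1)[OF uv(2)]] \<psi>'[OF uv(1)] \<psi>'[OF uv(2)] \<psi>'[OF KD(3)[OF uv]]
        unfolding gS by (simp add: algebra_simps)
      then show "g n dvd \<psi>' (u \<oplus> v) - (\<psi>' u + \<psi>' v)" using p0 by simp
    next
      fix s v assume v: "v \<in> K"
      have "g n * p dvd \<psi> (s \<star> v) - s * \<psi> v" unfolding gS[symmetric] using \<psi> KA(1)[OF v] by (rule linD(2))
      then have "p * g n dvd p * (\<psi>' (s \<star> v) - s * \<psi>' v)"
        using \<psi>'[OF v] \<psi>'[OF KD(4)[OF v]] by (simp add: algebra_simps)
      then show "g n dvd \<psi>' (s \<star> v) - s * \<psi>' v" using p0 by simp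
    qed
    then show ?thesis using \<psi>' by blast
  qed
  have "lifting_condition f n K"
    unfolding lifting_condition_def
  proof (intro ballI allI impI)
    fix i \<phi> assume i: "i \<in> {1..n}" and \<phi>: "lin (seg f i n) K \<phi>"
    define h where "h = seg f i n"
    have hS: "seg f i (Suc n) = h * p" using i by (simp add: h_def p_def seg_Suc)
    \<comment> \<open>The form \<open>p * \<phi>\<close> extends from \<open>K\<close> to \<open>A\<close>, modulo \<open>h * p\<close>, by sending \<open>x \<in> J\<close> to \<open>\<phi> (p \<star> x)\<close>.\<close>
    define \<Phi> where "\<Phi> v = p * \<phi> (\<rho> v) + (\<Sum>j\<in>J. coef v j * \<phi> (\<kappa> j))" for v
    have \<Phi>: "h * p dvd \<Phi> v - (p * \<phi> k + (\<Sum>j\<in>J. a j * \<phi> (\<kappa> j)))"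
      if v: "v \<in> A" and k: "k \<in> K" "v = k \<oplus> lc J a (\<lambda>x. x)" for v k a
    proof -
      obtain b where b: "\<And>j. j \<in> J \<Longrightarrow> coef v j - a j = p * b j" "k = \<rho> v \<oplus> lc J b \<kappa>"
        using uniq[OF v k] by blast
      have lK: "lc J b \<kappa> \<in> K" using finJ \<kappa>K by (intro lc_in_sub[OF K])
      have 1: "h dvd \<phi> (\<rho> v \<oplus> lc J b \<kappa>) - (\<phi> (\<rho> v) + \<phi> (lc J b \<kappa>))"
        unfolding h_def using \<phi> \<rho>K[OF v] lK by (rule linD(1))
      have 2: "h dvd \<phi> (lc J b \<kappa>) - (\<Sum>j\<in>J. b j * \<phi> (\<kappa> j))"
        unfolding h_def by (rule lin_lc[OF \<phi> K finJ \<kappa>K])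
      have 3: "(\<Sum>j\<in>J. coef v j * \<phi> (\<kappa> j)) - (\<Sum>j\<in>J. a j * \<phi> (\<kappa> j)) = p * (\<Sum>j\<in>J. b j * \<phi> (\<kappa> j))"
        unfolding sum_subtractf[symmetric] sum_distrib_left
        by (intro sum.cong refl) (simp add: b(1) mult.assoc flip: left_diff_distrib)
      have "h dvd \<phi> k - \<phi> (\<rho> v) - (\<Sum>j\<in>J. b j * \<phi> (\<kappa> j))"
        using dvd_add[OF 1 2] unfolding b(2)[symmetric] by (simp add: algebra_simps)
      then have "h * p dvd (\<phi> k - \<phi> (\<rho> v) - (\<Sum>j\<in>J. b j * \<phi> (\<kappa> j))) * (- p)"
        by (metis dvd_minus_iff mult_dvd_mono dvd_refl mult_minus_right)
      also have "\<dots> = \<Phi> v - (p * \<phi> k + (\<Sum>j\<in>J. a j * \<phi> (\<kappa> j)))"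
        unfolding \<Phi>_def using 3 by (simp add: algebra_simps)
      finally show ?thesis .
    qed
    have lin\<Phi>: "lin (h * p) A \<Phi>"
      unfolding lin_def
    proof (intro conjI ballI allI)
      fix u v assume uv: "u \<in> A" "v \<in> A"
      have X: "\<rho> u \<in> carrier V" "\<rho> v \<in> carrier V" "lc J c (\<lambda>x. x) \<in> carrier V" for c
        using KD(1)[OF \<rho>K] uv AD(1)[OF lJA] by auto
      have "u \<oplus> v = (\<rho> u \<oplus> lc J (coef u) (\<lambda>x. x)) \<oplus> (\<rho> v \<oplus> lc J (coef v) (\<lambda>x. x))"
        using \<rho> uv by simp
      also have "\<dots> = (\<rho> u \<oplus> \<rho> v) \<oplus> lc J (\<lambda>j. coef u j + coef v j) (\<lambda>x. x)"
        using X lc_add[OF finJ JX, of "coef u" "coef v"] by (simp add: a_ac)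
      finally have "h * p dvd \<Phi> (u \<oplus> v)
          - (p * \<phi> (\<rho> u \<oplus> \<rho> v) + (\<Sum>j\<in>J. (coef u j + coef v j) * \<phi> (\<kappa> j)))"
        by (rule \<Phi>[OF AD(3)[OF uv] KD(3)[OF \<rho>K[OF uv(1)] \<rho>K[OF uv(2)]]])
      moreover have "h * p dvd p * (\<phi> (\<rho> u \<oplus> \<rho> v) - (\<phi> (\<rho> u) + \<phi> (\<rho> v)))"
        using linD(1)[OF \<phi> \<rho>K[OF uv(1)] \<rho>K[OF uv(2)]] unfolding h_def
        by (subst mult.commute) (rule mult_dvd_mono[OF dvd_refl])
      ultimately have "h * p dvd (\<Phi> (u \<oplus> v)
          - (p * \<phi> (\<rho> u \<oplus> \<rho> v) + (\<Sum>j\<in>J. (coef u j + coef v j) * \<phi> (\<kappa> j))))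
          + p * (\<phi> (\<rho> u \<oplus> \<rho> v) - (\<phi> (\<rho> u) + \<phi> (\<rho> v)))" by (rule dvd_add)
      also have "\<dots> = \<Phi> (u \<oplus> v) - (\<Phi> u + \<Phi> v)"
        unfolding \<Phi>_def by (simp add: algebra_simps sum.distrib)
      finally show "h * p dvd \<Phi> (u \<oplus> v) - (\<Phi> u + \<Phi> v)" .
    next
      fix s v assume v: "v \<in> A"
      have X: "\<rho> v \<in> carrier V" "lc J c (\<lambda>x. x) \<in> carrier V" for c
        using KD(1)[OF \<rho>K[OF v]] AD(1)[OF lJA] by auto
      have "s \<star> v = s \<star> (\<rho> v \<oplus> lc J (coef v) (\<lambda>x. x))"
        using \<rho>[OF v] by simp
      also have "\<dots> = s \<star> \<rho> v \<oplus> lc J (\<lambda>j. s * coef v j) (\<lambda>x. x)"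
        using X act_lc[OF finJ JX, of s "coef v"] by (simp add: act_add_right)
      finally have "h * p dvd \<Phi> (s \<star> v)
          - (p * \<phi> (s \<star> \<rho> v) + (\<Sum>j\<in>J. (s * coef v j) * \<phi> (\<kappa> j)))"
        by (rule \<Phi>[OF AD(4)[OF v] KD(4)[OF \<rho>K[OF v]]])
      moreover have "h * p dvd p * (\<phi> (s \<star> \<rho> v) - s * \<phi> (\<rho> v))"
        using linD(2)[OF \<phi> \<rho>K[OF v]] unfolding h_def
        by (subst mult.commute) (rule mult_dvd_mono[OF dvd_refl])
      ultimately have "h * p dvd (\<Phi> (s \<star> v)
          - (p * \<phi> (s \<star> \<rho> v) + (\<Sum>j\<in>J. (s * coef v j) * \<phi> (\<kappa> j))))
          + p * (\<phi> (s \<star> \<rho> v) - s * \<phi> (\<rho> v))" by (rule dvd_add)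
      also have "\<dots> = \<Phi> (s \<star> v) - s * \<Phi> v"
        unfolding \<Phi>_def by (simp add: algebra_simps sum_distrib_left)
      finally show "h * p dvd \<Phi> (s \<star> v) - s * \<Phi> v" .
    qed
    then obtain \<psi> where \<psi>: "lin (g (Suc n)) A \<psi>" "\<And>v. v \<in> A \<Longrightarrow> h * p dvd \<Phi> v - \<psi> v"
      using lc i unfolding lifting_condition_def hS[symmetric] g_def by fastforce
    obtain \<psi>' where \<psi>': "lin (g n) K \<psi>'" "\<And>v. v \<in> K \<Longrightarrow> \<psi> v = p * \<psi>' v" using divide[OF \<psi>(1)] by blast
    have "h dvd \<phi> v - \<psi>' v" if v: "v \<in> K" for v
    proof -
      have "lc J (\<lambda>_. 0) (\<lambda>x. x) = \<zero>" using JX by (intro lc_zero) (auto simp: Pi_def)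
      then have "v = v \<oplus> lc J (\<lambda>_. 0) (\<lambda>x. x)" using KD(1)[OF v] by simp
      from \<Phi>[OF KA(1)[OF v] v this] have "h * p dvd \<Phi> v - p * \<phi> v" by simp
      then have "h * p dvd (\<Phi> v - \<psi> v) - (\<Phi> v - p * \<phi> v)" by (rule dvd_diff[OF \<psi>(2)[OF KA(1)[OF v]]])
      then have "h * p dvd (\<phi> v - \<psi>' v) * p" using \<psi>'(2)[OF v] by (simp add: algebra_simps)
      then show ?thesis using p0 by simp
    qed
    then show "\<exists>\<psi>. lin (seg f 0 n) K \<psi> \<and> (\<forall>v\<in>K. seg f i n dvd \<phi> v - \<psi> v)"
      using \<psi>'(1) unfolding g_def h_def by blast
  qed
  then have "has_standard_basis f n K"
    using K \<open>fg K\<close> KA(2) by (intro IH) (auto simp: g_def)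
  then obtain I :: "'x set" and e l where l: "l \<in> I \<rightarrow> {1..n}" and b: "cyclic_basis K I e (\<lambda>i. g (l i))"
    unfolding has_standard_basis_def g_def by blast
  have "\<exists>\<psi>'. lin (g n) K \<psi>' \<and> \<psi>' (\<kappa> j) dvd 1 \<and> (\<forall>k\<in>J. j \<noteq> k \<longrightarrow> \<not> \<psi>' (\<kappa> k) dvd 1)" if j: "j \<in> J" for j
  proof -
    have coefE: "p dvd coef v j - a j" if "v \<in> A" "k \<in> K" "v = k \<oplus> lc J a (\<lambda>x. x)" for v k a
      using uniq[OF that] j by force
    \<comment> \<open>The coordinates are only determined modulo \<open>p\<close>, but modulo \<open>p\<close> they are linear.\<close>
    have "lin p A (\<lambda>v. coef v j)"
      unfolding lin_def
    proof (intro conjI ballI allI)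
      fix u v assume uv: "u \<in> A" "v \<in> A"
      have X: "\<rho> u \<in> carrier V" "\<rho> v \<in> carrier V" "lc J c (\<lambda>x. x) \<in> carrier V" for c
        using KD(1)[OF \<rho>K] uv AD(1)[OF lJA] by auto
      have "u \<oplus> v = (\<rho> u \<oplus> lc J (coef u) (\<lambda>x. x)) \<oplus> (\<rho> v \<oplus> lc J (coef v) (\<lambda>x. x))"
        using \<rho> uv by simp
      also have "\<dots> = (\<rho> u \<oplus> \<rho> v) \<oplus> lc J (\<lambda>j. coef u j + coef v j) (\<lambda>x. x)"
        using X lc_add[OF finJ JX, of "coef u" "coef v"] by (simp add: a_ac)
      finally show "p dvd coef (u \<oplus> v) j - (coef u j + coef v j)"
        by (rule coefE[OF AD(3)[OF uv] KD(3)[OF \<rho>K[OF uv(1)] \<rho>K[OF uv(2)]]])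
    next
      fix s v assume v: "v \<in> A"
      have X: "\<rho> v \<in> carrier V" "lc J c (\<lambda>x. x) \<in> carrier V" for c
        using KD(1)[OF \<rho>K[OF v]] AD(1)[OF lJA] by auto
      have "s \<star> v = s \<star> (\<rho> v \<oplus> lc J (coef v) (\<lambda>x. x))"
        using \<rho>[OF v] by simp
      also have "\<dots> = s \<star> \<rho> v \<oplus> lc J (\<lambda>j. s * coef v j) (\<lambda>x. x)"
        using X act_lc[OF finJ JX, of s "coef v"] by (simp add: act_add_right)
      finally show "p dvd coef (s \<star> v) j - s * coef v j"
        by (rule coefE[OF AD(4)[OF v] KD(4)[OF \<rho>K[OF v]]])
    qed
    moreover have "seg f n (Suc n) = p" by (simp add: seg_def p_def)
    ultimately obtain \<psi> where \<psi>: "lin (g (Suc n)) A \<psi>" "\<And>v. v \<in> A \<Longrightarrow> p dvd coef v j - \<psi> v"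
      using lc n unfolding lifting_condition_def g_def by fastforce
    obtain \<psi>' where \<psi>': "lin (g n) K \<psi>'" "\<And>v. v \<in> K \<Longrightarrow> \<psi> v = p * \<psi>' v" using divide[OF \<psi>(1)] by blast
    have fn: "f n dvd g n" using n by (auto simp: g_def intro: seg_dvd)
    have fnu: "\<not> f n dvd 1" using n f by (simp add: chain_factors_def)
    \<comment> \<open>Modulo nonunits, \<open>\<psi>' (\<kappa> k)\<close> is the value of \<open>\<psi>\<close> at \<open>k\<close>, that is, the coordinate \<open>j\<close> of \<open>k\<close>.\<close>
    have val: "\<not> (\<psi>' (\<kappa> k) - (if k = j then 1 else 0)) dvd 1" if k: "k \<in> J" for k
    proof -
      have "g (Suc n) dvd \<psi> (\<kappa> k) - p * \<psi> k" unfolding \<kappa>_def using \<psi>(1) JA[OF k] by (rule linD(2))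
      then have "p * g n dvd p * (\<psi>' (\<kappa> k) - \<psi> k)"
        using \<psi>'(2)[OF \<kappa>K[OF k]] by (simp add: gS algebra_simps)
      then have "g n dvd \<psi>' (\<kappa> k) - \<psi> k" using p0 by simp
      then have 1: "\<not> (\<psi>' (\<kappa> k) - \<psi> k) dvd 1" using fn fnu by (meson dvd_trans)
      have "k = \<zero> \<oplus> lc J (\<lambda>i. if i = k then 1 else 0) (\<lambda>x. x)"
        using lc_single[OF finJ k JX, of 1] AD(1)[OF JA[OF k]] by simp
      from coefE[OF JA[OF k] KD(2) this] have "p dvd coef k j - (if k = j then 1 else 0)"
        by (simp add: eq_commute)
      then have "p dvd (coef k j - (if k = j then 1 else 0)) - (coef k j - \<psi> k)"
        by (rule dvd_diff[OF _ \<psi>(2)[OF JA[OF k]]])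
      then have "p dvd \<psi> k - (if k = j then 1 else 0)" by simp
      then have 2: "\<not> (\<psi> k - (if k = j then 1 else 0)) dvd 1" using pnu dvd_trans by blast
      show ?thesis using local[OF 1 2] by simp
    qed
    have "\<psi>' (\<kappa> j) dvd 1"
    proof (rule ccontr)
      assume "\<not> ?thesis"
      moreover have "\<not> (1 - \<psi>' (\<kappa> j)) dvd 1"
        using val[OF j] by (metis minus_diff_eq minus_dvd_iff)
      ultimately have "\<not> (\<psi>' (\<kappa> j) + (1 - \<psi>' (\<kappa> j))) dvd 1" by (rule local)
      then show False by simp
    qed
    moreover have "\<not> \<psi>' (\<kappa> k) dvd 1" if "k \<in> J" "j \<noteq> k" for k using val[OF that(1)] that(2) by simp
    ultimately show ?thesis using \<psi>'(1) by blast
  qed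
  then have "\<forall>j\<in>J. \<exists>\<psi>'. lin (g n) K \<psi>' \<and> \<psi>' (\<kappa> j) dvd 1 \<and>
      (\<forall>k\<in>J. j \<noteq> k \<longrightarrow> \<not> \<psi>' (\<kappa> k) dvd 1)" by (intro ballI)
  from bchoice[OF this] obtain \<psi> where "\<forall>j\<in>J. lin (g n) K (\<psi> j) \<and> \<psi> j (\<kappa> j) dvd 1 \<and>
      (\<forall>k\<in>J. j \<noteq> k \<longrightarrow> \<not> \<psi> j (\<kappa> k) dvd 1)" by (elim exE)
  then have \<psi>: "\<And>j. j \<in> J \<Longrightarrow> lin (g n) K (\<psi> j)" "\<And>j. j \<in> J \<Longrightarrow> \<psi> j (\<kappa> j) dvd 1"
    "\<And>j k. j \<in> J \<Longrightarrow> k \<in> J \<Longrightarrow> j \<noteq> k \<Longrightarrow> \<not> \<psi> j (\<kappa> k) dvd 1" by auto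
  have fn: "chain_factors f n" using f by (auto simp: chain_factors_def)
  have "\<exists>e' s. cyclic_basis K I e' (\<lambda>i. seg f 0 (l i)) \<and> inj_on s J \<and> s ` J \<subseteq> I \<and>
      (\<forall>j\<in>J. e' (s j) = \<kappa> j \<and> l (s j) = n)"
  proof (rule cyclic_basis_exchange_family[OF K fn l n])
    show "cyclic_basis K I e (\<lambda>i. seg f 0 (l i))" using b unfolding g_def .
    show "seg f 0 n \<star> v = \<zero>" if "v \<in> K" for v using KA(2)[OF that] unfolding g_def .
    show "lin (seg f 0 n) K (\<psi> j)" if "j \<in> J" for j using \<psi>(1)[OF that] unfolding g_def .
  qed (fact finJ \<kappa>K \<psi>)+
  then obtain e' s where b': "cyclic_basis K I e' (\<lambda>i. g (l i))" and s: "inj_on s J" "s ` J \<subseteq> I"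
    and es: "\<And>j. j \<in> J \<Longrightarrow> e' (s j) = \<kappa> j" "\<And>j. j \<in> J \<Longrightarrow> l (s j) = n"
    unfolding g_def by blast
  have fin: "finite I" and e'K: "\<And>i. i \<in> I \<Longrightarrow> e' i \<in> K" and spK: "K \<subseteq> span I e'"
    and kill': "\<And>i. i \<in> I \<Longrightarrow> g (l i) \<star> e' i = \<zero>"
    and ind': "\<And>c i. lc I c e' = \<zero> \<Longrightarrow> i \<in> I \<Longrightarrow> g (l i) dvd c i"
    using b' by (auto simp: cyclic_basis_def)
  define E where "E i = (if i \<in> s ` J then inv_into J s i else e' i)" for i
  define l' where "l' i = (if i \<in> s ` J then Suc n else l i)" for i
  have Es: "E (s j) = j" if "j \<in> J" for j using that s(1) by (simp add: E_def)
  have EA: "E i \<in> A" if "i \<in> I" for i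
    using that e'K KA(1) JA inv_into_into[of i s J] by (auto simp: E_def)
  have EX: "E \<in> I' \<rightarrow> carrier V" if "I' \<subseteq> I" for I' using EA AD(1) that by blast
  have e'E: "e' i = p \<star> E i" if i: "i \<in> s ` J" for i
  proof -
    obtain j where "j \<in> J" "i = s j" using i by blast
    then show ?thesis using es(1) Es by (simp add: \<kappa>_def)
  qed
  have sS: "sub (span I E)" using fin EX[OF subset_refl] by (rule sub_span)
  have ES: "E i \<in> span I E" if "i \<in> I" for i using fin EX[OF subset_refl] that by (rule span_base)
  have "A \<subseteq> span I E"
  proof
    fix v assume v: "v \<in> A"
    have "e' i \<in> span I E" if "i \<in> I" for i
      using e'E[of i] ES[OF that] subD(4)[OF sS] by (cases "i \<in> s ` J") (auto simp: E_def)
    then have "span I e' \<subseteq> span I E" using fin by (intro span_least[OF sS])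
    then have "\<rho> v \<in> span I E" using \<rho>K[OF v] spK by blast
    moreover have "j \<in> span I E" if "j \<in> J" for j using Es[OF that] ES[of "s j"] s(2) that by auto
    then have "lc J (coef v) (\<lambda>x. x) \<in> span I E" using finJ by (intro lc_in_sub[OF sS])
    ultimately show "v \<in> span I E" using \<rho>[OF v] subD(3)[OF sS] by metis
  qed
  moreover have "g (l' i) \<star> E i = \<zero>" if i: "i \<in> I" for i
    using kill[OF EA[OF i]] kill'[OF i] by (auto simp: l'_def E_def g_def)
  moreover have "g (l' i) dvd c i" if c: "lc I c E = \<zero>" and i: "i \<in> I" for c i
  proof -
    let ?S = "s ` J"
    have gE: "g n \<star> E i = \<zero>" if "i \<in> I - ?S" for i
      using e'K[of i] KA(2) that by (simp add: E_def)
    have "\<zero> = lc I c (\<lambda>i. g n \<star> E i)"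
      using c act_lc_right[OF fin EX[OF subset_refl], of "g n" c] by simp
    also have "\<dots> = lc ?S c (\<lambda>i. g n \<star> E i) \<oplus> lc (I - ?S) c (\<lambda>i. g n \<star> E i)"
      using fin s(2) EX[OF subset_refl] by (intro lc_split) auto
    also have "lc (I - ?S) c (\<lambda>i. g n \<star> E i) = \<zero>" using gE by (intro lc_zero) simp
    also have "lc ?S c (\<lambda>i. g n \<star> E i) = lc J (\<lambda>j. c (s j)) d"
      unfolding lc_def using s EX[OF s(2)] Es
      by (subst finsum_reindex) (auto simp: d_def Pi_def intro!: finsum_cong' dest: EX[THEN funcset_mem])
    finally have "lc J (\<lambda>j. c (s j)) d = \<zero>" using gJ[of "\<lambda>j. c (s j)"] AD(1)[OF lJA] by (metis act_closed r_zero)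
    then have "\<forall>i\<in>?S. \<exists>b. c i = p * b" using indG by (auto simp: dvd_def)
    then obtain b where b: "\<And>i. i \<in> ?S \<Longrightarrow> c i = p * b i" by metis
    have "lc I (\<lambda>i. if i \<in> ?S then b i else c i) e' = lc I c E"
    proof (rule lc_cong)
      fix i assume "i \<in> I"
      then show "(if i \<in> ?S then b i else c i) \<star> e' i = c i \<star> E i"
        using e'E[of i] b[of i] AD(1)[OF EA[of i]] by (auto simp: act_act mult.commute E_def)
    qed (use EA AD(1) in blast)
    then have "lc I (\<lambda>i. if i \<in> ?S then b i else c i) e' = \<zero>" using c by simp
    from ind'[OF this i] show ?thesis
    proof (cases "i \<in> ?S")
      case True
      then have "l i = n" using es(2) by auto
      then have "g n dvd b i" using ind'[OF \<open>lc I _ e' = \<zero>\<close> i] True by simp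
      then show ?thesis using b[OF True] True by (simp add: l'_def gS mult.commute mult_dvd_mono)
    next
      case False
      then show ?thesis using ind'[OF \<open>lc I _ e' = \<zero>\<close> i] by (simp add: l'_def)
    qed
  qed
  ultimately have "cyclic_basis A I E (\<lambda>i. g (l' i))"
    unfolding cyclic_basis_def using fin EA by blast
  moreover have "l' \<in> I \<rightarrow> {1..Suc n}" using l by (force simp: l'_def)
  ultimately show ?thesis unfolding has_standard_basis_def g_def by blast
qed

theorem lifting_condition_imp_standard_basis:
  assumes "1 \<le> n" "chain_factors f n" "sub A" "fg A"
    and "\<And>v. v \<in> A \<Longrightarrow> seg f 0 n \<star> v = \<zero>" and "lifting_condition f n A"
  shows "has_standard_basis f n A"
  using assms
proof (induction n arbitrary: A rule: nat_induct_at_least)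
  case base
  then show ?case using has_standard_basis_one by blast
next
  case (Suc n)
  have "chain_factors f n" using Suc.prems(1) by (auto simp: chain_factors_def)
  note IH = Suc.IH[OF this]
  show ?case by (rule standard_basis_extend[OF Suc.hyps Suc.prems]) (use IH in blast)+
qed

end

section \<open>Residue class rings and direct sums\<close>

text \<open>Residue classes are written without the ring structure because they serve for rings and for modules alike.\<close>

definition cls :: "'a::comm_ring_1 \<Rightarrow> 'a \<Rightarrow> 'a set" where
  "cls h s = {s + h * c | c. True}"

lemma cls_eq_iff: "cls h a = cls h b \<longleftrightarrow> h dvd a - b"
proof
  assume "cls h a = cls h b"
  moreover have "a \<in> cls h a" by (auto simp: cls_def intro!: exI[of _ 0])
  ultimately obtain c where "a = b + h * c" by (auto simp: cls_def)
  then show "h dvd a - b" by simp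
next
  assume "h dvd a - b"
  then obtain c where c: "a = b + h * c" by (auto simp: dvd_def algebra_simps)
  have "a + h * d = b + h * (c + d)" "b + h * d = a + h * (d - c)" for d
    by (simp_all add: c algebra_simps)
  then show "cls h a = cls h b" unfolding cls_def by blast
qed

lemma cls_memI: "h dvd b - a \<Longrightarrow> b \<in> cls h a"
  by (auto simp: cls_def dvd_def algebra_simps)

lemma cls_memD: "b \<in> cls h a \<Longrightarrow> h dvd b - a"
  by (auto simp: cls_def)

definition rep :: "'a set \<Rightarrow> 'a" where
  "rep A = (SOME a. a \<in> A)"

lemma rep_cls: "h dvd rep (cls h a) - a"
proof -
  have "a \<in> cls h a" by (rule cls_memI) simp
  then have "rep (cls h a) \<in> cls h a" unfolding rep_def by (rule someI)
  then show ?thesis by (rule cls_memD)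
qed

lemma cls_rep [simp]: "cls h (rep (cls h a)) = cls h a"
  using rep_cls by (simp add: cls_eq_iff)

lemma kxy_simps [simp]:
  "carrier kxy = UNIV" "monoid.mult kxy = (*)" "add kxy = (+)" "ring.zero kxy = 0" "monoid.one kxy = 1"
  by (simp_all add: ring_of_type_algebra_def)

lemma kxy_cring: "cring (kxy :: 'k::field fps fps ring)"
  by (rule cring_from_type_algebra)

lemma PIdl_kxy: "PIdl\<^bsub>kxy\<^esub> h = cls h 0"
  by (auto simp: cgenideal_def cls_def mult.commute)

lemma PIdl_kxy_ideal: "ideal (cls h 0) (kxy :: 'k::field fps fps ring)"
  using cring.cgenideal_ideal[OF kxy_cring, of h] by (simp add: PIdl_kxy)

lemma coset_kxy: "cls h 0 +>\<^bsub>kxy\<^esub> s = cls h s"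
  by (auto simp: a_r_coset_def r_coset_def cls_def add.commute)

lemma kxy_quot_carrier: "carrier (kxy_quot h) = range (cls h)"
  by (simp add: kxy_quot_def FactRing_def PIdl_kxy A_RCOSETS_def' coset_kxy) auto

lemma rcoset_mult_cls:
  assumes "g dvd h"
  shows "rcoset_mult kxy (PIdl\<^bsub>kxy\<^esub> g) (cls h a) (cls g b) = cls g (a * b)"
proof -
  obtain h' where h: "h = g * h'" using assms by (auto simp: dvd_def)
  have *: "cls g ((a + h * c) * (b + g * d)) = cls g (a * b)" for c d
  proof -
    have "(a + h * c) * (b + g * d) - a * b = g * (h' * c * b + a * d + h * c * d)"
      by (simp add: h algebra_simps)
    then show ?thesis unfolding cls_eq_iff by simp
  qed
  have "rcoset_mult kxy (PIdl\<^bsub>kxy\<^esub> g) (cls h a) (cls g b)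
      = (\<Union>x\<in>cls h a. \<Union>y\<in>cls g b. cls g (x * y))"
    by (simp add: rcoset_mult_def PIdl_kxy coset_kxy)
  also have "\<dots> = (\<Union>x\<in>cls h a. \<Union>y\<in>cls g b. cls g (a * b))"
    using * by (intro SUP_cong refl) (auto simp: cls_def[of h a] cls_def[of g b])
  also have "\<dots> = cls g (a * b)" using cls_memI[of h a a] cls_memI[of g b b] by auto
  finally show ?thesis .
qed

lemma set_add_cls: "set_add kxy (cls h a) (cls h b) = cls h (a + b)"
proof -
  have 1: "a + h * c + (b + h * d) \<in> cls h (a + b)" for c d
    by (rule cls_memI) (simp add: algebra_simps flip: distrib_left)
  have 2: "a + b + h * c \<in> (\<Union>x\<in>cls h a. \<Union>y\<in>cls h b. {x + y})" for c
  proof -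
    have "a + h * c \<in> cls h a" "b \<in> cls h b" by (rule cls_memI, simp)+
    moreover have "a + b + h * c \<in> {a + h * c + b}" by simp
    ultimately show ?thesis by (intro UN_I)
  qed
  have "set_add kxy (cls h a) (cls h b) = (\<Union>x\<in>cls h a. \<Union>y\<in>cls h b. {x + y})"
    by (simp add: set_add_def set_mult_def)
  also have "\<dots> = cls h (a + b)"
  proof
    show "(\<Union>x\<in>cls h a. \<Union>y\<in>cls h b. {x + y}) \<subseteq> cls h (a + b)"
      using 1 by (auto simp: cls_def[of h a] cls_def[of h b])
    show "cls h (a + b) \<subseteq> (\<Union>x\<in>cls h a. \<Union>y\<in>cls h b. {x + y})"
      using 2 by (auto simp: cls_def[of h "a + b"] simp del: UN_iff)
  qed
  finally show ?thesis .
qed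

lemma kxy_quot_simps:
  "cls h a \<otimes>\<^bsub>kxy_quot h\<^esub> cls h b = cls h (a * b)"
  "cls h a \<oplus>\<^bsub>kxy_quot h\<^esub> cls h b = cls h (a + b)"
  "\<one>\<^bsub>kxy_quot h\<^esub> = cls h 1" "\<zero>\<^bsub>kxy_quot h\<^esub> = cls h 0"
  using rcoset_mult_cls[of h h a b]
  by (simp_all add: kxy_quot_def FactRing_def set_add_cls PIdl_kxy coset_kxy)

lemma kxy_quot_cring: "cring (kxy_quot h)"
  unfolding kxy_quot_def using ideal.quotient_is_cring[OF PIdl_kxy_ideal kxy_cring]
  by (simp add: PIdl_kxy)

lemma kxy_quot_module_simps:
  "carrier (kxy_quot_module g) = range (cls g)"
  "\<zero>\<^bsub>kxy_quot_module g\<^esub> = cls g 0"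
  "cls g a \<oplus>\<^bsub>kxy_quot_module g\<^esub> cls g b = cls g (a + b)"
  "g dvd h \<Longrightarrow> cls h a \<odot>\<^bsub>kxy_quot_module g\<^esub> cls g b = cls g (a * b)"
  by (simp_all add: kxy_quot_module_def kxy_quot_carrier kxy_quot_simps rcoset_mult_cls)

lemma abelian_group_transfer:
  assumes "abelian_group A" "carrier B = carrier A" "add B = add A" "\<zero>\<^bsub>B\<^esub> = \<zero>\<^bsub>A\<^esub>"
  shows "abelian_group B"
proof -
  interpret A: abelian_group A by fact
  show ?thesis
    by (rule abelian_groupI)
      (use assms(2-4) A.l_neg A.a_inv_closed in \<open>auto simp: A.a_assoc intro: A.a_comm\<close>)
qed

lemma kxy_quot_module_module:
  assumes "g dvd h" shows "Module.module (kxy_quot h) (kxy_quot_module g)"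
proof (rule moduleI)
  show "cring (kxy_quot h)" by (rule kxy_quot_cring)
  have "abelian_group (kxy_quot g)" using kxy_quot_cring cring.axioms(1) ring.is_abelian_group by blast
  then show "abelian_group (kxy_quot_module g)"
    by (rule abelian_group_transfer) (simp_all add: kxy_quot_module_def)
qed (auto simp: kxy_quot_module_simps(1,2,3) kxy_quot_module_simps(4)[OF assms] kxy_quot_carrier
    kxy_quot_simps algebra_simps)

section \<open>Free modules\<close>

lemma direct_sum_simps:
  "carrier (direct_sum I M) = {v \<in> (\<Pi>\<^sub>E i\<in>I. carrier (M i)). finite {i\<in>I. v i \<noteq> \<zero>\<^bsub>M i\<^esub>}}"
  "\<zero>\<^bsub>direct_sum I M\<^esub> = (\<lambda>i\<in>I. \<zero>\<^bsub>M i\<^esub>)"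
  "v \<oplus>\<^bsub>direct_sum I M\<^esub> w = (\<lambda>i\<in>I. v i \<oplus>\<^bsub>M i\<^esub> w i)"
  "a \<odot>\<^bsub>direct_sum I M\<^esub> v = (\<lambda>i\<in>I. a \<odot>\<^bsub>M i\<^esub> v i)"
  by (simp_all add: direct_sum_def)

lemma direct_sum_carrier_finite:
  "finite I \<Longrightarrow> carrier (direct_sum I M) = (\<Pi>\<^sub>E i\<in>I. carrier (M i))"
  by (simp add: direct_sum_simps)

lemma module_abelian_group: "Module.module R M \<Longrightarrow> abelian_group M"
  by (simp add: Module.module_def)

lemma direct_sum_module:
  assumes R: "cring R" and M: "\<And>i. i \<in> I \<Longrightarrow> Module.module R (M i)"
  shows "Module.module R (direct_sum I M)"
proof -
  have ag: "abelian_group (M i)" if "i \<in> I" for i using M[OF that] by (rule module_abelian_group)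
  note AM = abelian_group.axioms(1)[OF ag]
  have add: "v \<oplus>\<^bsub>direct_sum I M\<^esub> w \<in> carrier (direct_sum I M)"
    if "v \<in> carrier (direct_sum I M)" "w \<in> carrier (direct_sum I M)" for v w
  proof -
    have "{i\<in>I. (v \<oplus>\<^bsub>direct_sum I M\<^esub> w) i \<noteq> \<zero>\<^bsub>M i\<^esub>} \<subseteq> {i\<in>I. v i \<noteq> \<zero>\<^bsub>M i\<^esub>} \<union> {i\<in>I. w i \<noteq> \<zero>\<^bsub>M i\<^esub>}"
      using AM by (auto simp: direct_sum_simps abelian_monoid.l_zero abelian_monoid.zero_closed)
    moreover have "finite ({i\<in>I. v i \<noteq> \<zero>\<^bsub>M i\<^esub>} \<union> {i\<in>I. w i \<noteq> \<zero>\<^bsub>M i\<^esub>})"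
      using that by (simp add: direct_sum_simps)
    ultimately have "finite {i\<in>I. (v \<oplus>\<^bsub>direct_sum I M\<^esub> w) i \<noteq> \<zero>\<^bsub>M i\<^esub>}" by (rule finite_subset)
    then show ?thesis using that AM
      by (auto simp: direct_sum_simps PiE_iff intro!: abelian_monoid.a_closed)
  qed
  have smult: "a \<odot>\<^bsub>direct_sum I M\<^esub> v \<in> carrier (direct_sum I M)"
    if "a \<in> carrier R" "v \<in> carrier (direct_sum I M)" for a v
  proof -
    have "{i\<in>I. (a \<odot>\<^bsub>direct_sum I M\<^esub> v) i \<noteq> \<zero>\<^bsub>M i\<^esub>} \<subseteq> {i\<in>I. v i \<noteq> \<zero>\<^bsub>M i\<^esub>}"
    proof -
      have "a \<odot>\<^bsub>M i\<^esub> \<zero>\<^bsub>M i\<^esub> = \<zero>\<^bsub>M i\<^esub>" if "i \<in> I" for i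
        using Module.module.smult_r_null[OF M[OF that]] \<open>a \<in> carrier R\<close> by blast
      then show ?thesis by (auto simp: direct_sum_simps)
    qed
    moreover have "finite {i\<in>I. v i \<noteq> \<zero>\<^bsub>M i\<^esub>}"
      using that by (simp add: direct_sum_simps)
    ultimately have "finite {i\<in>I. (a \<odot>\<^bsub>direct_sum I M\<^esub> v) i \<noteq> \<zero>\<^bsub>M i\<^esub>}" by (rule finite_subset)
    then show ?thesis using that M
      by (auto simp: direct_sum_simps PiE_iff intro!: Module.module.smult_closed)
  qed
  show ?thesis
  proof (rule moduleI)
    show "cring R" by (rule R)
    show "abelian_group (direct_sum I M)"
    proof (rule abelian_groupI)
      show "\<zero>\<^bsub>direct_sum I M\<^esub> \<in> carrier (direct_sum I M)"
        using AM by (auto simp: direct_sum_simps intro!: abelian_monoid.zero_closed)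
      fix v assume v: "v \<in> carrier (direct_sum I M)"
      show "\<zero>\<^bsub>direct_sum I M\<^esub> \<oplus>\<^bsub>direct_sum I M\<^esub> v = v"
        using v AM by (auto simp: direct_sum_simps PiE_iff fun_eq_iff extensional_def abelian_monoid.l_zero)
      have "\<ominus>\<^bsub>R\<^esub> \<one>\<^bsub>R\<^esub> \<in> carrier R" using R by (simp add: cring.cring_simprules)
      then have "(\<ominus>\<^bsub>R\<^esub> \<one>\<^bsub>R\<^esub>) \<odot>\<^bsub>direct_sum I M\<^esub> v \<in> carrier (direct_sum I M)" using v by (rule smult)
      moreover have "(\<ominus>\<^bsub>R\<^esub> \<one>\<^bsub>R\<^esub>) \<odot>\<^bsub>direct_sum I M\<^esub> v \<oplus>\<^bsub>direct_sum I M\<^esub> v = \<zero>\<^bsub>direct_sum I M\<^esub>"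
      proof -
        have "(\<ominus>\<^bsub>R\<^esub> \<one>\<^bsub>R\<^esub>) \<odot>\<^bsub>M i\<^esub> v i \<oplus>\<^bsub>M i\<^esub> v i = \<zero>\<^bsub>M i\<^esub>" if i: "i \<in> I" for i
        proof -
          have vi: "v i \<in> carrier (M i)" using v i by (auto simp: direct_sum_simps)
          then have "(\<ominus>\<^bsub>R\<^esub> \<one>\<^bsub>R\<^esub>) \<odot>\<^bsub>M i\<^esub> v i = \<ominus>\<^bsub>M i\<^esub> v i"
            using Module.module.smult_l_minus[OF M[OF i], of "\<one>\<^bsub>R\<^esub>" "v i"] R
              Module.module.smult_one[OF M[OF i]] by (simp add: cring.cring_simprules)
          then show ?thesis using abelian_group.l_neg[OF ag[OF i] vi] by simp
        qed
        then show ?thesis by (auto simp: direct_sum_simps fun_eq_iff)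
      qed
      ultimately show "\<exists>w\<in>carrier (direct_sum I M). w \<oplus>\<^bsub>direct_sum I M\<^esub> v = \<zero>\<^bsub>direct_sum I M\<^esub>" by blast
    next
      fix u v w assume "u \<in> carrier (direct_sum I M)" "v \<in> carrier (direct_sum I M)" "w \<in> carrier (direct_sum I M)"
      then show "u \<oplus>\<^bsub>direct_sum I M\<^esub> v \<oplus>\<^bsub>direct_sum I M\<^esub> w = u \<oplus>\<^bsub>direct_sum I M\<^esub> (v \<oplus>\<^bsub>direct_sum I M\<^esub> w)"
        using AM by (auto simp: direct_sum_simps PiE_iff fun_eq_iff intro!: abelian_monoid.a_assoc)
    next
      fix u v assume "u \<in> carrier (direct_sum I M)" "v \<in> carrier (direct_sum I M)"
      then show "u \<oplus>\<^bsub>direct_sum I M\<^esub> v = v \<oplus>\<^bsub>direct_sum I M\<^esub> u"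
        using AM by (auto simp: direct_sum_simps PiE_iff fun_eq_iff intro!: abelian_monoid.a_comm)
    qed (rule add)
  next
    fix a b v w assume "a \<in> carrier R" "b \<in> carrier R" and v: "v \<in> carrier (direct_sum I M)"
    then show "(a \<oplus>\<^bsub>R\<^esub> b) \<odot>\<^bsub>direct_sum I M\<^esub> v
        = a \<odot>\<^bsub>direct_sum I M\<^esub> v \<oplus>\<^bsub>direct_sum I M\<^esub> b \<odot>\<^bsub>direct_sum I M\<^esub> v"
      "(a \<otimes>\<^bsub>R\<^esub> b) \<odot>\<^bsub>direct_sum I M\<^esub> v = a \<odot>\<^bsub>direct_sum I M\<^esub> (b \<odot>\<^bsub>direct_sum I M\<^esub> v)"
      using M by (auto simp: direct_sum_simps PiE_iff fun_eq_iff
          intro!: Module.module.smult_l_distr Module.module.smult_assoc1)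
  next
    fix a v w assume "a \<in> carrier R" "v \<in> carrier (direct_sum I M)" "w \<in> carrier (direct_sum I M)"
    then show "a \<odot>\<^bsub>direct_sum I M\<^esub> (v \<oplus>\<^bsub>direct_sum I M\<^esub> w)
        = a \<odot>\<^bsub>direct_sum I M\<^esub> v \<oplus>\<^bsub>direct_sum I M\<^esub> a \<odot>\<^bsub>direct_sum I M\<^esub> w"
      using M by (auto simp: direct_sum_simps PiE_iff fun_eq_iff intro!: Module.module.smult_r_distr)
  next
    fix v assume "v \<in> carrier (direct_sum I M)"
    then show "\<one>\<^bsub>R\<^esub> \<odot>\<^bsub>direct_sum I M\<^esub> v = v"
      using M by (auto simp: direct_sum_simps PiE_iff fun_eq_iff extensional_def Module.module.smult_one)
  qed (rule smult)
qed

lemma regular_module_simps [simp]: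
  "carrier (regular_module R) = carrier R" "\<zero>\<^bsub>regular_module R\<^esub> = \<zero>\<^bsub>R\<^esub>"
  "a \<oplus>\<^bsub>regular_module R\<^esub> b = a \<oplus>\<^bsub>R\<^esub> b" "a \<odot>\<^bsub>regular_module R\<^esub> b = a \<otimes>\<^bsub>R\<^esub> b"
  by (simp_all add: regular_module_def)

lemma regular_module_module:
  assumes "cring R" shows "Module.module R (regular_module R)"
proof (rule moduleI)
  interpret R: cring R by fact
  show "\<one>\<^bsub>R\<^esub> \<odot>\<^bsub>regular_module R\<^esub> x = x" if "x \<in> carrier (regular_module R)" for x
    using that by simp
  have "abelian_group R" using assms cring.axioms(1) ring.is_abelian_group by blast
  then show "abelian_group (regular_module R)"
    by (rule abelian_group_transfer) (simp_all add: regular_module_def)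
qed (use assms in \<open>auto simp: cring.cring_simprules\<close>)

lemma free_module_module: "cring R \<Longrightarrow> Module.module R (free_module R B)"
  unfolding free_module_def by (intro direct_sum_module regular_module_module)

lemma mod_homI:
  assumes "\<And>x. x \<in> carrier M \<Longrightarrow> h x \<in> carrier N"
    and "\<And>x y. x \<in> carrier M \<Longrightarrow> y \<in> carrier M \<Longrightarrow> h (x \<oplus>\<^bsub>M\<^esub> y) = h x \<oplus>\<^bsub>N\<^esub> h y"
    and "\<And>a x. a \<in> carrier R \<Longrightarrow> x \<in> carrier M \<Longrightarrow> h (a \<odot>\<^bsub>M\<^esub> x) = a \<odot>\<^bsub>N\<^esub> h x"
    and M: "Module.module R M"
  shows "restrict h (carrier M) \<in> mod_hom R M N"
proof -
  interpret M: Module.module R M by (rule M)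
  show ?thesis using assms(1-3) by (auto simp: mod_hom_def)
qed

lemma mod_homD:
  assumes "h \<in> mod_hom R M N"
  shows "x \<in> carrier M \<Longrightarrow> h x \<in> carrier N"
    and "x \<in> carrier M \<Longrightarrow> y \<in> carrier M \<Longrightarrow> h (x \<oplus>\<^bsub>M\<^esub> y) = h x \<oplus>\<^bsub>N\<^esub> h y"
    and "a \<in> carrier R \<Longrightarrow> x \<in> carrier M \<Longrightarrow> h (a \<odot>\<^bsub>M\<^esub> x) = a \<odot>\<^bsub>N\<^esub> h x"
    and "h \<in> extensional (carrier M)"
  using assms by (auto simp: mod_hom_def PiE_iff)

lemma mod_hom_zero:
  assumes "Module.module R M" "Module.module R N" "h \<in> mod_hom R M N"
  shows "h \<zero>\<^bsub>M\<^esub> = \<zero>\<^bsub>N\<^esub>"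
proof -
  interpret M: Module.module R M by fact
  interpret N: Module.module R N by fact
  have "h (\<zero>\<^bsub>R\<^esub> \<odot>\<^bsub>M\<^esub> \<zero>\<^bsub>M\<^esub>) = \<zero>\<^bsub>R\<^esub> \<odot>\<^bsub>N\<^esub> h \<zero>\<^bsub>M\<^esub>"
    by (intro mod_homD(3)[OF assms(3)]) auto
  then show ?thesis using mod_homD(1)[OF assms(3), of "\<zero>\<^bsub>M\<^esub>"] by simp
qed

lemma mod_hom_finsum:
  assumes "Module.module R M" "Module.module R N" "h \<in> mod_hom R M N" "finite T" "F \<in> T \<rightarrow> carrier M"
  shows "h (finsum M F T) = finsum N (\<lambda>t. h (F t)) T"
proof -
  interpret M: Module.module R M by fact
  interpret N: Module.module R N by fact
  show ?thesis using assms(4,5)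
  proof (induction T rule: finite_induct)
    case empty
    then show ?case using mod_hom_zero[OF assms(1-3)] by simp
  next
    case (insert t T)
    have "F \<in> T \<rightarrow> carrier M" "F t \<in> carrier M" using insert.prems by auto
    moreover from this have "(\<lambda>t. h (F t)) \<in> T \<rightarrow> carrier N" "h (F t) \<in> carrier N"
      using mod_homD(1)[OF assms(3)] by auto
    moreover have "finsum M F T \<in> carrier M" using calculation by simp
    ultimately show ?case using insert mod_homD(2)[OF assms(3)] by simp
  qed
qed

text \<open>The linear map from the free module on \<open>B\<close> to \<open>N\<close> with the value \<open>u b\<close> at the basis vector of \<open>b\<close>.\<close>

definition lift ::
  "('r, 'c) ring_scheme \<Rightarrow> ('r, 'n, 'd) module_scheme \<Rightarrow> 'b set \<Rightarrow> ('b \<Rightarrow> 'n) \<Rightarrow> ('b \<Rightarrow> 'r) \<Rightarrow> 'n" where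
  "lift R N B u \<phi> = (\<Oplus>\<^bsub>N\<^esub>b\<in>{b\<in>B. \<phi> b \<noteq> \<zero>\<^bsub>R\<^esub>}. \<phi> b \<odot>\<^bsub>N\<^esub> u b)"

lemma eval_free_eq_lift: "eval_free R M B = lift R M B (\<lambda>b. b)"
  by (simp add: fun_eq_iff eval_free_def lift_def)

definition delta :: "('r, 'c) ring_scheme \<Rightarrow> 'b set \<Rightarrow> 'b \<Rightarrow> 'b \<Rightarrow> 'r" where
  "delta R B b = (\<lambda>b'\<in>B. if b' = b then \<one>\<^bsub>R\<^esub> else \<zero>\<^bsub>R\<^esub>)"

lemma free_module_simps:
  "carrier (free_module R B) = {\<phi> \<in> B \<rightarrow>\<^sub>E carrier R. finite {b\<in>B. \<phi> b \<noteq> \<zero>\<^bsub>R\<^esub>}}"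
  "\<zero>\<^bsub>free_module R B\<^esub> = (\<lambda>b\<in>B. \<zero>\<^bsub>R\<^esub>)"
  "\<phi> \<oplus>\<^bsub>free_module R B\<^esub> \<psi> = (\<lambda>b\<in>B. \<phi> b \<oplus>\<^bsub>R\<^esub> \<psi> b)"
  "a \<odot>\<^bsub>free_module R B\<^esub> \<phi> = (\<lambda>b\<in>B. a \<otimes>\<^bsub>R\<^esub> \<phi> b)"
  by (simp_all add: free_module_def direct_sum_simps)

context
  fixes R :: "('r, 'c) ring_scheme" and N :: "('r, 'n, 'd) module_scheme" and B :: "'b set"
    and u :: "'b \<Rightarrow> 'n"
  assumes N: "Module.module R N" and u: "\<And>b. b \<in> B \<Longrightarrow> u b \<in> carrier N"
begin

interpretation N: Module.module R N by (rule N)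
interpretation F: Module.module R "free_module R B" by (rule free_module_module) (rule N.R.is_cring)

lemma free_value: "\<phi> \<in> carrier (free_module R B) \<Longrightarrow> b \<in> B \<Longrightarrow> \<phi> b \<in> carrier R"
  by (auto simp: free_module_simps)

lemma lift_superset:
  assumes \<phi>: "\<phi> \<in> carrier (free_module R B)" and T: "finite T" "T \<subseteq> B" "{b\<in>B. \<phi> b \<noteq> \<zero>\<^bsub>R\<^esub>} \<subseteq> T"
  shows "lift R N B u \<phi> = (\<Oplus>\<^bsub>N\<^esub>b\<in>T. \<phi> b \<odot>\<^bsub>N\<^esub> u b)"
  unfolding lift_def
  by (rule N.M.add.finprod_mono_neutral_cong_left[OF T(1,3)]) (use T(2) u free_value[OF \<phi>] in auto)

lemma lift_closed: "\<phi> \<in> carrier (free_module R B) \<Longrightarrow> lift R N B u \<phi> \<in> carrier N"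
  unfolding lift_def by (intro N.M.finsum_closed) (use u free_value in auto)

lemma lift_hom: "restrict (lift R N B u) (carrier (free_module R B)) \<in> mod_hom R (free_module R B) N"
proof (rule mod_homI)
  show "Module.module R (free_module R B)" by (rule F.module_axioms)
  fix \<phi> \<psi> assume \<phi>: "\<phi> \<in> carrier (free_module R B)" and \<psi>: "\<psi> \<in> carrier (free_module R B)"
  let ?T = "{b\<in>B. \<phi> b \<noteq> \<zero>\<^bsub>R\<^esub>} \<union> {b\<in>B. \<psi> b \<noteq> \<zero>\<^bsub>R\<^esub>}"
  have T: "finite ?T" "?T \<subseteq> B" using \<phi> \<psi> by (auto simp: free_module_simps)
  have "{b\<in>B. (\<phi> \<oplus>\<^bsub>free_module R B\<^esub> \<psi>) b \<noteq> \<zero>\<^bsub>R\<^esub>} \<subseteq> ?T" by (auto simp: free_module_simps)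
  then have "lift R N B u (\<phi> \<oplus>\<^bsub>free_module R B\<^esub> \<psi>) = (\<Oplus>\<^bsub>N\<^esub>b\<in>?T. (\<phi> \<oplus>\<^bsub>free_module R B\<^esub> \<psi>) b \<odot>\<^bsub>N\<^esub> u b)"
    using F.M.a_closed[OF \<phi> \<psi>] T by (intro lift_superset)
  also have "\<dots> = (\<Oplus>\<^bsub>N\<^esub>b\<in>?T. \<phi> b \<odot>\<^bsub>N\<^esub> u b \<oplus>\<^bsub>N\<^esub> \<psi> b \<odot>\<^bsub>N\<^esub> u b)"
    using T(2) u free_value[OF \<phi>] free_value[OF \<psi>]
    by (intro N.M.finsum_cong') (auto simp: free_module_simps N.smult_l_distr)
  also have "\<dots> = (\<Oplus>\<^bsub>N\<^esub>b\<in>?T. \<phi> b \<odot>\<^bsub>N\<^esub> u b) \<oplus>\<^bsub>N\<^esub> (\<Oplus>\<^bsub>N\<^esub>b\<in>?T. \<psi> b \<odot>\<^bsub>N\<^esub> u b)"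
    using T(2) u free_value[OF \<phi>] free_value[OF \<psi>] by (intro N.M.finsum_addf) auto
  also have "\<dots> = lift R N B u \<phi> \<oplus>\<^bsub>N\<^esub> lift R N B u \<psi>"
    using \<phi> \<psi> T by (simp add: lift_superset[of _ ?T])
  finally show "lift R N B u (\<phi> \<oplus>\<^bsub>free_module R B\<^esub> \<psi>) = lift R N B u \<phi> \<oplus>\<^bsub>N\<^esub> lift R N B u \<psi>" .
next
  fix a \<phi> assume a: "a \<in> carrier R" and \<phi>: "\<phi> \<in> carrier (free_module R B)"
  let ?T = "{b\<in>B. \<phi> b \<noteq> \<zero>\<^bsub>R\<^esub>}"
  have T: "finite ?T" "?T \<subseteq> B" using \<phi> by (auto simp: free_module_simps)
  have "{b\<in>B. (a \<odot>\<^bsub>free_module R B\<^esub> \<phi>) b \<noteq> \<zero>\<^bsub>R\<^esub>} \<subseteq> ?T" using a by (auto simp: free_module_simps)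
  then have "lift R N B u (a \<odot>\<^bsub>free_module R B\<^esub> \<phi>) = (\<Oplus>\<^bsub>N\<^esub>b\<in>?T. (a \<odot>\<^bsub>free_module R B\<^esub> \<phi>) b \<odot>\<^bsub>N\<^esub> u b)"
    using F.smult_closed[OF a \<phi>] T by (intro lift_superset)
  also have "\<dots> = (\<Oplus>\<^bsub>N\<^esub>b\<in>?T. a \<odot>\<^bsub>N\<^esub> (\<phi> b \<odot>\<^bsub>N\<^esub> u b))"
    using T(2) u free_value[OF \<phi>] a
    by (intro N.M.finsum_cong') (auto simp: free_module_simps N.smult_assoc1)
  also have "\<dots> = a \<odot>\<^bsub>N\<^esub> (\<Oplus>\<^bsub>N\<^esub>b\<in>?T. \<phi> b \<odot>\<^bsub>N\<^esub> u b)"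
    using T a u free_value[OF \<phi>] by (intro N.finsum_smult_ldistr[symmetric]) auto
  finally show "lift R N B u (a \<odot>\<^bsub>free_module R B\<^esub> \<phi>) = a \<odot>\<^bsub>N\<^esub> lift R N B u \<phi>" by (simp add: lift_def)
qed (rule lift_closed)

lemma lift_add: "\<phi> \<in> carrier (free_module R B) \<Longrightarrow> \<psi> \<in> carrier (free_module R B) \<Longrightarrow>
    lift R N B u (\<phi> \<oplus>\<^bsub>free_module R B\<^esub> \<psi>) = lift R N B u \<phi> \<oplus>\<^bsub>N\<^esub> lift R N B u \<psi>"
  using mod_homD(2)[OF lift_hom] F.M.a_closed by simp

lemma lift_smult: "a \<in> carrier R \<Longrightarrow> \<phi> \<in> carrier (free_module R B) \<Longrightarrow>
    lift R N B u (a \<odot>\<^bsub>free_module R B\<^esub> \<phi>) = a \<odot>\<^bsub>N\<^esub> lift R N B u \<phi>"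
  using mod_homD(3)[OF lift_hom] F.smult_closed by simp

lemma delta_closed: "b \<in> B \<Longrightarrow> delta R B b \<in> carrier (free_module R B)"
proof -
  assume "b \<in> B"
  have "{b'\<in>B. delta R B b b' \<noteq> \<zero>\<^bsub>R\<^esub>} \<subseteq> {b}" by (auto simp: delta_def)
  then have "finite {b'\<in>B. delta R B b b' \<noteq> \<zero>\<^bsub>R\<^esub>}" by (rule finite_subset) simp
  then show ?thesis by (auto simp: free_module_simps delta_def)
qed

lemma lift_delta: "b \<in> B \<Longrightarrow> lift R N B u (delta R B b) = u b"
proof -
  assume b: "b \<in> B"
  then have "lift R N B u (delta R B b) = (\<Oplus>\<^bsub>N\<^esub>b'\<in>{b}. delta R B b b' \<odot>\<^bsub>N\<^esub> u b')"
    by (intro lift_superset delta_closed) (auto simp: delta_def)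
  then show ?thesis using b u by (simp add: delta_def)
qed

lemma hom_lift:
  assumes N': "Module.module R N'" and h: "h \<in> mod_hom R N N'" and \<phi>: "\<phi> \<in> carrier (free_module R B)"
  shows "h (lift R N B u \<phi>) = lift R N' B (\<lambda>b. h (u b)) \<phi>"
proof -
  interpret N': Module.module R N' by fact
  have "finite {b\<in>B. \<phi> b \<noteq> \<zero>\<^bsub>R\<^esub>}" using \<phi> by (simp add: free_module_simps)
  then have "h (lift R N B u \<phi>) = (\<Oplus>\<^bsub>N'\<^esub>b\<in>{b\<in>B. \<phi> b \<noteq> \<zero>\<^bsub>R\<^esub>}. h (\<phi> b \<odot>\<^bsub>N\<^esub> u b))"
    unfolding lift_def using u free_value[OF \<phi>] by (intro mod_hom_finsum[OF N N' h]) auto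
  also have "\<dots> = lift R N' B (\<lambda>b. h (u b)) \<phi>"
    unfolding lift_def using u free_value[OF \<phi>] mod_homD(1,3)[OF h]
    by (intro N'.M.finsum_cong') auto
  finally show ?thesis .
qed

end

section \<open>The first extension group\<close>

lemma hom_group_comm_group:
  assumes M: "Module.module R M" and N: "Module.module R N"
  shows "comm_group (hom_group R M N)"
proof -
  interpret M: Module.module R M by fact
  interpret N: Module.module R N by fact
  have add: "(\<lambda>x\<in>carrier M. g x \<oplus>\<^bsub>N\<^esub> h x) \<in> mod_hom R M N"
    if "g \<in> mod_hom R M N" "h \<in> mod_hom R M N" for g h
    using mod_homD[OF that(1)] mod_homD[OF that(2)]
    by (intro mod_homI[OF _ _ _ M]) (simp_all add: N.M.a_ac N.smult_r_distr)
  have neg: "(\<lambda>x\<in>carrier M. \<ominus>\<^bsub>N\<^esub> g x) \<in> mod_hom R M N" if "g \<in> mod_hom R M N" for g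
    using mod_homD[OF that]
    by (intro mod_homI[OF _ _ _ M]) (simp_all add: N.M.minus_add N.smult_r_minus N.M.a_comm)
  have zero: "(\<lambda>x\<in>carrier M. \<zero>\<^bsub>N\<^esub>) \<in> mod_hom R M N"
    by (intro mod_homI[OF _ _ _ M]) simp_all
  show ?thesis
  proof (rule comm_groupI)
    fix x y z assume "x \<in> carrier (hom_group R M N)" "y \<in> carrier (hom_group R M N)" "z \<in> carrier (hom_group R M N)"
    then have m: "x \<in> mod_hom R M N" "y \<in> mod_hom R M N" "z \<in> mod_hom R M N"
      by (simp_all add: hom_group_def)
    show "x \<otimes>\<^bsub>hom_group R M N\<^esub> y \<otimes>\<^bsub>hom_group R M N\<^esub> z
        = x \<otimes>\<^bsub>hom_group R M N\<^esub> (y \<otimes>\<^bsub>hom_group R M N\<^esub> z)"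
      using mod_homD(1)[OF m(1)] mod_homD(1)[OF m(2)] mod_homD(1)[OF m(3)]
      by (auto simp: hom_group_def fun_eq_iff N.M.a_assoc)
  next
    fix x y assume "x \<in> carrier (hom_group R M N)" "y \<in> carrier (hom_group R M N)"
    then have m: "x \<in> mod_hom R M N" "y \<in> mod_hom R M N" by (simp_all add: hom_group_def)
    show "x \<otimes>\<^bsub>hom_group R M N\<^esub> y = y \<otimes>\<^bsub>hom_group R M N\<^esub> x"
      using mod_homD(1)[OF m(1)] mod_homD(1)[OF m(2)]
      by (auto simp: hom_group_def fun_eq_iff N.M.a_comm)
    show "x \<otimes>\<^bsub>hom_group R M N\<^esub> y \<in> carrier (hom_group R M N)"
      using add m by (simp add: hom_group_def)
  next
    fix x assume "x \<in> carrier (hom_group R M N)"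
    then have m: "x \<in> mod_hom R M N" by (simp add: hom_group_def)
    show "\<one>\<^bsub>hom_group R M N\<^esub> \<otimes>\<^bsub>hom_group R M N\<^esub> x = x"
      using mod_homD(1,4)[OF m] by (auto simp: hom_group_def fun_eq_iff extensional_def)
    show "\<exists>y\<in>carrier (hom_group R M N). y \<otimes>\<^bsub>hom_group R M N\<^esub> x = \<one>\<^bsub>hom_group R M N\<^esub>"
      using neg[OF m] mod_homD(1)[OF m]
      by (intro bexI[of _ "\<lambda>x'\<in>carrier M. \<ominus>\<^bsub>N\<^esub> x x'"]) (auto simp: hom_group_def fun_eq_iff N.M.l_neg)
  qed (simp add: hom_group_def zero)
qed

text \<open>The cosets of \<open>B\<close> form the trivial group only if they all coincide with \<open>B\<close> itself,
  and then every element of \<open>Z\<close> lies in the coset that contains the unit.\<close>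

lemma trivial_subquotient_iff:
  assumes H: "comm_group H" and Z: "subgroup Z H" and B: "B \<subseteq> Z" "\<one>\<^bsub>H\<^esub> \<in> B"
  shows "trivial_group (H\<lparr>carrier := Z\<rparr> Mod B) \<longleftrightarrow> Z \<subseteq> B"
proof
  interpret H: comm_group H by fact
  have ZH: "Z \<subseteq> carrier H" using Z by (rule subgroup.subset)
  assume "trivial_group (H\<lparr>carrier := Z\<rparr> Mod B)"
  then have triv: "carrier (H\<lparr>carrier := Z\<rparr> Mod B) = {B}" by (simp add: trivial_group_def FactGroup_def)
  show "Z \<subseteq> B"
  proof
    fix z assume z: "z \<in> Z"
    then have "B #>\<^bsub>H\<lparr>carrier := Z\<rparr>\<^esub> z \<in> carrier (H\<lparr>carrier := Z\<rparr> Mod B)"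
      by (auto simp: carrier_FactGroup)
    then have "B #>\<^bsub>H\<lparr>carrier := Z\<rparr>\<^esub> z = B" using triv by simp
    moreover have "\<one>\<^bsub>H\<^esub> \<otimes>\<^bsub>H\<^esub> z \<in> B #>\<^bsub>H\<lparr>carrier := Z\<rparr>\<^esub> z" using B(2) by (auto simp: r_coset_def)
    ultimately show "z \<in> B" using z ZH by auto
  qed
next
  interpret H: comm_group H by fact
  assume "Z \<subseteq> B"
  then have BZ: "B = Z" using B by blast
  have ZH: "Z \<subseteq> carrier H" using Z by (rule subgroup.subset)
  interpret Z: comm_group "H\<lparr>carrier := Z\<rparr>"
    by (rule group.group_comm_groupI[OF subgroup.subgroup_is_group[OF Z H.is_group]])
      (use ZH H.m_comm in auto)
  have sub: "subgroup B (H\<lparr>carrier := Z\<rparr>)" using Z.subgroup_self BZ by simp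
  have "group (H\<lparr>carrier := Z\<rparr> Mod B)"
    by (rule normal.factorgroup_is_group) (rule Z.subgroup_imp_normal[OF sub])
  moreover have "carrier (H\<lparr>carrier := Z\<rparr> Mod B) = {B}"
  proof -
    have "B #>\<^bsub>H\<lparr>carrier := Z\<rparr>\<^esub> z = B" if "z \<in> Z" for z
      using Z.coset_join2[OF _ sub] that BZ by simp
    moreover have "\<one>\<^bsub>H\<^esub> \<in> Z" using B by blast
    ultimately show ?thesis by (auto simp: carrier_FactGroup)
  qed
  ultimately show "trivial_group (H\<lparr>carrier := Z\<rparr> Mod B)" by (simp add: trivial_group_def)
qed

text \<open>The first syzygy of \<open>M\<close> in the free resolution that starts with the free module on all elements of \<open>M\<close>.\<close>

definition relations :: "('r, 'c) ring_scheme \<Rightarrow> ('r, 'm, 'd) module_scheme \<Rightarrow> ('m \<Rightarrow> 'r) set" where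
  "relations R M = {\<phi>\<in>carrier (free_module R (carrier M)). eval_free R M (carrier M) \<phi> = \<zero>\<^bsub>M\<^esub>}"

lemma relations_submodule:
  assumes M: "Module.module R M"
  shows "submodule (relations R M) R (free_module R (carrier M))"
proof -
  interpret M: Module.module R M by fact
  interpret F: Module.module R "free_module R (carrier M)" by (rule free_module_module) (rule M.R.is_cring)
  have l: "restrict (eval_free R M (carrier M)) (carrier (free_module R (carrier M)))
      \<in> mod_hom R (free_module R (carrier M)) M"
    unfolding eval_free_eq_lift by (rule lift_hom[OF M])
  note lD = mod_homD[OF l]
  have z: "eval_free R M (carrier M) \<zero>\<^bsub>free_module R (carrier M)\<^esub> = \<zero>\<^bsub>M\<^esub>"
    using mod_hom_zero[OF F.module_axioms M l] by simp
  show ?thesis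
  proof (rule F.submoduleI)
    fix \<phi> assume \<phi>: "\<phi> \<in> relations R M"
    then have \<phi>': "\<phi> \<in> carrier (free_module R (carrier M))" "eval_free R M (carrier M) \<phi> = \<zero>\<^bsub>M\<^esub>"
      by (auto simp: relations_def)
    show smult: "a \<odot>\<^bsub>free_module R (carrier M)\<^esub> \<phi> \<in> relations R M" if "a \<in> carrier R" for a
      using lD(3)[OF that \<phi>'(1)] \<phi>' that F.smult_closed[OF that \<phi>'(1)] by (simp add: relations_def)
    have "\<ominus>\<^bsub>free_module R (carrier M)\<^esub> \<phi> = (\<ominus>\<^bsub>R\<^esub> \<one>\<^bsub>R\<^esub>) \<odot>\<^bsub>free_module R (carrier M)\<^esub> \<phi>"
      using \<phi>'(1) by (simp add: F.smult_l_minus F.smult_one)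
    then show "\<ominus>\<^bsub>free_module R (carrier M)\<^esub> \<phi> \<in> relations R M" using smult by simp
    fix \<psi> assume "\<psi> \<in> relations R M"
    then have \<psi>': "\<psi> \<in> carrier (free_module R (carrier M))" "eval_free R M (carrier M) \<psi> = \<zero>\<^bsub>M\<^esub>"
      by (auto simp: relations_def)
    show "\<phi> \<oplus>\<^bsub>free_module R (carrier M)\<^esub> \<psi> \<in> relations R M"
      using lD(2)[OF \<phi>'(1) \<psi>'(1)] \<phi>' \<psi>' F.M.a_closed[OF \<phi>'(1) \<psi>'(1)] by (simp add: relations_def)
  qed (use z in \<open>auto simp: relations_def\<close>)
qed

definition relation_module ::
  "('r, 'c) ring_scheme \<Rightarrow> ('r, 'm, 'd) module_scheme \<Rightarrow> ('r, 'm \<Rightarrow> 'r) module" where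
  "relation_module R M = (free_module R (carrier M))\<lparr>carrier := relations R M\<rparr>"

text \<open>A cocycle on the second free module \<open>F1\<close> is a map that factors through the image of \<open>F1\<close>, which is the
  syzygy; it is a coboundary if and only if the factored map extends to the first free module.\<close>

theorem trivial_Ext1_iff:
  assumes M: "Module.module R M" and N: "Module.module R N"
  shows "trivial_group (Ext1 R M N) \<longleftrightarrow>
    (\<forall>w\<in>mod_hom R (relation_module R M) N.
       \<exists>g\<in>mod_hom R (free_module R (carrier M)) N. \<forall>\<phi>\<in>relations R M. g \<phi> = w \<phi>)"
proof -
  interpret M: Module.module R M by fact
  interpret N: Module.module R N by fact
  have R: "cring R" by (rule M.R.is_cring)
  define F0 where "F0 = free_module R (carrier M)"
  define K0 where "K0 = relations R M"
  define F1 where "F1 = free_module R K0"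
  define d1 where "d1 = eval_free R F0 K0"
  define K1 where "K1 = {\<psi>\<in>carrier F1. d1 \<psi> = \<zero>\<^bsub>F0\<^esub>}"
  define F2 where "F2 = free_module R K1"
  define d2 where "d2 = eval_free R F1 K1"
  define Z where "Z = kernel (hom_group R F1 N) (hom_group R F2 N) (\<lambda>h. compose (carrier F2) h d2)"
  define Bd where "Bd = (\<lambda>g. compose (carrier F1) g d1) ` mod_hom R F0 N"
  interpret F0: Module.module R F0 unfolding F0_def by (rule free_module_module[OF R])
  interpret F1: Module.module R F1 unfolding F1_def by (rule free_module_module[OF R])
  interpret F2: Module.module R F2 unfolding F2_def by (rule free_module_module[OF R])
  have sub: "submodule K0 R F0" unfolding K0_def F0_def by (rule relations_submodule[OF M])
  note K0D = F0.submoduleE[OF sub]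
  have K0F: "\<And>k. k \<in> K0 \<Longrightarrow> k \<in> carrier F0" using K0D(1) by blast
  have K0m: "Module.module R (relation_module R M)"
    using submodule.submodule_is_module[OF sub F0.module_axioms] by (simp add: relation_module_def F0_def K0_def)
  have rm: "carrier (relation_module R M) = K0" "\<And>x y. x \<oplus>\<^bsub>relation_module R M\<^esub> y = x \<oplus>\<^bsub>F0\<^esub> y"
    "\<And>a x. a \<odot>\<^bsub>relation_module R M\<^esub> x = a \<odot>\<^bsub>F0\<^esub> x" "\<zero>\<^bsub>relation_module R M\<^esub> = \<zero>\<^bsub>F0\<^esub>"
    by (simp_all add: relation_module_def F0_def K0_def)
  have d1K: "d1 \<psi> \<in> K0" if "\<psi> \<in> carrier F1" for \<psi>
  proof -
    have "d1 \<psi> = (\<Oplus>\<^bsub>F0\<^esub>b\<in>{b\<in>K0. \<psi> b \<noteq> \<zero>\<^bsub>R\<^esub>}. \<psi> b \<odot>\<^bsub>F0\<^esub> b)" by (simp add: d1_def eval_free_def)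
    have fin: "finite {b\<in>K0. \<psi> b \<noteq> \<zero>\<^bsub>R\<^esub>}" and val: "\<And>b. b \<in> K0 \<Longrightarrow> \<psi> b \<in> carrier R"
      using that by (auto simp: F1_def free_module_simps)
    have "(\<Oplus>\<^bsub>F0\<^esub>b\<in>T. \<psi> b \<odot>\<^bsub>F0\<^esub> b) \<in> K0" if "finite T" "T \<subseteq> K0" for T
      using that
    proof (induction T rule: finite_induct)
      case empty
      then show ?case using subgroup.one_closed[OF submodule.axioms(1)[OF sub]] by simp
    next
      case (insert b T)
      have "b \<in> K0" using insert.prems by blast
      then have "\<psi> b \<odot>\<^bsub>F0\<^esub> b \<in> K0" using val K0D(4) by blast
      moreover have "(\<lambda>b. \<psi> b \<odot>\<^bsub>F0\<^esub> b) \<in> T \<rightarrow> carrier F0" "\<psi> b \<odot>\<^bsub>F0\<^esub> b \<in> carrier F0"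
        using insert.prems val K0D(4) K0F by blast+
      ultimately show ?case using insert K0D(5) by simp
    qed
    from this[OF fin] show ?thesis by (simp add: d1_def eval_free_def)
  qed
  have d1_add: "d1 (\<psi> \<oplus>\<^bsub>F1\<^esub> \<psi>') = d1 \<psi> \<oplus>\<^bsub>F0\<^esub> d1 \<psi>'" if "\<psi> \<in> carrier F1" "\<psi>' \<in> carrier F1" for \<psi> \<psi>'
    using that unfolding d1_def F1_def eval_free_eq_lift
    by (intro lift_add[where u = "\<lambda>b. b", OF F0.module_axioms K0F]) assumption+
  have d1_smult: "d1 (a \<odot>\<^bsub>F1\<^esub> \<psi>) = a \<odot>\<^bsub>F0\<^esub> d1 \<psi>" if "a \<in> carrier R" "\<psi> \<in> carrier F1" for a \<psi>
    using that unfolding d1_def F1_def eval_free_eq_lift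
    by (intro lift_smult[where u = "\<lambda>b. b", OF F0.module_axioms K0F]) assumption+
  have \<delta>: "delta R K0 k \<in> carrier F1" "d1 (delta R K0 k) = k" if k: "k \<in> K0" for k
  proof -
    show "delta R K0 k \<in> carrier F1"
      using k unfolding F1_def by (rule delta_closed[where u = "\<lambda>b. b", OF F0.module_axioms K0F, rotated])
    show "d1 (delta R K0 k) = k"
      using k unfolding d1_def F1_def eval_free_eq_lift
      by (rule lift_delta[where u = "\<lambda>b. b", OF F0.module_axioms K0F, rotated])
  qed
  have K1F: "\<And>\<psi>. \<psi> \<in> K1 \<Longrightarrow> \<psi> \<in> carrier F1" by (simp add: K1_def)
  have \<delta>2: "delta R K1 k \<in> carrier F2" "d2 (delta R K1 k) = k" if k: "k \<in> K1" for k
  proof -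
    show "delta R K1 k \<in> carrier F2"
      using k unfolding F2_def by (rule delta_closed[where u = "\<lambda>b. b", OF F1.module_axioms K1F, rotated])
    show "d2 (delta R K1 k) = k"
      using k unfolding d2_def F2_def eval_free_eq_lift
      by (rule lift_delta[where u = "\<lambda>b. b", OF F1.module_axioms K1F, rotated])
  qed
  have d2F: "d2 \<chi> \<in> carrier F1" if "\<chi> \<in> carrier F2" for \<chi>
    using that unfolding d2_def F2_def eval_free_eq_lift
    by (intro lift_closed[where u = "\<lambda>b. b", OF F1.module_axioms K1F]) assumption+
  have hd2: "h (d2 \<chi>) = \<zero>\<^bsub>N\<^esub>" if h: "h \<in> mod_hom R F1 N" "\<forall>\<psi>\<in>K1. h \<psi> = \<zero>\<^bsub>N\<^esub>" and \<chi>: "\<chi> \<in> carrier F2" for h \<chi>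
  proof -
    have "h (d2 \<chi>) = lift R N K1 h \<chi>"
      unfolding d2_def eval_free_eq_lift
      using \<chi> unfolding F2_def
      by (intro hom_lift[where u = "\<lambda>b. b", OF F1.module_axioms _ N h(1)] K1F) assumption+
    also have "\<dots> = (\<Oplus>\<^bsub>N\<^esub>b\<in>{b\<in>K1. \<chi> b \<noteq> \<zero>\<^bsub>R\<^esub>}. \<zero>\<^bsub>N\<^esub>)"
      unfolding lift_def using h(2) \<chi> by (intro N.M.finsum_cong') (auto simp: F2_def free_module_simps PiE_iff)
    also have "\<dots> = \<zero>\<^bsub>N\<^esub>" by simp
    finally show ?thesis .
  qed
  \<comment> \<open>Cocycles are the maps that vanish on the kernel \<open>K1\<close> of \<open>d1\<close>.\<close>
  have Z: "Z = {h \<in> mod_hom R F1 N. \<forall>\<psi>\<in>K1. h \<psi> = \<zero>\<^bsub>N\<^esub>}"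
  proof (intro equalityI subsetI)
    fix h assume "h \<in> Z"
    then have h: "h \<in> mod_hom R F1 N" "compose (carrier F2) h d2 = (\<lambda>x\<in>carrier F2. \<zero>\<^bsub>N\<^esub>)"
      by (auto simp: Z_def kernel_def hom_group_def)
    have "h \<psi> = \<zero>\<^bsub>N\<^esub>" if "\<psi> \<in> K1" for \<psi>
      using fun_cong[OF h(2), of "delta R K1 \<psi>"] \<delta>2[OF that] by (simp add: compose_def)
    then show "h \<in> {h \<in> mod_hom R F1 N. \<forall>\<psi>\<in>K1. h \<psi> = \<zero>\<^bsub>N\<^esub>}" using h by blast
  next
    fix h assume "h \<in> {h \<in> mod_hom R F1 N. \<forall>\<psi>\<in>K1. h \<psi> = \<zero>\<^bsub>N\<^esub>}"
    then have h: "h \<in> mod_hom R F1 N" "\<forall>\<psi>\<in>K1. h \<psi> = \<zero>\<^bsub>N\<^esub>" by auto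
    then have "compose (carrier F2) h d2 = (\<lambda>x\<in>carrier F2. \<zero>\<^bsub>N\<^esub>)"
      using hd2[OF h] by (auto simp: compose_def fun_eq_iff)
    then show "h \<in> Z" using h(1) by (simp add: Z_def kernel_def hom_group_def)
  qed
  have H: "comm_group (hom_group R F1 N)" by (rule hom_group_comm_group) (rule F1.module_axioms, rule N)
  interpret H: comm_group "hom_group R F1 N" by (rule H)
  have mult: "(x \<otimes>\<^bsub>hom_group R F1 N\<^esub> y) \<psi> = x \<psi> \<oplus>\<^bsub>N\<^esub> y \<psi>" if "\<psi> \<in> carrier F1" for x y \<psi>
    using that by (simp add: hom_group_def)
  have one: "\<one>\<^bsub>hom_group R F1 N\<^esub> = (\<lambda>\<psi>\<in>carrier F1. \<zero>\<^bsub>N\<^esub>)" by (simp add: hom_group_def)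
  have hc: "carrier (hom_group R F1 N) = mod_hom R F1 N" by (simp add: hom_group_def)
  have Zsub: "subgroup Z (hom_group R F1 N)"
  proof (rule H.subgroupI)
    show "Z \<subseteq> carrier (hom_group R F1 N)" by (auto simp: Z hc)
    have "\<one>\<^bsub>hom_group R F1 N\<^esub> \<in> Z" using H.one_closed K1F by (auto simp: Z hc one)
    then show "Z \<noteq> {}" by blast
    fix x assume x: "x \<in> Z"
    then have xc: "x \<in> carrier (hom_group R F1 N)" by (simp add: Z hc)
    have "(inv\<^bsub>hom_group R F1 N\<^esub> x) \<psi> = \<zero>\<^bsub>N\<^esub>" if \<psi>: "\<psi> \<in> K1" for \<psi>
    proof -
      have "(inv\<^bsub>hom_group R F1 N\<^esub> x \<otimes>\<^bsub>hom_group R F1 N\<^esub> x) \<psi> = \<zero>\<^bsub>N\<^esub>"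
        unfolding H.l_inv[OF xc] using K1F[OF \<psi>] by (simp add: one)
      moreover have "(inv\<^bsub>hom_group R F1 N\<^esub> x) \<psi> \<in> carrier N"
        using mod_homD(1)[OF H.inv_closed[OF xc, unfolded hc] K1F[OF \<psi>]] .
      moreover have "x \<psi> = \<zero>\<^bsub>N\<^esub>" using x \<psi> by (simp add: Z)
      ultimately show ?thesis using mult[OF K1F[OF \<psi>]] by simp
    qed
    then show "inv\<^bsub>hom_group R F1 N\<^esub> x \<in> Z" using H.inv_closed[OF xc] by (simp add: Z hc)
    fix y assume y: "y \<in> Z"
    then have yc: "y \<in> carrier (hom_group R F1 N)" by (simp add: Z hc)
    show "x \<otimes>\<^bsub>hom_group R F1 N\<^esub> y \<in> Z"
      using H.m_closed[OF xc yc] x y mult K1F by (simp add: Z hc)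
  qed
  have BdZ: "Bd \<subseteq> Z"
  proof
    fix h assume "h \<in> Bd"
    then obtain g where g: "g \<in> mod_hom R F0 N" "h = compose (carrier F1) g d1" by (auto simp: Bd_def)
    have "h \<in> mod_hom R F1 N"
      unfolding g(2) compose_def
      by (rule mod_homI) (use mod_homD[OF g(1)] d1K K0F d1_add d1_smult F1.module_axioms in simp_all)
    moreover have "h \<psi> = \<zero>\<^bsub>N\<^esub>" if "\<psi> \<in> K1" for \<psi>
      using that mod_hom_zero[OF F0.module_axioms N g(1)] by (simp add: g(2) compose_def K1_def)
    ultimately show "h \<in> Z" by (simp add: Z)
  qed
  have oneB: "\<one>\<^bsub>hom_group R F1 N\<^esub> \<in> Bd"
  proof -
    have "(\<lambda>x\<in>carrier F0. \<zero>\<^bsub>N\<^esub>) \<in> mod_hom R F0 N"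
      by (rule mod_homI) (simp_all add: F0.module_axioms)
    moreover have "\<one>\<^bsub>hom_group R F1 N\<^esub> = compose (carrier F1) (\<lambda>x\<in>carrier F0. \<zero>\<^bsub>N\<^esub>) d1"
      using d1K K0F by (auto simp: one compose_def fun_eq_iff)
    ultimately show ?thesis unfolding Bd_def by blast
  qed
  have Ext: "Ext1 R M N = (hom_group R F1 N)\<lparr>carrier := Z\<rparr> Mod Bd"
  proof -
    have c: "carrier (hom_group R F0 N) = mod_hom R F0 N" by (simp add: hom_group_def)
    have "K0 = {\<phi>\<in>carrier F0. eval_free R M (carrier M) \<phi> = \<zero>\<^bsub>M\<^esub>}" by (simp add: K0_def F0_def relations_def)
    then show ?thesis
      unfolding Ext1_def Let_def c[symmetric] Bd_def Z_def d2_def F2_def K1_def d1_def F1_def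
      by (simp only: F0_def[symmetric])
  qed
  have "trivial_group (Ext1 R M N) \<longleftrightarrow> Z \<subseteq> Bd"
    unfolding Ext by (rule trivial_subquotient_iff[OF H Zsub BdZ oneB])
  also have "\<dots> \<longleftrightarrow> (\<forall>w\<in>mod_hom R (relation_module R M) N.
       \<exists>g\<in>mod_hom R F0 N. \<forall>\<phi>\<in>K0. g \<phi> = w \<phi>)"
  proof
    assume ZB: "Z \<subseteq> Bd"
    show "\<forall>w\<in>mod_hom R (relation_module R M) N. \<exists>g\<in>mod_hom R F0 N. \<forall>\<phi>\<in>K0. g \<phi> = w \<phi>"
    proof
      fix w assume w: "w \<in> mod_hom R (relation_module R M) N"
      define z where "z = compose (carrier F1) w d1"
      have "z \<in> mod_hom R F1 N"
        unfolding z_def compose_def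
        by (rule mod_homI[OF _ _ _ F1.module_axioms])
          (use mod_homD(1-3)[OF w, unfolded rm] d1K d1_add d1_smult in simp_all)
      moreover have "z \<psi> = \<zero>\<^bsub>N\<^esub>" if "\<psi> \<in> K1" for \<psi>
        using that mod_hom_zero[OF K0m N w] by (simp add: z_def compose_def K1_def rm)
      ultimately have "z \<in> Bd" using ZB by (auto simp: Z)
      then obtain g where g: "g \<in> mod_hom R F0 N" "z = compose (carrier F1) g d1" by (auto simp: Bd_def)
      have "g k = w k" if "k \<in> K0" for k
        using fun_cong[OF g(2), of "delta R K0 k"] \<delta>[OF that] by (simp add: z_def compose_def)
      then show "\<exists>g\<in>mod_hom R F0 N. \<forall>\<phi>\<in>K0. g \<phi> = w \<phi>" using g(1) by blast
    qed
  next
    assume ext: "\<forall>w\<in>mod_hom R (relation_module R M) N. \<exists>g\<in>mod_hom R F0 N. \<forall>\<phi>\<in>K0. g \<phi> = w \<phi>"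
    show "Z \<subseteq> Bd"
    proof
      fix z assume "z \<in> Z"
      then have z: "z \<in> mod_hom R F1 N" "\<And>\<psi>. \<psi> \<in> K1 \<Longrightarrow> z \<psi> = \<zero>\<^bsub>N\<^esub>" by (auto simp: Z)
      have zeq: "z \<psi> = z \<psi>'" if \<psi>: "\<psi> \<in> carrier F1" "\<psi>' \<in> carrier F1" and eq: "d1 \<psi> = d1 \<psi>'" for \<psi> \<psi>'
      proof -
        let ?m = "(\<ominus>\<^bsub>R\<^esub> \<one>\<^bsub>R\<^esub>) \<odot>\<^bsub>F1\<^esub> \<psi>'"
        have m1: "\<ominus>\<^bsub>R\<^esub> \<one>\<^bsub>R\<^esub> \<in> carrier R" by simp
        have mc: "?m \<in> carrier F1" using m1 \<psi>(2) by (rule F1.smult_closed)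
        have "d1 (\<psi> \<oplus>\<^bsub>F1\<^esub> ?m) = d1 \<psi> \<oplus>\<^bsub>F0\<^esub> (\<ominus>\<^bsub>R\<^esub> \<one>\<^bsub>R\<^esub>) \<odot>\<^bsub>F0\<^esub> d1 \<psi>'"
          using d1_add[OF \<psi>(1) mc] d1_smult[OF m1 \<psi>(2)] by simp
        also have "\<dots> = \<zero>\<^bsub>F0\<^esub>"
          using K0F[OF d1K[OF \<psi>(2)]] by (simp add: eq F0.smult_l_minus F0.M.r_neg)
        finally have "z (\<psi> \<oplus>\<^bsub>F1\<^esub> ?m) = \<zero>\<^bsub>N\<^esub>" using \<psi>(1) mc by (intro z(2)) (simp add: K1_def)
        then have "z \<psi> \<oplus>\<^bsub>N\<^esub> (\<ominus>\<^bsub>N\<^esub> z \<psi>') = \<zero>\<^bsub>N\<^esub>"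
          using mod_homD(2)[OF z(1) \<psi>(1) mc] mod_homD(3)[OF z(1) m1 \<psi>(2)] mod_homD(1)[OF z(1) \<psi>(2)]
          by (simp add: N.smult_l_minus)
        then have "\<ominus>\<^bsub>N\<^esub> (\<ominus>\<^bsub>N\<^esub> z \<psi>') = z \<psi>" 
          using mod_homD(1)[OF z(1)] \<psi> by (intro N.M.minus_equality) auto
        then show ?thesis using mod_homD(1)[OF z(1) \<psi>(2)] by simp
      qed
      define w where "w = (\<lambda>k\<in>K0. z (delta R K0 k))"
      have "w \<in> mod_hom R (relation_module R M) N"
        unfolding w_def rm(1)[symmetric]
      proof (rule mod_homI[OF _ _ _ K0m])
        fix x assume x: "x \<in> carrier (relation_module R M)"
        then have x': "x \<in> K0" by (simp add: rm)
        show "z (delta R (carrier (relation_module R M)) x) \<in> carrier N"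
          using mod_homD(1)[OF z(1) \<delta>(1)[OF x']] by (simp add: rm)
        show "z (delta R (carrier (relation_module R M)) (a \<odot>\<^bsub>relation_module R M\<^esub> x))
            = a \<odot>\<^bsub>N\<^esub> z (delta R (carrier (relation_module R M)) x)" if a: "a \<in> carrier R" for a
        proof -
          have ax: "a \<odot>\<^bsub>F0\<^esub> x \<in> K0" using K0D(4)[OF a x'] .
          have "z (delta R K0 (a \<odot>\<^bsub>F0\<^esub> x)) = z (a \<odot>\<^bsub>F1\<^esub> delta R K0 x)"
            using \<delta>[OF ax] \<delta>[OF x'] d1_smult[OF a \<delta>(1)[OF x']] F1.smult_closed[OF a] by (intro zeq) auto
          then show ?thesis using mod_homD(3)[OF z(1) a \<delta>(1)[OF x']] by (simp add: rm)
        qed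
        fix y assume "y \<in> carrier (relation_module R M)"
        then have y': "y \<in> K0" by (simp add: rm)
        have xy: "x \<oplus>\<^bsub>F0\<^esub> y \<in> K0" using K0D(5)[OF x' y'] .
        have "z (delta R K0 (x \<oplus>\<^bsub>F0\<^esub> y)) = z (delta R K0 x \<oplus>\<^bsub>F1\<^esub> delta R K0 y)"
          using \<delta>[OF xy] \<delta>[OF x'] \<delta>[OF y'] d1_add[OF \<delta>(1)[OF x'] \<delta>(1)[OF y']] by (intro zeq) auto
        then show "z (delta R (carrier (relation_module R M)) (x \<oplus>\<^bsub>relation_module R M\<^esub> y))
            = z (delta R (carrier (relation_module R M)) x) \<oplus>\<^bsub>N\<^esub> z (delta R (carrier (relation_module R M)) y)"
          using mod_homD(2)[OF z(1) \<delta>(1)[OF x'] \<delta>(1)[OF y']] by (simp add: rm)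
      qed
      then obtain g where g: "g \<in> mod_hom R F0 N" "\<forall>k\<in>K0. g k = w k" using ext by blast
      have "z = compose (carrier F1) g d1"
      proof
        fix \<psi>
        show "z \<psi> = compose (carrier F1) g d1 \<psi>"
        proof (cases "\<psi> \<in> carrier F1")
          case True
          have "z \<psi> = z (delta R K0 (d1 \<psi>))" using \<delta>[OF d1K[OF True]] True by (intro zeq) auto
          then show ?thesis using True g(2) d1K[OF True] by (simp add: compose_def w_def)
        next
          case False
          then show ?thesis using mod_homD(4)[OF z(1)] by (simp add: compose_def extensional_def)
        qed
      qed
      then show "z \<in> Bd" unfolding Bd_def using g(1) by blast
    qed
  qed
  finally show ?thesis unfolding F0_def K0_def .
qed

section \<open>Vanishing of Ext against the chain of quotients\<close>

text \<open>Restriction of scalars from the residue class ring modulo \<open>F\<close> to the power series ring.\<close>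

definition sact ::
  "'k::field fps fps \<Rightarrow> ('k fps fps set, 'x, 'z) module_scheme \<Rightarrow> 'k fps fps \<Rightarrow> 'x \<Rightarrow> 'x" where
  "sact F Y s v = cls F s \<odot>\<^bsub>Y\<^esub> v"

lemma cls_carrier [simp]: "cls F s \<in> carrier (kxy_quot F)"
  by (simp add: kxy_quot_carrier)

lemma smodule_sact:
  assumes "Module.module (kxy_quot F) Y" shows "smodule Y (sact F Y)"
proof -
  interpret Y: Module.module "kxy_quot F" Y by fact
  show ?thesis
  proof
    fix v s t assume v: "v \<in> carrier Y"
    show "sact F Y s v \<in> carrier Y" using v by (simp add: sact_def)
    show "sact F Y (s + t) v = sact F Y s v \<oplus>\<^bsub>Y\<^esub> sact F Y t v"
      using v by (simp add: sact_def flip: kxy_quot_simps(2) Y.smult_l_distr)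
    show "sact F Y s (sact F Y t v) = sact F Y (s * t) v"
      using v by (simp add: sact_def flip: kxy_quot_simps(1) Y.smult_assoc1)
    show "sact F Y 1 v = v" using v by (simp add: sact_def flip: kxy_quot_simps(3))
    fix w assume "w \<in> carrier Y"
    then show "sact F Y s (v \<oplus>\<^bsub>Y\<^esub> w) = sact F Y s v \<oplus>\<^bsub>Y\<^esub> sact F Y s w"
      using v by (simp add: sact_def Y.smult_r_distr)
  qed
qed

lemma sact_modulus:
  assumes "Module.module (kxy_quot F) Y" "v \<in> carrier Y" "F dvd s"
  shows "sact F Y s v = \<zero>\<^bsub>Y\<^esub>"
proof -
  interpret Y: Module.module "kxy_quot F" Y by fact
  have "cls F s = \<zero>\<^bsub>kxy_quot F\<^esub>" using assms(3) by (simp add: kxy_quot_simps cls_eq_iff)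
  then show ?thesis using assms(2) by (simp add: sact_def)
qed

lemma mod_homI_sact:
  assumes M: "Module.module (kxy_quot F) M"
    and "\<And>x. x \<in> carrier M \<Longrightarrow> h x \<in> carrier N"
    and "\<And>x y. x \<in> carrier M \<Longrightarrow> y \<in> carrier M \<Longrightarrow> h (x \<oplus>\<^bsub>M\<^esub> y) = h x \<oplus>\<^bsub>N\<^esub> h y"
    and act: "\<And>s x. x \<in> carrier M \<Longrightarrow> h (sact F M s x) = sact F N s (h x)"
  shows "restrict h (carrier M) \<in> mod_hom (kxy_quot F) M N"
proof (rule mod_homI[OF assms(2,3) _ M])
  fix a x assume "a \<in> carrier (kxy_quot F)" "x \<in> carrier M"
  then obtain s where "a = cls F s" by (auto simp: kxy_quot_carrier)
  then show "h (a \<odot>\<^bsub>M\<^esub> x) = a \<odot>\<^bsub>N\<^esub> h x" using act[OF \<open>x \<in> carrier M\<close>, of s] by (simp add: sact_def)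
qed

lemma mod_hom_sact:
  "h \<in> mod_hom (kxy_quot F) M N \<Longrightarrow> x \<in> carrier M \<Longrightarrow> h (sact F M s x) = sact F N s (h x)"
  by (simp add: sact_def mod_homD(3))

lemma smodule_hom_lc:
  assumes V: "smodule V a" and N: "smodule N b" and K: "smodule.sub V a K"
    and add: "\<And>x y. x \<in> K \<Longrightarrow> y \<in> K \<Longrightarrow> w (x \<oplus>\<^bsub>V\<^esub> y) = w x \<oplus>\<^bsub>N\<^esub> w y"
    and act: "\<And>s x. x \<in> K \<Longrightarrow> w (a s x) = b s (w x)"
    and cl: "\<And>x. x \<in> K \<Longrightarrow> w x \<in> carrier N"
    and I: "finite I" "\<And>i. i \<in> I \<Longrightarrow> x i \<in> K"
  shows "w (smodule.lc V a I c x) = smodule.lc N b I c (\<lambda>i. w (x i))"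
proof -
  interpret V: smodule V a by fact
  interpret N: smodule N b by fact
  note KD = V.subD[OF K]
  show ?thesis using I
  proof (induction I rule: finite_induct)
    case empty
    have "w (a 0 \<zero>\<^bsub>V\<^esub>) = b 0 (w \<zero>\<^bsub>V\<^esub>)" using KD(2) by (rule act)
    then show ?case using cl[OF KD(2)] by simp
  next
    case (insert i I)
    have xK: "x i \<in> K" "\<And>j. j \<in> I \<Longrightarrow> x j \<in> K" using insert.prems by auto
    then have 1: "V.lc I c x \<in> K" using insert.hyps by (intro V.lc_in_sub[OF K])
    have "x \<in> insert i I \<rightarrow> carrier V" "(\<lambda>i. w (x i)) \<in> insert i I \<rightarrow> carrier N"
      using insert.prems KD(1) cl by auto
    then show ?case
      using insert.hyps insert.IH xK add[OF KD(4)[OF xK(1)] 1] act[OF xK(1)]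
      by (simp add: V.lc_insert N.lc_insert)
  qed
qed

lemma sub_relations:
  assumes Y: "Module.module (kxy_quot F) Y"
  shows "smodule.sub (free_module (kxy_quot F) (carrier Y)) (sact F (free_module (kxy_quot F) (carrier Y)))
    (relations (kxy_quot F) Y)"
proof -
  interpret F0: Module.module "kxy_quot F" "free_module (kxy_quot F) (carrier Y)"
    by (rule free_module_module[OF kxy_quot_cring])
  interpret F0s: smodule "free_module (kxy_quot F) (carrier Y)" "sact F (free_module (kxy_quot F) (carrier Y))"
    by (rule smodule_sact[OF F0.module_axioms])
  note D = F0.submoduleE[OF relations_submodule[OF Y]]
  have "\<zero>\<^bsub>free_module (kxy_quot F) (carrier Y)\<^esub> \<in> relations (kxy_quot F) Y"
    using subgroup.one_closed[OF submodule.axioms(1)[OF relations_submodule[OF Y]]] by simp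
  then show ?thesis unfolding F0s.sub_def using D by (auto simp: sact_def)
qed

lemma eval_free_hom:
  assumes Y: "Module.module R Y"
  shows "\<phi> \<in> carrier (free_module R (carrier Y)) \<Longrightarrow> eval_free R Y (carrier Y) \<phi> \<in> carrier Y"
    and "\<phi> \<in> carrier (free_module R (carrier Y)) \<Longrightarrow> \<psi> \<in> carrier (free_module R (carrier Y)) \<Longrightarrow>
      eval_free R Y (carrier Y) (\<phi> \<oplus>\<^bsub>free_module R (carrier Y)\<^esub> \<psi>)
        = eval_free R Y (carrier Y) \<phi> \<oplus>\<^bsub>Y\<^esub> eval_free R Y (carrier Y) \<psi>"
    and "a \<in> carrier R \<Longrightarrow> \<phi> \<in> carrier (free_module R (carrier Y)) \<Longrightarrow>
      eval_free R Y (carrier Y) (a \<odot>\<^bsub>free_module R (carrier Y)\<^esub> \<phi>) = a \<odot>\<^bsub>Y\<^esub> eval_free R Y (carrier Y) \<phi>"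
    and "y \<in> carrier Y \<Longrightarrow> delta R (carrier Y) y \<in> carrier (free_module R (carrier Y))"
    and "y \<in> carrier Y \<Longrightarrow> eval_free R Y (carrier Y) (delta R (carrier Y) y) = y"
  unfolding eval_free_eq_lift
  by (intro lift_closed[OF Y] lift_add[OF Y] lift_smult[OF Y] delta_closed[OF Y] lift_delta[OF Y]; assumption)+

lemma relation_module_simps:
  "carrier (relation_module R M) = relations R M"
  "x \<oplus>\<^bsub>relation_module R M\<^esub> y = x \<oplus>\<^bsub>free_module R (carrier M)\<^esub> y"
  "a \<odot>\<^bsub>relation_module R M\<^esub> x = a \<odot>\<^bsub>free_module R (carrier M)\<^esub> x"
  by (simp_all add: relation_module_def)

lemma relation_module_module:
  assumes "Module.module R M" shows "Module.module R (relation_module R M)"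
proof -
  interpret M: Module.module R M by fact
  show ?thesis unfolding relation_module_def
    by (rule submodule.submodule_is_module[OF relations_submodule[OF assms] free_module_module[OF M.R.is_cring]])
qed

text \<open>The sum of the quotients \<open>S / (g (l i))\<close> has Ext against \<open>N\<close> given by the kernels of the complementary
  products modulo the images of \<open>g (l i)\<close>.  Explicitly: a map \<open>w\<close> from the syzygy sends the relation \<open>x i\<close>, which
  expresses that \<open>g (l i)\<close> kills \<open>e i\<close>, into the kernel of \<open>seg f (l i) n\<close>; by the kernel condition its
  value is \<open>g (l i)\<close> times some \<open>u i\<close>.  Sending the basis vector of \<open>e i\<close> to \<open>u i\<close>, and correcting by \<open>w\<close>, extends \<open>w\<close>.\<close>

theorem Ext1_trivial_of_cyclic_basis:
  fixes f :: "nat \<Rightarrow> 'k::field fps fps" and n :: nat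
  defines "F \<equiv> seg f 0 n"
  assumes Y: "Module.module (kxy_quot F) Y" and N: "Module.module (kxy_quot F) N"
    and basis: "smodule.cyclic_basis Y (sact F Y) (carrier Y) I e (\<lambda>i. seg f 0 (l i))" and l: "l \<in> I \<rightarrow> {1..n}"
    and kc: "smodule.kernel_condition N (sact F N) f n (carrier N)"
  shows "trivial_group (Ext1 (kxy_quot F) Y N)"
  unfolding trivial_Ext1_iff[OF Y N]
proof
  define F0 where "F0 = free_module (kxy_quot F) (carrier Y)"
  define K where "K = relations (kxy_quot F) Y"
  define ev where "ev = eval_free (kxy_quot F) Y (carrier Y)"
  define D where "D i = delta (kxy_quot F) (carrier Y) (e i)" for i
  define g where "g = seg f 0"
  fix w assume w: "w \<in> mod_hom (kxy_quot F) (relation_module (kxy_quot F) Y) N"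
  have F0m: "Module.module (kxy_quot F) F0" unfolding F0_def by (rule free_module_module[OF kxy_quot_cring])
  interpret X: smodule F0 "sact F F0" by (rule smodule_sact[OF F0m])
  interpret Y: smodule Y "sact F Y" by (rule smodule_sact[OF Y])
  interpret N: smodule N "sact F N" by (rule smodule_sact[OF N])
  have K: "X.sub K" unfolding K_def F0_def by (rule sub_relations[OF Y])
  note KD = X.subD[OF K]
  have Kiff: "\<phi> \<in> K \<longleftrightarrow> \<phi> \<in> carrier F0 \<and> ev \<phi> = \<zero>\<^bsub>Y\<^esub>" for \<phi>
    by (auto simp: K_def relations_def F0_def ev_def)
  have evc: "ev \<phi> \<in> carrier Y" if "\<phi> \<in> carrier F0" for \<phi>
    using eval_free_hom(1)[OF Y] that unfolding ev_def F0_def by blast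
  have eva: "ev (\<phi> \<oplus>\<^bsub>F0\<^esub> \<psi>) = ev \<phi> \<oplus>\<^bsub>Y\<^esub> ev \<psi>" if "\<phi> \<in> carrier F0" "\<psi> \<in> carrier F0" for \<phi> \<psi>
    using eval_free_hom(2)[OF Y] that unfolding ev_def F0_def by blast
  have evs: "ev (sact F F0 s \<phi>) = sact F Y s (ev \<phi>)" if "\<phi> \<in> carrier F0" for s \<phi>
    using eval_free_hom(3)[OF Y cls_carrier] that unfolding ev_def F0_def sact_def by blast
  have wc: "w x \<in> carrier N" if "x \<in> K" for x
    using mod_homD(1)[OF w] that by (simp add: relation_module_simps K_def)
  have wa: "w (x \<oplus>\<^bsub>F0\<^esub> y) = w x \<oplus>\<^bsub>N\<^esub> w y" if "x \<in> K" "y \<in> K" for x y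
    using mod_homD(2)[OF w] that by (simp add: relation_module_simps K_def F0_def)
  have ws: "w (sact F F0 s x) = sact F N s (w x)" if "x \<in> K" for s x
    using mod_homD(3)[OF w] that by (simp add: relation_module_simps K_def F0_def sact_def)
  have fin: "finite I" and eY: "\<And>i. i \<in> I \<Longrightarrow> e i \<in> carrier Y" and sp: "carrier Y \<subseteq> Y.span I e"
    and kill: "\<And>i. i \<in> I \<Longrightarrow> sact F Y (g (l i)) (e i) = \<zero>\<^bsub>Y\<^esub>"
    and ind: "\<And>c i. Y.lc I c e = \<zero>\<^bsub>Y\<^esub> \<Longrightarrow> i \<in> I \<Longrightarrow> g (l i) dvd c i"
    using basis by (auto simp: Y.cyclic_basis_def g_def)
  have DF: "D i \<in> carrier F0" and evD: "ev (D i) = e i" if "i \<in> I" for i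
    using eval_free_hom(4,5)[OF Y eY[OF that]] by (simp_all add: D_def F0_def ev_def)
  have eI: "e \<in> I \<rightarrow> carrier Y" and DI: "D \<in> I \<rightarrow> carrier F0" using eY DF by auto
  have evlc: "ev (X.lc I c D) = Y.lc I c e" for c
    using smodule_hom_lc[where c = c, OF X.smodule_axioms Y.smodule_axioms X.sub_carrier eva evs evc fin DF]
      Y.lc_cong[of I c "\<lambda>i. ev (D i)" c e] eY evD by simp
  define x where "x i = sact F F0 (g (l i)) (D i)" for i
  have xK: "x i \<in> K" if "i \<in> I" for i
    using that DF evs kill by (simp add: Kiff x_def evD)
  have "\<exists>u\<in>carrier N. w (x i) = sact F N (g (l i)) u" if i: "i \<in> I" for i
  proof -
    have li: "l i \<in> {1..n}" using l i by blast
    have "seg f (l i) n * g (l i) = F"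
      using seg_mult[of 0 "l i" n f] li by (simp add: g_def F_def mult.commute)
    then have "sact F F0 (seg f (l i) n) (x i) = \<zero>\<^bsub>F0\<^esub>"
      using DF[OF i] sact_modulus[OF F0m DF[OF i]] by (simp add: x_def X.act_act)
    then have "sact F N (seg f (l i) n) (w (x i)) = w \<zero>\<^bsub>F0\<^esub>" using ws[OF xK[OF i]] by metis
    also have "w \<zero>\<^bsub>F0\<^esub> = \<zero>\<^bsub>N\<^esub>" using ws[OF KD(2), of 0] wc[OF KD(2)] by simp
    finally show ?thesis using kc wc[OF xK[OF i]] li unfolding N.kernel_condition_def g_def by blast
  qed
  then obtain u where u: "\<And>i. i \<in> I \<Longrightarrow> u i \<in> carrier N" "\<And>i. i \<in> I \<Longrightarrow> w (x i) = sact F N (g (l i)) (u i)"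
    by metis
  have uI: "u \<in> I \<rightarrow> carrier N" using u by auto
  \<comment> \<open>The value of the extension at \<open>\<phi>\<close>, computed from an expansion \<open>A\<close> of the image of \<open>\<phi>\<close> in \<open>Y\<close>.\<close>
  define S where "S \<phi> A = w (\<phi> \<ominus>\<^bsub>F0\<^esub> X.lc I A D) \<oplus>\<^bsub>N\<^esub> N.lc I A u" for \<phi> A
  have SK: "\<phi> \<ominus>\<^bsub>F0\<^esub> X.lc I A D \<in> K" if \<phi>: "\<phi> \<in> carrier F0" and A: "ev \<phi> = Y.lc I A e" for \<phi> A
  proof -
    have lcD: "X.lc I A D \<in> carrier F0" using DI by blast
    have m: "\<ominus>\<^bsub>F0\<^esub> X.lc I A D = sact F F0 (- 1) (X.lc I A D)" using lcD by (rule X.act_minus_one)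
    have "ev (\<phi> \<ominus>\<^bsub>F0\<^esub> X.lc I A D) = ev \<phi> \<oplus>\<^bsub>Y\<^esub> sact F Y (- 1) (Y.lc I A e)"
      unfolding a_minus_def m using eva evs evlc \<phi> lcD X.act_closed by simp
    also have "\<dots> = \<zero>\<^bsub>Y\<^esub>" using evc[OF \<phi>] by (simp add: A[symmetric] Y.act_minus_left Y.r_neg)
    finally show ?thesis using \<phi> lcD by (simp add: Kiff)
  qed
  have uniq: "S \<phi> A = S \<phi> A'" if \<phi>: "\<phi> \<in> carrier F0" and A: "ev \<phi> = Y.lc I A e" "ev \<phi> = Y.lc I A' e" for \<phi> A A'
  proof -
    have "Y.lc I (\<lambda>i. A i - A' i) e = \<zero>\<^bsub>Y\<^esub>"
      using evc[OF \<phi>] by (simp add: Y.lc_diff[OF fin eI] A(1)[symmetric] A(2)[symmetric] a_minus_def Y.r_neg)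
    from ind[OF this] have "\<forall>i\<in>I. \<exists>b. A i - A' i = g (l i) * b" by (auto simp: dvd_def)
    from bchoice[OF this] obtain b where b: "\<And>i. i \<in> I \<Longrightarrow> A i - A' i = g (l i) * b i" by blast
    have lcs: "X.lc I A D \<in> carrier F0" "X.lc I A' D \<in> carrier F0" "N.lc I A' u \<in> carrier N"
      "N.lc I A u \<in> carrier N" using DI uI by auto
    have d: "X.lc I A D \<ominus>\<^bsub>F0\<^esub> X.lc I A' D = X.lc I b x"
      unfolding X.lc_diff[OF fin DI, symmetric]
      using DF by (intro X.lc_cong) (auto simp: x_def b X.act_act mult.commute)
    have d': "N.lc I b (\<lambda>i. w (x i)) = N.lc I A u \<ominus>\<^bsub>N\<^esub> N.lc I A' u"
      unfolding N.lc_diff[OF fin uI, symmetric]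
      using u by (intro N.lc_cong) (auto simp: b N.act_act mult.commute)
    have xb: "X.lc I b x \<in> K" using fin xK by (intro X.lc_in_sub[OF K])
    have "\<phi> \<ominus>\<^bsub>F0\<^esub> X.lc I A' D = (\<phi> \<ominus>\<^bsub>F0\<^esub> X.lc I A D) \<oplus>\<^bsub>F0\<^esub> (X.lc I A D \<ominus>\<^bsub>F0\<^esub> X.lc I A' D)"
      using \<phi> lcs by (simp add: a_minus_def X.a_assoc X.r_neg1)
    then have "w (\<phi> \<ominus>\<^bsub>F0\<^esub> X.lc I A' D) = w (\<phi> \<ominus>\<^bsub>F0\<^esub> X.lc I A D) \<oplus>\<^bsub>N\<^esub> w (X.lc I b x)"
      unfolding d using wa[OF SK[OF \<phi> A(1)] xb] by simp
    also have "w (X.lc I b x) = N.lc I A u \<ominus>\<^bsub>N\<^esub> N.lc I A' u"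
      using smodule_hom_lc[where c = b, OF X.smodule_axioms N.smodule_axioms K wa ws wc fin xK] d' by simp
    finally have "S \<phi> A' = w (\<phi> \<ominus>\<^bsub>F0\<^esub> X.lc I A D) \<oplus>\<^bsub>N\<^esub> (N.lc I A u \<ominus>\<^bsub>N\<^esub> N.lc I A' u) \<oplus>\<^bsub>N\<^esub> N.lc I A' u"
      by (simp add: S_def)
    then show ?thesis using lcs wc[OF SK[OF \<phi> A(1)]]
      by (simp add: S_def a_minus_def N.a_assoc N.l_neg)
  qed
  have "\<exists>A. ev \<phi> = Y.lc I A e" if "\<phi> \<in> carrier F0" for \<phi>
    using sp evc[OF that] by (auto simp: Y.span_def)
  then obtain A where A: "\<And>\<phi>. \<phi> \<in> carrier F0 \<Longrightarrow> ev \<phi> = Y.lc I (A \<phi>) e" by metis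
  define T where "T \<phi> = S \<phi> (A \<phi>)" for \<phi>
  have T: "T \<phi> = S \<phi> A'" if "\<phi> \<in> carrier F0" "ev \<phi> = Y.lc I A' e" for \<phi> A'
    unfolding T_def using that A by (intro uniq) auto
  have lcs: "X.lc I c D \<in> carrier F0" "N.lc I c u \<in> carrier N" for c using DI uI by auto
  have "restrict T (carrier F0) \<in> mod_hom (kxy_quot F) F0 N"
  proof (rule mod_homI_sact[OF F0m])
    fix \<phi> assume \<phi>: "\<phi> \<in> carrier F0"
    note \<phi>K = SK[OF \<phi> A[OF \<phi>]]
    show "T \<phi> \<in> carrier N" using wc[OF \<phi>K] lcs by (simp add: T_def S_def)
    fix s
    have "ev (sact F F0 s \<phi>) = Y.lc I (\<lambda>i. s * A \<phi> i) e"
      using \<phi> A[OF \<phi>] by (simp add: evs Y.act_lc[OF fin eI])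
    then have "T (sact F F0 s \<phi>) = S (sact F F0 s \<phi>) (\<lambda>i. s * A \<phi> i)" using \<phi> by (intro T) auto
    also have "\<dots> = w (sact F F0 s (\<phi> \<ominus>\<^bsub>F0\<^esub> X.lc I (A \<phi>) D)) \<oplus>\<^bsub>N\<^esub> sact F N s (N.lc I (A \<phi>) u)"
      using \<phi> lcs by (simp add: S_def X.act_diff_right X.act_lc[OF fin DI] N.act_lc[OF fin uI])
    also have "\<dots> = sact F N s (T \<phi>)"
      using ws[OF \<phi>K] wc[OF \<phi>K] lcs by (simp add: T_def S_def N.act_add_right)
    finally show "T (sact F F0 s \<phi>) = sact F N s (T \<phi>)" .
    fix \<psi> assume \<psi>: "\<psi> \<in> carrier F0"
    note \<psi>K = SK[OF \<psi> A[OF \<psi>]]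
    have "ev (\<phi> \<oplus>\<^bsub>F0\<^esub> \<psi>) = Y.lc I (\<lambda>i. A \<phi> i + A \<psi> i) e"
      using \<phi> \<psi> A[OF \<phi>] A[OF \<psi>] by (simp add: eva Y.lc_add[OF fin eI])
    then have "T (\<phi> \<oplus>\<^bsub>F0\<^esub> \<psi>) = S (\<phi> \<oplus>\<^bsub>F0\<^esub> \<psi>) (\<lambda>i. A \<phi> i + A \<psi> i)" using \<phi> \<psi> by (intro T) auto
    also have "\<dots> = w (\<phi> \<oplus>\<^bsub>F0\<^esub> \<psi> \<ominus>\<^bsub>F0\<^esub> (X.lc I (A \<phi>) D \<oplus>\<^bsub>F0\<^esub> X.lc I (A \<psi>) D))
        \<oplus>\<^bsub>N\<^esub> (N.lc I (A \<phi>) u \<oplus>\<^bsub>N\<^esub> N.lc I (A \<psi>) u)"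
      by (simp add: S_def X.lc_add[OF fin DI] N.lc_add[OF fin uI])
    also have "\<phi> \<oplus>\<^bsub>F0\<^esub> \<psi> \<ominus>\<^bsub>F0\<^esub> (X.lc I (A \<phi>) D \<oplus>\<^bsub>F0\<^esub> X.lc I (A \<psi>) D)
        = (\<phi> \<ominus>\<^bsub>F0\<^esub> X.lc I (A \<phi>) D) \<oplus>\<^bsub>F0\<^esub> (\<psi> \<ominus>\<^bsub>F0\<^esub> X.lc I (A \<psi>) D)"
      using \<phi> \<psi> lcs by (simp add: a_minus_def X.minus_add X.a_ac)
    also have "w \<dots> \<oplus>\<^bsub>N\<^esub> (N.lc I (A \<phi>) u \<oplus>\<^bsub>N\<^esub> N.lc I (A \<psi>) u) = T \<phi> \<oplus>\<^bsub>N\<^esub> T \<psi>"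
      using wa[OF \<phi>K \<psi>K] wc[OF \<phi>K] wc[OF \<psi>K] lcs by (simp add: T_def S_def N.a_ac)
    finally show "T (\<phi> \<oplus>\<^bsub>F0\<^esub> \<psi>) = T \<phi> \<oplus>\<^bsub>N\<^esub> T \<psi>" .
  qed
  moreover have "restrict T (carrier F0) \<phi> = w \<phi>" if \<phi>: "\<phi> \<in> K" for \<phi>
  proof -
    have z: "X.lc I (\<lambda>_. 0) D = \<zero>\<^bsub>F0\<^esub>" "Y.lc I (\<lambda>_. 0) e = \<zero>\<^bsub>Y\<^esub>" "N.lc I (\<lambda>_. 0) u = \<zero>\<^bsub>N\<^esub>"
      using DF eY u by (auto intro!: X.lc_zero Y.lc_zero N.lc_zero)
    have "T \<phi> = S \<phi> (\<lambda>_. 0)" using \<phi> z by (intro T) (auto simp: Kiff)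
    moreover have "\<phi> \<ominus>\<^bsub>F0\<^esub> \<zero>\<^bsub>F0\<^esub> = \<phi>"
      using KD(1)[OF \<phi>] X.act_minus_one[OF X.zero_closed] by (simp add: a_minus_def)
    ultimately show ?thesis using \<phi> wc[OF \<phi>] KD(1)[OF \<phi>] by (simp add: S_def z)
  qed
  ultimately show "\<exists>g\<in>mod_hom (kxy_quot F) (free_module (kxy_quot F) (carrier Y)) N.
      \<forall>\<phi>\<in>relations (kxy_quot F) Y. g \<phi> = w \<phi>"
    unfolding F0_def K_def by blast
qed

text \<open>A linear form with values modulo \<open>g\<close> becomes, after composition with the projection from a free
  module, a form with values modulo the multiple \<open>F\<close> of \<open>g\<close>: the values at the basis vectors can be lifted.\<close>

lemma free_lift_form:
  fixes F g :: "'k::field fps fps"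
  assumes Y: "Module.module (kxy_quot F) Y" and g: "g dvd F"
    and lin: "smodule.lin Y (sact F Y) g (carrier Y) \<phi>0"
  defines "F0 \<equiv> free_module (kxy_quot F) (carrier Y)"
  shows "\<exists>\<mu>. smodule.lin F0 (sact F F0) F (carrier F0) \<mu> \<and>
    (\<forall>y\<in>carrier Y. F dvd \<mu> (delta (kxy_quot F) (carrier Y) y) - \<phi>0 y) \<and>
    (\<forall>\<phi>\<in>carrier F0. g dvd \<mu> \<phi> - \<phi>0 (eval_free (kxy_quot F) Y (carrier Y) \<phi>))"
proof -
  let ?R = "kxy_quot F"
  have R: "cring ?R" by (rule kxy_quot_cring)
  have F0m: "Module.module ?R F0" unfolding F0_def by (rule free_module_module[OF R])
  have Rm: "Module.module ?R (regular_module ?R)" by (rule regular_module_module[OF R])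
  have Sm: "Module.module ?R (kxy_quot_module g)" using g by (rule kxy_quot_module_module)
  interpret X: smodule F0 "sact F F0" by (rule smodule_sact[OF F0m])
  interpret Y: smodule Y "sact F Y" by (rule smodule_sact[OF Y])
  have lD: "g dvd \<phi>0 (u \<oplus>\<^bsub>Y\<^esub> v) - (\<phi>0 u + \<phi>0 v)" "g dvd \<phi>0 (sact F Y s v) - s * \<phi>0 v"
    if "u \<in> carrier Y" "v \<in> carrier Y" for u v s using lin that unfolding Y.lin_def by blast+
  define u where "u y = cls F (\<phi>0 y)" for y
  have uc: "u y \<in> carrier (regular_module ?R)" for y by (simp add: u_def)
  define L where "L = lift ?R (regular_module ?R) (carrier Y) u"
  have Lc: "L \<phi> \<in> carrier ?R" if "\<phi> \<in> carrier F0" for \<phi>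
    using lift_closed[where u = u, OF Rm uc] that unfolding L_def F0_def by (simp only: regular_module_simps)
  have La: "L (\<phi> \<oplus>\<^bsub>F0\<^esub> \<psi>) = L \<phi> \<oplus>\<^bsub>?R\<^esub> L \<psi>" if "\<phi> \<in> carrier F0" "\<psi> \<in> carrier F0" for \<phi> \<psi>
    using lift_add[where u = u, OF Rm uc] that unfolding L_def F0_def by (simp only: regular_module_simps)
  have Ls: "L (a \<odot>\<^bsub>F0\<^esub> \<phi>) = a \<otimes>\<^bsub>?R\<^esub> L \<phi>" if "a \<in> carrier ?R" "\<phi> \<in> carrier F0" for a \<phi>
    using lift_smult[where u = u, OF Rm uc] that unfolding L_def F0_def by (simp only: regular_module_simps)
  define \<mu> where "\<mu> \<phi> = rep (L \<phi>)" for \<phi>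
  have L\<mu>: "L \<phi> = cls F (\<mu> \<phi>)" if \<phi>: "\<phi> \<in> carrier F0" for \<phi>
  proof -
    obtain a where "L \<phi> = cls F a" using Lc[OF \<phi>] by (auto simp: kxy_quot_carrier)
    then show ?thesis by (simp add: \<mu>_def)
  qed
  have 1: "X.lin F (carrier F0) \<mu>"
    unfolding X.lin_def
  proof (intro conjI ballI allI)
    fix \<phi> \<psi> assume c: "\<phi> \<in> carrier F0" "\<psi> \<in> carrier F0"
    have "cls F (\<mu> (\<phi> \<oplus>\<^bsub>F0\<^esub> \<psi>)) = cls F (\<mu> \<phi> + \<mu> \<psi>)"
      using c by (simp add: La kxy_quot_simps flip: L\<mu>) (simp add: L\<mu> kxy_quot_simps)
    then show "F dvd \<mu> (\<phi> \<oplus>\<^bsub>F0\<^esub> \<psi>) - (\<mu> \<phi> + \<mu> \<psi>)" by (simp add: cls_eq_iff)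
  next
    fix s \<phi> assume c: "\<phi> \<in> carrier F0"
    have "cls F (\<mu> (sact F F0 s \<phi>)) = L (cls F s \<odot>\<^bsub>F0\<^esub> \<phi>)"
      using c L\<mu>[OF X.act_closed[OF c]] by (simp add: sact_def)
    also have "\<dots> = cls F (s * \<mu> \<phi>)" using c by (simp add: Ls L\<mu> kxy_quot_simps)
    finally show "F dvd \<mu> (sact F F0 s \<phi>) - s * \<mu> \<phi>" by (simp add: cls_eq_iff)
  qed
  have 2: "F dvd \<mu> (delta ?R (carrier Y) y) - \<phi>0 y" if y: "y \<in> carrier Y" for y
  proof -
    have "L (delta ?R (carrier Y) y) = cls F (\<phi>0 y)"
      unfolding L_def using lift_delta[where u = u, OF Rm uc y] by (simp add: u_def)
    then show ?thesis unfolding \<mu>_def using rep_cls by metis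
  qed
  define q where "q = restrict (\<lambda>A. cls g (rep A)) (carrier (regular_module ?R))"
  have qc: "cls g (rep (cls F a)) = cls g a" for a
    using rep_cls[of F a] g dvd_trans unfolding cls_eq_iff by blast
  have q: "q \<in> mod_hom ?R (regular_module ?R) (kxy_quot_module g)"
    unfolding q_def
  proof (rule mod_homI[OF _ _ _ Rm])
    fix A assume "A \<in> carrier (regular_module ?R)"
    then obtain a where a: "A = cls F a" by (auto simp: kxy_quot_carrier)
    show "cls g (rep A) \<in> carrier (kxy_quot_module g)" by (simp add: kxy_quot_module_simps)
    fix B assume "B \<in> carrier (regular_module ?R)"
    then obtain b where b: "B = cls F b" by (auto simp: kxy_quot_carrier)
    show "cls g (rep (A \<oplus>\<^bsub>regular_module ?R\<^esub> B)) = cls g (rep A) \<oplus>\<^bsub>kxy_quot_module g\<^esub> cls g (rep B)"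
      by (simp add: a b kxy_quot_simps qc kxy_quot_module_simps)
  next
    fix A B assume "A \<in> carrier ?R" "B \<in> carrier (regular_module ?R)"
    then obtain a b where a: "A = cls F a" "B = cls F b" by (auto simp: kxy_quot_carrier)
    show "cls g (rep (A \<odot>\<^bsub>regular_module ?R\<^esub> B)) = A \<odot>\<^bsub>kxy_quot_module g\<^esub> cls g (rep B)"
      by (simp add: a kxy_quot_simps qc kxy_quot_module_simps(4)[OF g])
  qed
  define \<Phi> where "\<Phi> = restrict (\<lambda>y. cls g (\<phi>0 y)) (carrier Y)"
  have \<Phi>: "\<Phi> \<in> mod_hom ?R Y (kxy_quot_module g)"
    unfolding \<Phi>_def
  proof (rule mod_homI_sact[OF Y])
    fix y assume y: "y \<in> carrier Y"
    show "cls g (\<phi>0 y) \<in> carrier (kxy_quot_module g)" by (simp add: kxy_quot_module_simps)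
    show "cls g (\<phi>0 (sact F Y s y)) = sact F (kxy_quot_module g) s (cls g (\<phi>0 y))" for s
      using lD(2)[OF y y] by (simp add: sact_def[of F "kxy_quot_module g"] kxy_quot_module_simps(4)[OF g] cls_eq_iff)
    fix v assume v: "v \<in> carrier Y"
    show "cls g (\<phi>0 (y \<oplus>\<^bsub>Y\<^esub> v)) = cls g (\<phi>0 y) \<oplus>\<^bsub>kxy_quot_module g\<^esub> cls g (\<phi>0 v)"
      using lD(1)[OF y v] by (simp add: kxy_quot_module_simps cls_eq_iff)
  qed
  have 3: "g dvd \<mu> \<phi> - \<phi>0 (eval_free ?R Y (carrier Y) \<phi>)" if \<phi>: "\<phi> \<in> carrier F0" for \<phi>
  proof -
    have "cls g (\<mu> \<phi>) = q (L \<phi>)" using Lc[OF \<phi>] by (simp add: q_def \<mu>_def)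
    also have "\<dots> = lift ?R (kxy_quot_module g) (carrier Y) (\<lambda>y. q (u y)) \<phi>"
      unfolding L_def using \<phi> uc unfolding F0_def by (intro hom_lift[OF Rm _ Sm q])
    also have "\<dots> = lift ?R (kxy_quot_module g) (carrier Y) (\<lambda>y. \<Phi> y) \<phi>"
    proof -
      have "q (u y) = \<Phi> y" if "y \<in> carrier Y" for y
        using that by (simp add: q_def u_def \<Phi>_def qc)
      moreover have "\<Phi> y \<in> carrier (kxy_quot_module g)" if "y \<in> carrier Y" for y
        using mod_homD(1)[OF \<Phi> that] .
      ultimately show ?thesis unfolding lift_def
        using \<phi> Module.module.smult_closed[OF Sm]
        by (intro abelian_monoid.finsum_cong'[OF abelian_group.axioms(1)[OF module_abelian_group[OF Sm]]])
          (auto simp: F0_def free_module_simps PiE_iff)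
    qed
    also have "\<dots> = \<Phi> (eval_free ?R Y (carrier Y) \<phi>)"
      unfolding eval_free_eq_lift using \<phi> unfolding F0_def
      by (intro hom_lift[symmetric, OF Y _ Sm \<Phi>])
    also have "\<dots> = cls g (\<phi>0 (eval_free ?R Y (carrier Y) \<phi>))"
      using eval_free_hom(1)[OF Y] \<phi> by (simp add: \<Phi>_def F0_def)
    finally show ?thesis by (simp add: cls_eq_iff)
  qed
  show ?thesis using 1 2 3 by blast
qed

definition chain_sum :: "(nat \<Rightarrow> 'k::field fps fps) \<Rightarrow> nat \<Rightarrow> ('k fps fps set, nat \<Rightarrow> 'k fps fps set) module" where
  "chain_sum f n = direct_sum {1..n} (\<lambda>i. kxy_quot_module (seg f 0 i))"

lemma seg_dvd_seg: "i \<le> n \<Longrightarrow> seg f 0 i dvd (seg f 0 n :: 'a::comm_ring_1)"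
  using seg_mult[of 0 i n f] by (metis dvd_triv_left le0)

lemma chain_sum_module: "Module.module (kxy_quot (seg f 0 n)) (chain_sum f n)"
  unfolding chain_sum_def
  by (intro direct_sum_module kxy_quot_cring kxy_quot_module_module seg_dvd_seg) simp

lemma chain_sum_carrier: "carrier (chain_sum f n) = (\<Pi>\<^sub>E i\<in>{1..n}. range (cls (seg f 0 i)))"
  unfolding chain_sum_def by (subst direct_sum_carrier_finite) (auto simp: kxy_quot_module_simps(1))

lemma chain_sum_simps:
  "\<zero>\<^bsub>chain_sum f n\<^esub> = (\<lambda>i\<in>{1..n}. cls (seg f 0 i) 0)"
  "v \<oplus>\<^bsub>chain_sum f n\<^esub> w = (\<lambda>i\<in>{1..n}. v i \<oplus>\<^bsub>kxy_quot_module (seg f 0 i)\<^esub> w i)"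
  "sact F (chain_sum f n) s v = (\<lambda>i\<in>{1..n}. cls F s \<odot>\<^bsub>kxy_quot_module (seg f 0 i)\<^esub> v i)"
  by (simp_all add: chain_sum_def direct_sum_simps sact_def kxy_quot_module_simps(2) cong: restrict_cong)

lemma chain_sum_component:
  assumes "v \<in> carrier (chain_sum f n)" "i \<in> {1..n}"
  shows "v i = cls (seg f 0 i) (rep (v i))"
proof -
  obtain a where "v i = cls (seg f 0 i) a" using assms by (fastforce simp: chain_sum_carrier PiE_iff)
  then show ?thesis by simp
qed

lemma chain_sum_lin_component:
  assumes i: "i \<in> {1..n}"
  shows "smodule.lin (chain_sum f n) (sact (seg f 0 n) (chain_sum f n)) (seg f 0 i)
    (carrier (chain_sum f n)) (\<lambda>m. rep (m i))"
proof -
  interpret M: smodule "chain_sum f n" "sact (seg f 0 n) (chain_sum f n)"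
    by (rule smodule_sact[OF chain_sum_module])
  have d: "seg f 0 i dvd seg f 0 n" using i by (simp add: seg_dvd_seg)
  show ?thesis
    unfolding M.lin_def
  proof (intro conjI ballI allI)
    fix u v assume uv: "u \<in> carrier (chain_sum f n)" "v \<in> carrier (chain_sum f n)"
    have "(u \<oplus>\<^bsub>chain_sum f n\<^esub> v) i = cls (seg f 0 i) (rep (u i) + rep (v i))"
      using i chain_sum_component[OF uv(1) i] chain_sum_component[OF uv(2) i]
      by (simp add: chain_sum_simps(2)) (metis kxy_quot_module_simps(3))
    then show "seg f 0 i dvd rep ((u \<oplus>\<^bsub>chain_sum f n\<^esub> v) i) - (rep (u i) + rep (v i))"
      by (simp add: rep_cls)
  next
    fix s v assume v: "v \<in> carrier (chain_sum f n)"
    have "(sact (seg f 0 n) (chain_sum f n) s v) i = cls (seg f 0 i) (s * rep (v i))"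
      using i chain_sum_component[OF v i]
      by (simp add: chain_sum_simps(3)) (metis kxy_quot_module_simps(4)[OF d])
    then show "seg f 0 i dvd rep ((sact (seg f 0 n) (chain_sum f n) s v) i) - s * rep (v i)"
      by (simp add: rep_cls)
  qed
qed

definition chain_unit :: "(nat \<Rightarrow> 'k::field fps fps) \<Rightarrow> nat \<Rightarrow> nat \<Rightarrow> nat \<Rightarrow> 'k fps fps set" where
  "chain_unit f n i = (\<lambda>j\<in>{1..n}. cls (seg f 0 j) (if j = i then 1 else 0))"

lemma chain_unit_closed: "chain_unit f n i \<in> carrier (chain_sum f n)"
  by (simp add: chain_sum_carrier chain_unit_def)

lemma sact_chain_unit:
  "sact (seg f 0 n) (chain_sum f n) s (chain_unit f n i) = (\<lambda>j\<in>{1..n}. cls (seg f 0 j) (if j = i then s else 0))"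
proof -
  have "cls (seg f 0 n) s \<odot>\<^bsub>kxy_quot_module (seg f 0 j)\<^esub> cls (seg f 0 j) a = cls (seg f 0 j) (s * a)"
    if "j \<in> {1..n}" for j a using that by (intro kxy_quot_module_simps(4) seg_dvd_seg) simp
  then show ?thesis by (auto simp: chain_sum_simps chain_unit_def fun_eq_iff)
qed

text \<open>Let \<open>F = g * h\<close> and let \<open>v\<close> be killed by \<open>h\<close>.  The projection to the summand \<open>S / (g)\<close> lifts to a form \<open>\<mu>\<close> on the
  free module, whose values on relations are multiples \<open>g * q\<close>.  The map sending a relation to \<open>q \<star> v\<close> is
  well defined since \<open>h\<close> kills \<open>v\<close>, and it is the one given by the periodic resolution.  An extension of it
  to the free module, evaluated at the generator of the summand, exhibits \<open>v\<close> as a multiple of \<open>g\<close>.\<close>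

theorem kernel_condition_of_Ext1_trivial:
  fixes f :: "nat \<Rightarrow> 'k::field fps fps" and n :: nat
  defines "F \<equiv> seg f 0 n"
  assumes F0: "F \<noteq> 0" and Y: "Module.module (kxy_quot F) Y"
    and ext: "trivial_group (Ext1 (kxy_quot F) (chain_sum f n) Y)"
  shows "smodule.kernel_condition Y (sact F Y) f n (carrier Y)"
proof -
  let ?R = "kxy_quot F" and ?M = "chain_sum f n"
  interpret Y: smodule Y "sact F Y" by (rule smodule_sact[OF Y])
  have M: "Module.module ?R ?M" unfolding F_def by (rule chain_sum_module)
  interpret M: smodule ?M "sact F ?M" by (rule smodule_sact[OF M])
  define F0 where "F0 = free_module ?R (carrier ?M)"
  have F0m: "Module.module ?R F0" unfolding F0_def by (rule free_module_module[OF kxy_quot_cring])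
  interpret G: smodule F0 "sact F F0" by (rule smodule_sact[OF F0m])
  define ev where "ev = eval_free ?R ?M (carrier ?M)"
  define K where "K = relations ?R ?M"
  have Kiff: "\<phi> \<in> K \<longleftrightarrow> \<phi> \<in> carrier F0 \<and> ev \<phi> = \<zero>\<^bsub>?M\<^esub>" for \<phi>
    by (auto simp: K_def relations_def F0_def ev_def)
  have K: "G.sub K" unfolding K_def F0_def by (rule sub_relations[OF M])
  note KD = G.subD[OF K]
  show ?thesis
    unfolding Y.kernel_condition_def
  proof (intro ballI impI)
    fix i v assume i: "i \<in> {1..n}" and v: "v \<in> carrier Y" and hv: "sact F Y (seg f i n) v = \<zero>\<^bsub>Y\<^esub>"
    define g where "g = seg f 0 i"
    define h where "h = seg f i n"
    have gh: "F = g * h" unfolding F_def g_def h_def using i by (simp add: seg_mult)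
    have g0: "g \<noteq> 0" using F0 gh by auto
    have gF: "g dvd F" by (simp add: gh)
    have hv': "sact F Y (h * c) v = \<zero>\<^bsub>Y\<^esub>" for c
      using Y.act_dvd_zero[of h "h * c" v] hv v by (simp add: h_def)
    have lin: "M.lin g (carrier ?M) (\<lambda>m. rep (m i))"
      unfolding F_def g_def by (rule chain_sum_lin_component[OF i])
    obtain \<mu> where \<mu>: "G.lin F (carrier F0) \<mu>"
      "\<And>y. y \<in> carrier ?M \<Longrightarrow> F dvd \<mu> (delta ?R (carrier ?M) y) - rep (y i)"
      "\<And>\<phi>. \<phi> \<in> carrier F0 \<Longrightarrow> g dvd \<mu> \<phi> - rep (ev \<phi> i)"
      using free_lift_form[OF M gF lin] unfolding F0_def ev_def by blast
    have "\<exists>q. \<mu> \<phi> = g * q" if \<phi>: "\<phi> \<in> K" for \<phi>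
    proof -
      have "ev \<phi> i = cls g 0" using \<phi> i by (simp add: Kiff chain_sum_simps g_def)
      then have "g dvd rep (ev \<phi> i)" using rep_cls[of g 0] by simp
      moreover have "g dvd \<mu> \<phi> - rep (ev \<phi> i)" using \<mu>(3) \<phi> Kiff by blast
      ultimately have "g dvd (\<mu> \<phi> - rep (ev \<phi> i)) + rep (ev \<phi> i)" by (intro dvd_add)
      then show ?thesis by (simp add: dvd_def)
    qed
    then obtain q where q: "\<And>\<phi>. \<phi> \<in> K \<Longrightarrow> \<mu> \<phi> = g * q \<phi>" by metis
    have qdiff: "sact F Y a v = sact F Y b v" if ab: "F dvd g * (a - b)" for a b
    proof -
      obtain c where "g * (a - b) = F * c" using ab by (auto simp: dvd_def)
      then have "g * (a - b) = g * (h * c)" by (simp add: gh mult.assoc)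
      then have "a - b = h * c" using g0 by simp
      then have "a = b + h * c" by (simp add: algebra_simps)
      then show ?thesis using hv' v by (simp add: Y.act_add_left)
    qed
    define w where "w = restrict (\<lambda>\<phi>. sact F Y (q \<phi>) v) (carrier (relation_module ?R ?M))"
    have w: "w \<in> mod_hom ?R (relation_module ?R ?M) Y"
      unfolding w_def
    proof (rule mod_homI_sact[OF relation_module_module[OF M]])
      fix \<phi> assume "\<phi> \<in> carrier (relation_module ?R ?M)"
      then have \<phi>: "\<phi> \<in> K" by (simp add: relation_module_simps K_def)
      show "sact F Y (q \<phi>) v \<in> carrier Y" using v by simp
      have "F dvd g * (q (sact F F0 s \<phi>) - s * q \<phi>)" for s
      proof -
        have "F dvd \<mu> (sact F F0 s \<phi>) - s * \<mu> \<phi>" using \<mu>(1) KD(1)[OF \<phi>] unfolding G.lin_def by blast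
        then show ?thesis using q[OF \<phi>] q[OF KD(4)[OF \<phi>]] by (simp add: algebra_simps)
      qed
      from qdiff[OF this]
      show "sact F Y (q (sact F (relation_module ?R ?M) s \<phi>)) v = sact F Y s (sact F Y (q \<phi>) v)" for s
        using v by (simp add: Y.act_act relation_module_simps F0_def sact_def[of F "relation_module ?R ?M"]
            sact_def[of F "free_module ?R (carrier ?M)"])
      fix \<psi> assume "\<psi> \<in> carrier (relation_module ?R ?M)"
      then have \<psi>: "\<psi> \<in> K" by (simp add: relation_module_simps K_def)
      have "F dvd \<mu> (\<phi> \<oplus>\<^bsub>F0\<^esub> \<psi>) - (\<mu> \<phi> + \<mu> \<psi>)"
        using \<mu>(1) KD(1)[OF \<phi>] KD(1)[OF \<psi>] unfolding G.lin_def by blast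
      then have "F dvd g * (q (\<phi> \<oplus>\<^bsub>F0\<^esub> \<psi>) - (q \<phi> + q \<psi>))"
        using q[OF \<phi>] q[OF \<psi>] q[OF KD(3)[OF \<phi> \<psi>]] by (simp add: algebra_simps)
      from qdiff[OF this]
      show "sact F Y (q (\<phi> \<oplus>\<^bsub>relation_module ?R ?M\<^esub> \<psi>)) v = sact F Y (q \<phi>) v \<oplus>\<^bsub>Y\<^esub> sact F Y (q \<psi>) v"
        using v by (simp add: Y.act_add_left relation_module_simps F0_def)
    qed
    then obtain W where W: "W \<in> mod_hom ?R F0 Y" "\<forall>\<phi>\<in>K. W \<phi> = w \<phi>"
      using ext unfolding trivial_Ext1_iff[OF M Y] F0_def K_def by blast
    define \<epsilon> where "\<epsilon> = chain_unit f n i"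
    define \<delta> where "\<delta> = delta ?R (carrier ?M) \<epsilon>"
    have \<epsilon>: "\<epsilon> \<in> carrier ?M" unfolding \<epsilon>_def by (rule chain_unit_closed)
    have \<delta>: "\<delta> \<in> carrier F0" "ev \<delta> = \<epsilon>"
      using eval_free_hom(4,5)[OF M \<epsilon>] by (simp_all add: \<delta>_def F0_def ev_def)
    have g\<delta>: "sact F F0 g \<delta> \<in> K"
    proof -
      have "ev (sact F F0 g \<delta>) = sact F ?M g (ev \<delta>)"
        using eval_free_hom(3)[OF M cls_carrier] \<delta>(1) unfolding ev_def F0_def sact_def by blast
      also have "\<dots> = \<zero>\<^bsub>?M\<^esub>"
        unfolding \<delta>(2) unfolding \<epsilon>_def F_def sact_chain_unit chain_sum_simps(1)
        by (auto simp: fun_eq_iff g_def cls_eq_iff)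
      finally show ?thesis using \<delta>(1) by (simp add: Kiff)
    qed
    \<comment> \<open>The projection takes the value 1 at the generator.\<close>
    have "g dvd \<mu> \<delta> - 1"
    proof -
      have "F dvd \<mu> \<delta> - rep (\<epsilon> i)" unfolding \<delta>_def by (rule \<mu>(2)[OF \<epsilon>])
      then have "g dvd \<mu> \<delta> - rep (\<epsilon> i)" using gF dvd_trans by blast
      moreover have "g dvd rep (\<epsilon> i) - 1" using i rep_cls[of g 1] by (simp add: \<epsilon>_def chain_unit_def g_def)
      ultimately have "g dvd (\<mu> \<delta> - rep (\<epsilon> i)) + (rep (\<epsilon> i) - 1)" by (rule dvd_add)
      then show ?thesis by simp
    qed
    then obtain a where a: "\<mu> \<delta> = 1 + g * a" by (auto simp: dvd_def algebra_simps)
    have "F dvd \<mu> (sact F F0 g \<delta>) - g * \<mu> \<delta>" using \<mu>(1) \<delta>(1) unfolding G.lin_def by blast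
    then have "F dvd g * (q (sact F F0 g \<delta>) - \<mu> \<delta>)" using q[OF g\<delta>] by (simp add: algebra_simps)
    from qdiff[OF this] have "w (sact F F0 g \<delta>) = sact F Y (\<mu> \<delta>) v"
      using g\<delta> by (simp add: w_def relation_module_simps K_def)
    also have "\<dots> = v \<oplus>\<^bsub>Y\<^esub> sact F Y g (sact F Y a v)" using v by (simp add: a Y.act_add_left Y.act_act)
    finally have "sact F Y g (W \<delta>) = v \<oplus>\<^bsub>Y\<^esub> sact F Y g (sact F Y a v)"
      using W(2) g\<delta> mod_hom_sact[OF W(1) \<delta>(1), of g] by simp
    moreover have W\<delta>: "W \<delta> \<in> carrier Y" using mod_homD(1)[OF W(1) \<delta>(1)] .
    ultimately have "sact F Y g (W \<delta> \<ominus>\<^bsub>Y\<^esub> sact F Y a v) = v"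
      using v by (simp add: Y.act_diff_right) (simp add: a_minus_def Y.a_assoc Y.r_neg)
    moreover have "W \<delta> \<ominus>\<^bsub>Y\<^esub> sact F Y a v \<in> carrier Y" using W\<delta> v by simp
    ultimately show "\<exists>w\<in>carrier Y. v = sact F Y (seg f 0 i) w" unfolding g_def by metis
  qed
qed

text \<open>Let \<open>F = h * g\<close> and let \<open>\<phi>0\<close> be a form on \<open>Y\<close> modulo \<open>h\<close>.  It lifts to a form \<open>\<mu>\<close> modulo \<open>F\<close> on the free module,
  whose values on relations are \<open>h * q\<close>; the failure to descend to \<open>Y\<close> is the map \<open>q\<close> to the summand
  \<open>S / (g)\<close>.  If this map extends to the free module, subtracting \<open>h\<close> times the extension from \<open>\<mu>\<close> leaves a form that
  vanishes on the relations.\<close>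

theorem lifting_condition_of_Ext1_trivial:
  fixes f :: "nat \<Rightarrow> 'k::field fps fps" and n :: nat
  defines "F \<equiv> seg f 0 n"
  assumes F0: "F \<noteq> 0" and Y: "Module.module (kxy_quot F) Y"
    and ext: "trivial_group (Ext1 (kxy_quot F) Y (chain_sum f n))"
  shows "smodule.lifting_condition Y (sact F Y) f n (carrier Y)"
proof -
  let ?R = "kxy_quot F" and ?M = "chain_sum f n"
  interpret Y: smodule Y "sact F Y" by (rule smodule_sact[OF Y])
  have M: "Module.module ?R ?M" unfolding F_def by (rule chain_sum_module)
  interpret M: smodule ?M "sact F ?M" by (rule smodule_sact[OF M])
  define F0 where "F0 = free_module ?R (carrier Y)"
  have F0m: "Module.module ?R F0" unfolding F0_def by (rule free_module_module[OF kxy_quot_cring])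
  interpret G: smodule F0 "sact F F0" by (rule smodule_sact[OF F0m])
  define ev where "ev = eval_free ?R Y (carrier Y)"
  define K where "K = relations ?R Y"
  have Kiff: "\<phi> \<in> K \<longleftrightarrow> \<phi> \<in> carrier F0 \<and> ev \<phi> = \<zero>\<^bsub>Y\<^esub>" for \<phi>
    by (auto simp: K_def relations_def F0_def ev_def)
  have eva: "ev (\<phi> \<oplus>\<^bsub>F0\<^esub> \<psi>) = ev \<phi> \<oplus>\<^bsub>Y\<^esub> ev \<psi>" if "\<phi> \<in> carrier F0" "\<psi> \<in> carrier F0" for \<phi> \<psi>
    using eval_free_hom(2)[OF Y] that unfolding ev_def F0_def by blast
  have evs: "ev (sact F F0 s \<phi>) = sact F Y s (ev \<phi>)" if "\<phi> \<in> carrier F0" for s \<phi>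
    using eval_free_hom(3)[OF Y cls_carrier] that unfolding ev_def F0_def sact_def by blast
  have evc: "ev \<phi> \<in> carrier Y" if "\<phi> \<in> carrier F0" for \<phi>
    using eval_free_hom(1)[OF Y] that unfolding ev_def F0_def by blast
  have K: "G.sub K" unfolding K_def F0_def by (rule sub_relations[OF Y])
  note KD = G.subD[OF K]
  define \<delta> where "\<delta> y = delta ?R (carrier Y) y" for y
  have \<delta>: "\<delta> y \<in> carrier F0" "ev (\<delta> y) = y" if "y \<in> carrier Y" for y
    using eval_free_hom(4,5)[OF Y that] by (simp_all add: \<delta>_def F0_def ev_def)
  show ?thesis
    unfolding Y.lifting_condition_def
  proof (intro ballI allI impI)
    fix i \<phi>0 assume i: "i \<in> {1..n}" and lin: "Y.lin (seg f i n) (carrier Y) \<phi>0"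
    define g where "g = seg f 0 i"
    define h where "h = seg f i n"
    have gh: "F = h * g" unfolding F_def g_def h_def using i seg_mult[of 0 i n f] by (simp add: mult.commute)
    have h0: "h \<noteq> 0" using F0 gh by auto
    have hF: "h dvd F" by (simp add: gh)
    have lin: "Y.lin h (carrier Y) \<phi>0" using lin by (simp add: h_def)
    have \<phi>0z: "h dvd \<phi>0 \<zero>\<^bsub>Y\<^esub>"
    proof -
      have "h dvd \<phi>0 (sact F Y 0 \<zero>\<^bsub>Y\<^esub>) - 0 * \<phi>0 \<zero>\<^bsub>Y\<^esub>"
        using lin Y.zero_closed unfolding Y.lin_def by blast
      then show ?thesis by simp
    qed
    obtain \<mu> where \<mu>: "G.lin F (carrier F0) \<mu>"
      "\<And>y. y \<in> carrier Y \<Longrightarrow> F dvd \<mu> (\<delta> y) - \<phi>0 y"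
      "\<And>\<phi>. \<phi> \<in> carrier F0 \<Longrightarrow> h dvd \<mu> \<phi> - \<phi>0 (ev \<phi>)"
      using free_lift_form[OF Y hF lin] unfolding F0_def ev_def \<delta>_def by blast
    have "\<exists>q. \<mu> \<phi> = h * q" if \<phi>: "\<phi> \<in> K" for \<phi>
    proof -
      have "h dvd (\<mu> \<phi> - \<phi>0 (ev \<phi>)) + \<phi>0 (ev \<phi>)"
      proof (rule dvd_add)
        show "h dvd \<mu> \<phi> - \<phi>0 (ev \<phi>)" using \<phi> unfolding Kiff by (intro \<mu>(3)) blast
        show "h dvd \<phi>0 (ev \<phi>)" using \<phi> \<phi>0z unfolding Kiff by simp
      qed
      then show ?thesis by (simp add: dvd_def)
    qed
    then obtain q where q: "\<And>\<phi>. \<phi> \<in> K \<Longrightarrow> \<mu> \<phi> = h * q \<phi>" by metis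
    have qdiff: "g dvd a" if "F dvd h * a" for a
    proof -
      have "h * g dvd h * a" using that by (simp add: gh)
      then show ?thesis using h0 by simp
    qed
    define \<iota> where "\<iota> a = sact F ?M a (chain_unit f n i)" for a
    have \<epsilon>: "chain_unit f n i \<in> carrier ?M" by (rule chain_unit_closed)
    have \<iota>c: "\<iota> a \<in> carrier ?M" for a unfolding \<iota>_def using \<epsilon> by simp
    have \<iota>: "\<iota> a = (\<lambda>j\<in>{1..n}. cls (seg f 0 j) (if j = i then a else 0))" for a
      unfolding \<iota>_def F_def by (rule sact_chain_unit)
    have \<iota>eq: "\<iota> a = \<iota> b" if "g dvd a - b" for a b
      using that by (auto simp: \<iota> fun_eq_iff cls_eq_iff g_def)
    have \<iota>i: "\<iota> a i = cls g a" for a using i by (simp add: \<iota> g_def)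
    define w where "w = restrict (\<lambda>\<phi>. \<iota> (q \<phi>)) (carrier (relation_module ?R Y))"
    have w: "w \<in> mod_hom ?R (relation_module ?R Y) ?M"
      unfolding w_def
    proof (rule mod_homI_sact[OF relation_module_module[OF Y]])
      fix \<phi> assume "\<phi> \<in> carrier (relation_module ?R Y)"
      then have \<phi>: "\<phi> \<in> K" by (simp add: relation_module_simps K_def)
      show "\<iota> (q \<phi>) \<in> carrier ?M" by (rule \<iota>c)
      have "F dvd h * (q (sact F F0 s \<phi>) - s * q \<phi>)" for s
      proof -
        have "F dvd \<mu> (sact F F0 s \<phi>) - s * \<mu> \<phi>" using \<mu>(1) KD(1)[OF \<phi>] unfolding G.lin_def by blast
        then show ?thesis using q[OF \<phi>] q[OF KD(4)[OF \<phi>]] by (simp add: algebra_simps)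
      qed
      from \<iota>eq[OF qdiff[OF this]]
      show "\<iota> (q (sact F (relation_module ?R Y) s \<phi>)) = sact F ?M s (\<iota> (q \<phi>))" for s
        using \<epsilon> by (simp add: \<iota>_def M.act_act relation_module_simps F0_def sact_def[of F "relation_module ?R Y"]
            sact_def[of F "free_module ?R (carrier Y)"])
      fix \<psi> assume "\<psi> \<in> carrier (relation_module ?R Y)"
      then have \<psi>: "\<psi> \<in> K" by (simp add: relation_module_simps K_def)
      have "F dvd \<mu> (\<phi> \<oplus>\<^bsub>F0\<^esub> \<psi>) - (\<mu> \<phi> + \<mu> \<psi>)"
        using \<mu>(1) KD(1)[OF \<phi>] KD(1)[OF \<psi>] unfolding G.lin_def by blast
      then have "F dvd h * (q (\<phi> \<oplus>\<^bsub>F0\<^esub> \<psi>) - (q \<phi> + q \<psi>))"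
        using q[OF \<phi>] q[OF \<psi>] q[OF KD(3)[OF \<phi> \<psi>]] by (simp add: algebra_simps)
      from \<iota>eq[OF qdiff[OF this]]
      show "\<iota> (q (\<phi> \<oplus>\<^bsub>relation_module ?R Y\<^esub> \<psi>)) = \<iota> (q \<phi>) \<oplus>\<^bsub>?M\<^esub> \<iota> (q \<psi>)"
        using \<epsilon> by (simp add: \<iota>_def M.act_add_left relation_module_simps F0_def)
    qed
    then obtain W where W: "W \<in> mod_hom ?R F0 ?M" "\<forall>\<phi>\<in>K. W \<phi> = w \<phi>"
      using ext unfolding trivial_Ext1_iff[OF Y M] F0_def K_def by blast
    \<comment> \<open>The component of \<open>W\<close> is determined modulo \<open>g\<close>, hence \<open>h\<close> times it modulo \<open>F\<close>.\<close>
    define \<psi>0 where "\<psi>0 \<phi> = \<mu> \<phi> - h * rep (W \<phi> i)" for \<phi>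
    have linM: "M.lin g (carrier ?M) (\<lambda>m. rep (m i))"
      unfolding F_def g_def by (rule chain_sum_lin_component[OF i])
    have add0: "F dvd \<psi>0 (\<phi> \<oplus>\<^bsub>F0\<^esub> \<psi>) - (\<psi>0 \<phi> + \<psi>0 \<psi>)" if c: "\<phi> \<in> carrier F0" "\<psi> \<in> carrier F0" for \<phi> \<psi>
    proof -
      have "g dvd rep ((W \<phi> \<oplus>\<^bsub>?M\<^esub> W \<psi>) i) - (rep (W \<phi> i) + rep (W \<psi> i))"
        using linM mod_homD(1)[OF W(1)] c unfolding M.lin_def by blast
      then have "F dvd h * (rep (W (\<phi> \<oplus>\<^bsub>F0\<^esub> \<psi>) i) - (rep (W \<phi> i) + rep (W \<psi> i)))"
        unfolding mod_homD(2)[OF W(1) c] gh by (rule mult_dvd_mono[OF dvd_refl])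
      moreover have "F dvd \<mu> (\<phi> \<oplus>\<^bsub>F0\<^esub> \<psi>) - (\<mu> \<phi> + \<mu> \<psi>)" using \<mu>(1) c unfolding G.lin_def by blast
      ultimately have "F dvd (\<mu> (\<phi> \<oplus>\<^bsub>F0\<^esub> \<psi>) - (\<mu> \<phi> + \<mu> \<psi>))
          - h * (rep (W (\<phi> \<oplus>\<^bsub>F0\<^esub> \<psi>) i) - (rep (W \<phi> i) + rep (W \<psi> i)))" by (rule dvd_diff[rotated])
      then show ?thesis by (simp add: \<psi>0_def algebra_simps)
    qed
    have act0: "F dvd \<psi>0 (sact F F0 s \<phi>) - s * \<psi>0 \<phi>" if c: "\<phi> \<in> carrier F0" for s \<phi>
    proof -
      have "g dvd rep ((sact F ?M s (W \<phi>)) i) - s * rep (W \<phi> i)"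
        using linM mod_homD(1)[OF W(1)] c unfolding M.lin_def by blast
      then have "F dvd h * (rep (W (sact F F0 s \<phi>) i) - s * rep (W \<phi> i))"
        unfolding mod_hom_sact[OF W(1) c, symmetric] by (subst gh) (rule mult_dvd_mono[OF dvd_refl])
      moreover have "F dvd \<mu> (sact F F0 s \<phi>) - s * \<mu> \<phi>" using \<mu>(1) c unfolding G.lin_def by blast
      ultimately have "F dvd (\<mu> (sact F F0 s \<phi>) - s * \<mu> \<phi>)
          - h * (rep (W (sact F F0 s \<phi>) i) - s * rep (W \<phi> i))" by (rule dvd_diff[rotated])
      then show ?thesis by (simp add: \<psi>0_def algebra_simps)
    qed
    have K0: "F dvd \<psi>0 \<phi>" if \<phi>: "\<phi> \<in> K" for \<phi>
    proof -
      have "W \<phi> i = cls g (q \<phi>)" using W(2) \<phi> by (simp add: w_def relation_module_simps K_def \<iota>i)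
      then have "g dvd rep (W \<phi> i) - q \<phi>" using rep_cls by metis
      then have "h * g dvd h * (rep (W \<phi> i) - q \<phi>)" by (rule mult_dvd_mono[OF dvd_refl])
      then have "F dvd - (h * (rep (W \<phi> i) - q \<phi>))" unfolding gh by (simp only: dvd_minus_iff)
      then show ?thesis using q[OF \<phi>] by (simp add: \<psi>0_def algebra_simps)
    qed
    have eq0: "F dvd \<psi>0 \<phi> - \<psi>0 \<psi>" if c: "\<phi> \<in> carrier F0" "\<psi> \<in> carrier F0" and e: "ev \<phi> = ev \<psi>" for \<phi> \<psi>
    proof -
      have m: "\<ominus>\<^bsub>F0\<^esub> \<psi> = sact F F0 (- 1) \<psi>" using c(2) by (rule G.act_minus_one)
      have "ev (\<phi> \<ominus>\<^bsub>F0\<^esub> \<psi>) = ev \<phi> \<oplus>\<^bsub>Y\<^esub> sact F Y (- 1) (ev \<psi>)"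
        unfolding a_minus_def m using eva evs c G.act_closed by simp
      also have "\<dots> = \<zero>\<^bsub>Y\<^esub>" using evc[OF c(2)] by (simp add: e Y.act_minus_left Y.r_neg)
      finally have k: "\<phi> \<ominus>\<^bsub>F0\<^esub> \<psi> \<in> K" using c by (simp add: Kiff)
      have "\<phi> = (\<phi> \<ominus>\<^bsub>F0\<^esub> \<psi>) \<oplus>\<^bsub>F0\<^esub> \<psi>" using c by (simp add: a_minus_def G.a_assoc G.l_neg)
      then have "F dvd \<psi>0 \<phi> - (\<psi>0 (\<phi> \<ominus>\<^bsub>F0\<^esub> \<psi>) + \<psi>0 \<psi>)" using add0[OF KD(1)[OF k] c(2)] by simp
      from dvd_add[OF this K0[OF k]] show ?thesis by simp
    qed
    define \<psi> where "\<psi> y = \<psi>0 (\<delta> y)" for y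
    have "Y.lin F (carrier Y) \<psi>"
      unfolding Y.lin_def
    proof (intro conjI ballI allI)
      fix u v assume uv: "u \<in> carrier Y" "v \<in> carrier Y"
      have "F dvd \<psi>0 (\<delta> (u \<oplus>\<^bsub>Y\<^esub> v)) - \<psi>0 (\<delta> u \<oplus>\<^bsub>F0\<^esub> \<delta> v)"
        using \<delta> uv eva by (intro eq0) auto
      from dvd_add[OF this add0[OF \<delta>(1)[OF uv(1)] \<delta>(1)[OF uv(2)]]]
      show "F dvd \<psi> (u \<oplus>\<^bsub>Y\<^esub> v) - (\<psi> u + \<psi> v)" by (simp add: \<psi>_def algebra_simps)
    next
      fix s v assume v: "v \<in> carrier Y"
      have "F dvd \<psi>0 (\<delta> (sact F Y s v)) - \<psi>0 (sact F F0 s (\<delta> v))"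
        using \<delta> v evs by (intro eq0) auto
      from dvd_add[OF this act0[OF \<delta>(1)[OF v], of s]]
      show "F dvd \<psi> (sact F Y s v) - s * \<psi> v" by (simp add: \<psi>_def algebra_simps)
    qed
    moreover have "h dvd \<phi>0 y - \<psi> y" if y: "y \<in> carrier Y" for y
    proof -
      have "h dvd \<mu> (\<delta> y) - \<phi>0 y" using \<mu>(2)[OF y] hF dvd_trans by blast
      then have "h dvd - (\<mu> (\<delta> y) - \<phi>0 y) + h * rep (W (\<delta> y) i)"
        by (intro dvd_add) (simp_all only: dvd_minus_iff dvd_triv_left)
      then show ?thesis by (simp add: \<psi>_def \<psi>0_def algebra_simps)
    qed
    ultimately show "\<exists>\<psi>. Y.lin (seg f 0 n) (carrier Y) \<psi> \<and> (\<forall>v\<in>carrier Y. seg f i n dvd \<phi>0 v - \<psi> v)"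
      unfolding F_def h_def by blast
  qed
qed

lemma fps_fps_local:
  fixes a b :: "'k::field fps fps"
  shows "\<not> a dvd 1 \<Longrightarrow> \<not> b dvd 1 \<Longrightarrow> \<not> (a + b) dvd 1"
  by (simp add: fps_fps_unit_iff)

lemma kxy_quot_nonunits:
  assumes F: "\<not> F dvd 1"
  shows "carrier (kxy_quot F) - Units (kxy_quot F) = {cls F s | s. \<not> s dvd 1}"
proof -
  have "cls F s \<in> Units (kxy_quot F) \<longleftrightarrow> s dvd 1" for s
  proof
    assume "cls F s \<in> Units (kxy_quot F)"
    then obtain y where "y \<in> carrier (kxy_quot F)" "y \<otimes>\<^bsub>kxy_quot F\<^esub> cls F s = \<one>\<^bsub>kxy_quot F\<^esub>"
      by (auto simp: Units_def)
    then obtain a where "F dvd a * s - 1"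
      by (auto simp: kxy_quot_carrier kxy_quot_simps cls_eq_iff)
    then obtain c where c: "a * s + F * (- c) = 1" by (auto simp: dvd_def algebra_simps)
    show "s dvd 1"
    proof (rule ccontr)
      assume "\<not> s dvd 1"
      then have "\<not> a * s dvd 1" using dvd_mult_right by blast
      moreover have "\<not> F * (- c) dvd 1" using F dvd_mult_left by blast
      ultimately have "\<not> (a * s + F * (- c)) dvd 1" by (rule fps_fps_local)
      then show False unfolding c by simp
    qed
  next
    assume "s dvd 1"
    then obtain a where "1 = s * a" by (auto simp: dvd_def)
    then have "cls F a \<otimes>\<^bsub>kxy_quot F\<^esub> cls F s = \<one>\<^bsub>kxy_quot F\<^esub>"
      "cls F s \<otimes>\<^bsub>kxy_quot F\<^esub> cls F a = \<one>\<^bsub>kxy_quot F\<^esub>"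
      by (simp_all add: kxy_quot_simps mult.commute)
    then show "cls F s \<in> Units (kxy_quot F)" by (auto simp: Units_def)
  qed
  then show ?thesis by (auto simp: kxy_quot_carrier)
qed

section \<open>Dimension one\<close>

text \<open>What the reducedness of the curve says about its irreducible factors: pairwise they are not
  associated.\<close>

definition factors :: "(nat \<Rightarrow> 'k::field fps fps) \<Rightarrow> nat \<Rightarrow> bool" where
  "factors f n \<longleftrightarrow> 1 \<le> n \<and> (\<forall>i\<in>{1..n}. Factorial_Ring.irreducible (f i)) \<and>
     (\<forall>i\<in>{1..n}. \<forall>j\<in>{1..n}. i \<noteq> j \<longrightarrow> \<not> f i dvd f j)"

lemma factors_prime: "factors f n \<Longrightarrow> i \<in> {1..n} \<Longrightarrow> prime_elem (f i)"
  using irreducible_fps_fps_imp_prime_elem unfolding factors_def by blast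

lemma factors_irreducible: "factors f n \<Longrightarrow> i \<in> {1..n} \<Longrightarrow> Factorial_Ring.irreducible (f i)"
  unfolding factors_def by blast

lemma factors_nonunit: "factors f n \<Longrightarrow> i \<in> {1..n} \<Longrightarrow> \<not> f i dvd 1"
  using factors_irreducible unfolding Factorial_Ring.irreducible_def by blast

lemma factors_dvd_seg: "i \<in> {1..n} \<Longrightarrow> (f i :: 'a::comm_ring_1) dvd seg f 0 n"
  using seg_mult[of 0 i n f] seg_dvd[of 0 i n f] by auto

lemma factors_seg_nonunit: "factors f n \<Longrightarrow> \<not> seg f 0 n dvd 1"
proof -
  assume f: "factors f n"
  then have "1 \<in> {1..n}" by (simp add: factors_def)
  then show ?thesis using factors_dvd_seg[of 1 n f] factors_nonunit[OF f, of 1] dvd_trans by blast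
qed

lemma factors_seg_nonzero: "factors f n \<Longrightarrow> i \<le> n \<Longrightarrow> seg f 0 i \<noteq> 0"
  using factors_prime[of f n] by (auto simp: seg_def prime_elem_def)

lemma prime_elem_dvd_seg:
  assumes "prime_elem (p :: 'a::idom)" "p dvd seg f i m" "\<And>j. j \<in> {Suc i..m} \<Longrightarrow> \<not> p dvd f j"
  shows False
proof -
  have "\<not> p dvd prod f J" if "finite J" "J \<subseteq> {Suc i..m}" for J
    using that
  proof (induction J rule: finite_induct)
    case empty
    then show ?case using assms(1) by (simp add: prime_elem_def)
  next
    case (insert j J)
    have "\<not> p dvd f j" using insert.prems by (intro assms(3)) auto
    moreover have "\<not> p dvd prod f J" using insert by auto
    ultimately show ?case using prime_elem_dvd_multD[OF assms(1), of "f j" "prod f J"] insert.hyps by auto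
  qed
  then show False using assms(2) unfolding seg_def by blast
qed

lemma primeideal_kxy_quot:
  fixes Q :: "'k::field fps fps set"
  assumes zero: "0 \<in> Q" and add: "\<And>a b. a \<in> Q \<Longrightarrow> b \<in> Q \<Longrightarrow> a + b \<in> Q"
    and mult: "\<And>a s. a \<in> Q \<Longrightarrow> s * a \<in> Q" and one: "1 \<notin> Q" and F: "F \<in> Q"
    and prime: "\<And>a b. a * b \<in> Q \<Longrightarrow> a \<in> Q \<or> b \<in> Q"
  shows "primeideal (cls F ` Q) (kxy_quot F)" and "\<And>s. cls F s \<in> cls F ` Q \<longleftrightarrow> s \<in> Q"
proof -
  show iff: "cls F s \<in> cls F ` Q \<longleftrightarrow> s \<in> Q" for s
  proof
    assume "cls F s \<in> cls F ` Q"
    then obtain a where a: "a \<in> Q" "F dvd s - a" by (auto simp: cls_eq_iff)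
    then obtain c where "s = a + c * F" by (auto simp: dvd_def algebra_simps)
    then show "s \<in> Q" using add mult a(1) F by blast
  qed auto
  interpret R: cring "kxy_quot F" by (rule kxy_quot_cring)
  have neg: "\<ominus>\<^bsub>kxy_quot F\<^esub> cls F a = cls F (- a)" for a
    by (rule R.minus_equality) (simp_all add: kxy_quot_simps)
  show "primeideal (cls F ` Q) (kxy_quot F)"
  proof (rule primeidealI)
    show "ideal (cls F ` Q) (kxy_quot F)"
    proof (rule idealI)
      show "ring (kxy_quot F)" by (rule R.ring_axioms)
      show "subgroup (cls F ` Q) (add_monoid (kxy_quot F))"
      proof (rule R.add.subgroupI)
        show "cls F ` Q \<subseteq> carrier (kxy_quot F)" by auto
        show "cls F ` Q \<noteq> {}" using zero by blast
        fix x assume "x \<in> cls F ` Q"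
        then obtain a where a: "a \<in> Q" "x = cls F a" by blast
        show "\<ominus>\<^bsub>kxy_quot F\<^esub> x \<in> cls F ` Q" using mult[OF a(1), of "- 1"] by (simp add: a(2) neg iff)
        fix y assume "y \<in> cls F ` Q"
        then obtain b where "b \<in> Q" "y = cls F b" by blast
        then show "x \<oplus>\<^bsub>kxy_quot F\<^esub> y \<in> cls F ` Q" using add a by (simp add: kxy_quot_simps)
      qed
      fix x y assume "x \<in> cls F ` Q" "y \<in> carrier (kxy_quot F)"
      then obtain a b where ab: "a \<in> Q" "x = cls F a" "y = cls F b" by (auto simp: kxy_quot_carrier)
      show "y \<otimes>\<^bsub>kxy_quot F\<^esub> x \<in> cls F ` Q" using mult ab by (simp add: kxy_quot_simps)
      then show "x \<otimes>\<^bsub>kxy_quot F\<^esub> y \<in> cls F ` Q" using ab by (simp add: kxy_quot_simps mult.commute)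
    qed
    show "cring (kxy_quot F)" by (rule R.is_cring)
    have "cls F 1 \<notin> cls F ` Q" using iff one by simp
    then show "carrier (kxy_quot F) \<noteq> cls F ` Q" using cls_carrier by blast
    fix x y assume "x \<in> carrier (kxy_quot F)" "y \<in> carrier (kxy_quot F)"
      and xy: "x \<otimes>\<^bsub>kxy_quot F\<^esub> y \<in> cls F ` Q"
    then obtain a b where ab: "x = cls F a" "y = cls F b" by (auto simp: kxy_quot_carrier)
    then have "a * b \<in> Q" using xy by (simp add: kxy_quot_simps iff)
    then show "x \<in> cls F ` Q \<or> y \<in> cls F ` Q" using prime ab by auto
  qed
qed

lemma primeideal_kxy_quotD:
  assumes "primeideal P (kxy_quot F)"
  shows "cls F 1 \<notin> P" and "F dvd a \<Longrightarrow> cls F a \<in> P"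
    and "cls F a \<in> P \<Longrightarrow> cls F (s * a) \<in> P"
    and "cls F a \<in> P \<Longrightarrow> cls F b \<in> P \<Longrightarrow> cls F (a + b) \<in> P"
    and "cls F (a * b) \<in> P \<Longrightarrow> cls F a \<in> P \<or> cls F b \<in> P"
proof -
  interpret P: primeideal P "kxy_quot F" by fact
  show "cls F 1 \<notin> P" using P.one_imp_carrier P.I_notcarr by (auto simp: kxy_quot_simps)
  show "cls F a \<in> P" if "F dvd a"
  proof -
    have "cls F a = \<zero>\<^bsub>kxy_quot F\<^esub>" using that by (simp add: kxy_quot_simps cls_eq_iff)
    then show ?thesis using additive_subgroup.zero_closed[OF P.additive_subgroup_axioms] by simp
  qed
  show "cls F (s * a) \<in> P" if "cls F a \<in> P"
    using P.I_l_closed[OF that cls_carrier, of s] by (simp add: kxy_quot_simps)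
  show "cls F (a + b) \<in> P" if "cls F a \<in> P" "cls F b \<in> P"
    using additive_subgroup.a_closed[OF P.additive_subgroup_axioms that] by (simp add: kxy_quot_simps)
  show "cls F a \<in> P \<or> cls F b \<in> P" if "cls F (a * b) \<in> P"
    using P.I_prime[of "cls F a" "cls F b"] that by (simp add: kxy_quot_simps)
qed

text \<open>In a chain of three primes the smallest contains some \<open>f j\<close>, the next one an element that is not a
  multiple of it, and hence a power of every nonunit; so the second prime is already maximal.
  A chain of two is formed by the multiples of \<open>f 1\<close> and the nonunits.\<close>

theorem krull_dim_kxy_quot:
  assumes f: "factors f n"
  shows "krull_dim (kxy_quot (seg f 0 n)) = 1"
proof -
  define F where "F = seg f 0 n"
  have n1: "1 \<in> {1..n}" using f by (simp add: factors_def)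
  have upper: "m \<le> 1" if P: "\<forall>i\<le>m. primeideal (P i) (kxy_quot F)" "\<forall>i<m. P i \<subset> P (Suc i)" for m P
  proof (rule ccontr)
    assume "\<not> m \<le> 1"
    then have m: "P 0 \<subset> P 1" "P 1 \<subset> P 2" "primeideal (P 0) (kxy_quot F)"
      "primeideal (P 1) (kxy_quot F)" "primeideal (P 2) (kxy_quot F)"
      using P by (auto simp: numeral_2_eq_2)
    note D0 = primeideal_kxy_quotD[OF m(3)] and D1 = primeideal_kxy_quotD[OF m(4)]
      and D2 = primeideal_kxy_quotD[OF m(5)]
    have sub: "x \<in> carrier (kxy_quot F)" if "x \<in> P 1 \<or> x \<in> P 2" for x
      using that m(4,5) unfolding primeideal_def ideal_def
      by (metis additive_subgroup.a_Hcarr)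
    have ex: "\<exists>j\<in>{1..k}. cls F (f j) \<in> P 0" if "cls F (seg f 0 k) \<in> P 0" "k \<le> n" for k
      using that
    proof (induction k)
      case 0
      then show ?case using D0(1) by simp
    next
      case (Suc k)
      then show ?case using D0(5)[of "seg f 0 k" "f (Suc k)"] by (force simp: seg_Suc)
    qed
    have "cls F (seg f 0 n) \<in> P 0" by (rule D0(2)) (simp add: F_def)
    then obtain j where j: "j \<in> {1..n}" "cls F (f j) \<in> P 0" using ex[OF _ order_refl] by blast
    obtain x where "x \<in> P 1" "x \<notin> P 0" using m(1) by blast
    then obtain a where a: "cls F a \<in> P 1" "cls F a \<notin> P 0" using sub by (auto simp: kxy_quot_carrier)
    have "\<not> f j dvd a"
    proof
      assume "f j dvd a"
      then obtain c where "a = f j * c" ..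
      then show False using D0(3)[OF j(2), of c] a(2) by (simp add: mult.commute)
    qed
    have nonunits: "cls F b \<in> P 1" if b: "\<not> b dvd 1" for b
    proof -
      obtain N s t where "b ^ N = f j * s + a * t"
        using power_mem_ideal_of_nonmultiple[OF factors_irreducible[OF f j(1)] \<open>\<not> f j dvd a\<close> b] by blast
      then have "b ^ N = s * f j + t * a" by (simp add: mult.commute)
      moreover have "cls F (s * f j + t * a) \<in> P 1" using D1(3,4) j(2) m(1) a(1) by blast
      ultimately have "cls F (b ^ N) \<in> P 1" by simp
      then show ?thesis
      proof (induction N)
        case 0
        then show ?case using D1(1) by simp
      next
        case (Suc N)
        then show ?case using D1(5)[of b "b ^ N"] by auto
      qed
    qed
    obtain y where "y \<in> P 2" "y \<notin> P 1" using m(2) by blast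
    then obtain s where s: "cls F s \<in> P 2" "cls F s \<notin> P 1" using sub by (auto simp: kxy_quot_carrier)
    then have "s dvd 1" using nonunits by blast
    then obtain s' where "1 = s' * s" by (auto simp: dvd_def mult.commute)
    then show False using D2(1) D2(3)[OF s(1), of s'] by simp
  qed
  have lower: "\<exists>P. (\<forall>i\<le>1. primeideal (P i) (kxy_quot F)) \<and> (\<forall>i<1. P i \<subset> P (Suc i))"
  proof -
    obtain t where t: "\<not> t dvd 1" "\<not> f 1 dvd t"
      using exists_common_nonmultiple[of "{1..n}" f] factors_irreducible[OF f] n1 by blast
    have p: "prime_elem (f 1)" using factors_prime[OF f n1] .
    have FQ: "f 1 dvd F" "\<not> F dvd 1"
      using factors_dvd_seg[OF n1] factors_seg_nonunit[OF f] by (simp_all add: F_def)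
    have P0: "primeideal (cls F ` {s. f 1 dvd s}) (kxy_quot F)"
      "\<And>s. cls F s \<in> cls F ` {s. f 1 dvd s} \<longleftrightarrow> s \<in> {s. f 1 dvd s}"
      by (rule primeideal_kxy_quot; use p FQ in \<open>auto simp: prime_elem_def\<close>)+
    have P1: "primeideal (cls F ` {s. \<not> s dvd 1}) (kxy_quot F)"
      "\<And>s. cls F s \<in> cls F ` {s. \<not> s dvd 1} \<longleftrightarrow> s \<in> {s. \<not> s dvd 1}"
      by (rule primeideal_kxy_quot; use FQ in \<open>auto simp: fps_fps_unit_iff\<close>)+
    have "\<not> s dvd 1" if "f 1 dvd s" for s using that p dvd_trans unfolding prime_elem_def by blast
    then have "cls F ` {s. f 1 dvd s} \<subseteq> cls F ` {s. \<not> s dvd 1}" by blast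
    moreover have "cls F t \<in> cls F ` {s. \<not> s dvd 1}" "cls F t \<notin> cls F ` {s. f 1 dvd s}"
      using t P0(2) by auto
    ultimately have "cls F ` {s. f 1 dvd s} \<subset> cls F ` {s. \<not> s dvd 1}" by blast
    then show ?thesis using P0(1) P1(1)
      by (intro exI[of _ "\<lambda>i. if i = 0 then cls F ` {s. f 1 dvd s} else cls F ` {s. \<not> s dvd 1}"]) simp
  qed
  show ?thesis
    unfolding krull_dim_def F_def[symmetric]
  proof (rule antisym)
    show "(SUP n\<in>{n. \<exists>P. (\<forall>i\<le>n. primeideal (P i) (kxy_quot F)) \<and> (\<forall>i<n. P i \<subset> P (Suc i))}. enat n) \<le> 1"
      by (rule SUP_least) (use upper in \<open>force simp: one_enat_def\<close>)
    have "enat 1 \<le> (SUP n\<in>{n. \<exists>P. (\<forall>i\<le>n. primeideal (P i) (kxy_quot F)) \<and> (\<forall>i<n. P i \<subset> P (Suc i))}. enat n)"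
      by (rule SUP_upper) (use lower in blast)
    then show "1 \<le> (SUP n\<in>{n. \<exists>P. (\<forall>i\<le>n. primeideal (P i) (kxy_quot F)) \<and> (\<forall>i<n. P i \<subset> P (Suc i))}. enat n)"
      by (simp add: one_enat_def)
  qed
qed

section \<open>Maximal Cohen--Macaulay modules\<close>

lemma fin_gen_module_iff_fg:
  assumes Y: "Module.module (kxy_quot F) Y"
  shows "fin_gen_module (kxy_quot F) Y \<longleftrightarrow> smodule.fg Y (sact F Y) (carrier Y)"
proof -
  interpret Y: smodule Y "sact F Y" by (rule smodule_sact[OF Y])
  have fs: "(\<Oplus>\<^bsub>Y\<^esub>a\<in>A. c a \<odot>\<^bsub>Y\<^esub> a) = Y.lc A r (\<lambda>b. b)"
    if "A \<subseteq> carrier Y" "\<And>a. a \<in> A \<Longrightarrow> c a = cls F (r a)" for A c r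
    unfolding Y.lc_def
  proof (rule Y.finsum_cong')
    show "(\<lambda>a. sact F Y (r a) a) \<in> A \<rightarrow> carrier Y" by (rule Pi_I, rule Y.act_closed, rule subsetD[OF that(1)], assumption)
    show "c a \<odot>\<^bsub>Y\<^esub> a = sact F Y (r a) a" if "a \<in> A" for a
      using \<open>\<And>a. a \<in> A \<Longrightarrow> c a = cls F (r a)\<close>[OF that] by (simp add: sact_def)
  qed simp
  show ?thesis
  proof
    assume "fin_gen_module (kxy_quot F) Y"
    then obtain A where A: "finite A" "A \<subseteq> carrier Y"
      "\<forall>x\<in>carrier Y. \<exists>c\<in>A \<rightarrow> carrier (kxy_quot F). x = (\<Oplus>\<^bsub>Y\<^esub>a\<in>A. c a \<odot>\<^bsub>Y\<^esub> a)"
      unfolding fin_gen_module_def by blast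
    have "x \<in> Y.span A (\<lambda>b. b)" if x: "x \<in> carrier Y" for x
    proof -
      obtain c where c: "c \<in> A \<rightarrow> carrier (kxy_quot F)" "x = (\<Oplus>\<^bsub>Y\<^esub>a\<in>A. c a \<odot>\<^bsub>Y\<^esub> a)"
        using A(3) x by blast
      have "c a = cls F (rep (c a))" if "a \<in> A" for a
      proof -
        have "c a \<in> range (cls F)" using c(1) that unfolding kxy_quot_carrier by blast
        then obtain s where "c a = cls F s" by (rule rangeE)
        then show ?thesis by simp
      qed
      then show ?thesis using fs[OF A(2), of c "\<lambda>a. rep (c a)"] c(2) by auto
    qed
    then show "Y.fg (carrier Y)" unfolding Y.fg_def using A(1,2) by blast
  next
    assume "Y.fg (carrier Y)"
    then obtain B where B: "finite B" "B \<subseteq> carrier Y" "carrier Y \<subseteq> Y.span B (\<lambda>b. b)"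
      unfolding Y.fg_def by blast
    have "\<exists>c\<in>B \<rightarrow> carrier (kxy_quot F). x = (\<Oplus>\<^bsub>Y\<^esub>a\<in>B. c a \<odot>\<^bsub>Y\<^esub> a)" if x: "x \<in> carrier Y" for x
    proof -
      obtain r where "x = Y.lc B r (\<lambda>b. b)" using B(3) x by (auto simp: Y.span_def)
      then show ?thesis using fs[OF B(2), of "\<lambda>a. cls F (r a)" r]
        by (intro bexI[of _ "\<lambda>a. cls F (r a)"]) auto
    qed
    then show "fin_gen_module (kxy_quot F) Y" unfolding fin_gen_module_def using Y B(1,2) by blast
  qed
qed

lemma seq_span_0: "seq_span Y xs 0 = {\<zero>\<^bsub>Y\<^esub>}" if "abelian_group Y"
proof -
  interpret Y: abelian_group Y by fact
  show ?thesis by (simp add: seq_span_def)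
qed

lemma seq_span_1:
  assumes Y: "Module.module R Y" and x: "xs ! 0 \<in> carrier R"
  shows "seq_span Y xs 1 = {xs ! 0 \<odot>\<^bsub>Y\<^esub> v | v. v \<in> carrier Y}"
proof -
  interpret Y: Module.module R Y by (rule Y)
  have s: "(\<Oplus>\<^bsub>Y\<^esub>j\<in>{..<1::nat}. (xs ! j) \<odot>\<^bsub>Y\<^esub> v j) = xs ! 0 \<odot>\<^bsub>Y\<^esub> v 0" if "v 0 \<in> carrier Y" for v
    using that x by (simp add: lessThan_Suc)
  show ?thesis
  proof (intro equalityI subsetI)
    fix y assume "y \<in> seq_span Y xs 1"
    then obtain v where "v \<in> {..<1::nat} \<rightarrow> carrier Y" "y = (\<Oplus>\<^bsub>Y\<^esub>j\<in>{..<1::nat}. (xs ! j) \<odot>\<^bsub>Y\<^esub> v j)"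
      by (auto simp: seq_span_def)
    then show "y \<in> {xs ! 0 \<odot>\<^bsub>Y\<^esub> v | v. v \<in> carrier Y}" using s[of v] by auto
  next
    fix y assume "y \<in> {xs ! 0 \<odot>\<^bsub>Y\<^esub> v | v. v \<in> carrier Y}"
    then obtain u where "u \<in> carrier Y" "y = xs ! 0 \<odot>\<^bsub>Y\<^esub> u" by blast
    then show "y \<in> seq_span Y xs 1" unfolding seq_span_def using s[of "\<lambda>_. u"]
      by (intro CollectI exI[of _ "\<lambda>_. u"]) auto
  qed
qed

lemma power_mem_ideal_of_nonmultiples:
  fixes f :: "nat \<Rightarrow> 'k::field fps fps"
  assumes "finite I" and "\<And>i. i \<in> I \<Longrightarrow> Factorial_Ring.irreducible (f i)" "\<And>i. i \<in> I \<Longrightarrow> \<not> f i dvd a"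
    and b: "\<not> b dvd 1"
  shows "\<exists>N s t. b ^ N = prod f I * s + a * t"
  using assms(1-3)
proof (induction I rule: finite_induct)
  case empty
  show ?case by (intro exI[of _ 0] exI[of _ 1]) simp
next
  case (insert i I)
  then obtain N s t where 1: "b ^ N = prod f I * s + a * t" by auto
  obtain N' s' t' where 2: "b ^ N' = f i * s' + a * t'"
    using power_mem_ideal_of_nonmultiple[of "f i" a b] insert.prems b by auto
  have "b ^ (N + N') = (prod f I * s + a * t) * (f i * s' + a * t')" by (simp add: power_add 1 2)
  also have "\<dots> = f i * prod f I * (s * s') + a * (t * (f i * s' + a * t') + prod f I * s * t')"
    by (simp add: algebra_simps)
  finally show ?case using insert.hyps by auto
qed

text \<open>If \<open>a\<close> is regular on \<open>Y\<close>, then the factors of \<open>F\<close> that divide \<open>a\<close> can be dropped: the product of the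
  other factors still kills \<open>Y\<close>.  A power of \<open>b\<close> lies in the ideal generated by that product and \<open>a\<close>.\<close>

lemma regular_power_absorb:
  fixes f :: "nat \<Rightarrow> 'k::field fps fps" and n :: nat
  defines "F \<equiv> seg f 0 n"
  assumes f: "factors f n" and Y: "Module.module (kxy_quot F) Y"
    and reg: "\<And>v. v \<in> carrier Y \<Longrightarrow> sact F Y a v = \<zero>\<^bsub>Y\<^esub> \<Longrightarrow> v = \<zero>\<^bsub>Y\<^esub>" and b: "\<not> b dvd 1"
  shows "\<exists>N. \<forall>v\<in>carrier Y. \<exists>u\<in>carrier Y. sact F Y (b ^ N) v = sact F Y a u"
proof -
  interpret Y: smodule Y "sact F Y" by (rule smodule_sact[OF Y])
  let ?I = "{i\<in>{1..n}. \<not> f i dvd a}" and ?J = "{i\<in>{1..n}. f i dvd a}"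
  have "\<exists>N s t. b ^ N = prod f ?I * s + a * t"
  proof (rule power_mem_ideal_of_nonmultiples)
    show "Factorial_Ring.irreducible (f i)" if "i \<in> ?I" for i using that by (intro factors_irreducible[OF f]) blast
    show "\<not> f i dvd a" if "i \<in> ?I" for i using that by blast
  qed (simp, rule b)
  then obtain N s t where N: "b ^ N = prod f ?I * s + a * t" by (elim exE)
  have "F = prod f ?I * prod f ?J"
  proof -
    have "{Suc 0..n} = ?I \<union> ?J" by auto
    moreover have "prod f (?I \<union> ?J) = prod f ?I * prod f ?J" by (rule prod.union_disjoint) auto
    ultimately show ?thesis by (simp only: F_def seg_def)
  qed
  moreover have "prod f ?J dvd a ^ card ?J"
    using prod_dvd_prod[of ?J f "\<lambda>_. a"] by simp
  ultimately have Fd: "F dvd a ^ card ?J * prod f ?I" by (simp add: mult.commute mult_dvd_mono)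
  have regk: "v = \<zero>\<^bsub>Y\<^esub>" if "v \<in> carrier Y" "sact F Y (a ^ k) v = \<zero>\<^bsub>Y\<^esub>" for k v
    using that
  proof (induction k)
    case (Suc k)
    have "sact F Y a (sact F Y (a ^ k) v) = \<zero>\<^bsub>Y\<^esub>" using Suc.prems by (simp add: Y.act_act)
    then show ?case using Suc reg Y.act_closed by blast
  qed simp
  have "sact F Y (b ^ N) v = sact F Y a (sact F Y t v)" if v: "v \<in> carrier Y" for v
  proof -
    have "sact F Y (a ^ card ?J) (sact F Y (prod f ?I) v) = \<zero>\<^bsub>Y\<^esub>"
      using sact_modulus[OF Y v Fd] v by (simp add: Y.act_act)
    then have "sact F Y (prod f ?I) v = \<zero>\<^bsub>Y\<^esub>" using regk v by blast
    then have "sact F Y (prod f ?I * s) v = \<zero>\<^bsub>Y\<^esub>" by (rule Y.act_dvd_zero[OF dvd_triv_left v])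
    then show ?thesis using v by (simp add: N Y.act_add_left Y.act_act)
  qed
  then show ?thesis using Y.act_closed by blast
qed

text \<open>A regular sequence cannot have a second member \<open>b\<close>: if the first is \<open>a\<close>, some power of \<open>b\<close> maps \<open>Y\<close> into
  \<open>a Y\<close>, and cancelling \<open>b\<close> modulo \<open>a Y\<close> would give \<open>Y = a Y\<close>, against Nakayama.  The element \<open>t\<close> alone
  is a regular sequence.\<close>

theorem depth_eq_one:
  fixes f :: "nat \<Rightarrow> 'k::field fps fps" and n :: nat
  defines "F \<equiv> seg f 0 n"
  assumes f: "factors f n" and Y: "Module.module (kxy_quot F) Y"
    and fg: "smodule.fg Y (sact F Y) (carrier Y)" and nz: "carrier Y \<noteq> {\<zero>\<^bsub>Y\<^esub>}"
    and t: "\<not> t dvd 1" "\<And>v. v \<in> carrier Y \<Longrightarrow> sact F Y t v = \<zero>\<^bsub>Y\<^esub> \<Longrightarrow> v = \<zero>\<^bsub>Y\<^esub>"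
  shows "depth (kxy_quot F) Y = 1"
proof -
  interpret Y: smodule Y "sact F Y" by (rule smodule_sact[OF Y])
  interpret L: local_smodule Y "sact F Y" t
    by unfold_locales (use t fps_fps_local in blast)+
  have ag: "abelian_group Y" by (rule Y.abelian_group_axioms)
  have Fnu: "\<not> F dvd 1" unfolding F_def using f by (rule factors_seg_nonunit)
  note nonunits = kxy_quot_nonunits[OF Fnu]
  have nak: "\<exists>v\<in>carrier Y. \<forall>u\<in>carrier Y. v \<noteq> sact F Y a u" if a: "\<not> a dvd 1" for a
  proof (rule ccontr)
    assume neg: "\<not> ?thesis"
    have "Y.sub {\<zero>\<^bsub>Y\<^esub>}" by (simp add: Y.sub_def)
    then have "carrier Y \<subseteq> {\<zero>\<^bsub>Y\<^esub>}"
    proof (rule Y.nakayama[OF _ Y.sub_carrier fg L.radical[OF a]])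
      fix v assume v: "v \<in> carrier Y"
      then obtain u where "u \<in> carrier Y" "v = sact F Y a u" using neg by blast
      then show "\<exists>u\<in>{\<zero>\<^bsub>Y\<^esub>}. \<exists>w\<in>carrier Y. v = u \<oplus>\<^bsub>Y\<^esub> sact F Y a w" by auto
    qed
    then show False using nz Y.zero_closed by blast
  qed
  show ?thesis
    unfolding depth_def
  proof (rule antisym)
    show "(SUP xs\<in>{xs. set xs \<subseteq> carrier (kxy_quot F) - Units (kxy_quot F) \<and> regular_sequence Y xs}. enat (length xs)) \<le> 1"
    proof (rule SUP_least)
      fix xs assume "xs \<in> {xs. set xs \<subseteq> carrier (kxy_quot F) - Units (kxy_quot F) \<and> regular_sequence Y xs}"
      then have xs: "set xs \<subseteq> {cls F s | s. \<not> s dvd 1}" "regular_sequence Y xs" by (auto simp: nonunits)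
      have "length xs \<le> 1"
      proof (rule ccontr)
        assume "\<not> length xs \<le> 1"
        then have len: "0 < length xs" "1 < length xs" by auto
        have "xs ! 0 \<in> set xs" "xs ! 1 \<in> set xs" using len by simp_all
        then have "xs ! 0 \<in> {cls F s | s. \<not> s dvd 1}" "xs ! 1 \<in> {cls F s | s. \<not> s dvd 1}" using xs(1) by blast+
        then obtain a b where ab: "xs ! 0 = cls F a" "\<not> a dvd 1" "xs ! 1 = cls F b" "\<not> b dvd 1" by blast
        have span1: "seq_span Y xs 1 = {sact F Y a v | v. v \<in> carrier Y}"
          using seq_span_1[OF Y, of xs] by (simp add: ab sact_def)
        have rega: "v = \<zero>\<^bsub>Y\<^esub>" if "v \<in> carrier Y" "sact F Y a v = \<zero>\<^bsub>Y\<^esub>" for v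
        proof -
          have "(xs ! 0) \<odot>\<^bsub>Y\<^esub> v \<in> seq_span Y xs 0" using that by (simp add: seq_span_0[OF ag] ab sact_def)
          then have "v \<in> seq_span Y xs 0" using xs(2) len that(1) unfolding regular_sequence_def by blast
          then show ?thesis by (simp add: seq_span_0[OF ag])
        qed
        have regb: "v \<in> seq_span Y xs 1" if "v \<in> carrier Y" "sact F Y b v \<in> seq_span Y xs 1" for v
        proof -
          have "(xs ! 1) \<odot>\<^bsub>Y\<^esub> v \<in> seq_span Y xs 1" using that(2) unfolding ab(3) sact_def .
          then show ?thesis using xs(2) len that(1) unfolding regular_sequence_def by blast
        qed
        obtain N where N: "\<forall>v\<in>carrier Y. \<exists>u\<in>carrier Y. sact F Y (b ^ N) v = sact F Y a u"
          using regular_power_absorb[OF f Y[unfolded F_def], of a b] rega ab(4) unfolding F_def by blast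
        have regbk: "v \<in> seq_span Y xs 1" if "v \<in> carrier Y" "sact F Y (b ^ k) v \<in> seq_span Y xs 1" for k v
          using that
        proof (induction k)
          case (Suc k)
          have "sact F Y b (sact F Y (b ^ k) v) \<in> seq_span Y xs 1" using Suc.prems by (simp add: Y.act_act)
          then have "sact F Y (b ^ k) v \<in> seq_span Y xs 1"
            by (rule regb[OF Y.act_closed[OF Suc.prems(1)]])
          then show ?case using Suc.IH Suc.prems(1) by blast
        qed simp
        obtain v where v: "v \<in> carrier Y" "\<forall>u\<in>carrier Y. v \<noteq> sact F Y a u" using nak[OF ab(2)] by blast
        have "sact F Y (b ^ N) v \<in> seq_span Y xs 1" using N v(1) unfolding span1 by blast
        then have "v \<in> seq_span Y xs 1" using regbk v(1) by blast
        then show False using v(2) unfolding span1 by blast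
      qed
      then show "enat (length xs) \<le> 1" by (simp add: one_enat_def)
    qed
    have span1: "seq_span Y [cls F t] 1 = {sact F Y t v | v. v \<in> carrier Y}"
      using seq_span_1[OF Y, of "[cls F t]"] by (simp add: sact_def)
    have "regular_sequence Y [cls F t]"
      unfolding regular_sequence_def
    proof (intro conjI allI ballI impI)
      fix i m assume "i < length [cls F t]" "m \<in> carrier Y" "[cls F t] ! i \<odot>\<^bsub>Y\<^esub> m \<in> seq_span Y [cls F t] i"
      then show "m \<in> seq_span Y [cls F t] i" using t(2) by (simp add: seq_span_0[OF ag] sact_def)
    next
      obtain v where "v \<in> carrier Y" "\<forall>u\<in>carrier Y. v \<noteq> sact F Y t u" using nak[OF t(1)] by blast
      then have "v \<notin> seq_span Y [cls F t] 1" unfolding span1 by blast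
      then show "seq_span Y [cls F t] (length [cls F t]) \<noteq> carrier Y" using \<open>v \<in> carrier Y\<close> by auto
    qed
    moreover have "set [cls F t] \<subseteq> carrier (kxy_quot F) - Units (kxy_quot F)"
      unfolding nonunits using t(1) by auto
    ultimately have "enat (length [cls F t]) \<le> (SUP xs\<in>{xs. set xs \<subseteq> carrier (kxy_quot F) - Units (kxy_quot F) \<and> regular_sequence Y xs}. enat (length xs))"
      by (intro SUP_upper) blast
    then show "1 \<le> (SUP xs\<in>{xs. set xs \<subseteq> carrier (kxy_quot F) - Units (kxy_quot F) \<and> regular_sequence Y xs}. enat (length xs))"
      by (simp add: one_enat_def)
  qed
qed

lemma regular_element_of_depth_one:
  assumes F: "\<not> F dvd 1" and Y: "Module.module (kxy_quot F) Y" and d: "depth (kxy_quot F) Y = 1"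
  shows "\<exists>t. \<not> t dvd 1 \<and> (\<forall>v\<in>carrier Y. sact F Y t v = \<zero>\<^bsub>Y\<^esub> \<longrightarrow> v = \<zero>\<^bsub>Y\<^esub>)"
proof -
  have ag: "abelian_group Y" using Y by (rule module_abelian_group)
  have "\<exists>xs. set xs \<subseteq> carrier (kxy_quot F) - Units (kxy_quot F) \<and> regular_sequence Y xs \<and> 0 < length xs"
  proof (rule ccontr)
    assume "\<not> ?thesis"
    then have "depth (kxy_quot F) Y \<le> 0" unfolding depth_def by (intro SUP_least) (auto simp: zero_enat_def)
    then show False using d by simp
  qed
  then obtain xs where xs: "set xs \<subseteq> {cls F s | s. \<not> s dvd 1}" "regular_sequence Y xs" "0 < length xs"
    unfolding kxy_quot_nonunits[OF F] by blast
  have "xs ! 0 \<in> {cls F s | s. \<not> s dvd 1}" using xs(1,3) nth_mem by blast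
  then obtain t where t: "xs ! 0 = cls F t" "\<not> t dvd 1" by blast
  have "v = \<zero>\<^bsub>Y\<^esub>" if "v \<in> carrier Y" "sact F Y t v = \<zero>\<^bsub>Y\<^esub>" for v
  proof -
    have "(xs ! 0) \<odot>\<^bsub>Y\<^esub> v \<in> seq_span Y xs 0" using that by (simp add: seq_span_0[OF ag] t sact_def)
    then have "v \<in> seq_span Y xs 0" using xs(2,3) that(1) unfolding regular_sequence_def by blast
    then show ?thesis by (simp add: seq_span_0[OF ag])
  qed
  then show ?thesis using t(2) by blast
qed

text \<open>The zero module is covered on the right-hand side because every \<open>t\<close> is regular on it.\<close>

theorem max_CM_iff:
  fixes f :: "nat \<Rightarrow> 'k::field fps fps" and n :: nat
  defines "F \<equiv> seg f 0 n"
  assumes f: "factors f n" and Y: "Module.module (kxy_quot F) Y"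
  shows "max_CM (kxy_quot F) Y \<longleftrightarrow> smodule.fg Y (sact F Y) (carrier Y) \<and>
    (\<exists>t. \<not> t dvd 1 \<and> (\<forall>v\<in>carrier Y. sact F Y t v = \<zero>\<^bsub>Y\<^esub> \<longrightarrow> v = \<zero>\<^bsub>Y\<^esub>))"
proof -
  have kd: "krull_dim (kxy_quot F) = 1" unfolding F_def using f by (rule krull_dim_kxy_quot)
  have Fnu: "\<not> F dvd 1" unfolding F_def using f by (rule factors_seg_nonunit)
  show ?thesis
  proof
    assume cm: "max_CM (kxy_quot F) Y"
    have "\<exists>t. \<not> t dvd 1 \<and> (\<forall>v\<in>carrier Y. sact F Y t v = \<zero>\<^bsub>Y\<^esub> \<longrightarrow> v = \<zero>\<^bsub>Y\<^esub>)"
    proof (cases "carrier Y = {\<zero>\<^bsub>Y\<^esub>}")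
      case True
      then show ?thesis using Fnu by auto
    next
      case False
      then have "depth (kxy_quot F) Y = 1" using cm kd by (simp add: max_CM_def)
      then show ?thesis by (rule regular_element_of_depth_one[OF Fnu Y])
    qed
    then show "smodule.fg Y (sact F Y) (carrier Y) \<and>
      (\<exists>t. \<not> t dvd 1 \<and> (\<forall>v\<in>carrier Y. sact F Y t v = \<zero>\<^bsub>Y\<^esub> \<longrightarrow> v = \<zero>\<^bsub>Y\<^esub>))"
      using cm fin_gen_module_iff_fg[OF Y] by (simp add: max_CM_def)
  next
    assume r: "smodule.fg Y (sact F Y) (carrier Y) \<and>
      (\<exists>t. \<not> t dvd 1 \<and> (\<forall>v\<in>carrier Y. sact F Y t v = \<zero>\<^bsub>Y\<^esub> \<longrightarrow> v = \<zero>\<^bsub>Y\<^esub>))"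
    then have "depth (kxy_quot F) Y = 1" if "carrier Y \<noteq> {\<zero>\<^bsub>Y\<^esub>}"
      using depth_eq_one[OF f Y[unfolded F_def]] that unfolding F_def by blast
    then show "max_CM (kxy_quot F) Y"
      using r fin_gen_module_iff_fg[OF Y] by (auto simp: max_CM_def kd)
  qed
qed

section \<open>The module M\<close>

text \<open>The primes in the product are cancelled one by one.\<close>

lemma seg_dvd_cancel:
  fixes f :: "nat \<Rightarrow> 'a::idom"
  assumes "\<And>k. k \<in> {1..j} \<Longrightarrow> prime_elem (f k)" "\<And>k. k \<in> {1..j} \<Longrightarrow> \<not> f k dvd c"
    and "seg f 0 j dvd c * s"
  shows "seg f 0 j dvd s"
  using assms
proof (induction j)
  case (Suc j)
  have "seg f 0 j dvd c * s" using Suc.prems(3) by (metis dvd_mult_left le0 seg_Suc)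
  then have "seg f 0 j dvd s" using Suc.prems by (intro Suc.IH) auto
  then obtain s' where s: "s = seg f 0 j * s'" ..
  have "seg f 0 j \<noteq> 0" using Suc.prems(1) by (auto simp: seg_def prime_elem_def)
  moreover have "seg f 0 j * f (Suc j) dvd seg f 0 j * (c * s')"
    using Suc.prems(3) by (simp add: seg_Suc s mult.left_commute)
  ultimately have "f (Suc j) dvd c * s'" by simp
  then have "f (Suc j) dvd s'" using Suc.prems(1,2)[of "Suc j"] by (auto dest: prime_elem_dvd_multD)
  then show ?case unfolding s seg_Suc[OF le0] by (rule mult_dvd_mono[OF dvd_refl])
qed simp

lemma factors_seg_cancel:
  assumes f: "factors f n" and k: "k \<le> i" "i \<le> n" and d: "seg f 0 k dvd seg f i n * s"
  shows "seg f 0 k dvd s"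
proof (rule seg_dvd_cancel[OF _ _ d])
  fix m assume m: "m \<in> {1..k}"
  then show p: "prime_elem (f m)" using k by (intro factors_prime[OF f]) auto
  show "\<not> f m dvd seg f i n"
  proof
    assume "f m dvd seg f i n"
    then show False by (rule prime_elem_dvd_seg[OF p]) (use f m k in \<open>auto simp: factors_def\<close>)
  qed
qed

lemma lc_chain_unit:
  assumes "J \<subseteq> {1..n}"
  shows "smodule.lc (chain_sum f n) (sact (seg f 0 n) (chain_sum f n)) J c (chain_unit f n)
    = (\<lambda>j\<in>{1..n}. cls (seg f 0 j) (if j \<in> J then c j else 0))"
proof -
  interpret M: smodule "chain_sum f n" "sact (seg f 0 n) (chain_sum f n)"
    by (rule smodule_sact[OF chain_sum_module])
  have "finite J" using assms finite_subset by blast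
  then show ?thesis using assms
  proof (induction J rule: finite_induct)
    case empty
    then show ?case by (simp add: chain_sum_simps(1))
  next
    case (insert i J)
    have "chain_unit f n \<in> insert i J \<rightarrow> carrier (chain_sum f n)" by (simp add: chain_unit_closed)
    then have "M.lc (insert i J) c (chain_unit f n)
        = sact (seg f 0 n) (chain_sum f n) (c i) (chain_unit f n i) \<oplus>\<^bsub>chain_sum f n\<^esub> M.lc J c (chain_unit f n)"
      using insert.hyps by (intro M.lc_insert)
    also have "\<dots> = (\<lambda>j\<in>{1..n}. cls (seg f 0 j) (if j \<in> insert i J then c j else 0))"
      using insert by (auto simp: sact_chain_unit chain_sum_simps(2) kxy_quot_module_simps(3) fun_eq_iff)
    finally show ?case .
  qed
qed

lemma chain_sum_basis:
  "smodule.cyclic_basis (chain_sum f n) (sact (seg f 0 n) (chain_sum f n)) (carrier (chain_sum f n))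
    {1..n} (chain_unit f n) (\<lambda>i. seg f 0 i)"
proof -
  interpret M: smodule "chain_sum f n" "sact (seg f 0 n) (chain_sum f n)"
    by (rule smodule_sact[OF chain_sum_module])
  show ?thesis
    unfolding M.cyclic_basis_def
  proof (intro conjI ballI allI impI subsetI)
    fix v assume v: "v \<in> carrier (chain_sum f n)"
    have "v = M.lc {1..n} (\<lambda>i. rep (v i)) (chain_unit f n)"
    proof
      fix j
      show "v j = M.lc {1..n} (\<lambda>i. rep (v i)) (chain_unit f n) j"
        using chain_sum_component[OF v, of j] v
        by (cases "j \<in> {1..n}") (auto simp: lc_chain_unit chain_sum_carrier PiE_iff extensional_def)
    qed
    then show "v \<in> M.span {1..n} (chain_unit f n)" using M.lc_in_span by metis
  next
    fix i assume i: "i \<in> {1..n}"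
    show "sact (seg f 0 n) (chain_sum f n) (seg f 0 i) (chain_unit f n i) = \<zero>\<^bsub>chain_sum f n\<^esub>"
      by (auto simp: sact_chain_unit chain_sum_simps(1) fun_eq_iff cls_eq_iff)
    fix c assume "M.lc {1..n} c (chain_unit f n) = \<zero>\<^bsub>chain_sum f n\<^esub>"
    then have "M.lc {1..n} c (chain_unit f n) i = \<zero>\<^bsub>chain_sum f n\<^esub> i" by simp
    then show "seg f 0 i dvd c i" using i by (simp add: lc_chain_unit chain_sum_simps(1) cls_eq_iff)
  qed (simp_all add: chain_unit_closed)
qed

lemma chain_sum_sact_component:
  assumes v: "v \<in> carrier (chain_sum f n)" and j: "j \<in> {1..n}"
  shows "sact (seg f 0 n) (chain_sum f n) s v j = cls (seg f 0 j) (s * rep (v j))"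
proof -
  have "cls (seg f 0 n) s \<odot>\<^bsub>kxy_quot_module (seg f 0 j)\<^esub> cls (seg f 0 j) (rep (v j)) = cls (seg f 0 j) (s * rep (v j))"
    using j by (intro kxy_quot_module_simps(4) seg_dvd_seg) simp
  then show ?thesis using j chain_sum_component[OF v j] by (simp add: chain_sum_simps(3))
qed

definition regular_on :: "'k::field fps fps \<Rightarrow> ('k fps fps set, 'x, 'z) module_scheme \<Rightarrow> 'k fps fps \<Rightarrow> bool" where
  "regular_on F Y t \<longleftrightarrow> (\<forall>v\<in>carrier Y. sact F Y t v = \<zero>\<^bsub>Y\<^esub> \<longrightarrow> v = \<zero>\<^bsub>Y\<^esub>)"

lemma chain_sum_regular:
  assumes f: "factors f n" and t: "\<forall>i\<in>{1..n}. \<not> f i dvd t"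
  shows "regular_on (seg f 0 n) (chain_sum f n) t"
  unfolding regular_on_def
proof (intro ballI impI)
  fix v assume v: "v \<in> carrier (chain_sum f n)" and z: "sact (seg f 0 n) (chain_sum f n) t v = \<zero>\<^bsub>chain_sum f n\<^esub>"
  have "v j = cls (seg f 0 j) 0" if j: "j \<in> {1..n}" for j
  proof -
    have "cls (seg f 0 j) (t * rep (v j)) = cls (seg f 0 j) 0"
      using chain_sum_sact_component[OF v j, of t] z j by (simp add: chain_sum_simps(1))
    then have "seg f 0 j dvd t * rep (v j)" by (simp add: cls_eq_iff)
    then have "seg f 0 j dvd rep (v j)"
      by (rule seg_dvd_cancel[rotated 2]) (use factors_prime[OF f] t j in auto)
    then have "cls (seg f 0 j) (rep (v j)) = cls (seg f 0 j) 0" by (simp add: cls_eq_iff)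
    then show ?thesis using chain_sum_component[OF v j] by simp
  qed
  then show "v = \<zero>\<^bsub>chain_sum f n\<^esub>"
    using v by (auto simp: chain_sum_simps(1) chain_sum_carrier PiE_iff extensional_def fun_eq_iff)
qed

text \<open>Componentwise: let \<open>seg f i n * s\<close> be divisible by \<open>seg f 0 j\<close>.  If \<open>j \<le> i\<close>, coprimality makes \<open>s\<close> vanish modulo
  \<open>seg f 0 j\<close>.  If \<open>i < j\<close>, it is divisible in particular by \<open>seg f 0 i\<close>, and coprimality makes \<open>s\<close> a multiple of
  \<open>seg f 0 i\<close>.  This is the vanishing of all \<open>Ext\<^sup>1(S\<^sub>i, S\<^sub>j)\<close>.\<close>

lemma chain_sum_kernel_condition:
  assumes f: "factors f n"
  shows "smodule.kernel_condition (chain_sum f n) (sact (seg f 0 n) (chain_sum f n)) f n (carrier (chain_sum f n))"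
proof -
  interpret M: smodule "chain_sum f n" "sact (seg f 0 n) (chain_sum f n)"
    by (rule smodule_sact[OF chain_sum_module])
  show ?thesis
    unfolding M.kernel_condition_def
  proof (intro ballI impI)
    fix i v assume i: "i \<in> {1..n}" and v: "v \<in> carrier (chain_sum f n)"
      and z: "sact (seg f 0 n) (chain_sum f n) (seg f i n) v = \<zero>\<^bsub>chain_sum f n\<^esub>"
    have "\<exists>u. seg f 0 j dvd rep (v j) - seg f 0 i * u" if j: "j \<in> {1..n}" for j
    proof -
      have "cls (seg f 0 j) (seg f i n * rep (v j)) = cls (seg f 0 j) 0"
        using chain_sum_sact_component[OF v j, of "seg f i n"] z j by (simp add: chain_sum_simps(1))
      then have d: "seg f 0 j dvd seg f i n * rep (v j)" by (simp add: cls_eq_iff)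
      show ?thesis
      proof (cases "j \<le> i")
        case True
        have "seg f 0 j dvd rep (v j)" by (rule factors_seg_cancel[OF f True _ d]) (use i in simp)
        then show ?thesis by (intro exI[of _ 0]) simp
      next
        case False
        then have "seg f 0 i dvd seg f i n * rep (v j)" using dvd_trans[OF seg_dvd_seg[of i j f] d] by simp
        then have "seg f 0 i dvd rep (v j)" by (rule factors_seg_cancel[OF f order_refl, rotated]) (use i in simp)
        then obtain u where "rep (v j) = seg f 0 i * u" ..
        then show ?thesis by (intro exI[of _ u]) simp
      qed
    qed
    then obtain u where u: "\<And>j. j \<in> {1..n} \<Longrightarrow> seg f 0 j dvd rep (v j) - seg f 0 i * u j" by metis
    define w where "w = (\<lambda>j\<in>{1..n}. cls (seg f 0 j) (u j))"
    have w: "w \<in> carrier (chain_sum f n)" by (simp add: w_def chain_sum_carrier)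
    have "v j = sact (seg f 0 n) (chain_sum f n) (seg f 0 i) w j" if j: "j \<in> {1..n}" for j
    proof -
      have "seg f 0 j dvd u j - rep (w j)"
        using rep_cls[of "seg f 0 j" "u j", THEN iffD2[OF dvd_minus_iff]] j by (simp add: w_def)
      then have "seg f 0 j dvd (rep (v j) - seg f 0 i * u j) + seg f 0 i * (u j - rep (w j))"
        using u[OF j] by (intro dvd_add dvd_mult)
      then have "cls (seg f 0 j) (rep (v j)) = cls (seg f 0 j) (seg f 0 i * rep (w j))"
        by (simp add: cls_eq_iff algebra_simps)
      then show ?thesis using chain_sum_sact_component[OF w j] chain_sum_component[OF v j] by simp
    qed
    then have "v = sact (seg f 0 n) (chain_sum f n) (seg f 0 i) w"
      using v M.act_closed[OF w, of "seg f 0 i"]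
      by (intro extensionalityI[of v "{1..n}"]) (auto simp: chain_sum_carrier PiE_iff)
    then show "\<exists>w\<in>carrier (chain_sum f n). v = sact (seg f 0 n) (chain_sum f n) (seg f 0 i) w"
      using w by blast
  qed
qed

lemma (in smodule) fg_of_span:
  assumes A: "sub A" and "finite I" "\<And>i. i \<in> I \<Longrightarrow> e i \<in> A" "A \<subseteq> span I e"
  shows "fg A"
proof -
  have eX: "e ` I \<subseteq> carrier V" using assms(3) subD(1)[OF A] by blast
  have s: "sub (span (e ` I) (\<lambda>b. b))" using assms(2) eX by (intro sub_span) auto
  have "span I e \<subseteq> span (e ` I) (\<lambda>b. b)"
  proof (rule span_least[OF s assms(2)])
    fix i assume "i \<in> I"
    then show "e i \<in> span (e ` I) (\<lambda>b. b)" using span_base[of "e ` I" "\<lambda>b. b" "e i"] assms(2) eX by auto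
  qed
  moreover have "e ` I \<subseteq> A" using assms(3) by blast
  ultimately show ?thesis unfolding fg_def using assms(2,4) by (intro exI[of _ "e ` I"]) auto
qed

lemma (in abelian_group) add_eq_imp_diff_eq:
  assumes c: "x \<in> carrier G" "y \<in> carrier G" "a \<in> carrier G" "b \<in> carrier G"
    and eq: "x \<oplus> y = a \<oplus> b"
  shows "x \<ominus> a = b \<ominus> y"
proof -
  have "(x \<oplus> y) \<oplus> (\<ominus> y \<oplus> \<ominus> a) = (x \<oplus> \<ominus> a) \<oplus> (y \<oplus> \<ominus> y)"
    using c by (simp only: a_ac a_closed a_inv_closed)
  moreover have "(a \<oplus> b) \<oplus> (\<ominus> y \<oplus> \<ominus> a) = (b \<oplus> \<ominus> y) \<oplus> (a \<oplus> \<ominus> a)"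
    using c by (simp only: a_ac a_closed a_inv_closed)
  ultimately show ?thesis using c eq by (simp add: a_minus_def r_neg)
qed

section \<open>Finite powers and retracts\<close>

definition power_module :: "nat \<Rightarrow> ('r, 'm, 'd) module_scheme \<Rightarrow> ('r, nat \<Rightarrow> 'm) module" where
  "power_module m N = direct_sum {..<m} (\<lambda>_. N)"

lemma power_module_module: "cring R \<Longrightarrow> Module.module R N \<Longrightarrow> Module.module R (power_module m N)"
  unfolding power_module_def by (rule direct_sum_module)

lemma power_module_simps:
  "carrier (power_module m N) = (\<Pi>\<^sub>E j\<in>{..<m}. carrier N)"
  "\<zero>\<^bsub>power_module m N\<^esub> = (\<lambda>j\<in>{..<m}. \<zero>\<^bsub>N\<^esub>)"
  "v \<oplus>\<^bsub>power_module m N\<^esub> w = (\<lambda>j\<in>{..<m}. v j \<oplus>\<^bsub>N\<^esub> w j)"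
  "a \<odot>\<^bsub>power_module m N\<^esub> v = (\<lambda>j\<in>{..<m}. a \<odot>\<^bsub>N\<^esub> v j)"
  by (simp_all add: power_module_def direct_sum_carrier_finite direct_sum_simps)

lemma power_module_sact: "sact F (power_module m N) s v = (\<lambda>j\<in>{..<m}. sact F N s (v j))"
  by (simp add: sact_def power_module_simps)

lemma power_module_fg:
  assumes N: "Module.module (kxy_quot F) N" and fg: "smodule.fg N (sact F N) (carrier N)"
  shows "smodule.fg (power_module m N) (sact F (power_module m N)) (carrier (power_module m N))"
proof -
  have Pm: "Module.module (kxy_quot F) (power_module m N)"
    by (rule power_module_module[OF kxy_quot_cring N])
  interpret N: smodule N "sact F N" by (rule smodule_sact[OF N])
  interpret P: smodule "power_module m N" "sact F (power_module m N)" by (rule smodule_sact[OF Pm])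
  obtain B where B: "finite B" "B \<subseteq> carrier N" "carrier N \<subseteq> N.span B (\<lambda>b. b)" using fg unfolding N.fg_def by blast
  define emb where "emb j x = (\<lambda>j'\<in>{..<m}. if j' = j then x else \<zero>\<^bsub>N\<^esub>)" for j x
  have embc: "emb j x \<in> carrier (power_module m N)" if "x \<in> carrier N" for j x
    using that by (simp add: emb_def power_module_simps)
  have emba: "emb j (x \<oplus>\<^bsub>N\<^esub> y) = emb j x \<oplus>\<^bsub>power_module m N\<^esub> emb j y" if "x \<in> carrier N" "y \<in> carrier N" for j x y
    using that by (auto simp: emb_def power_module_simps fun_eq_iff)
  have embs: "emb j (sact F N s x) = sact F (power_module m N) s (emb j x)" if "x \<in> carrier N" for j x s
    using that by (auto simp: emb_def power_module_sact fun_eq_iff)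
  let ?E = "\<lambda>(j, b). emb j b" and ?I = "{..<m} \<times> B"
  have EI: "?E \<in> ?I \<rightarrow> carrier (power_module m N)" using B(2) embc by auto
  have s: "P.sub (P.span ?I ?E)" using B(1) EI by (intro P.sub_span) auto
  have embS: "emb j x \<in> P.span ?I ?E" if j: "j < m" and x: "x \<in> carrier N" for j x
  proof -
    obtain c where c: "x = N.lc B c (\<lambda>b. b)" using B(3) x by (auto simp: N.span_def)
    have "emb j x = P.lc B c (emb j)"
      unfolding c
      using smodule_hom_lc[where w = "emb j" and x = "\<lambda>b. b" and c = c, OF N.smodule_axioms P.smodule_axioms
          N.sub_carrier emba embs embc B(1) subsetD[OF B(2)]] by simp
    also have "\<dots> \<in> P.span ?I ?E"
    proof (rule P.lc_in_sub[OF s B(1)])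
      fix b assume "b \<in> B"
      then show "emb j b \<in> P.span ?I ?E" using P.span_base[of ?I ?E "(j, b)"] B(1) EI j by auto
    qed
    finally show ?thesis .
  qed
  have "carrier (power_module m N) \<subseteq> P.span ?I ?E"
  proof
    fix v assume v: "v \<in> carrier (power_module m N)"
    then have vc: "v j \<in> carrier N" if "j < m" for j using that by (auto simp: power_module_simps)
    have "P.lc J (\<lambda>_. 1) (\<lambda>j. emb j (v j)) = (\<lambda>j\<in>{..<m}. if j \<in> J then v j else \<zero>\<^bsub>N\<^esub>)"
      if "finite J" "J \<subseteq> {..<m}" for J
      using that
    proof (induction J rule: finite_induct)
      case empty
      then show ?case by (simp add: power_module_simps)
    next
      case (insert i J)
      have "(\<lambda>j. emb j (v j)) \<in> insert i J \<rightarrow> carrier (power_module m N)" using insert.prems vc embc by auto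
      then have "P.lc (insert i J) (\<lambda>_. 1) (\<lambda>j. emb j (v j)) = emb i (v i) \<oplus>\<^bsub>power_module m N\<^esub> P.lc J (\<lambda>_. 1) (\<lambda>j. emb j (v j))"
        using insert.hyps by (simp add: P.lc_insert)
      also have "P.lc J (\<lambda>_. 1) (\<lambda>j. emb j (v j)) = (\<lambda>j\<in>{..<m}. if j \<in> J then v j else \<zero>\<^bsub>N\<^esub>)"
        by (rule insert.IH) (use insert.prems in auto)
      also have "emb i (v i) \<oplus>\<^bsub>power_module m N\<^esub> \<dots>
          = (\<lambda>j\<in>{..<m}. if j \<in> insert i J then v j else \<zero>\<^bsub>N\<^esub>)"
        using insert.hyps(2) vc by (auto simp: emb_def power_module_simps fun_eq_iff)
      finally show ?case .
    qed
    from this[of "{..<m}"] have "P.lc {..<m} (\<lambda>_. 1) (\<lambda>j. emb j (v j)) = v"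
      using v by (auto simp: power_module_simps PiE_iff extensional_def fun_eq_iff)
    moreover have "P.lc {..<m} (\<lambda>_. 1) (\<lambda>j. emb j (v j)) \<in> P.span ?I ?E"
      using vc embS by (intro P.lc_in_sub[OF s]) auto
    ultimately show "v \<in> P.span ?I ?E" by simp
  qed
  then show ?thesis
    by (intro P.fg_of_span[OF P.sub_carrier _ funcset_mem[OF EI]]) (use B(1) in simp_all)
qed

lemma power_module_regular:
  assumes "regular_on F N t"
  shows "regular_on F (power_module m N) t"
  unfolding regular_on_def
proof (intro ballI impI)
  fix v assume v: "v \<in> carrier (power_module m N)" and z: "sact F (power_module m N) t v = \<zero>\<^bsub>power_module m N\<^esub>"
  have "v j = \<zero>\<^bsub>N\<^esub>" if j: "j < m" for j
  proof -
    have "sact F N t (v j) = \<zero>\<^bsub>N\<^esub>" using fun_cong[OF z, of j] j by (simp add: power_module_sact power_module_simps)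
    moreover have "v j \<in> carrier N" using v j by (auto simp: power_module_simps)
    ultimately show ?thesis using assms unfolding regular_on_def by blast
  qed
  then show "v = \<zero>\<^bsub>power_module m N\<^esub>"
    using v by (auto simp: power_module_simps PiE_iff extensional_def fun_eq_iff)
qed

lemma power_module_kernel_condition:
  assumes N: "Module.module (kxy_quot F) N" and kc: "smodule.kernel_condition N (sact F N) f n (carrier N)"
  shows "smodule.kernel_condition (power_module m N) (sact F (power_module m N)) f n (carrier (power_module m N))"
proof -
  have Pm: "Module.module (kxy_quot F) (power_module m N)"
    by (rule power_module_module[OF kxy_quot_cring N])
  interpret N: smodule N "sact F N" by (rule smodule_sact[OF N])
  interpret P: smodule "power_module m N" "sact F (power_module m N)" by (rule smodule_sact[OF Pm])
  show ?thesis
    unfolding P.kernel_condition_def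
  proof (intro ballI impI)
    fix i v assume i: "i \<in> {1..n}" and v: "v \<in> carrier (power_module m N)"
      and z: "sact F (power_module m N) (seg f i n) v = \<zero>\<^bsub>power_module m N\<^esub>"
    have "\<exists>w\<in>carrier N. v j = sact F N (seg f 0 i) w" if j: "j < m" for j
    proof -
      have "sact F N (seg f i n) (v j) = \<zero>\<^bsub>N\<^esub>"
        using fun_cong[OF z, of j] j by (simp add: power_module_sact power_module_simps)
      moreover have "v j \<in> carrier N" using v j by (auto simp: power_module_simps)
      ultimately show ?thesis using kc i unfolding N.kernel_condition_def by blast
    qed
    then obtain w where w: "\<And>j. j < m \<Longrightarrow> w j \<in> carrier N" "\<And>j. j < m \<Longrightarrow> v j = sact F N (seg f 0 i) (w j)"
      by metis
    have "restrict w {..<m} \<in> carrier (power_module m N)" using w(1) by (simp add: power_module_simps)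
    moreover have "v = sact F (power_module m N) (seg f 0 i) (restrict w {..<m})"
      using v w(2) by (auto simp: power_module_simps power_module_sact PiE_iff extensional_def fun_eq_iff)
    ultimately show "\<exists>w\<in>carrier (power_module m N). v = sact F (power_module m N) (seg f 0 i) w" by blast
  qed
qed

text \<open>Finite generation, regularity of \<open>t\<close> and the kernel condition are expressed by linear equations;
  they hold in \<open>P\<close> after applying \<open>\<iota>\<close>, and \<open>\<rho>\<close> carries their solutions back to \<open>Y\<close>.\<close>

lemma retract_inherits:
  assumes P: "Module.module (kxy_quot F) P" and Y: "Module.module (kxy_quot F) Y"
    and \<iota>: "\<And>y. y \<in> carrier Y \<Longrightarrow> \<iota> y \<in> carrier P"
      "\<And>s y. y \<in> carrier Y \<Longrightarrow> \<iota> (sact F Y s y) = sact F P s (\<iota> y)"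
    and \<rho>: "\<And>x. x \<in> carrier P \<Longrightarrow> \<rho> x \<in> carrier Y"
      "\<And>x y. x \<in> carrier P \<Longrightarrow> y \<in> carrier P \<Longrightarrow> \<rho> (x \<oplus>\<^bsub>P\<^esub> y) = \<rho> x \<oplus>\<^bsub>Y\<^esub> \<rho> y"
      "\<And>s x. x \<in> carrier P \<Longrightarrow> \<rho> (sact F P s x) = sact F Y s (\<rho> x)"
    and \<rho>\<iota>: "\<And>y. y \<in> carrier Y \<Longrightarrow> \<rho> (\<iota> y) = y"
  shows "smodule.fg P (sact F P) (carrier P) \<Longrightarrow> smodule.fg Y (sact F Y) (carrier Y)"
    and "regular_on F P t \<Longrightarrow> regular_on F Y t"
    and "smodule.kernel_condition P (sact F P) f n (carrier P) \<Longrightarrow>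
      smodule.kernel_condition Y (sact F Y) f n (carrier Y)"
proof -
  interpret P: smodule P "sact F P" by (rule smodule_sact[OF P])
  interpret Y: smodule Y "sact F Y" by (rule smodule_sact[OF Y])
  have \<iota>0: "\<iota> \<zero>\<^bsub>Y\<^esub> = \<zero>\<^bsub>P\<^esub>" using \<iota>(2)[of "\<zero>\<^bsub>Y\<^esub>" 0] \<iota>(1) by simp
  have \<rho>0: "\<rho> \<zero>\<^bsub>P\<^esub> = \<zero>\<^bsub>Y\<^esub>" using \<rho>\<iota>[of "\<zero>\<^bsub>Y\<^esub>"] \<iota>0 by simp
  {
    assume "P.fg (carrier P)"
    then obtain B where B: "finite B" "B \<subseteq> carrier P" "carrier P \<subseteq> P.span B (\<lambda>b. b)" unfolding P.fg_def by blast
    have "carrier Y \<subseteq> Y.span B \<rho>"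
    proof
      fix y assume y: "y \<in> carrier Y"
      then obtain c where c: "\<iota> y = P.lc B c (\<lambda>b. b)" using B(3) \<iota>(1) by (auto simp: P.span_def)
      have "\<rho> (\<iota> y) = Y.lc B c \<rho>"
        unfolding c
        using smodule_hom_lc[where w = \<rho> and x = "\<lambda>b. b" and c = c, OF P.smodule_axioms Y.smodule_axioms
            P.sub_carrier \<rho>(2,3,1) B(1) subsetD[OF B(2)]] by simp
      then show "y \<in> Y.span B \<rho>" using \<rho>\<iota>[OF y] by auto
    qed
    then show "Y.fg (carrier Y)" using B(1,2) \<rho>(1) by (intro Y.fg_of_span[OF Y.sub_carrier, of B \<rho>]) auto
  }
  {
    assume r: "regular_on F P t"
    show "regular_on F Y t"
      unfolding regular_on_def
    proof (intro ballI impI)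
      fix v assume v: "v \<in> carrier Y" "sact F Y t v = \<zero>\<^bsub>Y\<^esub>"
      then have "sact F P t (\<iota> v) = \<zero>\<^bsub>P\<^esub>" using \<iota>(2)[OF v(1), of t] \<iota>0 by simp
      then have "\<iota> v = \<zero>\<^bsub>P\<^esub>" using r \<iota>(1)[OF v(1)] unfolding regular_on_def by blast
      then show "v = \<zero>\<^bsub>Y\<^esub>" using \<rho>\<iota>[OF v(1)] \<rho>0 by simp
    qed
  }
  {
    assume kc: "P.kernel_condition f n (carrier P)"
    show "Y.kernel_condition f n (carrier Y)"
      unfolding Y.kernel_condition_def
    proof (intro ballI impI)
      fix i v assume i: "i \<in> {1..n}" and v: "v \<in> carrier Y" "sact F Y (seg f i n) v = \<zero>\<^bsub>Y\<^esub>"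
      then have "sact F P (seg f i n) (\<iota> v) = \<zero>\<^bsub>P\<^esub>" using \<iota>(2)[OF v(1), of "seg f i n"] \<iota>0 by simp
      then obtain w where w: "w \<in> carrier P" "\<iota> v = sact F P (seg f 0 i) w"
        using kc i \<iota>(1)[OF v(1)] unfolding P.kernel_condition_def by blast
      have "v = sact F Y (seg f 0 i) (\<rho> w)" using \<rho>\<iota>[OF v(1)] \<rho>(3)[OF w(1)] w(2) by simp
      then show "\<exists>w\<in>carrier Y. v = sact F Y (seg f 0 i) w" using \<rho>(1)[OF w(1)] by blast
    qed
  }
qed

lemma is_add_retract:
  assumes M: "Module.module (kxy_quot F) M" and add: "is_add (kxy_quot F) M Y"
  obtains m \<iota> \<rho> where
    "\<And>y. y \<in> carrier Y \<Longrightarrow> \<iota> y \<in> carrier (power_module m M)"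
    "\<And>s y. y \<in> carrier Y \<Longrightarrow> \<iota> (sact F Y s y) = sact F (power_module m M) s (\<iota> y)"
    "\<And>x. x \<in> carrier (power_module m M) \<Longrightarrow> \<rho> x \<in> carrier Y"
    "\<And>x y. x \<in> carrier (power_module m M) \<Longrightarrow> y \<in> carrier (power_module m M) \<Longrightarrow>
      \<rho> (x \<oplus>\<^bsub>power_module m M\<^esub> y) = \<rho> x \<oplus>\<^bsub>Y\<^esub> \<rho> y"
    "\<And>s x. x \<in> carrier (power_module m M) \<Longrightarrow> \<rho> (sact F (power_module m M) s x) = sact F Y s (\<rho> x)"
    "\<And>y. y \<in> carrier Y \<Longrightarrow> \<rho> (\<iota> y) = y"
proof -
  obtain m A where A: "direct_summand (kxy_quot F) (power_module m M) A"
    and iso: "mod_isomorphic (kxy_quot F) Y ((power_module m M)\<lparr>carrier := A\<rparr>)"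
    and Y: "Module.module (kxy_quot F) Y"
    using add unfolding is_add_def power_module_def by blast
  let ?P = "power_module m M"
  have Pm: "Module.module (kxy_quot F) ?P" by (rule power_module_module[OF kxy_quot_cring M])
  interpret P: smodule ?P "sact F ?P" by (rule smodule_sact[OF Pm])
  interpret Y: smodule Y "sact F Y" by (rule smodule_sact[OF Y])
  obtain B where subs: "submodule A (kxy_quot F) ?P" "submodule B (kxy_quot F) ?P"
    and AB: "A \<inter> B = {\<zero>\<^bsub>?P\<^esub>}" "A <+>\<^bsub>?P\<^esub> B = carrier ?P"
    using A unfolding direct_summand_def by blast
  have sub: "P.sub C" if C: "submodule C (kxy_quot F) ?P" for C
    using Module.module.submoduleE[OF Pm C] subgroup.one_closed[OF submodule.axioms(1)[OF C]]
    unfolding P.sub_def by (auto simp: sact_def)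
  note AD = P.subD[OF sub[OF subs(1)]] and BD = P.subD[OF sub[OF subs(2)]]
  obtain h where h: "h \<in> mod_hom (kxy_quot F) Y (?P\<lparr>carrier := A\<rparr>)" "bij_betw h (carrier Y) A"
    using iso unfolding mod_isomorphic_def by auto
  have hA: "h y \<in> A" if "y \<in> carrier Y" for y using mod_homD(1)[OF h(1) that] by simp
  have ha: "h (x \<oplus>\<^bsub>Y\<^esub> y) = h x \<oplus>\<^bsub>?P\<^esub> h y" if "x \<in> carrier Y" "y \<in> carrier Y" for x y
    using mod_homD(2)[OF h(1) that] by simp
  have hs: "h (sact F Y s y) = sact F ?P s (h y)" if "y \<in> carrier Y" for s y
    using mod_hom_sact[OF h(1) that] by (simp add: sact_def)
  have "\<exists>a\<in>A. \<exists>b\<in>B. x = a \<oplus>\<^bsub>?P\<^esub> b" if "x \<in> carrier ?P" for x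
    using that unfolding AB(2)[symmetric] by (auto simp: set_add_def set_mult_def)
  then obtain pa pb where p: "\<And>x. x \<in> carrier ?P \<Longrightarrow> pa x \<in> A" "\<And>x. x \<in> carrier ?P \<Longrightarrow> pb x \<in> B"
    "\<And>x. x \<in> carrier ?P \<Longrightarrow> x = pa x \<oplus>\<^bsub>?P\<^esub> pb x" by metis
  have puniq: "pa x = a" if x: "x \<in> carrier ?P" and a: "a \<in> A" and b: "b \<in> B" and eq: "x = a \<oplus>\<^bsub>?P\<^esub> b" for x a b
  proof -
    have c: "pa x \<in> carrier ?P" "pb x \<in> carrier ?P" "a \<in> carrier ?P" "b \<in> carrier ?P"
      using AD(1) BD(1) p x a b by auto
    have e: "pa x \<ominus>\<^bsub>?P\<^esub> a = b \<ominus>\<^bsub>?P\<^esub> pb x"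
      using c p(3)[OF x] eq by (intro P.add_eq_imp_diff_eq) auto
    have "pa x \<ominus>\<^bsub>?P\<^esub> a \<in> A" using AD(6) p(1)[OF x] a by blast
    moreover have "pa x \<ominus>\<^bsub>?P\<^esub> a \<in> B" unfolding e using BD(6) p(2)[OF x] b by blast
    ultimately have "pa x \<ominus>\<^bsub>?P\<^esub> a = \<zero>\<^bsub>?P\<^esub>" using AB(1) by blast
    moreover have "pa x = (pa x \<ominus>\<^bsub>?P\<^esub> a) \<oplus>\<^bsub>?P\<^esub> a"
      using c by (simp add: a_minus_def P.a_assoc P.l_neg)
    ultimately show ?thesis using c by simp
  qed
  define \<rho> where "\<rho> x = inv_into (carrier Y) h (pa x)" for x
  have h\<rho>: "\<rho> x \<in> carrier Y" "h (\<rho> x) = pa x" if "x \<in> carrier ?P" for x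
    using p(1)[OF that] h(2) unfolding \<rho>_def bij_betw_def
    by (auto intro: inv_into_into f_inv_into_f)
  have hinj: "x = y" if "h x = h y" "x \<in> carrier Y" "y \<in> carrier Y" for x y
    using h(2) that unfolding bij_betw_def inj_on_def by blast
  show ?thesis
  proof (rule that[of h m \<rho>])
    fix y assume y: "y \<in> carrier Y"
    show hP: "h y \<in> carrier ?P" using hA[OF y] AD(1) by blast
    have "h y = h y \<oplus>\<^bsub>?P\<^esub> \<zero>\<^bsub>?P\<^esub>" using hA[OF y] AD(1) by simp
    then have "pa (h y) = h y" by (rule puniq[OF hP hA[OF y] BD(2)])
    then have "h (\<rho> (h y)) = h y" using h\<rho>(2)[OF hP] by simp
    then show "\<rho> (h y) = y" by (rule hinj[OF _ h\<rho>(1)[OF hP] y])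
    show "h (sact F Y s y) = sact F ?P s (h y)" for s using y by (rule hs)
  next
    fix x assume x: "x \<in> carrier ?P"
    show "\<rho> x \<in> carrier Y" using h\<rho> x by blast
    have c: "pa x \<in> carrier ?P" "pb x \<in> carrier ?P" using AD(1) BD(1) p x by auto
    show "\<rho> (sact F ?P s x) = sact F Y s (\<rho> x)" for s
    proof (rule hinj)
      have "sact F ?P s x = sact F ?P s (pa x) \<oplus>\<^bsub>?P\<^esub> sact F ?P s (pb x)"
        using arg_cong[OF p(3)[OF x], of "sact F ?P s"] P.act_add_right[OF c, of s] by (rule trans)
      then have "pa (sact F ?P s x) = sact F ?P s (pa x)"
        by (rule puniq[OF P.act_closed[OF x] AD(4)[OF p(1)[OF x]] BD(4)[OF p(2)[OF x]]])
      then show "h (\<rho> (sact F ?P s x)) = h (sact F Y s (\<rho> x))"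
        using h\<rho>[OF x] h\<rho>[OF P.act_closed[OF x]] hs by simp
    qed (use h\<rho> x in auto)
    fix y assume y: "y \<in> carrier ?P"
    have d: "pa y \<in> carrier ?P" "pb y \<in> carrier ?P" using AD(1) BD(1) p y by auto
    show "\<rho> (x \<oplus>\<^bsub>?P\<^esub> y) = \<rho> x \<oplus>\<^bsub>Y\<^esub> \<rho> y"
    proof (rule hinj)
      have "x \<oplus>\<^bsub>?P\<^esub> y = (pa x \<oplus>\<^bsub>?P\<^esub> pb x) \<oplus>\<^bsub>?P\<^esub> (pa y \<oplus>\<^bsub>?P\<^esub> pb y)" 
        by (rule arg_cong2[OF p(3)[OF x] p(3)[OF y]])
      also have "\<dots> = (pa x \<oplus>\<^bsub>?P\<^esub> pa y) \<oplus>\<^bsub>?P\<^esub> (pb x \<oplus>\<^bsub>?P\<^esub> pb y)" using c d by (simp add: P.a_ac)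
      finally have "pa (x \<oplus>\<^bsub>?P\<^esub> y) = pa x \<oplus>\<^bsub>?P\<^esub> pa y"
        by (rule puniq[OF P.a_closed[OF x y] AD(3)[OF p(1)[OF x] p(1)[OF y]] BD(3)[OF p(2)[OF x] p(2)[OF y]]])
      then show "h (\<rho> (x \<oplus>\<^bsub>?P\<^esub> y)) = h (\<rho> x \<oplus>\<^bsub>Y\<^esub> \<rho> y)"
        using h\<rho>[OF x] h\<rho>[OF y] h\<rho>[OF P.a_closed[OF x y]] ha by simp
    qed (use h\<rho> x y in auto)
  qed
qed

text \<open>A sum of \<open>m\<close> cyclic modules \<open>S / (seg f 0 l)\<close> is the summand of the \<open>m\<close>-th power of the chain sum that consists
  of one component in each copy.\<close>

theorem is_add_of_standard_basis:
  fixes f :: "nat \<Rightarrow> 'k::field fps fps" and n :: nat and Y :: "('k fps fps set, 'x) module"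
  defines "F \<equiv> seg f 0 n"
  assumes Y: "Module.module (kxy_quot F) Y"
    and basis: "smodule.has_standard_basis Y (sact F Y) f n (carrier Y)"
  shows "is_add (kxy_quot F) (chain_sum f n) Y"
proof -
  let ?M = "chain_sum f n" and ?R = "kxy_quot F"
  have M: "Module.module ?R ?M" unfolding F_def by (rule chain_sum_module)
  interpret M: smodule ?M "sact F ?M" by (rule smodule_sact[OF M])
  interpret Y: smodule Y "sact F Y" by (rule smodule_sact[OF Y])
  obtain I :: "'x set" and e l where l: "l \<in> I \<rightarrow> {1..n}"
    and b: "Y.cyclic_basis (carrier Y) I e (\<lambda>i. seg f 0 (l i))"
    using basis unfolding Y.has_standard_basis_def by blast
  note b' = b[unfolded Y.cyclic_basis_def]
  have fin: "finite I" using b' by (rule conjunct1)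
  have eY: "e \<in> I \<rightarrow> carrier Y" using b'[THEN conjunct2] by (rule conjunct1)
  have sp: "carrier Y \<subseteq> Y.span I e" using b'[THEN conjunct2, THEN conjunct2] by (rule conjunct1)
  have kill: "sact F Y (seg f 0 (l i)) (e i) = \<zero>\<^bsub>Y\<^esub>" if i: "i \<in> I" for i
    using b'[THEN conjunct2, THEN conjunct2, THEN conjunct2, THEN conjunct1] i by (rule bspec)
  have ind: "seg f 0 (l i) dvd c i" if z: "Y.lc I c e = \<zero>\<^bsub>Y\<^esub>" and i: "i \<in> I" for c i
    by (rule b'[THEN conjunct2, THEN conjunct2, THEN conjunct2, THEN conjunct2, rule_format, OF z i])
  have lc_eq_iff: "Y.lc I c e = Y.lc I d e \<longleftrightarrow> (\<forall>i\<in>I. seg f 0 (l i) dvd c i - d i)" for c d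
  proof
    assume "Y.lc I c e = Y.lc I d e"
    then have "Y.lc I (\<lambda>i. c i - d i) e = \<zero>\<^bsub>Y\<^esub>"
      using eY by (simp add: Y.lc_diff[OF fin eY] a_minus_def Y.r_neg)
    then show "\<forall>i\<in>I. seg f 0 (l i) dvd c i - d i" using ind by blast
  next
    assume d: "\<forall>i\<in>I. seg f 0 (l i) dvd c i - d i"
    have "Y.lc I (\<lambda>i. c i - d i) e = \<zero>\<^bsub>Y\<^esub>"
    proof (rule Y.lc_zero)
      fix i assume i: "i \<in> I"
      then have "e i \<in> carrier Y" using eY by blast
      then show "sact F Y (c i - d i) (e i) = \<zero>\<^bsub>Y\<^esub>" using Y.act_dvd_zero kill[OF i] d i by blast
    qed
    then have "Y.lc I (\<lambda>i. (c i - d i) + d i) e = \<zero>\<^bsub>Y\<^esub> \<oplus>\<^bsub>Y\<^esub> Y.lc I d e"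
      by (simp only: Y.lc_add[OF fin eY])
    then show "Y.lc I c e = Y.lc I d e" using eY by simp
  qed
  obtain coef where coef: "\<And>y. y \<in> carrier Y \<Longrightarrow> y = Y.lc I (coef y) e"
  proof -
    have "\<forall>y\<in>carrier Y. \<exists>c. y = Y.lc I c e" using sp by (auto simp: Y.span_def)
    from bchoice[OF this] show ?thesis using that by blast
  qed
  define m where "m = card I"
  obtain \<beta> where \<beta>: "bij_betw \<beta> {..<m} I"
    using ex_bij_betw_nat_finite[OF fin] unfolding m_def atLeast0LessThan by blast
  have \<beta>I: "\<beta> j \<in> I" if "j < m" for j using \<beta> that by (auto simp: bij_betw_def)
  have l\<beta>: "l (\<beta> j) \<in> {1..n}" if "j < m" for j using l \<beta>I[OF that] by blast
  let ?P = "power_module m ?M"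
  have Pm: "Module.module ?R ?P" by (rule power_module_module[OF kxy_quot_cring M])
  interpret P: smodule ?P "sact F ?P" by (rule smodule_sact[OF Pm])
  \<comment> \<open>the element of \<open>M\<^sup>m\<close> whose \<open>j\<close>-th entry is \<open>a (\<beta> j)\<close> in the summand with index \<open>l (\<beta> j)\<close>\<close>
  define vec where "vec a = (\<lambda>j\<in>{..<m}. sact F ?M (a (\<beta> j)) (chain_unit f n (l (\<beta> j))))" for a
  have vec: "vec a = (\<lambda>j\<in>{..<m}. \<lambda>i\<in>{1..n}. cls (seg f 0 i) (if i = l (\<beta> j) then a (\<beta> j) else 0))" for a
    unfolding vec_def F_def sact_chain_unit by simp
  have vecP: "vec a \<in> carrier ?P" for a
    by (auto simp: vec_def power_module_simps chain_unit_closed intro!: M.act_closed)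
  have vec_add: "vec (\<lambda>i. a i + c i) = vec a \<oplus>\<^bsub>?P\<^esub> vec c" for a c
    by (auto simp: vec_def power_module_simps fun_eq_iff M.act_add_left chain_unit_closed)
  have vec_act: "vec (\<lambda>i. s * a i) = sact F ?P s (vec a)" for s a
    by (auto simp: vec_def power_module_sact fun_eq_iff M.act_act chain_unit_closed)
  have vec_eq_iff: "vec a = vec c \<longleftrightarrow> (\<forall>i\<in>I. seg f 0 (l i) dvd a i - c i)" for a c
  proof
    assume eq: "vec a = vec c"
    show "\<forall>i\<in>I. seg f 0 (l i) dvd a i - c i"
    proof
      fix i assume "i \<in> I"
      then obtain j where j: "j < m" "i = \<beta> j" using \<beta> by (auto simp: bij_betw_def)
      have "vec a j (l i) = vec c j (l i)" using eq by simp
      then show "seg f 0 (l i) dvd a i - c i" using j l\<beta>[OF j(1)] by (simp add: vec cls_eq_iff)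
    qed
  next
    assume "\<forall>i\<in>I. seg f 0 (l i) dvd a i - c i"
    then show "vec a = vec c" using \<beta>I by (auto simp: vec fun_eq_iff cls_eq_iff)
  qed
  \<comment> \<open>\<open>A\<close> keeps the component \<open>l (\<beta> j)\<close> of the copy \<open>j\<close>, and \<open>B\<close> the remaining ones.\<close>
  define A where "A = range vec"
  define B where "B = {p \<in> carrier ?P. \<forall>j<m. p j (l (\<beta> j)) = cls (seg f 0 (l (\<beta> j))) 0}"
  have submod: "submodule C ?R ?P" if C: "P.sub C" for C
  proof (rule Module.module.submoduleI[OF Pm])
    note CD = P.subD[OF C]
    show "C \<subseteq> carrier ?P" "\<zero>\<^bsub>?P\<^esub> \<in> C" using CD by auto
    show "\<ominus>\<^bsub>?P\<^esub> x \<in> C" if "x \<in> C" for x using CD(5) that .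
    show "x \<oplus>\<^bsub>?P\<^esub> y \<in> C" if "x \<in> C" "y \<in> C" for x y using CD(3) that .
    show "a \<odot>\<^bsub>?P\<^esub> x \<in> C" if "a \<in> carrier ?R" "x \<in> C" for a x
      using CD(4)[OF that(2)] that(1) by (auto simp: kxy_quot_carrier sact_def)
  qed
  have vec0: "vec (\<lambda>_. 0) = \<zero>\<^bsub>?P\<^esub>"
    by (auto simp: vec_def power_module_simps(2) fun_eq_iff chain_unit_closed)
  have "P.sub A"
    unfolding P.sub_def A_def
  proof (intro conjI ballI allI)
    show "range vec \<subseteq> carrier ?P" using vecP by blast
    show "\<zero>\<^bsub>?P\<^esub> \<in> range vec" using vec0 by (metis rangeI)
    show "u \<oplus>\<^bsub>?P\<^esub> v \<in> range vec" if "u \<in> range vec" "v \<in> range vec" for u v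
      using that by (auto simp flip: vec_add)
    show "sact F ?P s v \<in> range vec" if "v \<in> range vec" for s v
      using that by (auto simp flip: vec_act)
  qed
  then have subA: "submodule A ?R ?P" by (rule submod)
  have Pc: "p j \<in> carrier ?M" if "p \<in> carrier ?P" "j < m" for p j using that by (auto simp: power_module_simps)
  have "P.sub B"
    unfolding P.sub_def
  proof (intro conjI ballI allI)
    show "B \<subseteq> carrier ?P" by (auto simp: B_def)
    show "\<zero>\<^bsub>?P\<^esub> \<in> B" using P.zero_closed l\<beta> by (simp add: B_def power_module_simps(2) chain_sum_simps(1))
    fix u v assume u: "u \<in> B" and v: "v \<in> B"
    have "(u \<oplus>\<^bsub>?P\<^esub> v) j (l (\<beta> j)) = cls (seg f 0 (l (\<beta> j))) 0" if j: "j < m" for j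
      using u v j l\<beta>[OF j] by (simp add: B_def power_module_simps(3) chain_sum_simps(2) kxy_quot_module_simps(3))
    then show "u \<oplus>\<^bsub>?P\<^esub> v \<in> B" using u v P.a_closed by (simp add: B_def)
  next
    fix s v assume v: "v \<in> B"
    have "(sact F ?P s v) j (l (\<beta> j)) = cls (seg f 0 (l (\<beta> j))) 0" if j: "j < m" for j
    proof -
      have vj: "v j \<in> carrier ?M" "v j (l (\<beta> j)) = cls (seg f 0 (l (\<beta> j))) 0" using v j Pc by (auto simp: B_def)
      have "seg f 0 (l (\<beta> j)) dvd s * rep (v j (l (\<beta> j)))"
        unfolding vj(2) using rep_cls[of "seg f 0 (l (\<beta> j))" 0] by simp
      then show ?thesis using chain_sum_sact_component[OF vj(1) l\<beta>[OF j], of s] j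
        by (simp add: power_module_sact F_def cls_eq_iff)
    qed
    then show "sact F ?P s v \<in> B" using v P.act_closed by (simp add: B_def)
  qed
  then have subB: "submodule B ?R ?P" by (rule submod)
  have int: "A \<inter> B = {\<zero>\<^bsub>?P\<^esub>}"
  proof (intro equalityI subsetI)
    fix p assume "p \<in> A \<inter> B"
    then obtain a where a: "p = vec a" "vec a \<in> B" by (auto simp: A_def)
    have "\<forall>i\<in>I. seg f 0 (l i) dvd a i - 0"
    proof
      fix i assume "i \<in> I"
      then obtain j where j: "j < m" "i = \<beta> j" using \<beta> by (auto simp: bij_betw_def)
      then have "vec a j (l i) = cls (seg f 0 (l i)) 0" using a(2) by (simp add: B_def)
      then show "seg f 0 (l i) dvd a i - 0" using j l\<beta>[OF j(1)] by (simp add: vec cls_eq_iff)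
    qed
    then have "vec a = vec (\<lambda>_. 0)" unfolding vec_eq_iff .
    then show "p \<in> {\<zero>\<^bsub>?P\<^esub>}" using a(1) vec0 by simp
  next
    fix p assume "p \<in> {\<zero>\<^bsub>?P\<^esub>}"
    then show "p \<in> A \<inter> B"
      using P.subD(2)[OF \<open>P.sub A\<close>] P.subD(2)[OF \<open>P.sub B\<close>] by simp
  qed
  have "\<exists>a. \<exists>q\<in>B. p = vec a \<oplus>\<^bsub>?P\<^esub> q" if p: "p \<in> carrier ?P" for p
  proof -
    define a where "a i = rep (p (inv_into {..<m} \<beta> i) (l i))" for i
    define q where "q = (\<lambda>j\<in>{..<m}. \<lambda>i\<in>{1..n}. if i = l (\<beta> j) then cls (seg f 0 i) 0 else p j i)"
    have a: "a (\<beta> j) = rep (p j (l (\<beta> j)))" if "j < m" for j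
      using \<beta> that by (simp add: a_def bij_betw_def)
    have comp: "p j i = cls (seg f 0 i) (rep (p j i))" if "j < m" "i \<in> {1..n}" for i j
      using chain_sum_component[OF Pc[OF p that(1)] that(2)] .
    have qj: "q j \<in> carrier ?M" if "j < m" for j
      using that comp by (auto simp: q_def chain_sum_carrier intro!: rangeI) (metis rangeI atLeastAtMost_iff One_nat_def)
    then have "q \<in> carrier ?P" by (auto simp: power_module_simps q_def)
    moreover have "q j (l (\<beta> j)) = cls (seg f 0 (l (\<beta> j))) 0" if "j < m" for j
      using that l\<beta>[OF that] by (simp add: q_def)
    ultimately have "q \<in> B" by (simp add: B_def)
    moreover have "p = vec a \<oplus>\<^bsub>?P\<^esub> q"
    proof -
      have eq: "p j = vec a j \<oplus>\<^bsub>?M\<^esub> q j" if j: "j < m" for j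
      proof -
        have "p j i = (vec a j \<oplus>\<^bsub>?M\<^esub> q j) i" if i: "i \<in> {1..n}" for i
        proof (cases "i = l (\<beta> j)")
          case True
          have "cls (seg f 0 i) (rep (p j i)) \<oplus>\<^bsub>kxy_quot_module (seg f 0 i)\<^esub> cls (seg f 0 i) 0 = cls (seg f 0 i) (rep (p j i))"
            by (simp add: kxy_quot_module_simps(3))
          then show ?thesis using True i j comp[OF j i] a[OF j]
            by (simp add: chain_sum_simps(2) vec q_def)
        next
          case False
          have "cls (seg f 0 i) 0 \<oplus>\<^bsub>kxy_quot_module (seg f 0 i)\<^esub> cls (seg f 0 i) (rep (p j i)) = cls (seg f 0 i) (rep (p j i))"
            by (simp add: kxy_quot_module_simps(3))
          then show ?thesis using False i j comp[OF j i]
            by (simp add: chain_sum_simps(2) vec q_def)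
        qed
        moreover have "p j \<in> extensional {1..n}" using Pc[OF p j] by (auto simp: chain_sum_carrier PiE_iff)
        ultimately show ?thesis
          by (intro extensionalityI[of _ "{1..n}"]) (auto simp: chain_sum_simps(2))
      qed
      have "p \<in> extensional {..<m}" using p by (auto simp: power_module_simps PiE_iff)
      then show ?thesis
      proof (rule extensionalityI)
        show "vec a \<oplus>\<^bsub>?P\<^esub> q \<in> extensional {..<m}" by (simp add: power_module_simps(3))
        show "p j = (vec a \<oplus>\<^bsub>?P\<^esub> q) j" if "j \<in> {..<m}" for j
          using eq[of j] that by (simp add: power_module_simps(3))
      qed
    qed
    ultimately show ?thesis by blast
  qed
  then have sum: "A <+>\<^bsub>?P\<^esub> B = carrier ?P"
    using P.subD(1)[OF \<open>P.sub A\<close>] P.subD(1)[OF \<open>P.sub B\<close>]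
    by (fastforce simp: A_def set_add_def set_mult_def)
  have "direct_summand ?R ?P A" unfolding direct_summand_def using subA subB int sum by blast
  moreover have "mod_isomorphic ?R Y (?P\<lparr>carrier := A\<rparr>)"
  proof -
    define H where "H = restrict (\<lambda>y. vec (coef y)) (carrier Y)"
    have "H \<in> mod_hom ?R Y (?P\<lparr>carrier := A\<rparr>)"
      unfolding H_def
    proof (rule mod_homI_sact[OF Y])
      fix y assume y: "y \<in> carrier Y"
      show "vec (coef y) \<in> carrier (?P\<lparr>carrier := A\<rparr>)" by (simp add: A_def)
      have "Y.lc I (coef (sact F Y s y)) e = Y.lc I (\<lambda>i. s * coef y i) e" for s
        using coef[OF Y.act_closed[OF y], symmetric]
          trans[OF arg_cong[OF coef[OF y], of "sact F Y s"] Y.act_lc[OF fin eY, of s "coef y"]] by (rule trans)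
      then have "vec (coef (sact F Y s y)) = vec (\<lambda>i. s * coef y i)" for s
        unfolding vec_eq_iff lc_eq_iff .
      then show "vec (coef (sact F Y s y)) = sact F (?P\<lparr>carrier := A\<rparr>) s (vec (coef y))" for s
        by (simp add: vec_act) (simp add: sact_def)
      fix z assume z: "z \<in> carrier Y"
      have "Y.lc I (coef (y \<oplus>\<^bsub>Y\<^esub> z)) e = Y.lc I (\<lambda>i. coef y i + coef z i) e"
        using coef[OF Y.a_closed[OF y z], symmetric]
          trans[OF arg_cong2[OF coef[OF y] coef[OF z], of "add Y"] Y.lc_add[OF fin eY, of "coef y" "coef z", symmetric]]
        by (rule trans)
      then have "vec (coef (y \<oplus>\<^bsub>Y\<^esub> z)) = vec (\<lambda>i. coef y i + coef z i)"
        unfolding vec_eq_iff lc_eq_iff .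
      then show "vec (coef (y \<oplus>\<^bsub>Y\<^esub> z)) = vec (coef y) \<oplus>\<^bsub>?P\<lparr>carrier := A\<rparr>\<^esub> vec (coef z)"
        by (simp add: vec_add)
    qed
    moreover have "bij_betw H (carrier Y) A"
      unfolding bij_betw_def
    proof
      show "inj_on H (carrier Y)"
      proof (rule inj_onI)
        fix y z assume yz: "y \<in> carrier Y" "z \<in> carrier Y" "H y = H z"
        then have "vec (coef y) = vec (coef z)" by (simp add: H_def)
        then have "Y.lc I (coef y) e = Y.lc I (coef z) e" unfolding vec_eq_iff lc_eq_iff .
        with coef[OF yz(1)] have "y = Y.lc I (coef z) e" by (rule trans)
        then show "y = z" using coef[OF yz(2), symmetric] by (rule trans)
      qed
      show "H ` carrier Y = A"
      proof (intro equalityI subsetI)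
        fix p assume "p \<in> A"
        then obtain a where a: "p = vec a" by (auto simp: A_def)
        have c: "Y.lc I a e \<in> carrier Y" using eY by blast
        have "vec (coef (Y.lc I a e)) = vec a"
          unfolding vec_eq_iff lc_eq_iff[symmetric] by (rule coef[OF c, symmetric])
        then show "p \<in> H ` carrier Y" using a c by (auto simp: H_def intro!: image_eqI[of _ _ "Y.lc I a e"])
      qed (auto simp: H_def A_def)
    qed
    ultimately show ?thesis unfolding mod_isomorphic_def by auto
  qed
  ultimately show ?thesis unfolding is_add_def using Y unfolding power_module_def by blast
qed

section \<open>Cluster tilting\<close>

lemma kxy_max_memI: "s $ 0 $ 0 = 0 \<Longrightarrow> s \<in> (kxy_max :: 'k::field fps fps set)"
proof -
  assume s: "s $ 0 $ 0 = 0"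
  have "(s $ 0) = fps_X * fps_shift 1 (s $ 0)" using s by (rule fps_eq_mult_X)
  then have x: "fps_const (s $ 0) = fps_const fps_X * fps_const (fps_shift 1 (s $ 0))"
    by (metis fps_const_mult)
  have "(s - fps_const (s $ 0)) $ 0 = 0" by simp
  then obtain b where "s - fps_const (s $ 0) = fps_X * b" using fps_eq_mult_X by blast
  then have eq: "s = fps_const (fps_shift 1 (s $ 0)) * fps_const fps_X + b * fps_X"
    using x by (simp add: algebra_simps)
  show ?thesis
    unfolding kxy_max_def genideal_def
  proof (intro InterI, elim CollectE conjE)
    fix J :: "'k fps fps set" assume J: "ideal J kxy" "{fps_const fps_X, fps_X} \<subseteq> J"
    then have "fps_const (fps_shift 1 (s $ 0)) * fps_const fps_X \<in> J" "b * fps_X \<in> J"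
      using ideal.I_l_closed[OF J(1), of _ "fps_const (fps_shift 1 (s $ 0))"]
        ideal.I_l_closed[OF J(1), of _ b] J(2) by (simp_all del: fps_const_mult)
    then have "fps_const (fps_shift 1 (s $ 0)) * fps_const fps_X + b * fps_X \<in> J"
      using additive_subgroup.a_closed[OF ideal.axioms(1)[OF J(1)]] by simp
    then show "s \<in> J" using eq by simp
  qed
qed

text \<open>A series without constant and linear terms is \<open>x * a + y * b\<close> with \<open>a\<close> and \<open>b\<close> in the maximal ideal.\<close>

lemma kxy_max_square_memI:
  fixes p :: "'k::field fps fps"
  assumes "p $ 0 $ 0 = 0" "p $ 0 $ 1 = 0" "p $ 1 $ 0 = 0"
  shows "p \<in> ideal_prod kxy kxy_max kxy_max"
proof -
  define a where "a = fps_shift 1 (p $ 0)"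
  have pa: "p $ 0 = fps_X * a" unfolding a_def using assms(1) by (rule fps_eq_mult_X)
  have a0: "a $ 0 = 0" using assms(2) by (simp add: a_def)
  define b where "b = fps_shift 1 p"
  have "p - fps_const (p $ 0) = fps_X * fps_shift 1 (p - fps_const (p $ 0))" by (rule fps_eq_mult_X) simp
  also have "fps_shift 1 (p - fps_const (p $ 0)) = b" by (simp add: b_def fps_eq_iff)
  finally have eq: "p = fps_const fps_X * fps_const a + fps_X * b" by (simp add: pa algebra_simps)
  have b0: "b $ 0 $ 0 = 0" using assms(3) by (simp add: b_def)
  have "fps_const fps_X * fps_const a \<in> ideal_prod kxy kxy_max (kxy_max :: 'k fps fps set)"
    using ideal_prod.prod[of "fps_const fps_X" kxy_max "fps_const a" kxy_max kxy] a0 by (simp add: kxy_max_memI)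
  moreover have "fps_X * b \<in> ideal_prod kxy kxy_max (kxy_max :: 'k fps fps set)"
    using ideal_prod.prod[of fps_X kxy_max b kxy_max kxy] b0 by (simp add: kxy_max_memI)
  ultimately show ?thesis using ideal_prod.sum[of _ kxy kxy_max kxy_max] eq by fastforce
qed

text \<open>If \<open>f i\<close> divides \<open>f j\<close>, the two are associated, and the product of all factors except \<open>f j\<close> is
  nilpotent but not zero modulo the product of all.\<close>

lemma factors_of_reduced:
  fixes f :: "nat \<Rightarrow> 'k::field fps fps"
  assumes n: "1 \<le> n" and irr: "\<And>i. i \<in> {1..n} \<Longrightarrow> Factorial_Ring.irreducible (f i)"
    and red: "reduced_ring (kxy_quot (seg f 0 n))"
  shows "factors f n"
proof -
  have "\<not> f i dvd f j" if i: "i \<in> {1..n}" and j: "j \<in> {1..n}" and ne: "i \<noteq> j" for i j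
  proof
    assume "f i dvd f j"
    then obtain c where c: "f j = f i * c" ..
    have "\<not> f i dvd 1" using irr[OF i] by (simp add: Factorial_Ring.irreducible_def)
    then have "c dvd 1" using irr[OF j] c unfolding Factorial_Ring.irreducible_def by blast
    then have ji: "f j dvd f i" unfolding c by (simp add: mult_unit_dvd_iff_ring)
    define a where "a = prod f ({1..n} - {j})"
    have F: "seg f 0 n = f j * a" unfolding seg_def a_def using j by (simp add: prod.remove)
    have "f i dvd a" unfolding a_def using i ne by (intro dvd_prodI) auto
    then have "f j dvd a" using ji dvd_trans by blast
    then have d: "seg f 0 n dvd a * a" unfolding F by (rule mult_dvd_mono) simp
    interpret R: cring "kxy_quot (seg f 0 n)" by (rule kxy_quot_cring)
    have "cls (seg f 0 n) a [^]\<^bsub>kxy_quot (seg f 0 n)\<^esub> (2::nat) = \<zero>\<^bsub>kxy_quot (seg f 0 n)\<^esub>"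
      using d by (simp add: numeral_2_eq_2 kxy_quot_simps cls_eq_iff)
    then have "cls (seg f 0 n) a = \<zero>\<^bsub>kxy_quot (seg f 0 n)\<^esub>"
      using red cls_carrier unfolding reduced_ring_def by blast
    then have "f j * a dvd 1 * a" by (simp add: kxy_quot_simps cls_eq_iff F)
    moreover have "f k \<noteq> 0" if "k \<in> {1..n}" for k
      using irr[OF that] by (auto simp: Factorial_Ring.irreducible_def)
    then have "a \<noteq> 0" by (auto simp: a_def)
    ultimately have "f j dvd 1" by (simp only: dvd_mult_cancel_right) simp
    then show False using irr[OF j] by (simp add: Factorial_Ring.irreducible_def)
  qed
  then show ?thesis unfolding factors_def using n irr by blast
qed

text \<open>A nonunit outside the square of the maximal ideal has a nonzero linear term.\<close>

lemma chain_factors_of_linear: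
  fixes f :: "nat \<Rightarrow> 'k::field fps fps"
  assumes f: "factors f n" and lin: "\<forall>i\<in>{1..n}. f i \<notin> ideal_prod kxy kxy_max kxy_max"
  shows "chain_factors f n"
  unfolding chain_factors_def
proof (intro ballI conjI)
  fix j assume j: "j \<in> {1..n}"
  show "f j \<noteq> 0" using factors_prime[OF f j] by (simp add: prime_elem_def)
  show nu: "\<not> f j dvd 1" using f j by (rule factors_nonunit)
  then have "f j $ 0 $ 0 = 0" by (simp add: fps_fps_unit_iff)
  then show "\<exists>\<pi>. residue_uniformizer (f j) \<pi>"
    using lin j kxy_max_square_memI[of "f j"] by (intro residue_uniformizer_exists) auto
qed

lemma is_add_chain_sum:
  fixes f :: "nat \<Rightarrow> 'k::field fps fps" and n :: nat
  defines "F \<equiv> seg f 0 n"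
  assumes f: "factors f n" and add: "is_add (kxy_quot F) (chain_sum f n) Y"
  shows "max_CM (kxy_quot F) Y" and "smodule.kernel_condition Y (sact F Y) f n (carrier Y)"
proof -
  have M: "Module.module (kxy_quot F) (chain_sum f n)" unfolding F_def by (rule chain_sum_module)
  have Y: "Module.module (kxy_quot F) Y" using add by (simp add: is_add_def)
  interpret M: smodule "chain_sum f n" "sact F (chain_sum f n)" by (rule smodule_sact[OF M])
  have b: "M.cyclic_basis (carrier (chain_sum f n)) {1..n} (chain_unit f n) (\<lambda>i. seg f 0 i)"
    unfolding F_def by (rule chain_sum_basis)
  have fg: "M.fg (carrier (chain_sum f n))"
    by (rule M.fg_of_span[OF M.sub_carrier, of "{1..n}" "chain_unit f n"])
      (use b in \<open>auto simp: M.cyclic_basis_def\<close>)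
  obtain t where t: "\<not> t dvd 1" "\<forall>i\<in>{1..n}. \<not> f i dvd t"
    using exists_common_nonmultiple[of "{1..n}" f] factors_irreducible[OF f] by blast
  have reg: "regular_on F (chain_sum f n) t" unfolding F_def using f t(2) by (rule chain_sum_regular)
  have kc: "M.kernel_condition f n (carrier (chain_sum f n))"
    unfolding F_def using f by (rule chain_sum_kernel_condition)
  obtain m \<iota> \<rho> where r: "\<And>y. y \<in> carrier Y \<Longrightarrow> \<iota> y \<in> carrier (power_module m (chain_sum f n))"
    "\<And>s y. y \<in> carrier Y \<Longrightarrow> \<iota> (sact F Y s y) = sact F (power_module m (chain_sum f n)) s (\<iota> y)"
    "\<And>x. x \<in> carrier (power_module m (chain_sum f n)) \<Longrightarrow> \<rho> x \<in> carrier Y"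
    "\<And>x y. x \<in> carrier (power_module m (chain_sum f n)) \<Longrightarrow> y \<in> carrier (power_module m (chain_sum f n)) \<Longrightarrow>
      \<rho> (x \<oplus>\<^bsub>power_module m (chain_sum f n)\<^esub> y) = \<rho> x \<oplus>\<^bsub>Y\<^esub> \<rho> y"
    "\<And>s x. x \<in> carrier (power_module m (chain_sum f n)) \<Longrightarrow>
      \<rho> (sact F (power_module m (chain_sum f n)) s x) = sact F Y s (\<rho> x)"
    "\<And>y. y \<in> carrier Y \<Longrightarrow> \<rho> (\<iota> y) = y"
    by (rule is_add_retract[OF M add]; rule that; (assumption | simp | blast))
  have P: "Module.module (kxy_quot F) (power_module m (chain_sum f n))"
    by (rule power_module_module[OF kxy_quot_cring M])
  note inh = retract_inherits[where \<iota> = \<iota> and \<rho> = \<rho>, OF P Y r]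
  have "smodule.fg Y (sact F Y) (carrier Y)" by (rule inh(1); (assumption | rule power_module_fg[OF M fg]))
  moreover have "regular_on F Y t" by (rule inh(2); (assumption | rule power_module_regular[OF reg]))
  ultimately show "max_CM (kxy_quot F) Y"
    using max_CM_iff[OF f Y[unfolded F_def]] t(1) unfolding F_def regular_on_def by blast
  show "smodule.kernel_condition Y (sact F Y) f n (carrier Y)"
    by (rule inh(3); (assumption | rule power_module_kernel_condition[OF M kc]))
qed

lemma max_CM_local_smodule:
  assumes f: "factors f n" and cm: "max_CM (kxy_quot (seg f 0 n)) Y"
  shows "Module.module (kxy_quot (seg f 0 n)) Y" and "smodule.fg Y (sact (seg f 0 n) Y) (carrier Y)"
    and "\<exists>t. local_smodule Y (sact (seg f 0 n) Y) t"
proof -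
  show Y: "Module.module (kxy_quot (seg f 0 n)) Y" using cm by (simp add: max_CM_def fin_gen_module_def)
  have c: "smodule.fg Y (sact (seg f 0 n) Y) (carrier Y)"
    "\<exists>t. \<not> t dvd 1 \<and> (\<forall>v\<in>carrier Y. sact (seg f 0 n) Y t v = \<zero>\<^bsub>Y\<^esub> \<longrightarrow> v = \<zero>\<^bsub>Y\<^esub>)"
    using cm max_CM_iff[OF f Y] by blast+
  show "smodule.fg Y (sact (seg f 0 n) Y) (carrier Y)" by (rule c(1))
  obtain t where t: "\<not> t dvd 1" "\<forall>v\<in>carrier Y. sact (seg f 0 n) Y t v = \<zero>\<^bsub>Y\<^esub> \<longrightarrow> v = \<zero>\<^bsub>Y\<^esub>"
    using c(2) by blast
  have "local_smodule Y (sact (seg f 0 n) Y) t"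
    by (intro local_smodule.intro smodule_sact[OF Y] local_smodule_axioms.intro fps_fps_local)
      (use t in auto)
  then show "\<exists>t. local_smodule Y (sact (seg f 0 n) Y) t" by blast
qed

text \<open>Both halves of the cluster tilting property are cycles of implications through the standard basis:
  membership in add gives the vanishing of Ext, this gives the kernel or the lifting condition,
  these give a standard basis, and a standard basis gives membership in add.\<close>

theorem theorem4p1:
  fixes f :: "nat \<Rightarrow> 'k::field fps fps" and n :: nat
  defines "R \<equiv> kxy_quot (\<Prod>i=1..n. f i)"
    and "M \<equiv> direct_sum {1..n} (\<lambda>i. kxy_quot_module (\<Prod>j=1..i. f j))"
  assumes "infinite (UNIV :: 'k set)"
    and "1 \<le> n"
    and "\<And>i. i \<in> {1..n} \<Longrightarrow> Factorial_Ring.irreducible (f i)"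
    and "\<And>i. i \<in> {1..n} \<Longrightarrow> f i \<in> kxy_max"
    and "reduced_ring R"
  shows "rigid_CM R M \<and>
    ((\<forall>i\<in>{1..n}. f i \<notin> ideal_prod kxy kxy_max kxy_max) \<longrightarrow> cluster_tilting_CM TYPE('x) R M)"
proof -
  have R: "R = kxy_quot (seg f 0 n)" and M: "M = chain_sum f n"
    by (simp_all add: R_def M_def chain_sum_def seg_def)
  have f: "factors f n" using assms(4,5,7) unfolding R by (rule factors_of_reduced)
  have F0: "seg f 0 n \<noteq> 0" using factors_seg_nonzero[OF f] by simp
  have Mm: "Module.module R M" unfolding R M by (rule chain_sum_module)
  have Mb: "smodule.cyclic_basis M (sact (seg f 0 n) M) (carrier M) {1..n} (chain_unit f n) (\<lambda>i. seg f 0 i)"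
    unfolding M by (rule chain_sum_basis)
  have Mk: "smodule.kernel_condition M (sact (seg f 0 n) M) f n (carrier M)"
    unfolding M using f by (rule chain_sum_kernel_condition)
  have Ext_M: "trivial_group (Ext1 R M Y)"
    if "Module.module R Y" "smodule.kernel_condition Y (sact (seg f 0 n) Y) f n (carrier Y)"
    for Y :: "('k fps fps set, 'y) module"
    using Ext1_trivial_of_cyclic_basis[OF _ _ Mb, of Y] that Mm unfolding R by simp
  obtain t where t: "\<not> t dvd 1" "\<forall>i\<in>{1..n}. \<not> f i dvd t"
    using exists_common_nonmultiple[of "{1..n}" f] factors_irreducible[OF f] by blast
  have Mfg: "smodule.fg M (sact (seg f 0 n) M) (carrier M)"
  proof -
    interpret M: smodule M "sact (seg f 0 n) M" using Mm unfolding R by (rule smodule_sact)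
    show ?thesis
      by (rule M.fg_of_span[OF M.sub_carrier, of "{1..n}" "chain_unit f n"])
        (use Mb in \<open>auto simp: M.cyclic_basis_def\<close>)
  qed
  have cm: "max_CM R M"
    using max_CM_iff[OF f Mm[unfolded R]] Mfg t(1) chain_sum_regular[OF f t(2)]
    unfolding R M regular_on_def by blast
  have rigid: "rigid_CM R M" unfolding rigid_CM_def using cm Ext_M[OF Mm Mk] by blast
  moreover have "cluster_tilting_CM TYPE('x) R M"
    if lin: "\<forall>i\<in>{1..n}. f i \<notin> ideal_prod kxy kxy_max kxy_max"
  proof -
    have cf: "chain_factors f n" using f lin by (rule chain_factors_of_linear)
    have basis: "smodule.has_standard_basis Y (sact (seg f 0 n) Y) f n (carrier Y)"
      if Y: "max_CM R Y" and c: "smodule.kernel_condition Y (sact (seg f 0 n) Y) f n (carrier Y) \<or>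
        smodule.lifting_condition Y (sact (seg f 0 n) Y) f n (carrier Y)" for Y :: "('k fps fps set, 'x) module"
    proof -
      note Yf = max_CM_local_smodule[OF f Y[unfolded R]]
      obtain t where "local_smodule Y (sact (seg f 0 n) Y) t" using Yf(3) by blast
      then interpret Y: local_smodule Y "sact (seg f 0 n) Y" t .
      have kill: "sact (seg f 0 n) Y (seg f 0 n) v = \<zero>\<^bsub>Y\<^esub>" if "v \<in> carrier Y" for v
        using sact_modulus[OF Yf(1) that] by simp
      show ?thesis
        using c Y.kernel_condition_imp_standard_basis[OF assms(4) cf Y.sub_carrier Yf(2) kill]
          Y.lifting_condition_imp_standard_basis[OF assms(4) cf Y.sub_carrier Yf(2) kill] by blast
    qed
    have "is_add R M Y \<longleftrightarrow> max_CM R Y \<and> trivial_group (Ext1 R M Y)" for Y :: "('k fps fps set, 'x) module"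
    proof
      assume add: "is_add R M Y"
      then have "Module.module R Y" by (simp add: is_add_def)
      then show "max_CM R Y \<and> trivial_group (Ext1 R M Y)"
        using is_add_chain_sum[OF f add[unfolded R M]] Ext_M unfolding R by blast
    next
      assume Y: "max_CM R Y \<and> trivial_group (Ext1 R M Y)"
      then have Ym: "Module.module R Y" using max_CM_local_smodule(1)[OF f] unfolding R by blast
      have "smodule.kernel_condition Y (sact (seg f 0 n) Y) f n (carrier Y)"
        using kernel_condition_of_Ext1_trivial[OF F0 Ym[unfolded R]] Y unfolding R M by blast
      then show "is_add R M Y"
        using is_add_of_standard_basis[OF Ym[unfolded R]] basis Y unfolding R M by blast
    qed
    moreover have "is_add R M Y \<longleftrightarrow> max_CM R Y \<and> trivial_group (Ext1 R Y M)" for Y :: "('k fps fps set, 'x) module"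
    proof
      assume add: "is_add R M Y"
      then have Ym: "Module.module R Y" by (simp add: is_add_def)
      have Y: "max_CM R Y" "smodule.kernel_condition Y (sact (seg f 0 n) Y) f n (carrier Y)"
        using is_add_chain_sum[OF f add[unfolded R M]] unfolding R by blast+
      interpret Y: smodule Y "sact (seg f 0 n) Y" using Ym unfolding R by (rule smodule_sact)
      obtain I :: "'x set" and e l where "l \<in> I \<rightarrow> {1..n}" "Y.cyclic_basis (carrier Y) I e (\<lambda>i. seg f 0 (l i))"
        using basis[OF Y(1)] Y(2) unfolding Y.has_standard_basis_def by blast
      then have "trivial_group (Ext1 R Y M)"
        using Ext1_trivial_of_cyclic_basis[OF Ym[unfolded R] Mm[unfolded R] _ _ Mk] unfolding R by blast
      then show "max_CM R Y \<and> trivial_group (Ext1 R Y M)" using Y(1) by blast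
    next
      assume Y: "max_CM R Y \<and> trivial_group (Ext1 R Y M)"
      then have Ym: "Module.module R Y" using max_CM_local_smodule(1)[OF f] unfolding R by blast
      have "smodule.lifting_condition Y (sact (seg f 0 n) Y) f n (carrier Y)"
        using lifting_condition_of_Ext1_trivial[OF F0 Ym[unfolded R]] Y unfolding R M by blast
      then show "is_add R M Y"
        using is_add_of_standard_basis[OF Ym[unfolded R]] basis Y unfolding R M by blast
    qed
    ultimately show ?thesis unfolding cluster_tilting_CM_def using cm by blast
  qed
  ultimately show ?thesis by blast
qed

end
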